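(* Let $X$ be the $(\xi,\psi)$-superprocess described in the context, with mean semigroup $(P^\beta_t)_{t\ge 0}$. Assume: (i) there exist a constant $\lambda>0$, a positive function $\phi\in\mathcal B_b(E)$ and a probability measure $\nu$ with full support on $E$ such that $P^\beta_t\phi=e^{\lambda t}\phi$ and $\nu P^\beta_t=e^{\lambda t}\nu$ for all $t\ge 0$, and $\nu(\phi)=1$; (ii) for all $t>0$, $x\in E$ and $f\in L_1^+(\nu)$ one has $P^\beta_tf(x)=e^{\lambda t}\phi(x)\nu(f)(1+C_{t,x,f})$ for some $C_{t,x,f}\in\mathbb R$, and $c_t:=\sup_{x\in E,f\in L_1^+(\nu)}|C_{t,x,f}|$ satisfies $\lim_{t\to\infty}c_t=0$ and (normalization) $\sup_{t>1}c_t<\infty$; (iii) $\int_E\nu(dy)\int_1^\infty r\ln r\,\pi^\phi(y,dr)<\infty$. Let $1<a<p\le 2$ and $\frac1a+\frac1{a^*}=1$, and let $A_t(a^* )=\int_0^te^{\lambda s/a^*}(M_\infty(\phi)-M_s(\phi))\,ds$, $t\ge 0$. Consider the condition $$\int_E\nu(dy)\int_1^\infty r^p\,\pi^\phi(y,dr)<\infty.\qquad( * )$$ (1) If $( * )$ holds, then for any $\mu\in\mathcal M^0(E)$, $A_t(a^* )-A_1(a^* )$ converges in $L^p(\mathbb P_\mu)$ and $\mathbb P_\mu$-almost surely as $t\to\infty$. (2) If for some $\mu\in\mathcal M^0(E)$, $A_t(a^* )-A_1(a^* )$ converges in $L^p(\mathbb P_\mu)$ as $t\to\infty$, then it must converge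 $\mathbb P_\mu$-almost surely and $( * )$ holds. (3) If $( * )$ holds, then for any $\mu\in\mathcal M^0(E)$, $\|M_\infty(\phi)-M_t(\phi)\|_p=o(e^{-\lambda t/a^*})$ as $t\to\infty$, where $\|\cdot\|_p$ is the norm of $L^p(\mathbb P_\mu)$. (4) If for some $\mu\in\mathcal M^0(E)$, $\|M_\infty(\phi)-M_t(\phi)\|_p=o(1)$ as $t\to\infty$, where $\|\cdot\|_p$ is the norm of $L^p(\mathbb P_\mu)$, then $( * )$ holds.
   Context: $E$ is a locally compact separable metric space and $E_\partial=E\cup\{\partial\}$ is its one-point compactification. $\mathcal B_b(E)$ (resp. $\mathcal B_b^+(E)$) is the set of bounded (resp. bounded non-negative) real Borel functions on $E$; functions $f$ on $E$ are extended to $E_\partial$ by $f(\partial)=0$. $\xi=\{(\xi_t)_{t\ge0};\Pi_x,x\in E\}$ is a Hunt process on $E$ with lifetime $\zeta=\inf\{t>0:\xi_t=\partial\}$. $\mathcal M(E)$ and $\mathcal M(E_\partial)$ are the spaces of finite Borel measures with the weak topology, $\mathcal M(E)$ is identified with a subset of $\mathcal M(E_\partial)$ by zero extension, and $\mathcal M^0(E)=\mathcal M(E)\setminus\{\mathbf 0\}$ where $\mathbf 0$ is the null measure. $\langle f,\mu\rangle=\mu(f)=\int f\,d\mu$. Branching mechanism: for $x\in E$, $z\ge0$, $\psi(x,z)=-\beta(x)z+\frac12\alpha(x)z^2+\int_{(0,\infty)}(e^{-zr}-1+zr)\,\pi(x,dr)$, where $\alpha\ge0$ and $\beta$ are in $\mathcal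 B_b(E)$ and $\pi$ is a kernel from $E$ to $\mathbb R_+$ with $\int_0^\infty(r\wedge r^2)\,\pi(\cdot,dr)\in\mathcal B_b^+(E)$. Extend $\psi$ to $\overline\psi$ on $E_\partial$ by $\overline\psi(\partial,z)=0$. Superprocess: $\overline X$ is an $\mathcal M(E_\partial)$-valued Hunt process (realized with c\`adl\`ag paths), with laws $\mathbb P_\mu$, such that $\mathbb P_\mu[e^{-\overline X_t(f)}]=e^{-\mu(\overline V_tf)}$ for non-negative bounded Borel $f$ on $E_\partial$, where $(t,x)\mapsto\overline V_tf(x)$ is the unique non-negative map, bounded on $[0,T]\times E_\partial$ for every $T>0$, with $\overline V_tf(x)+\Pi_x[\int_0^t\overline\psi(\xi_s,\overline V_{t-s}f(\xi_s))ds]=\Pi_x[f(\xi_t)]$. $X_t$ is the restriction of $\overline X_t$ to $E$; $X=(X_t)_{t\ge0}$ is the $(\xi,\psi)$-superprocess, and $X_t(f)=\overline X_t(f)$ for functions $f$ on $E$. $\mathbb P_\mu$ also denotes expectation. It is assumed throughout that $\mathbb P_{\delta_x}(X_t(E)=0)>0$ for all $x\in E$, $t>0$. Mean semigroup: $P^\beta_tf(x)=\Pi_x\big(\exp(\int_0^t\beta(\xi_s)ds)f(\xi_t)1_{\{t<\zeta\}}\big)$; then $\mathbb P_\mu[X_t(f)]=\mu(P_t^\beta f)$. $L_1^+(\nu)$ is the set of non-negative Borel functions on $E$ integrable with respect to $\nu$. The kernel $\pi^\phi$ is defined by $\int_0^\infty f(r)\,\pi^\phi(x,dr)=\int_0^\infty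 f(r\phi(x))\,\pi(x,dr)$ for non-negative Borel $f$ on $\mathbb R_+$. $M_t(\phi):=e^{-\lambda t}\langle\phi,X_t\rangle$ is a non-negative c\`adl\`ag martingale, and $M_\infty(\phi)$ is its almost sure limit as $t\to\infty$. *)

theory Defs
  imports "HOL-Probability.Probability" "HOL-Library.Landau_Symbols"
begin

section \<open>State spaces\<close>

definition topo_borel :: "'s topology \<Rightarrow> 's measure" where
  "topo_borel S = sigma (topspace S) {U. openin S U}"

text \<open>The one-point compactification of \<^term>\<open>E\<close> (the whole type \<^typ>\<open>'e\<close>). The cemetery point
  is \<^term>\<open>None\<close>, and it is isolated when \<^typ>\<open>'e\<close> is compact.\<close>

abbreviation E_del :: "'e::topological_space option topology" where
  "E_del \<equiv> Alexandroff_compactification euclidean"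

text \<open>Extension of functions by the value 0 at the cemetery.\<close>

definition ext0 :: "('e \<Rightarrow> 'b::zero) \<Rightarrow> 'e option \<Rightarrow> 'b" where
  "ext0 f y = (case y of None \<Rightarrow> 0 | Some x \<Rightarrow> f x)"

definition bounded_borel :: "'s measure \<Rightarrow> ('s \<Rightarrow> real) \<Rightarrow> bool" where
  "bounded_borel B f \<longleftrightarrow> f \<in> borel_measurable B \<and> bounded (f ` space B)"

definition finite_measures :: "'s measure \<Rightarrow> 's measure set" where
  "finite_measures B = {\<mu>. sets \<mu> = sets B \<and> finite_measure \<mu>}"

definition nonzero_measures :: "'s measure \<Rightarrow> 's measure set" where
  "nonzero_measures B = finite_measures B - {null_measure B}"

text \<open>The topology of weak convergence on the finite Borel measures on \<^term>\<open>S\<close>.\<close>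

definition weak_topology :: "'s topology \<Rightarrow> 's measure topology" where
  "weak_topology S = topology_generated_by
     {{\<mu> \<in> finite_measures (topo_borel S). (\<integral>x. f x \<partial>\<mu>) \<in> U} | f U.
        continuous_map S euclideanreal f \<and> bounded (f ` topspace S) \<and> open U}"

definition zero_ext :: "'e::topological_space measure \<Rightarrow> 'e option measure" where
  "zero_ext \<mu> = distr \<mu> (topo_borel E_del) Some"

definition restr_E :: "'e option measure \<Rightarrow> 'e::topological_space measure" where
  "restr_E \<mu> = distr (restrict_space \<mu> (range Some)) borel the"

section \<open>Hunt processes\<close>

definition cadlag :: "'s topology \<Rightarrow> (real \<Rightarrow> 's) \<Rightarrow> bool" where
  "cadlag S w \<longleftrightarrow> (\<forall>t\<ge>0. limitin S w (w t) (at_right t)) \<and> (\<forall>t>0. \<exists>l. limitin S w l (at_left t))"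

text \<open>A Hunt process with state space \<^term>\<open>S\<close>, where \<^term>\<open>S\<close> already contains the cemetery, if
  there is one. Paths are only considered on \<open>[0, \<infinity>)\<close>, whereas stopping times take values in
  \<open>[0, \<infinity>]\<close>; for this reason the filtration is indexed by \<^typ>\<open>ennreal\<close>. The conditional
  expectation in the strong Markov property uses the junk value \<open>enn2real \<infinity> = 0\<close> off
  \<open>{\<tau> < \<infinity>}\<close>, which is harmless as this event belongs to the \<open>\<sigma>\<close>-algebra of \<open>\<tau>\<close>.\<close>

locale hunt_process = filtration "space M" F
  for S :: "'s topology" and M :: "'w measure" and F :: "ennreal \<Rightarrow> 'w measure"
    and X :: "real \<Rightarrow> 'w \<Rightarrow> 's" and P :: "'s \<Rightarrow> 'w measure" +
  assumes F_subset: "\<And>t. sets (F t) \<subseteq> sets M"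
    and F_right_continuous: "\<And>t. t < \<top> \<Longrightarrow> sets (F t) = (\<Inter>s\<in>{t<..}. sets (F s))"
    and adapted: "\<And>t. 0 \<le> t \<Longrightarrow> X t \<in> F (ennreal t) \<rightarrow>\<^sub>M topo_borel S"
    and cadlag_paths: "\<And>\<omega>. \<omega> \<in> space M \<Longrightarrow> cadlag S (\<lambda>t. X t \<omega>)"
    and shifts: "\<And>t. 0 \<le> t \<Longrightarrow> \<exists>\<theta>\<in>space M \<rightarrow> space M.
          \<forall>\<omega>\<in>space M. \<forall>s\<ge>0. X s (\<theta> \<omega>) = X (t + s) \<omega>"
    and sets_P: "\<And>x. x \<in> topspace S \<Longrightarrow> sets (P x) = sets M"
    and prob_P: "\<And>x. x \<in> topspace S \<Longrightarrow> prob_space (P x)"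
    and transition_measurable: "\<And>t A. 0 \<le> t \<Longrightarrow> A \<in> sets (topo_borel S) \<Longrightarrow>
          (\<lambda>x. measure (P x) {\<omega> \<in> space M. X t \<omega> \<in> A}) \<in> borel_measurable (topo_borel S)"
    and normal: "\<And>x. x \<in> topspace S \<Longrightarrow> AE \<omega> in P x. X 0 \<omega> = x"
    and strong_markov: "\<And>x \<tau> s A. x \<in> topspace S \<Longrightarrow> stopping_time F \<tau> \<Longrightarrow> 0 \<le> s \<Longrightarrow>
          A \<in> sets (topo_borel S) \<Longrightarrow>
          AE \<omega> in P x. \<tau> \<omega> < \<top> \<longrightarrow>
            real_cond_exp (P x) (pre_sigma \<tau>) (\<lambda>\<omega>'. indicator A (X (enn2real (\<tau> \<omega>') + s) \<omega>')) \<omega>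
            = measure (P (X (enn2real (\<tau> \<omega>)) \<omega>)) {\<omega>' \<in> space M. X s \<omega>' \<in> A}"
    and quasi_left_continuous: "\<And>x \<tau>s \<tau>. x \<in> topspace S \<Longrightarrow>
          (\<And>n. stopping_time F (\<tau>s n)) \<Longrightarrow> stopping_time F \<tau> \<Longrightarrow>
          (\<And>\<omega>. \<omega> \<in> space M \<Longrightarrow> incseq (\<lambda>n. \<tau>s n \<omega>)) \<Longrightarrow>
          (\<And>\<omega>. \<omega> \<in> space M \<Longrightarrow> \<tau> \<omega> = (SUP n. \<tau>s n \<omega>)) \<Longrightarrow>
          AE \<omega> in P x. \<tau> \<omega> < \<top> \<longrightarrow>
            limitin S (\<lambda>n. X (enn2real (\<tau>s n \<omega>)) \<omega>) (X (enn2real (\<tau> \<omega>)) \<omega>) sequentially"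

definition lifetime :: "(real \<Rightarrow> 'w \<Rightarrow> 'e option) \<Rightarrow> 'w \<Rightarrow> ereal" where
  "lifetime \<xi> \<omega> = Inf {ereal t | t. 0 < t \<and> \<xi> t \<omega> = None}"

section \<open>Superprocesses\<close>

text \<open>All integrals against \<^term>\<open>\<pi> x\<close> are over \<open>(0, \<infinity>)\<close> or smaller, so an atom at 0 is allowed but
  plays no role.\<close>

locale branching_mechanism =
  fixes \<alpha> \<beta> :: "'e::topological_space \<Rightarrow> real" and \<pi> :: "'e \<Rightarrow> real measure"
  assumes alpha: "bounded_borel borel \<alpha>" "\<And>x. 0 \<le> \<alpha> x"
    and beta: "bounded_borel borel \<beta>"
    and sets_pi: "\<And>x. sets (\<pi> x) = sets borel"
    and pi_nonneg: "\<And>x. emeasure (\<pi> x) {..<0} = 0"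
    and pi_kernel: "\<And>A. A \<in> sets borel \<Longrightarrow> (\<lambda>x. emeasure (\<pi> x) A) \<in> borel_measurable borel"
    and pi_bounded: "\<exists>C::real. \<forall>x. (\<integral>\<^sup>+r\<in>{0<..}. ennreal (min r (r\<^sup>2)) \<partial>\<pi> x) \<le> ennreal C"

definition psi :: "('e \<Rightarrow> real) \<Rightarrow> ('e \<Rightarrow> real) \<Rightarrow> ('e \<Rightarrow> real measure) \<Rightarrow> 'e \<Rightarrow> real \<Rightarrow> real" where
  "psi \<alpha> \<beta> \<pi> x z = - \<beta> x * z + 1/2 * \<alpha> x * z\<^sup>2
     + (LINT r:{0<..}|\<pi> x. exp (- z * r) - 1 + z * r)"

definition psi_bar :: "('e \<Rightarrow> real \<Rightarrow> real) \<Rightarrow> 'e option \<Rightarrow> real \<Rightarrow> real" where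
  "psi_bar \<psi> y z = ext0 (\<lambda>x. \<psi> x z) y"

text \<open>\<^term>\<open>v\<close> is a non-negative, locally bounded (Borel) solution \<open>(t, x) \<mapsto> V\<^sub>t f(x)\<close> of the cumulant
  equation. Its values at \<^prop>\<open>t < 0\<close> are irrelevant.\<close>

definition cumulant_solution ::
  "(real \<Rightarrow> 'w \<Rightarrow> 'e::topological_space option) \<Rightarrow> ('e option \<Rightarrow> 'w measure) \<Rightarrow>
   ('e \<Rightarrow> real \<Rightarrow> real) \<Rightarrow> ('e option \<Rightarrow> real) \<Rightarrow> (real \<Rightarrow> 'e option \<Rightarrow> real) \<Rightarrow> bool" where
  "cumulant_solution \<xi> Q \<psi> f v \<longleftrightarrow>
     (\<lambda>(t, x). v t x) \<in> borel_measurable (restrict_space borel {0..} \<Otimes>\<^sub>M topo_borel E_del) \<and>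
     (\<forall>t\<ge>0. \<forall>x. 0 \<le> v t x) \<and>
     (\<forall>T>0. \<exists>K. \<forall>t\<in>{0..T}. \<forall>x. v t x \<le> K) \<and>
     (\<forall>t\<ge>0. \<forall>x. v t x + (\<integral>\<omega>. (LBINT s:{0..t}. psi_bar \<psi> (\<xi> s \<omega>) (v (t - s) (\<xi> s \<omega>))) \<partial>Q x)
        = (\<integral>\<omega>. f (\<xi> t \<omega>) \<partial>Q x))"

text \<open>\<^term>\<open>Q x\<close> is the law of the spatial motion \<open>\<xi>\<close> started at \<^term>\<open>x\<close>, and \<^term>\<open>P \<mu>\<close> that of the
  superprocess started at \<^term>\<open>\<mu>\<close>. \<^term>\<open>X\<close> below is the process of measures on the
  compactification; the superprocess itself is its restriction to \<^typ>\<open>'e\<close> by \<^const>\<open>restr_E\<close>.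
  Separability of the metric space \<^typ>\<open>'e\<close> is expressed by second countability, the form available
  as a type class.\<close>

locale superprocess =
  motion: hunt_process E_del M F \<xi> Q +
  branching: branching_mechanism \<alpha> \<beta> \<pi> +
  mass: hunt_process "weak_topology E_del" W G X P
  for M :: "'v measure" and F :: "ennreal \<Rightarrow> 'v measure"
    and \<xi> :: "real \<Rightarrow> 'v \<Rightarrow> 'e::{metric_space, second_countable_topology} option"
    and Q :: "'e option \<Rightarrow> 'v measure"
    and \<alpha> \<beta> :: "'e \<Rightarrow> real" and \<pi> :: "'e \<Rightarrow> real measure"
    and W :: "'w measure" and G :: "ennreal \<Rightarrow> 'w measure"
    and X :: "real \<Rightarrow> 'w \<Rightarrow> 'e option measure" and P :: "'e option measure \<Rightarrow> 'w measure" +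
  assumes trap: "\<And>\<omega> s t. \<omega> \<in> space M \<Longrightarrow> 0 \<le> s \<Longrightarrow> s \<le> t \<Longrightarrow> \<xi> s \<omega> = None \<Longrightarrow> \<xi> t \<omega> = None"
    and laplace: "\<And>f. bounded_borel (topo_borel E_del) f \<Longrightarrow> (\<And>y. 0 \<le> f y) \<Longrightarrow>
          \<exists>v. cumulant_solution \<xi> Q (psi \<alpha> \<beta> \<pi>) f v \<and>
            (\<forall>v'. cumulant_solution \<xi> Q (psi \<alpha> \<beta> \<pi>) f v' \<longrightarrow> (\<forall>t\<ge>0. \<forall>x. v' t x = v t x)) \<and>
            (\<forall>\<mu>\<in>finite_measures (topo_borel E_del). \<forall>t\<ge>0.
               (\<integral>\<omega>. exp (- (\<integral>y. f y \<partial>X t \<omega>)) \<partial>P \<mu>) = exp (- (\<integral>y. v t y \<partial>\<mu>)))"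

text \<open>The mean semigroup, for functions with values in \<open>[0, \<infinity>]\<close>.\<close>

definition mean_semigroup ::
  "(real \<Rightarrow> 'v \<Rightarrow> 'e option) \<Rightarrow> ('e option \<Rightarrow> 'v measure) \<Rightarrow> ('e \<Rightarrow> real) \<Rightarrow>
   real \<Rightarrow> ('e \<Rightarrow> ennreal) \<Rightarrow> 'e \<Rightarrow> ennreal" where
  "mean_semigroup \<xi> Q \<beta> t f x =
     (\<integral>\<^sup>+\<omega>. ennreal (exp (LBINT s:{0..t}. ext0 \<beta> (\<xi> s \<omega>))) * ext0 f (\<xi> t \<omega>)
          * indicator {\<omega>. ereal t < lifetime \<xi> \<omega>} \<omega> \<partial>Q (Some x))"

definition L1_plus :: "'e::topological_space measure \<Rightarrow> ('e \<Rightarrow> real) set" where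
  "L1_plus \<nu> = {f \<in> borel_measurable borel. (\<forall>x. 0 \<le> f x) \<and> integrable \<nu> f}"

definition pi_phi :: "('e \<Rightarrow> real measure) \<Rightarrow> ('e \<Rightarrow> real) \<Rightarrow> 'e \<Rightarrow> real measure" where
  "pi_phi \<pi> \<phi> x = distr (\<pi> x) borel (\<lambda>r. r * \<phi> x)"

definition M_phi ::
  "real \<Rightarrow> ('e \<Rightarrow> real) \<Rightarrow> (real \<Rightarrow> 'w \<Rightarrow> 'e::topological_space option measure) \<Rightarrow>
   real \<Rightarrow> 'w \<Rightarrow> real" where
  "M_phi l \<phi> X t \<omega> = exp (- l * t) * (\<integral>x. \<phi> x \<partial>restr_E (X t \<omega>))"

definition A_int :: "real \<Rightarrow> real \<Rightarrow> ('w \<Rightarrow> real) \<Rightarrow> (real \<Rightarrow> 'w \<Rightarrow> real) \<Rightarrow> real \<Rightarrow> 'w \<Rightarrow> real" where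
  "A_int l b Minf Mart t \<omega> = (LBINT s:{0..t}. exp (l * s / b) * (Minf \<omega> - Mart s \<omega>))"

section \<open>Convergence in \<open>L\<^sup>p\<close>\<close>

definition Lp_space :: "real \<Rightarrow> 'w measure \<Rightarrow> ('w \<Rightarrow> real) set" where
  "Lp_space p M = {f \<in> borel_measurable M. integrable M (\<lambda>\<omega>. \<bar>f \<omega>\<bar> powr p)}"

text \<open>Only meaningful on \<^const>\<open>Lp_space\<close>, so it is always used along with a membership condition.\<close>

definition Lp_norm :: "real \<Rightarrow> 'w measure \<Rightarrow> ('w \<Rightarrow> real) \<Rightarrow> real" where
  "Lp_norm p M f = (\<integral>\<omega>. \<bar>f \<omega>\<bar> powr p \<partial>M) powr (1 / p)"

definition converges_Lp :: "real \<Rightarrow> 'w measure \<Rightarrow> (real \<Rightarrow> 'w \<Rightarrow> real) \<Rightarrow> bool" where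
  "converges_Lp p M Y \<longleftrightarrow> (\<forall>\<^sub>F t in at_top. Y t \<in> Lp_space p M) \<and>
     (\<exists>Z\<in>Lp_space p M. ((\<lambda>t. Lp_norm p M (\<lambda>\<omega>. Y t \<omega> - Z \<omega>)) \<longlongrightarrow> 0) at_top)"

definition converges_AE :: "'w measure \<Rightarrow> (real \<Rightarrow> 'w \<Rightarrow> real) \<Rightarrow> bool" where
  "converges_AE M Y \<longleftrightarrow> (AE \<omega> in M. \<exists>l. ((\<lambda>t. Y t \<omega>) \<longlongrightarrow> l) at_top)"

definition Lp_norm_smallo ::
  "real \<Rightarrow> 'w measure \<Rightarrow> (real \<Rightarrow> 'w \<Rightarrow> real) \<Rightarrow> (real \<Rightarrow> real) \<Rightarrow> bool" where
  "Lp_norm_smallo p M Y g \<longleftrightarrow> (\<forall>\<^sub>F t in at_top. Y t \<in> Lp_space p M) \<and>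
     (\<lambda>t. Lp_norm p M (Y t)) \<in> o[at_top](g)"

end

theory Submission
 imports Defs
begin

text \<open>Write \<open>X(\<phi>)\<close> for the integral of \<open>\<phi>\<close> against \<open>X\<close>. The proof compares moments of increments of the
martingale \<open>exp (- l t) X\<^sub>t(\<phi>)\<close> with moments of the jump measure \<open>\<pi>\<close>, scaled by \<open>\<phi>\<close> and averaged over \<open>\<nu>\<close>.
Started from \<open>\<eta>\<close>, the centred variable \<open>Z = exp (- l s) X\<^sub>s(\<phi>) - \<eta>(\<phi>)\<close> satisfies
\<open>E (exp (- \<theta> Z) - 1 + \<theta> Z) = exp (\<eta>(d)) - 1\<close>, where \<open>d\<close> is the gap between \<open>\<theta> \<phi>\<close> and its cumulant
(\<open>exprem_expectation\<close>). The left side measures the truncated square \<open>min \<bar>\<theta> Z\<bar> (\<theta> Z)\<^sup>2\<close>. On the right side, \<open>d\<close> is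
an integral over the mean semigroup of the non-linear part of the branching mechanism, evaluated near \<open>\<theta> \<phi>\<close>, and this
part is comparable to the integral of the truncated square of \<open>\<theta> r\<close> against the scaled jump measure. A comparison of
truncated squares at all small scales \<open>\<theta>\<close> yields one of \<open>p\<close>-th moments (\<open>tail_moment_comparison\<close>), since
\<open>\<bar>u\<bar> powr p\<close> is a mixture of truncated squares.

If the \<open>p\<close>-th jump moment is finite, then \<open>d\<close> is bounded from above (\<open>deficit_le_cells\<close>), and
the Markov property at time \<open>t\<close> bounds the \<open>p\<close>-th moment of any increment after \<open>t\<close> by a multiple of
\<open>exp (- l (p - 1) t)\<close> (\<open>increment_moment_le\<close>): there is one factor \<open>exp (l t)\<close> for the
mass present at time \<open>t\<close> and a factor \<open>exp (- l p t)\<close> for the normalization. By Fatou's lemma the same bound holds for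
the remainder of the martingale. The weight \<open>exp (l s / a_star)\<close> contributes \<open>exp (l p s / a_star)\<close>, and
\<open>p / a_star < p - 1\<close> because \<open>a < p\<close>. An exponential rate is left over; it gives the third claim at
once, and the first one through a weighted Hoelder inequality (\<open>random_integral_converges\<close>).

Conversely, \<open>d\<close> is bounded from below by the jump integral over the mass present at time \<open>t\<close>, and for large \<open>t\<close>
the mean semigroup spreads this mass over \<open>\<nu>\<close>. One sufficiently late increment in \<open>L\<^sup>p\<close> therefore forces the
moment condition (\<open>increment_moment_imp_nu_jump\<close>). The fourth claim is then immediate. For the second one, the limit is
eliminated by comparing the averages of the martingale over two disjoint time windows; projecting the later average on the
past turns it into a single value of the martingale (\<open>windows_Lp_imp_increment_Lp\<close>).\<close>

text \<open>Short names for notions that occur in almost every line; \<open>NN\<close> is the analogue of \<open>LINT\<close> for the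
non-negative integral.\<close>

abbreviation (input) bm :: "'a measure => ('a => 'b::topological_space) set" where "bm == borel_measurable"

abbreviation (input) en :: "real => ennreal" where "en == ennreal"

abbreviation (input) ind :: "'a set => 'a => 'b::zero_neq_one" where "ind == indicator"

abbreviation (input) prodm (infixr "\<Otimes>" 80) where "A \<Otimes> B == A \<Otimes>\<^sub>M B"

abbreviation "BE == topo_borel E_del"

syntax "_NN" :: "pttrn => 'a measure => ennreal => ennreal" ("(NN _|_./ _)" [0, 110, 60] 60)
translations "NN x|M. f" => "CONST nn_integral M (%x. f)"

section \<open>Truncated squares and the exponential remainder\<close>

definition qmin :: "real => real" where
 "qmin u = min \<bar>u\<bar> (u\<^sup>2)"

definition exprem :: "real => real" where
 "exprem u = exp (- u) - 1 + u"

lemma qmin_measurable [measurable]: "qmin : bm borel"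
 unfolding qmin_def by measurable

lemma exprem_measurable [measurable]: "exprem : bm borel"
 unfolding exprem_def by measurable

lemma qmin_nonneg [simp]: "0 <= qmin u"
 unfolding qmin_def by simp

lemma exprem_nonneg [simp]: "0 <= exprem u"
 using exp_ge_add_one_self[of "- u"] unfolding exprem_def by simp

lemma qmin_abs [simp]: "qmin \<bar>u\<bar> = qmin u"
 unfolding qmin_def by simp

lemma exprem_le_qmin:
 assumes "0 <= u"
 shows "exprem u <= qmin u"
proof -
 have e: "1 + u + u\<^sup>2 / 2 <= exp u"
  using exp_lower_Taylor_quadratic[OF assms] by simp
 have "1 <= 1 + u\<^sup>2/2 + u^3/2 + u^4/2"
  using assms by simp
 also have "... = (1 - u + u\<^sup>2) * (1 + u + u\<^sup>2 / 2)"
  by (simp add: field_simps power2_eq_square power3_eq_cube power4_eq_xxxx)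
 also have "... <= (1 - u + u\<^sup>2) * exp u"
 proof (intro mult_left_mono e)
  have "0 <= (1 - u/2)\<^sup>2 + 3/4 * u\<^sup>2" by simp
  also have "... = 1 - u + u\<^sup>2" by (simp add: power2_eq_square algebra_simps)
  finally show "0 <= 1 - u + u\<^sup>2" .
 qed
 finally have "exp (- u) <= 1 - u + u\<^sup>2"
  by (simp add: exp_minus field_simps)
 thus ?thesis
  using assms unfolding exprem_def qmin_def by (auto simp: min_def)
qed

lemma qmin_le_exprem: "qmin u / 4 <= exprem u"
proof -
 consider "u < 0" | "0 <= u" "u <= 2" | "2 < u" by linarith
 thus ?thesis
 proof cases
  case 1
  have "1 + (- u) + (- u)\<^sup>2 / 2 <= exp (- u)"
  by (rule exp_lower_Taylor_quadratic) (use 1 in simp)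
  hence "u\<^sup>2 / 2 <= exprem u" unfolding exprem_def by simp
  moreover have "qmin u <= u\<^sup>2" unfolding qmin_def by simp
  ultimately show ?thesis using zero_le_power2[of u] by linarith
 next
  case 2
  have "1 - u / 2 <= exp (- (u / 2))"
  using exp_ge_add_one_self[of "- (u / 2)"] by simp
  hence "(1 - u / 2)\<^sup>2 <= (exp (- (u / 2)))\<^sup>2"
  using 2 by (intro power_mono) auto
  also have "... = exp (- u)"
  by (simp add: power2_eq_square flip: exp_add)
  finally have "u\<^sup>2 / 4 <= exprem u"
  unfolding exprem_def by (simp add: power2_eq_square field_simps)
  moreover have "qmin u <= u\<^sup>2" unfolding qmin_def by simp
  ultimately show ?thesis by linarith
 next
  case 3
  have "u / 2 <= exprem u" using 3 exp_gt_zero[of "- u"] unfolding exprem_def by linarith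
  moreover have "qmin u <= u" using 3 unfolding qmin_def by simp
  ultimately show ?thesis using 3 by linarith
 qed
qed

text \<open>The remainder grows exponentially at \<open>-\<infinity>\<close>. A centred functional of a superprocess is bounded
 below by minus its mean, which is the initial mass; the factor \<open>exp (- m)\<close> is what makes up for
 this growth.\<close>

lemma exp_exprem_le_qmin:
 assumes "0 <= m" "- m <= u"
 shows "exp (- m) * exprem u <= qmin u"
proof (cases "0 <= u")
 case True
 have "exp (- m) * exprem u <= 1 * exprem u"
  using assms by (intro mult_right_mono) auto
 thus ?thesis using exprem_le_qmin[OF True] by simp
next
 case False
 have "exp (- m) * exprem u <= exp u * exprem u"
  using assms by (intro mult_right_mono) auto
 also have "... = 1 - (1 - u) * exp u"
  unfolding exprem_def by (simp add: algebra_simps flip: exp_add)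
 also have "... <= qmin u"
 proof -
  have "1 + u <= exp u" by (rule exp_ge_add_one_self)
  hence "(1 - u) * (1 + u) <= (1 - u) * exp u"
  using False by (intro mult_left_mono) auto
  moreover have "(1 - u) * exp u \<ge> 1 * exp u"
  using False by (intro mult_right_mono) auto
  moreover have "(1 - u) * (1 + u) = 1 - u\<^sup>2" by (simp add: power2_eq_square algebra_simps)
  ultimately have "1 - (1 - u) * exp u <= u\<^sup>2" "1 - (1 - u) * exp u <= - u"
  using \<open>1 + u \<le> exp u\<close> by linarith+
  thus ?thesis
  using False unfolding qmin_def by simp
 qed
 finally show ?thesis .
qed

lemma qmin_le_powr:
 assumes "1 <= p" "p <= 2"
 shows "qmin u <= \<bar>u\<bar> powr p"
proof (cases "\<bar>u\<bar> <= 1")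
 case True
 show ?thesis
 proof (cases "u = 0")
  case False
  have "qmin u <= \<bar>u\<bar> powr 2" using False unfolding qmin_def by (simp add: powr_numeral)
  also have "... <= \<bar>u\<bar> powr p" using True assms by (intro powr_mono') auto
  finally show ?thesis .
 qed (simp add: qmin_def)
next
 case False
 have "qmin u <= \<bar>u\<bar> powr 1" using False unfolding qmin_def by simp
 also have "... <= \<bar>u\<bar> powr p" using False assms by (intro powr_mono) auto
 finally show ?thesis .
qed

lemma qmin_mult_ge:
 assumes "0 <= k" "k <= 1"
 shows "k\<^sup>2 * qmin u <= qmin (k * u)"
proof -
 have "k\<^sup>2 * \<bar>u\<bar> <= k * \<bar>u\<bar>" using assms
  by (intro mult_right_mono) (auto simp: power2_eq_square mult_left_le)
 thus ?thesis
  using assms unfolding qmin_def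
  by (auto simp: abs_mult power_mult_distrib min_le_iff_disj min_mult_distrib_left)
qed

section \<open>Moments from truncated squares\<close>

lemma inverse_powr: "0 < v ==> (1 / v) powr x = v powr (- x)" for v x :: real
 by (simp add: powr_divide powr_minus_divide)

lemma nn_integral_set_has_integral:
 fixes f :: "real => real"
 assumes "\<And>x. 0 <= f x" "(f has_integral I) S"
 shows "(\<integral>\<^sup>+x\<in>S. en (f x) \<partial>lborel) = en I"
proof -
 have "(\<integral>\<^sup>+x\<in>S. en (f x) \<partial>lborel) = (NN x|lborel. en (f x * ind S x))"
  by (intro nn_integral_cong) (auto simp: indicator_def)
 also have "... = en I"
  using nn_integral_has_integral_lebesgue[OF assms] by (simp add: mult.commute)
 finally show ?thesis .
qed

text \<open>For \<open>1 < p < 2\<close> the function \<open>\<bar>u\<bar> powr p\<close> is a mixture of the truncated squares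
 \<open>qmin (th * u)\<close> with weight \<open>th powr (- 1 - p)\<close>. The scales up to \<open>1 / \<bar>u\<bar>\<close> alone already
 contribute a fixed proportion, which is why a comparison for small \<open>th\<close> controls the tails.\<close>

lemma nn_integral_qmin_scale_le:
 assumes p: "1 < p" "p < 2"
 shows "(\<integral>\<^sup>+th\<in>{0<..}. en (th powr (- 1 - p) * qmin (th * u)) \<partial>lborel)
  <= en (1 / (2 - p) + 1 / (p - 1)) * en (\<bar>u\<bar> powr p)"
proof (cases "u = 0")
  let ?a0 = "%v. (1/v) powr (2 - p) / (2 - p)"
  let ?b0 = "%v. (1/v) powr (1 - p) / (p - 1)"
 case False
 define v where "v = \<bar>u\<bar>"
 have v: "0 < v" using False by (simp add: v_def)
 have i1: "((%x. x powr (1 - p)) has_integral (?a0 v)) {0..1/v}"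
  using has_integral_powr_from_0[of "1 - p" "1/v"] p v by (simp add: algebra_simps)
 have i2: "((%x. x powr (- p)) has_integral (?b0 v)) {1/v..}"
 proof -
  have "- ((1/v) powr (- p + 1)) / (- p + 1) = (1/v) powr (1 - p) / (p - 1)"
  using p by (simp add: field_simps)
  thus ?thesis
  using has_integral_powr_to_inf[of "- p" "1/v"] p v by simp
 qed
 have n1: "(\<integral>\<^sup>+x\<in>{0..1/v}. en (x powr (1 - p)) \<partial>lborel) = en (?a0 v)"
  by (rule nn_integral_set_has_integral[OF _ i1]) simp
 have n2: "(\<integral>\<^sup>+x\<in>{1/v..}. en (x powr (- p)) \<partial>lborel) = en (?b0 v)"
  by (rule nn_integral_set_has_integral[OF _ i2]) simp
 have "(\<integral>\<^sup>+th\<in>{0<..}. en (th powr (- 1 - p) * qmin (th * u)) \<partial>lborel)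
  <= (NN th|lborel. en (v\<^sup>2) * (en (th powr (1 - p)) * ind {0..1/v} th)
  + en v * (en (th powr (- p)) * ind {1/v..} th))"
 proof (intro nn_integral_mono)
  fix th :: real
  show "en (th powr (- 1 - p) * qmin (th * u)) * ind {0<..} th
  <= en (v\<^sup>2) * (en (th powr (1 - p)) * ind {0..1/v} th)
  + en v * (en (th powr (- p)) * ind {1/v..} th)"
  proof (cases "0 < th")
  case True
  show ?thesis
  proof (cases "th <= 1/v")
  case le: True
  have "th powr (- 1 - p) * qmin (th * u) <= th powr (- 1 - p) * (th powr 2 * v\<^sup>2)"
  using True by (intro mult_left_mono) (auto simp: qmin_def v_def power_mult_distrib powr_numeral)
  also have "... = v\<^sup>2 * th powr (1 - p)"
  by (simp add: mult.assoc[symmetric] powr_add[symmetric])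
  finally show ?thesis
  using True le by (auto simp: indicator_def ennreal_mult'[symmetric] intro!: add_increasing2 ennreal_leI)
  next
  case gt: False
  have "th powr (- 1 - p) * qmin (th * u) <= th powr (- 1 - p) * (th powr 1 * v)"
  using True by (intro mult_left_mono) (auto simp: qmin_def v_def abs_mult)
  also have "... = v * th powr (- p)"
  by (simp only: mult.assoc[symmetric] powr_add[symmetric]) (simp add: mult.commute)
  finally show ?thesis
  using True gt v by (auto simp: indicator_def ennreal_mult'[symmetric] intro!: add_increasing2 ennreal_leI)
  qed
  qed simp
 qed
 also have "... = en (v\<^sup>2) * en (?a0 v) + en v * en (?b0 v)"
  by (subst nn_integral_add) (simp_all add: nn_integral_cmult n1 n2)
 also have "... = en (v\<^sup>2 * (?a0 v) + v * (?b0 v))"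
  using v p by (simp add: ennreal_mult'[symmetric] ennreal_plus[symmetric] del: ennreal_plus)
 also have "v\<^sup>2 * (?a0 v) = v powr p / (2 - p)"
 proof -
  have "v\<^sup>2 * (1/v) powr (2 - p) = v powr 2 * v powr (- (2 - p))"
  unfolding inverse_powr[OF v] using v by (simp add: powr_numeral)
  also have "... = v powr p" by (simp add: powr_add[symmetric])
  finally show ?thesis by simp
 qed
 also have "v * (?b0 v) = v powr p / (p - 1)"
 proof -
  have "v * (1/v) powr (1 - p) = v powr 1 * v powr (- (1 - p))"
  unfolding inverse_powr[OF v] using v by simp
  also have "... = v powr p" by (simp only: powr_add[symmetric]) simp
  finally show ?thesis by simp
 qed
 also have "v powr p / (2 - p) + v powr p / (p - 1) = (1 / (2 - p) + 1 / (p - 1)) * v powr p"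
  by (simp add: algebra_simps)
 also have "ennreal ... = en (1 / (2 - p) + 1 / (p - 1)) * en (\<bar>u\<bar> powr p)"
  using p by (simp add: v_def ennreal_mult')
 finally show ?thesis .
qed (simp add: qmin_def)

lemma nn_integral_qmin_scale_ge:
 assumes p: "1 < p" "p < 2" and T: "0 < T" "1 / T <= \<bar>u\<bar>"
 shows "en (1 / (2 - p)) * en (\<bar>u\<bar> powr p)
  <= (\<integral>\<^sup>+th\<in>{0<..T}. en (th powr (- 1 - p) * qmin (th * u)) \<partial>lborel)"
proof -
  let ?a0 = "%v. (1/v) powr (2 - p) / (2 - p)"
 define v where "v = \<bar>u\<bar>"
 have v: "0 < v" using T by (auto simp: v_def intro: less_le_trans[of 0 "1/T"])
 have vT: "1 / v <= T" using T v by (simp add: v_def field_simps)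
 have i1: "((%x. x powr (1 - p)) has_integral (?a0 v)) {0..1/v}"
  using has_integral_powr_from_0[of "1 - p" "1/v"] p v by (simp add: algebra_simps)
 have n1: "(\<integral>\<^sup>+x\<in>{0..1/v}. en (x powr (1 - p)) \<partial>lborel) = en (?a0 v)"
  by (rule nn_integral_set_has_integral[OF _ i1]) simp
 have "v\<^sup>2 * (?a0 v) = v powr p / (2 - p)"
 proof -
  have "v\<^sup>2 * (1/v) powr (2 - p) = v powr 2 * v powr (- (2 - p))"
  unfolding inverse_powr[OF v] using v by (simp add: powr_numeral)
  also have "... = v powr p" by (simp add: powr_add[symmetric])
  finally show ?thesis by simp
 qed
 hence "en (1 / (2 - p)) * en (\<bar>u\<bar> powr p) = en (v\<^sup>2 * (?a0 v))"
  using p by (simp add: v_def ennreal_mult'[symmetric])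
 also have "... = (NN th|lborel. en (v\<^sup>2) * (en (th powr (1 - p)) * ind {0..1/v} th))"
  using p v by (simp add: nn_integral_cmult n1 ennreal_mult'[symmetric])
 also have "... <= (\<integral>\<^sup>+th\<in>{0<..T}. en (th powr (- 1 - p) * qmin (th * u)) \<partial>lborel)"
 proof (intro nn_integral_mono)
  fix th :: real
  show "en (v\<^sup>2) * (en (th powr (1 - p)) * ind {0..1/v} th)
  <= en (th powr (- 1 - p) * qmin (th * u)) * ind {0<..T} th"
  proof (cases "0 < th \<and> th <= 1/v")
  case True
  have "th * v <= 1" using True v by (simp add: field_simps)
  hence "(th * v) * (th * v) <= 1 * (th * v)" using True v by (intro mult_right_mono) auto
  hence "qmin (th * u) = th powr 2 * v\<^sup>2"
  using True unfolding qmin_def v_def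
  by (auto simp: power2_eq_square abs_mult powr_numeral mult_ac min_def)
  hence "th powr (- 1 - p) * qmin (th * u) = v\<^sup>2 * th powr (1 - p)"
  by (simp add: mult.assoc[symmetric] powr_add[symmetric])
  thus ?thesis using True vT by (simp add: ennreal_mult')
  next
  case False
  thus ?thesis by (cases "th = 0") (auto simp: indicator_def)
  qed
 qed
 finally show ?thesis .
qed

text \<open>If the truncated squares of \<open>f\<close> are dominated by those of \<open>g\<close> at all small scales, then the
 tail of the \<open>p\<close>-th moment of \<open>f\<close> is dominated by the \<open>p\<close>-th moment of \<open>g\<close>. For \<open>p < 2\<close> the
 hypothesis is integrated against \<open>th powr (- 1 - p)\<close>. This weight fails for \<open>p = 2\<close>, where
 instead \<open>th\<close> tends to 0 since \<open>qmin (th * u) / th\<^sup>2\<close> increases to \<open>u\<^sup>2\<close>.\<close>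

lemma tail_moment_comparison:
 fixes f :: "'a => real" and g :: "'b => real" and K :: ennreal
 assumes A: "sigma_finite_measure A" and B: "sigma_finite_measure B"
  and f [measurable]: "f : bm A" and g [measurable]: "g : bm B"
  and p: "1 < p" "p <= 2" and T: "0 < T"
  and le: "\<And>th. 0 < th ==> th <= T ==>
  (NN x|A. en (qmin (th * f x))) <= K * (NN y|B. en (qmin (th * g y)))"
 shows "(NN x|A. en (\<bar>f x\<bar> powr p) * ind {x. 1 / T <= \<bar>f x\<bar>} x)
  <= en (1 / (p - 1)) * (K * (NN y|B. en (\<bar>g y\<bar> powr p)))"
proof (cases "p = 2")
 case True
 have n2: "en (real n ^ 2) * (NN x|A. en (qmin (1 / real n * f x)))
  <= K * (NN y|B. en (\<bar>g y\<bar> powr p))" if n: "1 / T <= real n" for n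
 proof -
  have "0 < 1 / T" using T by simp
  with n have np: "0 < real n" by linarith
  have "(NN x|A. en (qmin (1 / real n * f x))) <= K * (NN y|B. en (qmin (1 / real n * g y)))"
  using n np T by (intro le) (auto simp: field_simps)
  hence "en (real n ^ 2) * (NN x|A. en (qmin (1 / real n * f x)))
  <= en (real n ^ 2) * (K * (NN y|B. en (qmin (1 / real n * g y))))"
  by (rule mult_left_mono) simp
  also have "... = K * (NN y|B. en (real n ^ 2) * en (qmin (1 / real n * g y)))"
  by (subst nn_integral_cmult) (auto simp: mult_ac)
  also have "... <= K * (NN y|B. en (\<bar>g y\<bar> powr p))"
  proof (intro mult_left_mono nn_integral_mono)
  fix y
  have "real n ^ 2 * qmin (1 / real n * g y) <= real n ^ 2 * (1 / real n * g y)\<^sup>2"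
  by (intro mult_left_mono) (auto simp: qmin_def)
  also have "... = (g y)\<^sup>2" using np by (simp add: power_mult_distrib power_divide)
  also have "... = \<bar>g y\<bar> powr p" using True by (cases "g y = 0") (auto simp: powr_numeral)
  finally show "en (real n ^ 2) * en (qmin (1 / real n * g y)) <= en (\<bar>g y\<bar> powr p)"
  by (simp add: ennreal_mult'[symmetric] ennreal_leI)
  qed simp
  finally show ?thesis .
 qed
 have lim: "(%n. real n ^ 2 * qmin (1 / real n * u)) \<longlonglongrightarrow> \<bar>u\<bar> powr p" for u
 proof (rule Lim_transform_eventually[OF tendsto_const])
  obtain N :: nat where N: "\<bar>u\<bar> < real N" using reals_Archimedean2 by blast
  show "\<forall>\<^sub>F n in sequentially. \<bar>u\<bar> powr p = real n ^ 2 * qmin (1 / real n * u)"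
  using eventually_ge_at_top[of "max N 1"]
  proof eventually_elim
  case (elim n)
  hence n: "0 < real n" "\<bar>u\<bar> <= real n" using N by auto
  have "\<bar>u\<bar> * \<bar>u\<bar> <= real n * \<bar>u\<bar>" by (rule mult_right_mono) (use n in auto)
  hence "(1 / real n * u)\<^sup>2 <= \<bar>1 / real n * u\<bar>"
  using n by (simp add: abs_mult power2_eq_square field_simps)
  hence "real n ^ 2 * qmin (1 / real n * u) = u\<^sup>2"
  using n by (simp add: qmin_def min_def power_mult_distrib power_divide)
  thus ?case using True by (cases "u = 0") (auto simp: powr_numeral)
  qed
 qed
 have "(NN x|A. en (\<bar>f x\<bar> powr p) * ind {x. 1 / T <= \<bar>f x\<bar>} x)
  <= (NN x|A. liminf (%n. en (real n ^ 2 * qmin (1 / real n * f x))))"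
 proof (intro nn_integral_mono)
  fix x
  have "liminf (%n. en (real n ^ 2 * qmin (1 / real n * f x))) = en (\<bar>f x\<bar> powr p)"
  by (intro lim_imp_Liminf tendsto_ennrealI lim) simp
  thus "en (\<bar>f x\<bar> powr p) * ind {x. 1 / T <= \<bar>f x\<bar>} x
  <= liminf (%n. en (real n ^ 2 * qmin (1 / real n * f x)))"
  by (auto simp: indicator_def)
 qed
 also have "... <= liminf (%n. \<integral>\<^sup>+x. en (real n ^ 2 * qmin (1 / real n * f x)) \<partial>A)"
  by (rule nn_integral_liminf) measurable
 also have "... <= liminf (%n. K * (NN y|B. en (\<bar>g y\<bar> powr p)))"
 proof (rule Liminf_mono)
  obtain N :: nat where N: "1 / T < real N" using reals_Archimedean2 by blast
  show "\<forall>\<^sub>F n in sequentially. (NN x|A. en (real n ^ 2 * qmin (1 / real n * f x)))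
  <= K * (NN y|B. en (\<bar>g y\<bar> powr p))"
  using eventually_ge_at_top[of N]
  proof eventually_elim
  case (elim n)
  hence "1 / T <= real n" using N by linarith
  from n2[OF this] show ?case
  by (simp add: ennreal_mult' nn_integral_cmult)
  qed
 qed
 also have "... = K * (NN y|B. en (\<bar>g y\<bar> powr p))"
  by (intro Liminf_const) simp
 finally show ?thesis using True by simp
next
 case False
 hence p2: "p < 2" using p by simp
 interpret A: sigma_finite_measure A by fact
 interpret B: sigma_finite_measure B by fact
 interpret AL: pair_sigma_finite A lborel ..
 interpret BL: pair_sigma_finite B lborel ..
 define w where "w th u = en (th powr (- 1 - p) * qmin (th * u))" for th u
 have w_eq: "w th u = en (th powr (- 1 - p)) * en (qmin (th * u))" for th u
  unfolding w_def by (simp add: ennreal_mult')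
 have [measurable]: "(%(th, u). w th u) : bm (borel \<Otimes> borel)"
  unfolding w_def by measurable
 have "en (1 / (2 - p)) * (NN x|A. en (\<bar>f x\<bar> powr p) * ind {x. 1 / T <= \<bar>f x\<bar>} x)
  = (NN x|A. en (1 / (2 - p)) * (en (\<bar>f x\<bar> powr p) * ind {x. 1 / T <= \<bar>f x\<bar>} x))"
  by (subst nn_integral_cmult) auto
 also have "... <= (NN x|A. (\<integral>\<^sup>+th\<in>{0<..T}. w th (f x) \<partial>lborel))"
 proof (intro nn_integral_mono)
  fix x
  show "en (1 / (2 - p)) * (en (\<bar>f x\<bar> powr p) * ind {x. 1 / T <= \<bar>f x\<bar>} x)
  <= (\<integral>\<^sup>+th\<in>{0<..T}. w th (f x) \<partial>lborel)"
  using nn_integral_qmin_scale_ge[OF p(1) p2 T, of "f x"] unfolding w_def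
  by (auto simp: indicator_def)
 qed
 also have "... = (NN th|lborel. (NN x|A. w th (f x) * ind {0<..T} th))"
  by (rule AL.Fubini'[symmetric]) measurable
 also have "... <= (NN th|lborel. K * (NN y|B. w th (g y) * ind {0<..T} th))"
 proof (intro nn_integral_mono)
  fix th :: real
  show "(NN x|A. w th (f x) * ind {0<..T} th) <= K * (NN y|B. w th (g y) * ind {0<..T} th)"
  proof (cases "th : {0<..T}")
  case True
  have "en (th powr (- 1 - p)) * (NN x|A. en (qmin (th * f x)))
  <= en (th powr (- 1 - p)) * (K * (NN y|B. en (qmin (th * g y))))"
  using True by (intro mult_left_mono le) auto
  thus ?thesis
  using True by (simp add: w_eq nn_integral_cmult mult.left_commute)
  qed simp
 qed
 also have "... = K * (NN th|lborel. (NN y|B. w th (g y) * ind {0<..T} th))"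
  by (rule nn_integral_cmult) measurable
 also have "(NN th|lborel. (NN y|B. w th (g y) * ind {0<..T} th))
  = (NN y|B. (\<integral>\<^sup>+th\<in>{0<..T}. w th (g y) \<partial>lborel))"
  by (rule BL.Fubini') measurable
 also have "K * ... <= K * (NN y|B. en (1 / (2 - p) + 1 / (p - 1)) * en (\<bar>g y\<bar> powr p))"
 proof (intro mult_left_mono nn_integral_mono)
  fix y
  have "(\<integral>\<^sup>+th\<in>{0<..T}. w th (g y) \<partial>lborel) <= (\<integral>\<^sup>+th\<in>{0<..}. w th (g y) \<partial>lborel)"
  by (intro nn_integral_mono) (auto simp: indicator_def)
  also have "... <= en (1 / (2 - p) + 1 / (p - 1)) * en (\<bar>g y\<bar> powr p)"
  unfolding w_def by (rule nn_integral_qmin_scale_le[OF p(1) p2])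
  finally show "(\<integral>\<^sup>+th\<in>{0<..T}. w th (g y) \<partial>lborel) <= en (1 / (2 - p) + 1 / (p - 1)) * en (\<bar>g y\<bar> powr p)" .
 qed simp
 finally have main: "en (1 / (2 - p)) * (NN x|A. en (\<bar>f x\<bar> powr p) * ind {x. 1 / T <= \<bar>f x\<bar>} x)
  <= en (1 / (2 - p) + 1 / (p - 1)) * (K * (NN y|B. en (\<bar>g y\<bar> powr p)))" (is "_ * ?L <= _ * ?R")
  by (simp add: nn_integral_cmult mult.left_commute)
 have "en (2 - p) * (en (1 / (2 - p)) * ?L) <= en (2 - p) * (en (1 / (2 - p) + 1 / (p - 1)) * ?R)"
  by (intro mult_left_mono main) simp
 moreover have "en (2 - p) * en (1 / (2 - p)) = 1"
  using p2 by (simp add: ennreal_mult'[symmetric])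
 moreover have "(2 - p) * (1 / (2 - p) + 1 / (p - 1)) = 1 / (p - 1)"
 proof -
  have "(2 - p) * (1 / (2 - p)) = 1" "(2 - p) * (1 / (p - 1)) + 1 = 1 / (p - 1)"
  using p2 p by (simp_all add: field_simps)
  thus ?thesis by (simp add: distrib_left)
 qed
 hence "en (2 - p) * en (1 / (2 - p) + 1 / (p - 1)) = en (1 / (p - 1))"
  using p2 by (simp add: ennreal_mult'[symmetric])
 ultimately show ?thesis by (simp add: mult.assoc[symmetric])
qed

text \<open>A linear functional on the non-negative Borel functions of the line that respects increasing
 limits is integration against a measure. Nested integrals over kernels become single measures in
 this way, and \<open>tail_moment_comparison\<close> applies to them.\<close>

lemma functional_is_integral:
 fixes J :: "(real => ennreal) => ennreal"
 assumes add: "\<And>f g. f : bm borel ==> g : bm borel ==> J (%x. f x + g x) = J f + J g"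
  and cmult: "\<And>f c. f : bm borel ==> J (%x. c * f x) = c * J f"
  and SUP: "\<And>f. (\<And>i::nat. f i : bm borel) ==> incseq f ==> J (%x. SUP i. f i x) = (SUP i. J (f i))"
 obtains G where "sets G = sets borel"
  and "\<And>f. f : bm borel ==> (NN x|G. f x) = J f"
proof -
  let ?a0 = "%A. J (ind A)"
 define G where "G = measure_of UNIV (sets borel) ?a0"
 have zero: "J (%_. 0) = 0" using cmult[of "%_. 0" 0] by simp
 have sets_G: "sets G = sets borel" unfolding G_def
  by (metis sets.sets_measure_of_eq space_borel)
 have sum: "J (%x. \<Sum>i<n. f i x) = (\<Sum>i<n. J (f i))"
  if "\<And>i. f i : bm borel" for f :: "nat => real => ennreal" and n :: nat
  using that by (induction n) (simp_all add: zero add)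
 have "countably_additive (sets borel) ?a0"
 proof (rule countably_additiveI)
  fix A :: "nat => real set" assume A: "range A \<subseteq> sets borel" "disjoint_family A"
  have [measurable]: "\<And>i. A i : sets borel" using A by auto
  have "(\<Sum>i. J (ind (A i))) = (SUP n. \<Sum>i<n. J (ind (A i)))"
  by (rule suminf_eq_SUP)
  also have "... = (SUP n. J (%x. \<Sum>i<n. ind (A i) x))"
  by (subst sum) auto
  also have "... = J (%x. SUP n. \<Sum>i<n. ind (A i) x)"
  by (intro SUP[symmetric]) (auto simp: incseq_def le_fun_def intro!: sum_mono2)
  also have "(%x. SUP n. \<Sum>i<n. ind (A i) x :: ennreal) = ind (\<Union>i. A i)"
  by (intro ext) (simp add: suminf_eq_SUP[symmetric] suminf_indicator[OF A(2)])
  finally show "(\<Sum>i. J (ind (A i))) = J (ind (\<Union>i. A i))" .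
 qed
 moreover have "positive (sets borel) ?a0"
 proof -
  have "(ind {} :: real => ennreal) = (%_. 0)" by (auto simp: fun_eq_iff)
  thus ?thesis using zero by (simp add: positive_def)
 qed
 ultimately have em: "emeasure G A = J (ind A)" if "A : sets borel" for A
  unfolding G_def using that sets.sigma_algebra_axioms[of "borel :: real measure"]
  by (intro emeasure_measure_of_sigma) (auto)
 have "(NN x|G. f x) = J f" if "f : bm borel" for f
  using that
 proof (induction rule: borel_measurable_induct)
  case (cong f g)
  hence "f = g" by auto
  with cong show ?case by simp
 next
  case (set A)
  have "(NN x|G. ind A x) = emeasure G A"
  by (rule nn_integral_indicator) (simp add: sets_G set)
  thus ?case using em[OF set] by (simp add: eta_contract_eq[symmetric] del: nn_integral_indicator)
 next
  case (mult u c)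
  have "u : bm G" using mult by (simp add: measurable_cong_sets[OF sets_G refl])
  thus ?case using mult by (simp add: nn_integral_cmult cmult)
 next
  case (add u v)
  have "u : bm G" "v : bm G"
  using add by (simp_all add: measurable_cong_sets[OF sets_G refl])
  thus ?case using add by (simp add: nn_integral_add assms(1))
 next
  case (seq U)
  have "\<And>i. U i : bm G" using seq by (simp add: measurable_cong_sets[OF sets_G refl])
  hence "(NN x|G. (SUP i. U i x)) = (SUP i. \<integral>\<^sup>+x. U i x \<partial>G)"
  using seq by (intro nn_integral_monotone_convergence_SUP) auto
  thus ?case using SUP[OF seq(1)] seq by (simp add: image_comp SUP_apply[abs_def])
 qed
 with sets_G that show ?thesis by blast
qed

section \<open>Measurability on the one-point compactification\<close>

lemma space_topo_borel [simp]: "space (topo_borel S) = topspace S"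
 unfolding topo_borel_def by (rule space_measure_of) (auto dest: openin_subset)

lemma sets_topo_borel: "sets (topo_borel S) = sigma_sets (topspace S) {U. openin S U}"
 unfolding topo_borel_def by (rule sets_measure_of) (auto dest: openin_subset)

lemma openin_sets_topo_borel: "openin S U ==> U : sets (topo_borel S)"
 unfolding sets_topo_borel by blast

lemma continuous_map_topo_borel_measurable:
 fixes g :: "'s => real"
 assumes "continuous_map S euclideanreal g"
 shows "g : bm (topo_borel S)"
proof (rule borel_measurableI)
 fix U :: "real set" assume "open U"
 hence "openin S {x : topspace S. g x : U}"
  using assms by (auto simp: continuous_map_def)
 moreover have "{x : topspace S. g x : U} = g -` U \<inter> space (topo_borel S)" by auto
 ultimately show "g -` U \<inter> space (topo_borel S) : sets (topo_borel S)"
  by (metis openin_sets_topo_borel)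
qed

lemma insert_None_range_Some [simp]: "insert None (range Some) = UNIV"
 by (simp add: UNIV_option_conv)

lemma Some_measurable [measurable]: "Some : borel \<rightarrow>\<^sub>M topo_borel (E_del :: 'e::topological_space option topology)"
 unfolding topo_borel_def
proof (rule measurable_measure_of)
 fix U :: "'e option set" assume "U : {U. openin E_del U}"
 hence "openin euclidean {x : topspace euclidean. Some x : U}"
  using continuous_map_Some[of "euclidean :: 'e topology"] by (auto simp: continuous_map_def)
 thus "Some -` U \<inter> space borel : sets borel" by (simp add: vimage_def)
qed (auto dest: openin_subset)

lemma image_Some_sets: "B : sets borel ==> Some ` B : sets (topo_borel (E_del :: 'e::topological_space option topology))"
proof -
 have op: "Some ` U : sets (topo_borel (E_del :: 'e option topology))" if "open U" for U :: "'e set"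
  using that by (intro openin_sets_topo_borel) simp
 assume "B : sets borel"
 hence "B : sigma_sets UNIV {U. open U}" by (simp add: borel_def)
 thus ?thesis
 proof (induction)
  case (Compl a)
  have "Some ` (UNIV - a) = range Some - Some ` a" by auto
  thus ?case using op[of UNIV] Compl by auto
 next
  case (Union a)
  have "Some ` (\<Union>i. a i) = (\<Union>i. Some ` a i)" by auto
  thus ?case using Union by auto
 qed (auto intro: op)
qed

lemma range_Some_sets [measurable]: "range Some : sets (topo_borel (E_del :: 'e::topological_space option topology))"
 using image_Some_sets[of UNIV] by simp

lemma None_sets [measurable]: "{None} : sets (topo_borel (E_del :: 'e::topological_space option topology))"
proof -
 have "{None} = space (topo_borel (E_del :: 'e option topology)) - range Some"
  by (auto simp: notin_range_Some)
 thus ?thesis by (metis range_Some_sets sets.compl_sets)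
qed

lemma measurable_E_del_iff:
 fixes f :: "'e::topological_space option => 'b"
 assumes None: "f None : space N"
 shows "f : BE \<rightarrow>\<^sub>M N \<longleftrightarrow> (%x. f (Some x)) : borel \<rightarrow>\<^sub>M N"
proof
 assume "f : BE \<rightarrow>\<^sub>M N"
 thus "(%x. f (Some x)) : borel \<rightarrow>\<^sub>M N" by measurable
next
 assume m: "(%x. f (Some x)) : borel \<rightarrow>\<^sub>M N"
 show "f : BE \<rightarrow>\<^sub>M N"
 proof (rule measurableI)
  fix x show "f x : space N"
  using None measurable_space[OF m] by (cases x) auto
 next
  fix A assume A: "A : sets N"
  have "f -` A \<inter> space (BE) = Some ` ((%x. f (Some x)) -` A \<inter> space borel) \<union> (if f None : A then {None} else {})"
  proof (intro set_eqI)
  fix x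
  show "x : f -` A \<inter> space (BE) \<longleftrightarrow>
  x : Some ` ((%x. f (Some x)) -` A \<inter> space borel) \<union> (if f None : A then {None} else {})"
  by (cases x) auto
  qed
  also have "... : sets (BE)"
  using measurable_sets[OF m A] by (intro sets.Un image_Some_sets) auto
  finally show "f -` A \<inter> space (BE) : sets (BE)" .
 qed
qed

lemma ext0_None [simp]: "ext0 f None = 0" and ext0_Some [simp]: "ext0 f (Some x) = f x"
 by (simp_all add: ext0_def)

lemma ext0_measurable_iff:
 fixes f :: "'e::topological_space => 'b::{zero, topological_space}"
 shows "ext0 f : bm (BE) \<longleftrightarrow> f : bm borel"
 by (subst measurable_E_del_iff) auto

lemmas ext0_measurable = ext0_measurable_iff[THEN iffD2]

lemma continuous_map_E_del:
 fixes h :: "'e::metric_space => real"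
 assumes h: "continuous_on UNIV h" and C: "compact C" "\<And>x. x \<notin> C ==> h x = 0"
 shows "continuous_map E_del euclideanreal (ext0 h)"
 unfolding continuous_map_def
proof (intro conjI allI impI)
 fix V :: "real set" assume "openin euclidean V"
 hence V: "open V" by simp
 have op: "open (h -` V)" using h V by (simp add: continuous_on_open_vimage)
 show "openin E_del {x : topspace E_del. ext0 h x : V}"
 proof (cases "0 : V")
  case False
  hence "{x : topspace E_del. ext0 h x : V} = Some ` (h -` V)"
  by (auto simp: ext0_def split: option.splits)
  thus ?thesis using op by simp
 next
  case True
  have "closed (h -` (- V))" using op by (simp add: vimage_Compl closed_def)
  moreover have "h -` (- V) \<subseteq> C"
  proof
  fix x assume "x : h -` (- V)"
  thus "x : C" using C(2)[of x] True by (cases "x : C") auto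
  qed
  ultimately have "compact (h -` (- V))"
  using C(1) by (metis compact_Int_closed inf.absorb_iff2)
  moreover have "{x : topspace E_del. ext0 h x : V} = insert None (Some ` (topspace euclidean - h -` (- V)))"
  proof (rule set_eqI)
  fix y show "y : {x : topspace E_del. ext0 h x : V} \<longleftrightarrow> y : insert None (Some ` (topspace euclidean - h -` (- V)))"
  using True by (cases y) auto
  qed
  ultimately show ?thesis
  using \<open>closed (h -` (- V))\<close> unfolding openin_Alexandroff_compactification by (intro disjI2 exI[of _ "h -` (- V)"]) auto
 qed
qed auto

text \<open>The indicator of a compact set is a limit of the cut-off functions \<open>(1 - n d(x, K))\<^sup>+\<close>. By
 local compactness they have compact support for large \<open>n\<close>, so that they are continuous on the
 compactification.\<close>

lemma indicator_compact_approx: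
 fixes K :: "'e::metric_space set"
 assumes E: "locally_compact_space (euclidean :: 'e topology)" and K: "compact K"
 obtains g :: "nat => 'e option => real"
 where "\<And>n. continuous_map E_del euclideanreal (g n)" "\<And>n y. 0 <= g n y" "\<And>n y. g n y <= 1"
  "\<And>y. (%n. g n y) \<longlonglongrightarrow> ind (Some ` K) y"
proof (cases "K = {}")
 case True
 show ?thesis by (rule that[of "%_ _. 0"]) (auto simp: True)
next
 case False
 have "\<forall>x\<in>K. \<exists>U C. open U \<and> compact C \<and> x : U \<and> U \<subseteq> C"
  using E unfolding locally_compact_space_def by (auto simp: compactin_euclidean_iff)
 then obtain U C where UC: "\<And>x. x : K ==> open (U x) \<and> compact (C x) \<and> x : U x \<and> U x \<subseteq> C x"
  by metis
 have "K \<subseteq> (\<Union>x\<in>K. U x)" using UC by auto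
 then obtain F where F: "F \<subseteq> K" "finite F" "K \<subseteq> (\<Union>x\<in>F. U x)"
  using compactE_image[OF K, of K U] UC by blast
 have op: "open (\<Union>x\<in>F. U x)" using UC F by (intro open_UN) auto
 obtain e where e: "0 < e" "(\<Union>x\<in>K. ball x e) \<subseteq> (\<Union>x\<in>F. U x)"
  using compact_subset_open_imp_ball_epsilon_subset[OF K op F(3)] by auto
 define D where "D = (\<Union>x\<in>F. C x)"
 have D: "compact D" unfolding D_def using F UC by (intro compact_UN) auto
 have inD: "x : D" if lt: "infdist x K < e" for x
 proof -
  have "bdd_below (dist x ` K)" by (rule bdd_belowI2[of _ 0]) simp
  then obtain a where "a : K" "dist x a < e"
  using lt cINF_less_iff[OF False, of "dist x" e] unfolding infdist_notempty[OF False] by blast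
  hence "x : (\<Union>x\<in>K. ball x e)" using that by (auto simp: dist_commute)
  thus ?thesis using e(2) F UC unfolding D_def by blast
 qed
 obtain N :: nat where N: "1 / e < real N" using reals_Archimedean2 by blast
 hence N0: "0 < real N" using e by (smt (verit) divide_pos_pos)
 define h where "h n x = max 0 (1 - (real n + real N) * infdist x K)" for n x
 have zero: "h n x = 0" if "x \<notin> D" for n x
 proof -
  have "e <= infdist x K" using inD that by force
  moreover have "1 <= real N * e" using N e by (simp add: field_simps)
  moreover have "real N * e <= (real n + real N) * infdist x K"
  using calculation e by (intro mult_mono) auto
  ultimately show ?thesis unfolding h_def by simp
 qed
 show ?thesis
 proof (rule that[of "%n. ext0 (h n)"])
  show "continuous_map E_del euclideanreal (ext0 (h n))" for n
  unfolding h_def using D zero[unfolded h_def]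
  by (intro continuous_map_E_del continuous_intros) auto
  show "0 <= ext0 (h n) y" "ext0 (h n) y <= 1" for n y
  using N0 by (auto simp: ext0_def h_def infdist_nonneg split: option.splits)
  show "(%n. ext0 (h n) y) \<longlonglongrightarrow> ind (Some ` K) y" for y
  proof (cases y)
  case (Some x)
  show ?thesis
  proof (cases "x : K")
  case True
  thus ?thesis using Some by (simp add: h_def)
  next
  case False
  hence "0 < infdist x K"
  using in_closed_iff_infdist_zero[OF compact_imp_closed[OF K] \<open>K \<noteq> {}\<close>] infdist_nonneg[of x K]
  by (metis less_eq_real_def)
  then obtain m :: nat where m: "1 / infdist x K < real m" using reals_Archimedean2 by blast
  have "\<forall>\<^sub>F n in sequentially. 0 = ext0 (h n) y"
  using eventually_ge_at_top[of m]
  proof eventually_elim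
  case (elim n)
  have "1 <= real m * infdist x K" using m \<open>0 < infdist x K\<close> by (simp add: field_simps)
  also have "... <= (real n + real N) * infdist x K"
  using elim N0 \<open>0 < infdist x K\<close> by (intro mult_right_mono) auto
  finally show ?case using Some by (simp add: h_def)
  qed
  hence "(%n. ext0 (h n) y) \<longlonglongrightarrow> 0"
  by (rule Lim_transform_eventually[OF tendsto_const])
  moreover have "ind (Some ` K) y = (0 :: real)" using False Some by (auto simp: indicator_def)
  ultimately show ?thesis by simp
  qed
  qed auto
 qed
qed

lemma open_countable_union_compact:
 fixes U :: "'e::{metric_space, second_countable_topology} set"
 assumes E: "locally_compact_space (euclidean :: 'e topology)" and U: "open U"
 obtains \<C> where "countable \<C>" "\<And>C. C : \<C> ==> compact C" "\<Union>\<C> = U"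
proof -
 have "neighbourhood_base_of (compactin euclidean) (euclidean :: 'e topology)"
  using E locally_compact_space_neighbourhood_base[of "euclidean :: 'e topology"]
  by (simp add: Hausdorff_space_euclidean)
 hence "\<forall>x\<in>U. \<exists>V C. open V \<and> compact C \<and> x : V \<and> V \<subseteq> C \<and> C \<subseteq> U"
  using U unfolding neighbourhood_base_of_def neighbourhood_base_at_def
  by (auto simp: compactin_euclidean_iff)
 then obtain V C where VC: "\<And>x. x : U ==> open (V x) \<and> compact (C x) \<and> x : V x \<and> V x \<subseteq> C x \<and> C x \<subseteq> U"
  by metis
 obtain F where F: "F \<subseteq> V ` U" "countable F" "\<Union>F = \<Union>(V ` U)"
  by (rule Lindelof[of "V ` U"]) (use VC in auto)
 obtain G where G: "countable G" "G \<subseteq> U" "F = V ` G"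
  using F by (metis countable_subset_image)
 show ?thesis
 proof (rule that[of "C ` G"])
  show "\<Union>(C ` G) = U"
  proof
  show "\<Union>(C ` G) \<subseteq> U" using VC G by blast
  have "U \<subseteq> \<Union>(V ` U)" using VC by auto
  also have "... = \<Union>(V ` G)" using F G by simp
  also have "... \<subseteq> \<Union>(C ` G)" using VC G by blast
  finally show "U \<subseteq> \<Union>(C ` G)" .
  qed
 qed (use VC G in auto)
qed

lemma sets_E_del_compact:
 assumes E: "locally_compact_space (euclidean :: 'e::{metric_space, second_countable_topology} topology)"
 shows "sets (topo_borel (E_del :: 'e option topology)) = sigma_sets UNIV {Some ` K | K. compact K}"
  (is "_ = sigma_sets UNIV ?G")
proof
 show "sets (topo_borel (E_del :: 'e option topology)) \<subseteq> sigma_sets UNIV ?G"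
  unfolding sets_topo_borel topspace_Alexandroff_compactification topspace_euclidean insert_None_range_Some
 proof (rule sigma_sets_mono, rule subsetI)
  interpret sigma_algebra UNIV "sigma_sets UNIV ?G" by (rule sigma_algebra_sigma_sets) simp
  have cpt: "Some ` K : sigma_sets UNIV ?G" if "compact K" for K using that by blast
  have op: "Some ` U : sigma_sets UNIV ?G" if U: "open U" for U :: "'e set"
  proof -
  obtain \<C> where C: "countable \<C>" "\<And>C. C : \<C> ==> compact C" "\<Union>\<C> = U"
  using open_countable_union_compact[OF E U] by blast
  have "Some ` U = (\<Union>C\<in>\<C>. Some ` C)" using C(3) by auto
  also have "... : sigma_sets UNIV ?G" using C(1) cpt[OF C(2)] by (rule countable_UN'')
  finally show ?thesis .
  qed
  fix W :: "'e option set" assume "W : {U. openin E_del U}"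
  then consider U where "open U" "W = Some ` U" | C where "compact C" "W = insert None (Some ` (UNIV - C))"
  by (auto simp: openin_Alexandroff_compactification compactin_euclidean_iff)
  thus "W : sigma_sets UNIV ?G"
  proof cases
  case (1 U)
  show ?thesis unfolding 1(2) by (rule op[OF 1(1)])
  next
  case (2 C)
  have W: "W = UNIV - Some ` C"
  proof (rule set_eqI)
  fix y show "y : W \<longleftrightarrow> y : UNIV - Some ` C" by (cases y) (auto simp: 2)
  qed
  show ?thesis unfolding W by (rule compl_sets[OF cpt[OF 2(1)]])
  qed
 qed
 show "sigma_sets UNIV ?G \<subseteq> sets (topo_borel (E_del :: 'e option topology))"
 proof -
  have "?G \<subseteq> sets (topo_borel (E_del :: 'e option topology))"
  proof
  fix A :: "'e option set" assume "A : ?G"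
  then obtain K where "compact K" "A = Some ` K" by blast
  thus "A : sets (BE)" by (simp only: image_Some_sets[OF borel_compact])
  qed
  from sets.sigma_sets_subset[OF this] show ?thesis
  by (simp only: space_topo_borel topspace_Alexandroff_compactification topspace_euclidean insert_None_range_Some)
 qed
qed

lemma measurable_into_E_del:
 fixes \<Phi> :: "'y => 'e::{metric_space, second_countable_topology} option"
 assumes E: "locally_compact_space (euclidean :: 'e topology)"
  and m: "\<And>g. continuous_map E_del euclideanreal g ==> (%y. g (\<Phi> y)) : bm N"
 shows "\<Phi> : N \<rightarrow>\<^sub>M BE"
proof -
 have "\<Phi> : N \<rightarrow>\<^sub>M sigma UNIV {Some ` K | K. compact K}"
 proof (rule measurable_measure_of)
  fix A :: "'e option set" assume "A : {Some ` K | K. compact K}"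
  then obtain K where K: "compact K" "A = Some ` K" by auto
  obtain g where g: "\<And>n. continuous_map E_del euclideanreal (g n)" "\<And>n y. 0 <= g n y" "\<And>n y. g n y <= 1"
  "\<And>y. (%n. g n y :: real) \<longlonglongrightarrow> ind (Some ` K) y"
  by (rule indicator_compact_approx[OF E K(1)]) blast
  have "(%y. ind A (\<Phi> y) :: real) : bm N"
  unfolding K by (rule borel_measurable_LIMSEQ_real[OF g(4)]) (intro m g)
  hence "(%y. ind A (\<Phi> y) :: real) -` {1} \<inter> space N : sets N" by measurable
  moreover have "(%y. ind A (\<Phi> y) :: real) -` {1} \<inter> space N = \<Phi> -` A \<inter> space N"
  by (auto simp: indicator_def split: if_splits)
  ultimately show "\<Phi> -` A \<inter> space N : sets N" by simp
 qed auto
 moreover have eq: "sets (sigma UNIV {Some ` K | K. compact K}) = sets (topo_borel (E_del :: 'e option topology))"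
  unfolding sets_E_del_compact[OF E] by (rule sets_measure_of) blast
 ultimately show ?thesis by (simp only: measurable_cong_sets[OF refl eq])
qed

lemma finite_measures_iff: "\<mu> : finite_measures B \<longleftrightarrow> sets \<mu> = sets B \<and> finite_measure \<mu>"
 by (simp add: finite_measures_def)

lemmas measurable_congI = measurable_cong[THEN iffD2]

lemma kernel_nn_integral_measurable:
 assumes sets: "\<And>y. y : space N ==> sets (ka y) = sets B"
  and em: "\<And>A. A : sets B ==> (%y. emeasure (ka y) A) : bm N"
  and f: "f : bm B"
 shows "(%y. \<integral>\<^sup>+x. f x \<partial>ka y) : bm N"
 using f
proof (induction rule: borel_measurable_induct)
 case (cong f g)
 have "(NN x|ka y. f x) = (NN x|ka y. g x)" if "y : space N" for y
  using cong(3) sets_eq_imp_space_eq[OF sets[OF that]] by (intro nn_integral_cong) simp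
 thus ?case using cong(4) by (rule measurable_congI)
next
 case (set A)
 have "(NN x|ka y. ind A x) = emeasure (ka y) A" if "y : space N" for y
  by (rule nn_integral_indicator) (simp add: sets[OF that] set)
 thus ?case using em[OF set] by (rule measurable_congI)
next
 case (mult u c)
 have "(NN x|ka y. c * u x) = c * (NN x|ka y. u x)" if "y : space N" for y
  by (rule nn_integral_cmult) (simp add: measurable_cong_sets[OF sets[OF that] refl] mult)
 thus ?case by (rule measurable_congI) (use mult in measurable)
next
 case (add u v)
 have "(NN x|ka y. v x + u x) = (NN x|ka y. v x) + (NN x|ka y. u x)" if "y : space N" for y
  by (rule nn_integral_add) (simp_all add: measurable_cong_sets[OF sets[OF that] refl] add)
 thus ?case by (rule measurable_congI) (use add in measurable)
next
 case (seq U)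
 have "(NN x|ka y. (SUP i. U i) x) = (SUP i. \<integral>\<^sup>+x. U i x \<partial>ka y)" if "y : space N" for y
  unfolding SUP_apply
  by (rule nn_integral_monotone_convergence_SUP) (simp_all add: measurable_cong_sets[OF sets[OF that] refl] seq)
 thus ?case by (rule measurable_congI) (use seq in measurable)
qed

text \<open>A family of finite measures on the compactification that integrates continuous functions
 measurably is a kernel.\<close>

lemma finite_kernel_measurable:
 fixes ka :: "'y => 'e::{metric_space, second_countable_topology} option measure"
 assumes E: "locally_compact_space (euclidean :: 'e topology)"
  and ka: "\<And>y. y : space N ==> ka y : finite_measures (BE)"
  and m: "\<And>g. continuous_map E_del euclideanreal g ==> (\<And>y. 0 <= g y) ==> (\<And>y. g y <= 1) ==>
  (%y. \<integral>x. g x \<partial>ka y) : bm N"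
  and A: "A : sets (BE)"
 shows "(%y. emeasure (ka y) A) : bm N"
proof -
 let ?B = "topo_borel (E_del :: 'e option topology)"
 let ?G = "{Some ` K | K :: 'e set. compact K}"
 have setska: "sets (ka y) = sets ?B" and fin: "finite_measure (ka y)" if "y : space N" for y
  using ka[OF that] by (auto simp: finite_measures_iff)
 have spaceka: "space (ka y) = UNIV" if "y : space N" for y
  using sets_eq_imp_space_eq[OF setska[OF that]] by simp
 have em: "emeasure (ka y) A = en (measure (ka y) A)" if "y : space N" for y A
  using finite_measure.emeasure_eq_measure[OF fin[OF that]] .
 have UNIV: "(%y. emeasure (ka y) UNIV) : bm N"
 proof -
  have "(%y. en (LINT x|ka y. 1)) : bm N"
  by (intro measurable_compose[OF m measurable_ennreal]) auto
  moreover have "en (LINT x|ka y. 1) = emeasure (ka y) UNIV" if "y : space N" for y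
  using spaceka[OF that] em[OF that, of UNIV] by simp
  ultimately show ?thesis by (metis (no_types, lifting) measurable_congI)
 qed
 have "Int_stable ?G"
  unfolding Int_stable_def
 proof (clarify)
  fix K L :: "'e set" assume "compact K" "compact L"
  thus "\<exists>Ka. Some ` K \<inter> Some ` L = Some ` Ka \<and> compact Ka"
  by (intro exI[of _ "K \<inter> L"]) (auto simp: compact_Int)
 qed
 moreover have "?G \<subseteq> Pow UNIV" by simp
 moreover have "A : sigma_sets UNIV ?G" using A sets_E_del_compact[OF E] by simp
 ultimately show ?thesis
 proof (induction rule: sigma_sets_induct_disjoint)
  case (basic A)
  then obtain K where K: "compact K" "A = Some ` K" by auto
  obtain g where g: "\<And>n. continuous_map E_del euclideanreal (g n)" "\<And>n y. 0 <= g n y" "\<And>n y. g n y <= 1"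
  "\<And>y. (%n. g n y :: real) \<longlonglongrightarrow> ind (Some ` K) y"
  by (rule indicator_compact_approx[OF E K(1)]) blast
  have A: "A : sets ?B" unfolding K by (intro image_Some_sets borel_compact K)
  have lim: "(%n. \<integral>x. g n x \<partial>ka y) \<longlonglongrightarrow> measure (ka y) A" if y: "y : space N" for y
  proof -
  interpret finite_measure "ka y" by (rule fin[OF y])
  have "(%n. \<integral>x. g n x \<partial>ka y) \<longlonglongrightarrow> (LINT x|ka y. ind A x)"
  proof (rule integral_dominated_convergence[where w = "%_. 1"])
  show "(ind A :: _ => real) : bm (ka y)" using A setska[OF y] by simp
  show "g n : bm (ka y)" for n
  using continuous_map_topo_borel_measurable[OF g(1)] measurable_cong_sets[OF setska[OF y] refl] by blast
  qed (use g in \<open>auto simp: K\<close>)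
  thus ?thesis using A setska[OF y] spaceka[OF y] by simp
  qed
  have "(%y. measure (ka y) A) : bm N"
  proof (rule borel_measurable_LIMSEQ_real)
  show "(%n. \<integral>x. g n x \<partial>ka y) \<longlonglongrightarrow> measure (ka y) A" if "y : space N" for y by (rule lim[OF that])
  show "(%y. \<integral>x. g n x \<partial>ka y) : bm N" for n by (intro m g)
  qed
  thus ?case by (intro measurable_congI[OF em]) auto
 next
  case (compl A)
  have "A : sets ?B" using compl(1) sets_E_del_compact[OF E] by simp
  hence "emeasure (ka y) (UNIV - A) = emeasure (ka y) UNIV - emeasure (ka y) A" if "y : space N" for y
  using emeasure_compl[of A "ka y"] em[OF that] setska[OF that] spaceka[OF that] by simp
  thus ?case by (rule measurable_congI) (use compl UNIV in measurable)
 next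
  case (union A)
  have "\<And>i. A i : sets ?B" using union(2) sets_E_del_compact[OF E] by auto
  hence "emeasure (ka y) (\<Union>i. A i) = (\<Sum>i. emeasure (ka y) (A i))" if "y : space N" for y
  using union(1) setska[OF that] by (intro suminf_emeasure[symmetric]) auto
  thus ?case by (rule measurable_congI) (use union in measurable)
 qed simp
qed

lemma topspace_weak_topology [simp]: "topspace (weak_topology S) = finite_measures (topo_borel S)"
proof
 show "topspace (weak_topology S) \<subseteq> finite_measures (topo_borel S)"
  unfolding weak_topology_def topology_generated_by_topspace by (rule Union_least) blast
 have "{\<mu> : finite_measures (topo_borel S). (LINT x|\<mu>. 0) : (UNIV :: real set)} \<in>
  {{\<mu> : finite_measures (topo_borel S). (LINT x|\<mu>. f x) : U} | f U.
  continuous_map S euclideanreal f \<and> bounded (f ` topspace S) \<and> open U}"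
 proof (rule CollectI, rule exI[of _ "%_. 0"], rule exI[of _ UNIV], intro conjI)
  show "bounded ((%_. 0 :: real) ` topspace S)" by (rule bounded_subset[of "{0}"]) auto
 qed (rule refl, rule continuous_map_const[THEN iffD2], rule disjI2, simp, rule open_UNIV)
 hence "openin (weak_topology S) {\<mu> : finite_measures (topo_borel S). (LINT x|\<mu>. 0) : (UNIV :: real set)}"
  unfolding weak_topology_def by (rule topology_generated_by_Basis)
 from openin_subset[OF this] show "finite_measures (topo_borel S) \<subseteq> topspace (weak_topology S)"
  by (simp only: UNIV_I simp_thms) blast
qed

lemma continuous_map_weak_topology_integral:
 assumes "continuous_map S euclideanreal g" "bounded (g ` topspace S)"
 shows "continuous_map (weak_topology S) euclideanreal (%\<mu>. \<integral>x. g x \<partial>\<mu>)"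
 unfolding continuous_map_def
proof (intro conjI allI impI)
 fix U :: "real set" assume "openin euclidean U"
 hence "openin (weak_topology S) {\<mu> : finite_measures (topo_borel S). (LINT x|\<mu>. g x) : U}"
  unfolding weak_topology_def using assms by (intro topology_generated_by_Basis) auto
 thus "openin (weak_topology S) {\<mu> : topspace (weak_topology S). (LINT x|\<mu>. g x) : U}" by simp
qed auto

lemma bounded_unit_range: "(\<And>y. 0 <= g y) ==> (\<And>y. g y <= (1::real)) ==> bounded (g ` A)"
 by (auto simp: bounded_iff intro!: exI[of _ 1])

lemma weak_topology_nn_integral_measurable:
 fixes f :: "'e::{metric_space, second_countable_topology} option => ennreal"
 assumes E: "locally_compact_space (euclidean :: 'e topology)"
  and f: "f : bm (BE)"
 shows "(%\<mu>. \<integral>\<^sup>+x. f x \<partial>\<mu>) : bm (topo_borel (weak_topology E_del))"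
proof (rule kernel_nn_integral_measurable[OF _ _ f])
  let ?a0 = "topo_borel (weak_topology E_del)"
 show "sets \<mu> = sets (BE)" if "\<mu> : space ?a0" for \<mu> :: "'e option measure"
  using that by (simp add: finite_measures_iff)
 show "(%\<mu>. emeasure \<mu> A) : bm ?a0"
  if "A : sets (BE)" for A :: "'e option set"
 proof (rule finite_kernel_measurable[OF E _ _ that])
  show "(%\<mu>. \<integral>x. g x \<partial>\<mu>) : bm ?a0"
  if "continuous_map E_del euclideanreal g" "\<And>y. 0 <= g y" "\<And>y. g y <= 1" for g :: "'e option => real"
  by (rule continuous_map_topo_borel_measurable, rule continuous_map_weak_topology_integral[OF that(1)],
  rule bounded_unit_range) (use that in auto)
 next
  show "\<mu> : finite_measures (BE)"
  if "\<mu> : space ?a0" for \<mu> :: "'e option measure"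
  using that by simp
 qed
qed

section \<open>Joint measurability of right-continuous processes\<close>

lemma right_continuous_joint_measurable:
 fixes h :: "real => 'w => real"
 assumes m: "\<And>r. h r : bm N"
  and rc: "\<And>w r. w : space N ==> ((%s. h s w) \<longlongrightarrow> h r w) (at_right r)"
 shows "(%(r, w). h r w) : bm (borel \<Otimes> N)"
proof -
  let ?a0 = "borel \<Otimes> N"
 define d where "d n r = (real_of_int \<lfloor>(real n + 1) * r\<rfloor> + 1) / (real n + 1)" for n :: nat and r :: real
 have d1: "r < d n r" for n r
 proof -
  have "(real n + 1) * r < real_of_int \<lfloor>(real n + 1) * r\<rfloor> + 1" by linarith
  thus ?thesis unfolding d_def by (simp add: pos_less_divide_eq mult.commute)
 qed
 have d2: "d n r <= r + 1 / (real n + 1)" for n r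
 proof -
  have "d n r <= ((real n + 1) * r + 1) / (real n + 1)"
  unfolding d_def by (intro divide_right_mono) auto
  thus ?thesis by (simp add: add_divide_distrib)
 qed
 have lim: "filterlim (%n. d n r) (at_right r) sequentially" for r
  unfolding filterlim_at
 proof (intro conjI)
  show "\<forall>\<^sub>F n in sequentially. d n r : {r<..} \<and> d n r \<noteq> r"
  using d1[of r] by (intro always_eventually allI) (simp add: less_imp_neq[symmetric])
  have "(%n. r + inverse (real (Suc n))) \<longlonglongrightarrow> r + 0"
  by (rule tendsto_add[OF tendsto_const LIMSEQ_inverse_real_of_nat])
  moreover have "inverse (real (Suc n)) = 1 / (real n + 1)" for n by (simp add: inverse_eq_divide)
  ultimately have lim2: "(%n. r + 1 / (real n + 1)) \<longlonglongrightarrow> r"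
  by (simp only: add_0_right)
  show "((%n. d n r) \<longlongrightarrow> r) sequentially"
  proof (rule tendsto_sandwich[OF _ _ tendsto_const lim2])
  show "\<forall>\<^sub>F n in sequentially. r <= d n r" using less_imp_le[OF d1] by simp
  show "\<forall>\<^sub>F n in sequentially. d n r <= r + 1 / (real n + 1)" using d2 by simp
  qed
 qed
 have meas: "(%x. h (d n (fst x)) (snd x)) : bm ?a0" for n
 proof -
  have "(%x. h ((real_of_int i + 1) / (real n + 1)) (snd x)) : bm ?a0" for i :: int
  by (rule measurable_compose[OF measurable_snd m])
  moreover have "(%x. \<lfloor>(real n + 1) * fst x\<rfloor>) : ?a0 \<rightarrow>\<^sub>M count_space UNIV"
  by measurable
  ultimately show ?thesis
  unfolding d_def by (rule measurable_compose_countable)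
 qed
 have "(%x. h (fst x) (snd x)) : bm ?a0"
 proof (rule borel_measurable_LIMSEQ_real[OF _ meas])
  fix x assume "x : space ((borel :: real measure) \<Otimes> N)"
  hence "snd x : space N" by (auto simp: space_pair_measure)
  from filterlim_compose[OF rc[OF this] lim]
  show "(%n. h (d n (fst x)) (snd x)) \<longlonglongrightarrow> h (fst x) (snd x)" .
 qed
 thus ?thesis by (simp add: case_prod_beta')
qed

lemma cadlag_continuous_map_at_right:
 assumes "cadlag S w" "continuous_map S euclideanreal g" "0 <= t"
 shows "((%s. g (w s)) \<longlongrightarrow> g (w t)) (at_right t)"
proof -
 have "limitin S w (w t) (at_right t)" using assms by (simp add: cadlag_def)
 from continuous_map_limit[OF assms(2) this] show ?thesis by (simp add: o_def)
qed

text \<open>Times are clamped to \<open>[0, t]\<close> to make the path constant outside this interval; in this form the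
 statement expresses progressive measurability.\<close>

lemma cadlag_clamped_joint_measurable:
 assumes m: "\<And>s. 0 <= s ==> s <= t ==> (%w. g (X s w)) : bm N" and t: "0 <= t"
  and c: "\<And>w. w : space N ==> cadlag S (%s. X s w)" and g: "continuous_map S euclideanreal g"
 shows "(%(r, w). g (X (max 0 (min r t)) w)) : bm (borel \<Otimes> N)"
proof (rule right_continuous_joint_measurable)
 show "(%w. g (X (max 0 (min r t)) w)) : bm N" for r
  using t by (intro m) auto
next
 fix w r assume w: "w : space N"
 consider "r < 0" | "0 <= r" "r < t" | "t <= r" using t by linarith
 thus "((%s. g (X (max 0 (min s t)) w)) \<longlongrightarrow> g (X (max 0 (min r t)) w)) (at_right r)"
 proof cases
  case 1
  have "\<forall>\<^sub>F s in at_right r. g (X (max 0 (min r t)) w) = g (X (max 0 (min s t)) w)"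
  using eventually_at_right_less[of r] order_tendstoD(2)[OF tendsto_ident_at 1, of "{r<..}"]
  by eventually_elim (use 1 t in \<open>auto simp: max_def min_def\<close>)
  thus ?thesis by (rule Lim_transform_eventually[OF tendsto_const])
 next
  case 2
  have ev: "\<forall>\<^sub>F s in at_right r. g (X s w) = g (X (max 0 (min s t)) w)"
  using eventually_at_right_less[of r] order_tendstoD(2)[OF tendsto_ident_at 2(2), of "{r<..}"]
  by eventually_elim (use 2 t in \<open>auto simp: max_def min_def\<close>)
  have r: "max 0 (min r t) = r" using 2 by simp
  show ?thesis unfolding r
  by (rule Lim_transform_eventually[OF cadlag_continuous_map_at_right[OF c[OF w] g 2(1)] ev])
 next
  case 3
  have "\<forall>\<^sub>F s in at_right r. g (X (max 0 (min r t)) w) = g (X (max 0 (min s t)) w)"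
  using eventually_at_right_less[of r]
  by eventually_elim (use 3 t in \<open>auto simp: max_def min_def\<close>)
  thus ?thesis by (rule Lim_transform_eventually[OF tendsto_const])
 qed
qed

section \<open>The Markov property\<close>

context hunt_process
begin

lemma space_P: "x : topspace S ==> space (P x) = space M"
 using sets_eq_imp_space_eq[OF sets_P] .

lemma subalgebra_P: "x : topspace S ==> subalgebra (P x) (F t)"
 using F_subset by (auto simp: subalgebra_def space_P space_F sets_P)

lemma id_measurable_F: "(%w. w) : M \<rightarrow>\<^sub>M F t"
proof (rule measurableI)
 fix A assume "A : sets (F t)"
 moreover have "(%w. w) -` A \<inter> space M = A"
  using sets.sets_into_space[OF \<open>A \<in> sets (F t)\<close>] by (auto simp: space_F)
 ultimately show "(%w. w) -` A \<inter> space M : sets M" using F_subset by auto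
qed (simp add: space_F)

lemma id_measurable_P: "x : topspace S ==> (%w. w) : P x \<rightarrow>\<^sub>M F t"
 by (subst measurable_cong_sets[OF sets_P refl]) (simp_all add: id_measurable_F)

lemma X_measurable_F: "0 <= t ==> t <= u ==> X t : F (en u) \<rightarrow>\<^sub>M topo_borel S"
 by (rule measurable_mono[THEN subsetD, OF order_refl _ _ _ adapted])
  (use sets_F_mono[OF ennreal_leI, of t u] in \<open>auto simp: space_F\<close>)

lemma X_measurable_M: "0 <= t ==> X t : M \<rightarrow>\<^sub>M topo_borel S"
 by (rule measurable_mono[THEN subsetD, OF order_refl _ _ _ adapted]) (auto simp: F_subset space_F)

lemma X_measurable: "0 <= t ==> x : topspace S ==> X t : P x \<rightarrow>\<^sub>M topo_borel S"
 by (subst measurable_cong_sets[OF sets_P refl]) (simp_all add: X_measurable_M)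

lemma X_in_topspace: "0 <= t ==> w : space M ==> X t w : topspace S"
 using measurable_space[OF X_measurable_M] by simp

definition transition :: "real => 's => 's measure" where
 "transition s x = distr (P x) (topo_borel S) (X s)"

lemma sets_transition [simp]: "sets (transition s x) = sets (topo_borel S)"
 by (simp add: transition_def)

lemma prob_space_transition: "0 <= s ==> x : topspace S ==> prob_space (transition s x)"
 unfolding transition_def by (intro prob_space.prob_space_distr prob_P X_measurable)

lemma emeasure_transition:
 assumes "0 <= s" "x : topspace S" "A : sets (topo_borel S)"
 shows "emeasure (transition s x) A = en (measure (P x) {w : space M. X s w : A})"
proof -
 interpret prob_space "P x" using assms by (intro prob_P)
 have "emeasure (transition s x) A = emeasure (P x) (X s -` A \<inter> space (P x))"
  unfolding transition_def using assms by (intro emeasure_distr X_measurable)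
 also have "X s -` A \<inter> space (P x) = {w : space M. X s w : A}"
  using space_P[OF assms(2)] by auto
 finally show ?thesis by (simp add: emeasure_eq_measure)
qed

lemma transition_kernel:
 assumes "0 <= s"
 shows "transition s : topo_borel S \<rightarrow>\<^sub>M subprob_algebra (topo_borel S)"
proof (rule measurable_subprob_algebra)
 show "subprob_space (transition s x)" if "x : space (topo_borel S)" for x
  using that assms by (intro prob_space_imp_subprob_space prob_space_transition) auto
 show "(%x. emeasure (transition s x) A) : bm (topo_borel S)"
  if A: "A : sets (topo_borel S)" for A
 proof (rule measurable_congI)
  show "emeasure (transition s x) A = en (measure (P x) {w : space M. X s w : A})"
  if "x : space (topo_borel S)" for x
  using that assms A by (intro emeasure_transition) auto
  show "(%x. en (measure (P x) {w : space M. X s w : A})) : bm (topo_borel S)"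
  by (intro measurable_compose[OF transition_measurable measurable_ennreal] assms A)
 qed
qed simp

lemma markov_rectangle:
 assumes x: "x : topspace S" and t: "0 <= t" and s: "0 <= s"
  and B: "B : sets (F (en t))" and A: "A : sets (topo_borel S)"
 shows "emeasure (P x) {w : B. X (t + s) w : A} = (NN w|P x. ind B w * emeasure (transition s (X t w)) A)"
proof -
 interpret prob_space "P x" using x by (rule prob_P)
 let ?\<tau> = "%_::'w. en t"
 have st: "stopping_time F ?\<tau>" by (rule stopping_time_const)
 have sub: "subalgebra (P x) (pre_sigma ?\<tau>)"
  unfolding subalgebra_def
 proof
  show "space (pre_sigma ?\<tau>) = space (P x)" by (simp add: space_pre_sigma space_P[OF x])
  show "sets (pre_sigma ?\<tau>) \<subseteq> sets (P x)"
  proof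
  fix C assume "C : sets (pre_sigma ?\<tau>)"
  from sets_pre_sigmaD[OF st this, of "en t"] have "C : sets (F (en t))" by simp
  thus "C : sets (P x)" using F_subset sets_P[OF x] by blast
  qed
 qed
 interpret finite_measure_subalgebra "P x" "pre_sigma ?\<tau>"
  by unfold_locales (rule sub)
 have B\<tau>: "B : sets (pre_sigma ?\<tau>)"
 proof (rule sets_pre_sigmaI[OF st])
  fix u show "{w : B. en t <= u} : sets (F u)"
  using sets_F_mono[of "en t" u] B by (cases "en t <= u") auto
 qed
 have BM: "B : sets (P x)" using B F_subset sets_P[OF x] by blast
 have Bsp: "B \<subseteq> space M" using sets.sets_into_space[OF B] space_F by auto
 let ?f = "%w. ind A (X (t + s) w) :: real"
 let ?g = "%w. measure (P (X t w)) {w' : space M. X s w' : A}"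
 have f [measurable]: "?f : bm (P x)"
  by (rule measurable_compose[OF X_measurable borel_measurable_indicator[OF A]]) (use x t s in auto)
 have g [measurable]: "?g : bm (P x)"
  by (rule measurable_compose[OF X_measurable[OF t x] transition_measurable[OF s A]])
 have g01: "0 <= ?g w" "?g w <= 1" if "w : space (P x)" for w
 proof -
  have "X t w : topspace S" using that X_in_topspace[OF t] space_P[OF x] by auto
  then interpret p: prob_space "P (X t w)" by (rule prob_P)
  show "0 <= ?g w" "?g w <= 1" by auto
 qed
 have fi: "integrable (P x) ?f"
  by (rule integrable_const_bound[of _ 1, OF _ f]) (auto simp: indicator_def)
 have ae: "AE w in P x. real_cond_exp (P x) (pre_sigma ?\<tau>) ?f w = ?g w"
  using strong_markov[OF x st s A] t by simp
 have Bf: "integrable (P x) (%w. ind B w * ?f w)"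
  by (rule integrable_const_bound[of _ 1, OF _ borel_measurable_times[OF borel_measurable_indicator[OF BM] f]])
  (auto simp: indicator_def)
 have Bg: "integrable (P x) (%w. ind B w * ?g w)"
  by (rule integrable_const_bound[of _ 1, OF _ borel_measurable_times[OF borel_measurable_indicator[OF BM] g]])
  (use g01 in \<open>auto simp: indicator_def\<close>)
 have "(LINT w|P x. ind B w * ?f w) = (LINT w|P x. ind B w * real_cond_exp (P x) (pre_sigma ?\<tau>) ?f w)"
  using real_cond_exp_intA[OF fi B\<tau>] by (simp add: set_lebesgue_integral_def)
 also have "... = (LINT w|P x. ind B w * ?g w)"
  using ae BM by (intro integral_cong_AE) auto
 finally have eq: "(LINT w|P x. ind B w * ?f w) = (LINT w|P x. ind B w * ?g w)" .
 have set: "{w : B. X (t + s) w : A} : sets (P x)"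
 proof -
  have "{w : B. X (t + s) w : A} = B \<inter> (X (t + s) -` A \<inter> space (P x))"
  using Bsp space_P[OF x] by auto
  thus ?thesis using measurable_sets[OF X_measurable A, of "t + s" x] x t s BM by auto
 qed
 have "emeasure (P x) {w : B. X (t + s) w : A} = (NN w|P x. ind {w : B. X (t + s) w : A} w)"
  using set by simp
 also have "... = (NN w|P x. en (ind B w * ?f w))"
  by (intro nn_integral_cong) (auto simp: indicator_def)
 also have "... = en (LINT w|P x. ind B w * ?f w)"
  by (rule nn_integral_eq_integral[OF Bf]) simp
 also have "... = (NN w|P x. en (ind B w * ?g w))"
  unfolding eq by (rule nn_integral_eq_integral[OF Bg, symmetric]) (auto intro!: AE_I2)
 also have "... = (NN w|P x. ind B w * emeasure (transition s (X t w)) A)"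
 proof (intro nn_integral_cong)
  fix w assume "w : space (P x)"
  hence "X t w : topspace S" using X_in_topspace[OF t] space_P[OF x] by auto
  thus "en (ind B w * ?g w) = ind B w * emeasure (transition s (X t w)) A"
  by (simp add: emeasure_transition s A ennreal_mult' indicator_def)
 qed
 finally show ?thesis .
qed

text \<open>The strong Markov property at a constant time, for functionals of the past and of the position
 after a further time \<open>s\<close>.\<close>

lemma markov_distr:
 assumes x: "x : topspace S" and t: "0 <= t" and s: "0 <= s"
 defines "\<K> \<equiv> %w. distr (transition s (X t w)) (F (en t) \<Otimes> topo_borel S) (Pair w)"
 shows "\<K> : P x \<rightarrow>\<^sub>M subprob_algebra (F (en t) \<Otimes> topo_borel S)" (is ?A)
  and "distr (P x) (F (en t) \<Otimes> topo_borel S) (%w. (w, X (t + s) w)) = P x \<bind> \<K>" (is ?B)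
proof -
  let ?a0 = "%w. (w, X (t + s) w)"
 let ?N = "F (en t) \<Otimes> topo_borel S"
 have k: "(%w. transition s (X t w)) : F (en t) \<rightarrow>\<^sub>M subprob_algebra (topo_borel S)"
  by (rule measurable_compose[OF adapted[OF t] transition_kernel[OF s]])
 have "\<K> : F (en t) \<rightarrow>\<^sub>M subprob_algebra ?N"
  unfolding \<K>_def by (rule measurable_distr2[OF _ k]) simp
 thus ?A by (rule measurable_from_subalg[OF subalgebra_P[OF x]])
 note K = \<open>?A\<close>
 have id: "(%w. w) : P x \<rightarrow>\<^sub>M F (en t)"
  by (rule id_measurable_P[OF x])
 have pm: "?a0 : P x \<rightarrow>\<^sub>M ?N"
  by (intro measurable_Pair id X_measurable x) (use t s in simp)
 interpret prob_space "P x" using x by (rule prob_P)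
 have ne: "space (P x) \<noteq> {}" using not_empty by simp
 let ?G = "{a \<times> b | a b. a : sets (F (en t)) \<and> b : sets (topo_borel S)}"
 show ?B
 proof (rule measure_eqI_generator_eq[of ?G "space ?N" _ _ "%_. space ?N"])
  show "Int_stable ?G" by (rule Int_stable_pair_measure_generator)
  show "?G \<subseteq> Pow (space ?N)"
  unfolding space_pair_measure by (rule pair_measure_closed)
  show "sets (distr (P x) ?N ?a0) = sigma_sets (space ?N) ?G"
  by (simp add: sets_pair_measure space_pair_measure)
  have "sets (P x \<bind> \<K>) = sets ?N"
  by (rule sets_bind[OF sets_kernel[OF K] ne])
  thus "sets (P x \<bind> \<K>) = sigma_sets (space ?N) ?G"
  by (simp add: sets_pair_measure space_pair_measure)
  show "range (%_::nat. space ?N) \<subseteq> ?G"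
  unfolding space_pair_measure by (blast intro: sets.top)
  show "(\<Union>i::nat. space ?N) = space ?N" by simp
  show "emeasure (distr (P x) ?N ?a0) (space ?N) \<noteq> \<infinity>"
  using emeasure_distr[OF pm, of "space ?N"] by (simp add: emeasure_eq_measure)
 next
  fix C assume "C : ?G"
  then obtain B A where BA: "C = B \<times> A" "B : sets (F (en t))" "A : sets (topo_borel S)" by auto
  have C: "C : sets ?N" using BA by auto
  have "B \<subseteq> space (P x)" using sets.sets_into_space[OF BA(2)] space_F space_P[OF x] by auto
  hence "emeasure (distr (P x) ?N ?a0) C = emeasure (P x) {w : B. X (t + s) w : A}"
  unfolding emeasure_distr[OF pm C] by (intro arg_cong[where f = "emeasure (P x)"]) (auto simp: BA)
  also have "... = (NN w|P x. ind B w * emeasure (transition s (X t w)) A)"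
  by (rule markov_rectangle[OF x t s BA(2,3)])
  also have "... = (NN w|P x. emeasure (\<K> w) C)"
  proof (intro nn_integral_cong)
  fix w assume w: "w : space (P x)"
  have "Pair w : topo_borel S \<rightarrow>\<^sub>M ?N"
  using w space_F space_P[OF x] by (intro measurable_Pair1') auto
  hence "Pair w : transition s (X t w) \<rightarrow>\<^sub>M ?N"
  by (simp add: measurable_cong_sets[OF sets_transition refl])
  hence "emeasure (\<K> w) C = emeasure (transition s (X t w)) (Pair w -` C \<inter> space (transition s (X t w)))"
  unfolding \<K>_def by (rule emeasure_distr[OF _ C])
  also have "Pair w -` C \<inter> space (transition s (X t w)) = (if w : B then A else {})"
  using sets.sets_into_space[OF BA(3)] sets_eq_imp_space_eq[OF sets_transition]
  by (auto simp: BA)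
  finally show "ind B w * emeasure (transition s (X t w)) A = emeasure (\<K> w) C" by simp
  qed
  also have "... = emeasure (P x \<bind> \<K>) C" by (rule emeasure_bind[OF ne K C, symmetric])
  finally show "emeasure (distr (P x) ?N ?a0) C = emeasure (P x \<bind> \<K>) C" .
 qed
qed

lemma markov_nn_integral:
 assumes x: "x : topspace S" and t: "0 <= t" and s: "0 <= s"
  and H: "(%(w, y). H w y) : bm (F (en t) \<Otimes> topo_borel S)"
 shows "(NN w|P x. H w (X (t + s) w)) = (NN w|P x. (NN w'|P (X t w). H w (X s w')))"
proof -
 let ?N = "F (en t) \<Otimes> topo_borel S"
 have pm: "(%w. (w, X (t + s) w)) : P x \<rightarrow>\<^sub>M ?N"
  by (intro measurable_Pair X_measurable id_measurable_P x) (use t s in simp)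
 have "(NN w|P x. H w (X (t + s) w)) = (NN z|distr (P x) ?N (%w. (w, X (t + s) w)). (case z of (w, y) => H w y))"
  by (subst nn_integral_distr[OF pm]) (use H in simp_all)
 also have "... = (NN w|P x. (NN z|distr (transition s (X t w)) ?N (Pair w). (case z of (w, y) => H w y)))"
  unfolding markov_distr(2)[OF x t s] by (rule nn_integral_bind[OF H markov_distr(1)[OF x t s]])
 also have "... = (NN w|P x. (NN w'|P (X t w). H w (X s w')))"
 proof (intro nn_integral_cong)
  fix w assume "w : space (P x)"
  hence w: "w : space (F (en t))" "X t w : topspace S"
  using X_in_topspace[OF t] space_P[OF x] space_F by auto
  have P1: "Pair w : topo_borel S \<rightarrow>\<^sub>M ?N" using w by (intro measurable_Pair1') auto
  hence P2: "Pair w : transition s (X t w) \<rightarrow>\<^sub>M ?N"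
  by (simp add: measurable_cong_sets[OF sets_transition refl])
  have H1: "(%y. H w y) : bm (topo_borel S)"
  using measurable_compose[OF P1 H] by simp
  show "(NN z|distr (transition s (X t w)) ?N (Pair w). (case z of (w, y) => H w y)) = (NN w'|P (X t w). H w (X s w'))"
  by (subst nn_integral_distr[OF P2])
  (use H H1 in \<open>simp_all add: transition_def nn_integral_distr[OF X_measurable[OF s w(2)]]\<close>)
 qed
 finally show ?thesis .
qed

lemma markov_integral:
 fixes H :: "'w => 's => real"
 assumes x: "x : topspace S" and t: "0 <= t" and s: "0 <= s"
  and H: "(%(w, y). H w y) : bm (F (en t) \<Otimes> topo_borel S)"
  and B: "\<And>w y. w : space M ==> y : topspace S ==> \<bar>H w y\<bar> <= B"
 shows "(LINT w|P x. H w (X (t + s) w)) = (LINT w|P x. (LINT w'|P (X t w). H w (X s w')))"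
proof -
 interpret prob_space "P x" using x by (rule prob_P)
 let ?N = "F (en t) \<Otimes> topo_borel S"
 have pm: "(%w. (w, X (t + s) w)) : P x \<rightarrow>\<^sub>M ?N"
  by (intro measurable_Pair X_measurable id_measurable_P x) (use t s in simp)
 have "(LINT w|P x. H w (X (t + s) w)) = (LINT z|distr (P x) ?N (%w. (w, X (t + s) w)). (case z of (w, y) => H w y))"
  by (simp add: integral_distr[OF pm H])
 also have "... = (LINT w|P x. (LINT z|distr (transition s (X t w)) ?N (Pair w). (case z of (w, y) => H w y)))"
  unfolding markov_distr(2)[OF x t s]
 proof (rule integral_bind[OF H _ markov_distr(1)[OF x t s], of B 1])
  show "\<bar>case z of (w, y) => H w y\<bar> <= B" if "z : space ?N" for z
  using that B by (auto simp: space_pair_measure space_F)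
  show "finite_measure (P x)" by unfold_locales
  show "AE w in P x. emeasure (distr (transition s (X t w)) ?N (Pair w)) (space (distr (transition s (X t w)) ?N (Pair w))) <= en 1"
  using subprob_space.emeasure_space_le_1[OF subprob_space_kernel[OF markov_distr(1)[OF x t s]]] by simp
 qed
 also have "... = (LINT w|P x. (LINT w'|P (X t w). H w (X s w')))"
 proof (intro Bochner_Integration.integral_cong refl)
  fix w assume "w : space (P x)"
  hence w: "w : space (F (en t))" "X t w : topspace S"
  using X_in_topspace[OF t] space_P[OF x] space_F by auto
  have P1: "Pair w : topo_borel S \<rightarrow>\<^sub>M ?N" using w by (intro measurable_Pair1') auto
  hence P2: "Pair w : transition s (X t w) \<rightarrow>\<^sub>M ?N"
  by (simp add: measurable_cong_sets[OF sets_transition refl])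
  have H1: "(%y. H w y) : bm (topo_borel S)"
  using measurable_compose[OF P1 H] by simp
  show "(LINT z|distr (transition s (X t w)) ?N (Pair w). (case z of (w, y) => H w y)) = (LINT w'|P (X t w). H w (X s w'))"
  unfolding integral_distr[OF P2 H] unfolding transition_def
  by (simp add: integral_distr[OF X_measurable[OF s w(2)] H1])
 qed
 finally show ?thesis .
qed

end

lemma measurable_unclamp:
 fixes h :: "real => 'w => 'b"
 assumes "\<And>n::nat. (%(r, w). h (max 0 (min r (real n))) w) : borel \<Otimes> N \<rightarrow>\<^sub>M B"
 shows "(%(r, w). h (max 0 r) w) : borel \<Otimes> N \<rightarrow>\<^sub>M B"
proof -
 have "(%x. (%n x. h (max 0 (min (fst x) (real n))) (snd x)) (nat \<lceil>fst x\<rceil>) x) : borel \<Otimes> N \<rightarrow>\<^sub>M B"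
 proof (rule measurable_compose_countable)
  show "(%x. h (max 0 (min (fst x) (real n))) (snd x)) : borel \<Otimes> N \<rightarrow>\<^sub>M B" for n
  using assms[of n] by (simp add: case_prod_beta')
  show "(%x. nat \<lceil>fst x\<rceil>) : (borel :: real measure) \<Otimes> N \<rightarrow>\<^sub>M count_space UNIV" by measurable
 qed
 moreover have "min r (real (nat \<lceil>r\<rceil>)) = r" for r :: real by (simp add: real_nat_ceiling_ge)
 ultimately show ?thesis by (simp add: case_prod_beta')
qed

lemma (in hunt_process) cadlag_F: "w : space (F t) ==> cadlag S (%s. X s w)"
 using cadlag_paths by (simp add: space_F)

text \<open>Local compactness makes the one-point compactification a Hausdorff space, in which the Borel structure is generated
 by continuous functions.\<close>

locale superprocess_lc = superprocess M F \<xi> Q \<alpha> \<beta> \<pi> W G X P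
 for M :: "'v measure" and F :: "ennreal => 'v measure"
  and \<xi> :: "real => 'v => 'e::{metric_space, second_countable_topology} option"
  and Q :: "'e option => 'v measure"
  and \<alpha> \<beta> :: "'e => real" and \<pi> :: "'e => real measure"
  and W :: "'w measure" and G :: "ennreal => 'w measure"
  and X :: "real => 'w => 'e option measure" and P :: "'e option measure => 'w measure" +
 assumes locally_compact: "locally_compact_space (euclidean :: 'e topology)"
begin

lemma \<xi>_clamped_measurable:
 assumes t: "0 <= t"
 shows "(%(r, w). \<xi> (max 0 (min r t)) w) : borel \<Otimes> F (en t) \<rightarrow>\<^sub>M BE"
proof (rule measurable_into_E_del[OF locally_compact])
 fix g :: "'e option => real" assume g: "continuous_map E_del euclideanreal g"
 have "(%(r, w). g (\<xi> (max 0 (min r t)) w)) : bm (borel \<Otimes> F (en t))"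
  by (rule cadlag_clamped_joint_measurable[OF _ t motion.cadlag_F g])
  (auto intro!: measurable_compose[OF motion.X_measurable_F continuous_map_topo_borel_measurable[OF g]])
 thus "(%y. g ((%(r, w). \<xi> (max 0 (min r t)) w) y)) : bm (borel \<Otimes> F (en t))"
  by (simp add: case_prod_beta')
qed

lemma X_finite_measure: "0 <= t ==> w : space W ==> X t w : finite_measures (BE)"
 using mass.X_in_topspace by simp

lemma X_nn_integral_clamped_measurable:
 assumes t: "0 <= t" and f: "f : bm (BE)"
 shows "(%(r, w). \<integral>\<^sup>+x. f x \<partial>X (max 0 (min r t)) w) : bm (borel \<Otimes> G (en t))"
proof -
  let ?a0 = "borel \<Otimes> G (en t)"
  let ?b0 = "%y. max 0 (min (fst y) t)"
 have sp: "X (?b0 y) (snd y) : finite_measures (BE)"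
  if "y : space ?a0" for y :: "real \<times> 'w"
  using that by (intro X_finite_measure) (auto simp: space_pair_measure mass.space_F)
 have "(%y. \<integral>\<^sup>+x. f x \<partial>X (?b0 y) (snd y)) : bm ?a0"
 proof (rule kernel_nn_integral_measurable[OF _ _ f])
  show "sets (X (?b0 y) (snd y)) = sets (BE)"
  if "y : space ?a0" for y :: "real \<times> 'w"
  using sp[OF that] by (simp add: finite_measures_iff)
  show "(%y. emeasure (X (?b0 y) (snd y)) A) : bm ?a0"
  if A: "A : sets (BE)" for A
  proof (rule finite_kernel_measurable[OF locally_compact sp _ A])
  fix g :: "'e option => real" assume g: "continuous_map E_del euclideanreal g" "\<And>y. 0 <= g y" "\<And>y. g y <= 1"
  have c: "continuous_map (weak_topology E_del) euclideanreal (%\<mu>. \<integral>x. g x \<partial>\<mu>)"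
  by (rule continuous_map_weak_topology_integral[OF g(1) bounded_unit_range[OF g(2,3)]])
  have "(%(r, w). \<integral>x. g x \<partial>X (max 0 (min r t)) w) : bm ?a0"
  by (rule cadlag_clamped_joint_measurable[OF _ t mass.cadlag_F c])
  (auto intro!: measurable_compose[OF mass.X_measurable_F continuous_map_topo_borel_measurable[OF c]])
  thus "(%y. \<integral>x. g x \<partial>X (?b0 y) (snd y)) : bm ?a0"
  by (simp add: case_prod_beta')
  qed
 qed
 thus ?thesis by (simp add: case_prod_beta')
qed

lemma X_nn_integral_joint_measurable:
 assumes f: "f : bm (BE)"
 shows "(%(r, w). \<integral>\<^sup>+x. f x \<partial>X (max 0 r) w) : bm (borel \<Otimes> W)"
proof (rule measurable_unclamp[where h = "%r w. \<integral>\<^sup>+x. f x \<partial>X r w"])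
 fix n :: nat
 have "(%y :: real \<times> 'w. (fst y, snd y)) : borel \<Otimes> W \<rightarrow>\<^sub>M borel \<Otimes> G (en (real n))"
  by (intro measurable_Pair measurable_fst measurable_compose[OF measurable_snd mass.id_measurable_F])
 from measurable_compose[OF this X_nn_integral_clamped_measurable[OF _ f]]
 show "(%(r, w). \<integral>\<^sup>+x. f x \<partial>X (max 0 (min r (real n))) w) : bm (borel \<Otimes> W)"
  by (simp add: case_prod_beta')
qed

lemma X_nn_integral_measurable_G:
 assumes "0 <= s" "s <= t" and f: "f : bm (BE)"
 shows "(%w. \<integral>\<^sup>+x. f x \<partial>X s w) : bm (G (en t))"
 using measurable_compose[OF mass.X_measurable_F[OF assms(1,2)] weak_topology_nn_integral_measurable[OF locally_compact f]] .

lemma X_nn_integral_measurable: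
 assumes "0 <= s" and f: "f : bm (BE)"
 shows "(%w. \<integral>\<^sup>+x. f x \<partial>X s w) : bm W"
 using measurable_compose[OF mass.X_measurable_M[OF assms(1)] weak_topology_nn_integral_measurable[OF locally_compact f]] .

end

section \<open>The non-linear part of the branching mechanism\<close>

definition jump :: "real measure => (real => ennreal) => ennreal" where
 "jump m f = (\<integral>\<^sup>+r\<in>{0<..}. f r \<partial>m)"

text \<open>The branching mechanism without its linear part.\<close>

definition psi0 :: "('e => real) => ('e => real measure) => 'e => real => real" where
 "psi0 \<alpha> \<pi> x z = 1/2 * \<alpha> x * z\<^sup>2 + enn2real (jump (\<pi> x) (%r. en (exprem (z * r))))"

text \<open>The jumps of size at least one after rescaling by the eigenfunction.\<close>

definition big_jump :: "('e => real measure) => ('e => real) => 'e => (real => ennreal) => ennreal" where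
 "big_jump \<pi> \<phi> x f = jump (\<pi> x) (%r. f (r * \<phi> x) * ind {1..} (r * \<phi> x))"

lemma qmin_mult_le: "0 <= z ==> 0 <= r ==> qmin (z * r) <= max z (z\<^sup>2) * min r (r\<^sup>2)"
proof -
 assume z: "0 <= z" and r: "0 <= r"
 have "z * r <= max z (z\<^sup>2) * r" "z\<^sup>2 * r\<^sup>2 <= max z (z\<^sup>2) * r\<^sup>2"
  using r by (auto intro: mult_right_mono)
 thus ?thesis
  using z r unfolding qmin_def by (auto simp: min_def power_mult_distrib)
qed

lemma exprem_mono_Lipschitz:
 assumes "0 <= b" "b <= a" "a <= K" "0 <= r"
 shows "exprem (b * r) <= exprem (a * r)"
  and "exprem (a * r) <= exprem (b * r) + (a - b) * (max 1 K * min r (r\<^sup>2))"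
proof -
 have d: "0 <= (a - b) * r" using assms by simp
 have ab: "exp (- (b * r)) = exp (- (a * r)) * exp ((a - b) * r)"
  by (simp add: algebra_simps flip: exp_add)
 have ba: "exp (- (a * r)) = exp (- (b * r)) * exp (- ((a - b) * r))"
  by (simp add: algebra_simps flip: exp_add)
 have "exp (- (b * r)) * (1 - (a - b) * r) <= exp (- (a * r))"
  unfolding ba using exp_ge_add_one_self[of "- ((a - b) * r)"] by (intro mult_left_mono) auto
 moreover have "exp (- (b * r)) * ((a - b) * r) <= 1 * ((a - b) * r)"
  using d assms by (intro mult_right_mono) auto
 ultimately show "exprem (b * r) <= exprem (a * r)"
  unfolding exprem_def by (simp add: algebra_simps)
 have "exp (- (a * r)) * (1 + (a - b) * r) <= exp (- (b * r))"
  unfolding ab using exp_ge_add_one_self[of "(a - b) * r"] by (intro mult_left_mono) auto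
 hence "exprem (a * r) - exprem (b * r) <= ((a - b) * r) * (1 - exp (- (a * r)))"
  unfolding exprem_def by (simp add: algebra_simps)
 also have "... <= ((a - b) * r) * (max 1 K * min 1 r)"
 proof (intro mult_left_mono d)
  have "1 - exp (- (a * r)) <= a * r"
  using exp_ge_add_one_self[of "- (a * r)"] by simp
  also have "... <= max 1 K * r" using assms by (intro mult_right_mono) auto
  finally have "1 - exp (- (a * r)) <= max 1 K * r" .
  moreover have "1 - exp (- (a * r)) <= max 1 K * 1"
  using exp_gt_zero[of "- (a * r)"] by (smt (verit) max.cobounded1 mult_1_right)
  ultimately show "1 - exp (- (a * r)) <= max 1 K * min 1 r" by (simp add: min_def)
 qed
 also have "... = (a - b) * (max 1 K * min r (r\<^sup>2))"
 proof -
  have "r * min 1 r = min r (r\<^sup>2)" using assms by (simp add: min_mult_distrib_left power2_eq_square)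
  thus ?thesis by (metis mult.assoc mult.left_commute)
 qed
 finally show "exprem (a * r) <= exprem (b * r) + (a - b) * (max 1 K * min r (r\<^sup>2))" by simp
qed

context branching_mechanism
begin

lemma pi_measurable [measurable_cong]: "sets (\<pi> x) = sets borel"
 by (rule sets_pi)

definition jump_bound :: real where
 "jump_bound = (SOME C. 0 <= C \<and> (\<forall>x. jump (\<pi> x) (%r. en (min r (r\<^sup>2))) <= en C))"

lemma jump_bound: "0 <= jump_bound" "jump (\<pi> x) (%r. en (min r (r\<^sup>2))) <= en jump_bound"
proof -
  let ?a0 = "%r. en (min r (r\<^sup>2))"
 obtain C where "\<forall>x. jump (\<pi> x) ?a0 <= en C"
  using pi_bounded unfolding jump_def by auto
 hence "\<exists>C. 0 <= C \<and> (\<forall>x. jump (\<pi> x) ?a0 <= en C)"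
  by (intro exI[of _ "max 0 C"]) (auto intro: order_trans ennreal_leI)
 from someI_ex[OF this] show "0 <= jump_bound" "jump (\<pi> x) ?a0 <= en jump_bound"
  unfolding jump_bound_def by auto
qed

lemma jump_mono: "(\<And>r. 0 < r ==> f r <= g r) ==> jump (\<pi> x) f <= jump (\<pi> x) g"
 unfolding jump_def by (intro nn_integral_mono) (auto simp: indicator_def)

lemma jump_cong: "(\<And>r. 0 < r ==> f r = g r) ==> jump (\<pi> x) f = jump (\<pi> x) g"
 unfolding jump_def by (intro nn_integral_cong) (auto simp: indicator_def)

lemma jump_add:
 assumes "f : bm borel" "g : bm borel"
 shows "jump (\<pi> x) (%r. f r + g r) = jump (\<pi> x) f + jump (\<pi> x) g"
 unfolding jump_def distrib_right
 by (intro nn_integral_add) (use assms in \<open>simp_all add: measurable_cong_sets[OF sets_pi refl]\<close>)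

lemma jump_cmult:
 assumes "f : bm borel"
 shows "jump (\<pi> x) (%r. c * f r) = c * jump (\<pi> x) f"
 unfolding jump_def mult.assoc
 by (intro nn_integral_cmult) (use assms in \<open>simp_all add: measurable_cong_sets[OF sets_pi refl]\<close>)

lemma jump_SUP:
 assumes "\<And>i::nat. f i : bm borel" "incseq f"
 shows "jump (\<pi> x) (%r. SUP i. f i r) = (SUP i. jump (\<pi> x) (f i))"
proof -
 have "jump (\<pi> x) (%r. SUP i. f i r) = (NN r|\<pi> x. (SUP i. f i r * ind {0<..} r))"
  unfolding jump_def by (intro nn_integral_cong) (auto simp: indicator_def)
 also have "... = (SUP i. \<integral>\<^sup>+r. f i r * ind {0<..} r \<partial>\<pi> x)"
  using assms by (intro nn_integral_monotone_convergence_SUP)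
  (auto simp: measurable_cong_sets[OF sets_pi refl] incseq_def le_fun_def intro!: mult_right_mono)
 finally show ?thesis unfolding jump_def .
qed

text \<open>The kernel \<open>\<pi>\<close> may be infinite near the origin; weighted by \<open>min r r\<^sup>2\<close> it becomes a finite
 kernel, for which joint measurability is available.\<close>

lemma jump_measurable:
 assumes f: "(%(y, r). f y r) : bm (N \<Otimes> borel)" and g: "g : N \<rightarrow>\<^sub>M borel"
 shows "(%y. jump (\<pi> (g y)) (f y)) : bm N"
proof -
 define c where "c = jump_bound + 1"
 have c: "0 < c" "jump_bound <= c" using jump_bound(1) by (auto simp: c_def)
 define w where "w r = en (min r (r\<^sup>2) / c) * ind {0<..} r" for r :: real
 have w [measurable]: "w : bm borel" unfolding w_def by measurable
 define ka where "ka x = density (\<pi> x) w" for x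
 have wpi: "w : bm (\<pi> x)" for x using w by (simp add: measurable_cong_sets[OF sets_pi refl])
 have setska: "sets (ka x) = sets borel" for x by (simp add: ka_def sets_pi)
 have em: "emeasure (ka x) A = (NN r|\<pi> x. w r * ind A r)" if "A : sets borel" for x A
  unfolding ka_def using that by (intro emeasure_density wpi) (simp add: sets_pi)
 have k: "ka : borel \<rightarrow>\<^sub>M subprob_algebra borel"
 proof (rule measurable_subprob_algebra)
  show "(%x. emeasure (ka x) A) : bm borel" if A [measurable]: "A : sets borel" for A
  unfolding em[OF A]
  by (rule kernel_nn_integral_measurable[where B = borel, OF sets_pi pi_kernel borel_measurable_times_ennreal[OF w borel_measurable_indicator[OF A]]])
  show "subprob_space (ka x)" for x
  proof (rule subprob_spaceI)
  have "emeasure (ka x) (space (ka x)) = (NN r|\<pi> x. en (1 / c) * (en (min r (r\<^sup>2)) * ind {0<..} r))"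
  using sets_eq_imp_space_eq[OF setska] em[of UNIV x] c
  by (auto simp: w_def indicator_def ennreal_mult'[symmetric] intro!: nn_integral_cong)
  also have "... = en (1 / c) * jump (\<pi> x) (%r. en (min r (r\<^sup>2)))"
  unfolding jump_def by (rule nn_integral_cmult) (simp add: measurable_cong_sets[OF sets_pi refl])
  also have "... <= en (1 / c) * en jump_bound"
  by (intro mult_left_mono jump_bound) simp
  also have "... <= 1" using c by (simp add: ennreal_mult'[symmetric])
  finally show "emeasure (ka x) (space (ka x)) <= 1" .
  show "space (ka x) \<noteq> {}" using sets_eq_imp_space_eq[OF setska] by simp
  qed
 qed (rule setska)
 define h where "h y r = f y r * en (c / min r (r\<^sup>2))" for y r
 have h: "(%(y, r). h y r) : bm (N \<Otimes> borel)"
  unfolding h_def case_prod_beta'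
  by (intro borel_measurable_times_ennreal f[unfolded case_prod_beta']) measurable
 have "(%y. \<integral>\<^sup>+r. h y r \<partial>ka (g y)) : bm N"
  by (rule nn_integral_measurable_subprob_algebra2[OF h measurable_compose[OF g k]])
 moreover have "jump (\<pi> (g y)) (f y) = (NN r|ka (g y). h y r)" if "y : space N" for y
 proof -
  have hy: "h y : bm (\<pi> (g y))"
  using measurable_compose[OF measurable_Pair1'[OF that] h] by (simp add: measurable_cong_sets[OF sets_pi refl])
  have "(NN r|ka (g y). h y r) = (NN r|\<pi> (g y). w r * h y r)"
  unfolding ka_def by (rule nn_integral_density[OF wpi hy])
  also have "... = jump (\<pi> (g y)) (f y)"
  unfolding jump_def
  proof (intro nn_integral_cong)
  fix r :: real
  show "w r * h y r = f y r * ind {0<..} r"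
  proof (cases "0 < r")
  case True
  hence m: "0 < min r (r\<^sup>2)" by simp
  have "en (min r (r\<^sup>2) / c) * en (c / min r (r\<^sup>2)) = en ((min r (r\<^sup>2) / c) * (c / min r (r\<^sup>2)))"
  using m c by (intro ennreal_mult'[symmetric] divide_nonneg_nonneg) auto
  also have "(min r (r\<^sup>2) / c) * (c / min r (r\<^sup>2)) = 1"
  using less_imp_neq[OF m] less_imp_neq[OF c(1)] by (simp only: times_divide_times_eq) (simp add: mult.commute)
  finally have "en (min r (r\<^sup>2) / c) * en (c / min r (r\<^sup>2)) = 1" by simp
  thus ?thesis using True unfolding w_def h_def by (simp add: mult_ac)
  qed (simp add: w_def)
  qed
  finally show ?thesis ..
 qed
 ultimately show ?thesis by (rule measurable_congI[rotated])
qed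

lemma jump_exprem_le:
 assumes "0 <= z"
 shows "jump (\<pi> x) (%r. en (exprem (z * r))) <= en (max z (z\<^sup>2) * jump_bound)"
proof -
 have "jump (\<pi> x) (%r. en (exprem (z * r))) <= jump (\<pi> x) (%r. en (max z (z\<^sup>2)) * en (min r (r\<^sup>2)))"
  using assms
  by (intro jump_mono) (auto simp: ennreal_mult'[symmetric] intro!: ennreal_leI order_trans[OF exprem_le_qmin qmin_mult_le])
 also have "... = en (max z (z\<^sup>2)) * jump (\<pi> x) (%r. en (min r (r\<^sup>2)))"
  by (rule jump_cmult) simp
 also have "... <= en (max z (z\<^sup>2)) * en jump_bound"
  by (intro mult_left_mono jump_bound) simp
 finally show ?thesis using assms by (simp add: ennreal_mult')
qed

lemma jump_exprem_finite: "0 <= z ==> jump (\<pi> x) (%r. en (exprem (z * r))) < \<top>"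
 using jump_exprem_le[of z x] by (auto intro: le_less_trans)

lemma psi_eq_psi0:
 assumes "0 <= z"
 shows "psi \<alpha> \<beta> \<pi> x z = psi0 \<alpha> \<pi> x z - \<beta> x * z"
proof -
  let ?a0 = "\<integral>\<^sup>+r. en (ind {0<..} r *\<^sub>R (exp (- z * r) - 1 + z * r)) \<partial>\<pi> x"
 have "(LINT r:{0<..}|\<pi> x. exp (- z * r) - 1 + z * r) = enn2real ?a0"
  unfolding set_lebesgue_integral_def
 proof (rule integral_eq_nn_integral)
  show "(%r. ind {0<..} r *\<^sub>R (exp (- z * r) - 1 + z * r)) : bm (\<pi> x)"
  by (simp add: measurable_cong_sets[OF sets_pi refl])
  show "AE r in \<pi> x. 0 <= ind {0<..} r *\<^sub>R (exp (- z * r) - 1 + z * r)"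
  using exprem_nonneg[of "z * _"] by (simp add: exprem_def indicator_def)
 qed
 also have "?a0 = jump (\<pi> x) (%r. en (exprem (z * r)))"
  unfolding jump_def exprem_def by (intro nn_integral_cong) (auto simp: indicator_def)
 finally show ?thesis unfolding psi_def psi0_def by simp
qed

lemma psi0_nonneg: "0 <= psi0 \<alpha> \<pi> x z"
 unfolding psi0_def using alpha(2)[of x] by simp

lemma psi0_0 [simp]: "psi0 \<alpha> \<pi> x 0 = 0"
 unfolding psi0_def jump_def exprem_def by simp

lemma psi0_measurable:
 assumes g: "g : N \<rightarrow>\<^sub>M borel" and z: "z : bm N"
 shows "(%y. psi0 \<alpha> \<pi> (g y) (z y)) : bm N"
proof -
 have [measurable]: "\<alpha> : bm borel" using alpha(1) by (simp add: bounded_borel_def)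
 note [measurable] = g z
 have "(%y. jump (\<pi> (g y)) (%r. en (exprem (z y * r)))) : bm N"
  by (rule jump_measurable[OF _ g]) measurable
 thus ?thesis unfolding psi0_def by measurable
qed

definition alpha_bound :: real where
 "alpha_bound = (SOME C. 0 <= C \<and> (\<forall>x. \<alpha> x <= C))"

lemma alpha_bound: "0 <= alpha_bound" "\<alpha> x <= alpha_bound"
proof -
 obtain C where "\<forall>x. \<bar>\<alpha> x\<bar> <= C" using alpha(1) unfolding bounded_borel_def bounded_iff by auto
 hence "\<exists>C. 0 <= C \<and> (\<forall>x. \<alpha> x <= C)"
  by (intro exI[of _ "max 0 C"]) (auto intro: order_trans[OF abs_ge_self] max.coboundedI2)
 from someI_ex[OF this] show "0 <= alpha_bound" "\<alpha> x <= alpha_bound"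
  unfolding alpha_bound_def by auto
qed

definition psi0_slope :: "real => real" where
 "psi0_slope K = alpha_bound * K + max 1 K * jump_bound"

lemma psi0_slope_nonneg: "0 <= K ==> 0 <= psi0_slope K"
 unfolding psi0_slope_def using alpha_bound jump_bound by simp

lemma psi0_mono_Lipschitz:
 assumes "0 <= b" "b <= a" "a <= K"
 shows "psi0 \<alpha> \<pi> x b <= psi0 \<alpha> \<pi> x a"
  and "psi0 \<alpha> \<pi> x a <= psi0 \<alpha> \<pi> x b + psi0_slope K * (a - b)"
proof -
 let ?J = "%z. jump (\<pi> x) (%r. en (exprem (z * r)))"
 have "?J b <= ?J a"
  using assms by (intro jump_mono ennreal_leI exprem_mono_Lipschitz(1)[OF _ _ order_refl]) auto
 hence J: "enn2real (?J b) <= enn2real (?J a)"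
  using assms by (intro enn2real_mono jump_exprem_finite) auto
 have sq: "b\<^sup>2 <= a\<^sup>2" using assms by (intro power_mono) auto
 have "\<alpha> x * b\<^sup>2 <= \<alpha> x * a\<^sup>2" using sq alpha(2) by (intro mult_left_mono)
 with J show "psi0 \<alpha> \<pi> x b <= psi0 \<alpha> \<pi> x a" unfolding psi0_def by simp
 have "?J a <= jump (\<pi> x) (%r. en (exprem (b * r)) + en ((a - b) * max 1 K) * en (min r (r\<^sup>2)))"
  using assms exprem_mono_Lipschitz(2)[OF assms]
  by (intro jump_mono) (auto simp: ennreal_mult'[symmetric] ennreal_plus[symmetric] mult.assoc simp del: ennreal_plus intro!: ennreal_leI)
 also have "... = ?J b + en ((a - b) * max 1 K) * jump (\<pi> x) (%r. en (min r (r\<^sup>2)))"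
  by (subst jump_add) (auto simp: jump_cmult)
 also have "... <= ?J b + en ((a - b) * max 1 K) * en jump_bound"
  by (intro add_left_mono mult_left_mono jump_bound) simp
 also have "... = en (enn2real (?J b) + (a - b) * max 1 K * jump_bound)"
  using assms jump_bound(1) jump_exprem_finite[of b x] by (simp add: ennreal_mult' ennreal_enn2real)
 finally have "enn2real (?J a) <= enn2real (?J b) + (a - b) * max 1 K * jump_bound"
  using assms jump_bound(1) by (intro enn2real_leI) auto
 moreover have "\<alpha> x * a\<^sup>2 <= \<alpha> x * b\<^sup>2 + 2 * alpha_bound * K * (a - b)"
 proof -
  have "\<alpha> x * (a\<^sup>2 - b\<^sup>2) = \<alpha> x * ((a + b) * (a - b))" by (simp add: power2_eq_square algebra_simps)
  also have "... <= alpha_bound * ((2 * K) * (a - b))"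
  using assms alpha(2)[of x] alpha_bound(2)[of x] by (intro mult_mono mult_right_mono) auto
  finally show ?thesis by (simp add: algebra_simps)
 qed
 ultimately show "psi0 \<alpha> \<pi> x a <= psi0 \<alpha> \<pi> x b + psi0_slope K * (a - b)"
  unfolding psi0_def psi0_slope_def by (simp add: algebra_simps)
qed

lemma psi0_le_slope: "0 <= a ==> a <= K ==> psi0 \<alpha> \<pi> x a <= psi0_slope K * a"
 using psi0_mono_Lipschitz(2)[of 0 a K x] by simp

text \<open>Near zero the mechanism \<open>psi0\<close> is of smaller than linear order. This is what identifies the
 first moments of the superprocess.\<close>

lemma psi0_sublinear:
 assumes K: "0 <= K"
 shows "(%n. real (Suc n) * psi0 \<alpha> \<pi> x (K / real (Suc n))) \<longlonglongrightarrow> 0"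
proof -
  let ?a0 = "%r. en (min r (r\<^sup>2)) * ind {0<..} r"
  let ?b0 = "max K (K\<^sup>2)"
 let ?n = "%n. real (Suc n)"
 have inv: "(%n. 1 / ?n n) \<longlonglongrightarrow> 0"
  using LIMSEQ_inverse_real_of_nat by (simp add: inverse_eq_divide)
 have lim1: "(%n. 1/2 * \<alpha> x * K\<^sup>2 * (1 / ?n n)) \<longlonglongrightarrow> 1/2 * \<alpha> x * K\<^sup>2 * 0"
  by (intro tendsto_mult tendsto_const inv)
 have bnd: "?n n * exprem (K / ?n n * r) <= max K (K\<^sup>2) * min r (r\<^sup>2)"
  and bnd2: "?n n * exprem (K / ?n n * r) <= (K * r)\<^sup>2 * (1 / ?n n)" if r: "0 < r" for n r
 proof -
  have n1: "1 <= ?n n" by simp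
  have e: "exprem (K / ?n n * r) <= qmin (K / ?n n * r)" using r K by (intro exprem_le_qmin) auto
  have "?n n * exprem (K / ?n n * r) <= ?n n * (K / ?n n * r)"
  using e K r by (intro mult_left_mono order_trans[OF e]) (auto simp: qmin_def min_le_iff_disj abs_mult)
  hence a1: "?n n * exprem (K / ?n n * r) <= K * r" by simp
  have "?n n * exprem (K / ?n n * r) <= ?n n * (K / ?n n * r)\<^sup>2"
  using e by (intro mult_left_mono order_trans[OF e]) (auto simp: qmin_def)
  also have "... = (K * r)\<^sup>2 * (1 / ?n n)"
  by (simp add: power2_eq_square field_simps del: of_nat_Suc)
  finally show "?n n * exprem (K / ?n n * r) <= (K * r)\<^sup>2 * (1 / ?n n)" .
  also have "... <= (K * r)\<^sup>2 * 1" using n1 by (intro mult_left_mono) auto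
  finally have "?n n * exprem (K / ?n n * r) <= qmin (K * r)"
  using a1 K r by (simp add: qmin_def)
  also have "... <= max K (K\<^sup>2) * min r (r\<^sup>2)" using K r by (intro qmin_mult_le) auto
  finally show "?n n * exprem (K / ?n n * r) <= max K (K\<^sup>2) * min r (r\<^sup>2)" .
 qed
 have "(%n. \<integral>\<^sup>+r. en (?n n * exprem (K / ?n n * r)) * ind {0<..} r \<partial>\<pi> x) \<longlonglongrightarrow> (NN r|\<pi> x. 0)"
 proof (rule nn_integral_dominated_convergence[where w = "%r. en ?b0 * (?a0 r)"])
  show "(%r. en (?n n * exprem (K / ?n n * r)) * ind {0<..} r) : bm (\<pi> x)" for n
  by (simp add: measurable_cong_sets[OF sets_pi refl] del: of_nat_Suc)
  show "(%r. en ?b0 * (?a0 r)) : bm (\<pi> x)"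
  by (simp add: measurable_cong_sets[OF sets_pi refl])
  show "AE r in \<pi> x. en (?n n * exprem (K / ?n n * r)) * ind {0<..} r <= en ?b0 * (?a0 r)" for n
  using bnd K by (intro AE_I2) (auto simp: indicator_def ennreal_mult'[symmetric] intro!: ennreal_leI simp del: of_nat_Suc)
  have "(NN r|\<pi> x. en ?b0 * (?a0 r)) = en ?b0 * jump (\<pi> x) (%r. en (min r (r\<^sup>2)))"
  unfolding jump_def by (rule nn_integral_cmult) (simp add: measurable_cong_sets[OF sets_pi refl])
  also have "... <= en ?b0 * en jump_bound"
  by (intro mult_left_mono jump_bound) simp
  also have "... < \<infinity>" by (simp add: ennreal_mult_less_top)
  finally show "(NN r|\<pi> x. en ?b0 * (?a0 r)) < \<infinity>" .
  show "AE r in \<pi> x. (%n. en (?n n * exprem (K / ?n n * r)) * ind {0<..} r) \<longlonglongrightarrow> 0"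
  proof (intro AE_I2)
  fix r :: real
  show "(%n. en (?n n * exprem (K / ?n n * r)) * ind {0<..} r) \<longlonglongrightarrow> 0"
  proof (cases "0 < r")
  case True
  have "(%n. (K * r)\<^sup>2 * (1 / ?n n)) \<longlonglongrightarrow> (K * r)\<^sup>2 * 0"
  by (intro tendsto_mult tendsto_const inv)
  hence lim0: "(%n. (K * r)\<^sup>2 * (1 / ?n n)) \<longlonglongrightarrow> 0"
  by (simp only: mult_zero_right)
  have "(%n. ?n n * exprem (K / ?n n * r)) \<longlonglongrightarrow> 0"
  proof (rule tendsto_sandwich[OF _ _ tendsto_const lim0])
  show "\<forall>\<^sub>F n in sequentially. 0 <= ?n n * exprem (K / ?n n * r)"
  by (intro always_eventually allI mult_nonneg_nonneg exprem_nonneg of_nat_0_le_iff)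
  show "\<forall>\<^sub>F n in sequentially. ?n n * exprem (K / ?n n * r) <= (K * r)\<^sup>2 * (1 / ?n n)"
  by (intro always_eventually allI bnd2[OF True])
  qed
  hence "(%n. en (?n n * exprem (K / ?n n * r))) \<longlonglongrightarrow> en 0"
  by (rule tendsto_ennrealI)
  thus ?thesis using True by simp
  qed simp
  qed
 qed simp
 moreover have "(NN r|\<pi> x. en (?n n * exprem (K / ?n n * r)) * ind {0<..} r)
  = en (?n n) * jump (\<pi> x) (%r. en (exprem (K / ?n n * r)))" for n
 proof -
  have "(NN r|\<pi> x. en (?n n * exprem (K / ?n n * r)) * ind {0<..} r) = jump (\<pi> x) (%r. en (?n n) * en (exprem (K / ?n n * r)))"
  unfolding jump_def by (intro nn_integral_cong) (simp add: ennreal_mult' del: of_nat_Suc)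
  also have "... = en (?n n) * jump (\<pi> x) (%r. en (exprem (K / ?n n * r)))"
  by (rule jump_cmult) simp
  finally show ?thesis .
 qed
 ultimately have "(%n. en (?n n) * jump (\<pi> x) (%r. en (exprem (K / ?n n * r)))) \<longlonglongrightarrow> 0"
  by (simp del: of_nat_Suc)
 hence "(%n. enn2real (en (?n n) * jump (\<pi> x) (%r. en (exprem (K / ?n n * r))))) \<longlonglongrightarrow> enn2real 0"
  by (intro tendsto_enn2real) auto
 hence "(%n. ?n n * enn2real (jump (\<pi> x) (%r. en (exprem (K / ?n n * r))))) \<longlonglongrightarrow> 0"
  by (simp add: enn2real_mult del: of_nat_Suc)
 note lim2 = this
 have eq: "?n n * psi0 \<alpha> \<pi> x (K / ?n n) = 1/2 * \<alpha> x * K\<^sup>2 * (1 / ?n n) + ?n n * enn2real (jump (\<pi> x) (%r. en (exprem (K / ?n n * r))))" for n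
 proof -
  have "?n n * (1/2 * \<alpha> x * (K / ?n n)\<^sup>2) = 1/2 * \<alpha> x * K\<^sup>2 * (1 / ?n n)"
  by (simp add: power2_eq_square del: of_nat_Suc)
  thus ?thesis unfolding psi0_def by (simp only: distrib_left)
 qed
 show ?thesis unfolding eq using tendsto_add[OF lim1 lim2] by (simp only: mult_zero_right add_0_right)
qed

end

section \<open>Jumps seen through the eigenfunction\<close>

context branching_mechanism
begin

lemma big_jump_eq_pi_phi:
 assumes "0 < \<phi> x" "f : bm borel"
 shows "big_jump \<pi> \<phi> x f = (\<integral>\<^sup>+r\<in>{1..}. f r \<partial>pi_phi \<pi> \<phi> x)"
proof -
 have "(\<integral>\<^sup>+r\<in>{1..}. f r \<partial>pi_phi \<pi> \<phi> x) = (NN r|\<pi> x. f (r * \<phi> x) * ind {1..} (r * \<phi> x))"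
  unfolding pi_phi_def using assms
  by (subst nn_integral_distr) (simp_all add: measurable_cong_sets[OF sets_pi refl])
 also have "... = big_jump \<pi> \<phi> x f"
  unfolding big_jump_def jump_def
 proof (intro nn_integral_cong)
  fix r :: real
  have "\<not> 1 <= r * \<phi> x" if "\<not> 0 < r"
  using that assms by (smt (verit) mult_nonneg_nonneg mult_less_0_iff mult_nonpos_nonneg)
  thus "f (r * \<phi> x) * ind {1..} (r * \<phi> x) = f (r * \<phi> x) * ind {1..} (r * \<phi> x) * ind {0<..} r"
  by (auto simp: indicator_def)
 qed
 finally show ?thesis ..
qed

lemma big_jump_mono: "0 < \<phi> x ==> (\<And>r. 1 <= r ==> f r <= g r) ==> big_jump \<pi> \<phi> x f <= big_jump \<pi> \<phi> x g"
 unfolding big_jump_def by (intro jump_mono) (auto simp: indicator_def)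

lemma big_jump_add:
 assumes "f : bm borel" "g : bm borel"
 shows "big_jump \<pi> \<phi> x (%r. f r + g r) = big_jump \<pi> \<phi> x f + big_jump \<pi> \<phi> x g"
 unfolding big_jump_def distrib_right using assms by (intro jump_add) simp_all

lemma big_jump_cmult:
 assumes "f : bm borel"
 shows "big_jump \<pi> \<phi> x (%r. c * f r) = c * big_jump \<pi> \<phi> x f"
 unfolding big_jump_def mult.assoc using assms by (intro jump_cmult) simp_all

lemma big_jump_SUP:
 assumes f: "\<And>i::nat. f i : bm borel" and inc: "incseq f"
 shows "big_jump \<pi> \<phi> x (%r. SUP i. f i r) = (SUP i. big_jump \<pi> \<phi> x (f i))"
proof -
 have "big_jump \<pi> \<phi> x (%r. SUP i. f i r) = jump (\<pi> x) (%r. SUP i. f i (r * \<phi> x) * ind {1..} (r * \<phi> x))"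
  unfolding big_jump_def by (intro jump_cong) (auto simp: indicator_def)
 also have "... = (SUP i. big_jump \<pi> \<phi> x (f i))"
  unfolding big_jump_def
 proof (rule jump_SUP)
  have m: "(%r. r * \<phi> x) : borel \<rightarrow>\<^sub>M borel" by simp
  show "(%r. f i (r * \<phi> x) * ind {1..} (r * \<phi> x)) : bm borel" for i
  by (intro borel_measurable_times_ennreal measurable_compose[OF m f]
  measurable_compose[OF m borel_measurable_indicator[of "{1..}" borel]]) simp
  show "incseq (%i r. f i (r * \<phi> x) * ind {1..} (r * \<phi> x))"
  using inc by (auto simp: incseq_def le_fun_def intro!: mult_right_mono)
 qed
 finally show ?thesis .
qed

lemma big_jump_measurable:
 assumes f: "(%(x, r). f x r) : bm (borel \<Otimes> borel)" and \<phi> [measurable]: "\<phi> : bm borel"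
 shows "(%x. big_jump \<pi> \<phi> x (f x)) : bm borel"
 unfolding big_jump_def
proof (rule jump_measurable)
  let ?a0 = "borel \<Otimes> borel"
 have "(%y. (fst y, snd y * \<phi> (fst y))) : borel \<Otimes> borel \<rightarrow>\<^sub>M borel \<Otimes> borel" by measurable
 from measurable_compose[OF this f]
 have "(%y. f (fst y) (snd y * \<phi> (fst y))) : bm ?a0" by simp
 moreover have "(%y. ind {1..} (snd y * \<phi> (fst y)) :: ennreal) : bm ?a0" by measurable
 ultimately show "(%(y, r). f y (r * \<phi> y) * ind {1..} (r * \<phi> y)) : bm ?a0"
  unfolding case_prod_beta' by (rule borel_measurable_times_ennreal)
qed simp

lemma big_jump_first_moment:
 assumes "0 < \<phi> x" "\<phi> x <= B" "1 <= B"
 shows "big_jump \<pi> \<phi> x (%r. en r) <= en (B * jump_bound * \<phi> x)"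
proof -
 have "big_jump \<pi> \<phi> x (%r. en r) <= jump (\<pi> x) (%r. en (B * \<phi> x) * en (min r (r\<^sup>2)))"
  unfolding big_jump_def
 proof (rule jump_mono)
  fix r :: real assume r: "0 < r"
  show "en (r * \<phi> x) * ind {1..} (r * \<phi> x) <= en (B * \<phi> x) * en (min r (r\<^sup>2))"
  proof (cases "1 <= r * \<phi> x")
  case True
  have "1 <= r * B" using True assms r by (smt (verit) mult_left_mono)
  hence "r * 1 <= r * (r * B)" using r by (intro mult_left_mono) auto
  moreover have "1 * r <= B * r" using r assms by (intro mult_right_mono) auto
  ultimately have "r <= B * min r (r\<^sup>2)" using r by (simp add: min_def power2_eq_square mult_ac)
  hence "r * \<phi> x <= B * min r (r\<^sup>2) * \<phi> x" using assms by (intro mult_right_mono) auto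
  thus ?thesis using True assms by (simp add: ennreal_mult'[symmetric] mult_ac ennreal_leI)
  qed simp
 qed
 also have "... = en (B * \<phi> x) * jump (\<pi> x) (%r. en (min r (r\<^sup>2)))"
  by (rule jump_cmult) simp
 also have "... <= en (B * \<phi> x) * en jump_bound"
  by (intro mult_left_mono jump_bound) simp
 finally show ?thesis using assms jump_bound(1) by (simp add: ennreal_mult'[symmetric] mult_ac)
qed

lemma psi0_ge_big_jump:
 assumes "0 < \<phi> x" "0 <= th"
 shows "en (1/4) * big_jump \<pi> \<phi> x (%r. en (qmin (th * r))) <= en (psi0 \<alpha> \<pi> x (th * \<phi> x))"
proof -
  let ?a0 = "%r. en (exprem (th * \<phi> x * r))"
 have "en (1/4) * big_jump \<pi> \<phi> x (%r. en (qmin (th * r))) = big_jump \<pi> \<phi> x (%r. en (1/4) * en (qmin (th * r)))"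
  by (rule big_jump_cmult[symmetric]) simp
 also have "... <= jump (\<pi> x) ?a0"
  unfolding big_jump_def
 proof (rule jump_mono)
  fix r :: real
  show "en (1/4) * en (qmin (th * (r * \<phi> x))) * ind {1..} (r * \<phi> x) <= en (exprem (th * \<phi> x * r))"
  using qmin_le_exprem[of "th * \<phi> x * r"]
  by (auto simp: indicator_def ennreal_mult'[symmetric] mult_ac intro!: ennreal_leI)
 qed
 also have "... = en (enn2real (jump (\<pi> x) ?a0))"
  using jump_exprem_finite[of "th * \<phi> x" x] assms by (simp add: ennreal_enn2real)
 also have "... <= en (psi0 \<alpha> \<pi> x (th * \<phi> x))"
  unfolding psi0_def using alpha(2) by (intro ennreal_leI) simp
 finally show ?thesis .
qed

lemma psi0_le_big_jump:
 assumes "0 < \<phi> x" "\<phi> x <= B" "1 <= B" "0 <= th"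
 shows "en (psi0 \<alpha> \<pi> x (th * \<phi> x))
  <= en ((alpha_bound + 2 * jump_bound) * B * th\<^sup>2 * \<phi> x) + big_jump \<pi> \<phi> x (%r. en (qmin (th * r)))"
proof -
 let ?c = "th\<^sup>2 * \<phi> x * (2 * B)"
 let ?b = "%r. en (qmin (th * (r * \<phi> x))) * ind {1..} (r * \<phi> x)"
 have c: "0 <= ?c" using assms by simp
 have "jump (\<pi> x) (%r. en (exprem (th * \<phi> x * r))) <= jump (\<pi> x) (%r. en ?c * en (min r (r\<^sup>2)) + ?b r)"
 proof (rule jump_mono)
  fix r :: real assume r: "0 < r"
  have e: "exprem (th * \<phi> x * r) <= qmin (th * (r * \<phi> x))"
  using exprem_le_qmin[of "th * \<phi> x * r"] assms r by (simp add: mult_ac)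
  show "en (exprem (th * \<phi> x * r)) <= en ?c * en (min r (r\<^sup>2)) + ?b r"
  proof (cases "1 <= r * \<phi> x")
  case True
  have "en (exprem (th * \<phi> x * r)) <= ?b r" using True e by (simp add: ennreal_leI)
  also have "... <= en ?c * en (min r (r\<^sup>2)) + ?b r" by simp
  finally show ?thesis .
  next
  case False
  have sq: "(r * \<phi> x)\<^sup>2 <= \<phi> x * (2 * B) * min r (r\<^sup>2)"
  proof (cases "r <= 1")
  case True
  have m: "min r (r\<^sup>2) = r\<^sup>2" using True r by (simp add: min_def power2_eq_square)
  have "\<phi> x * \<phi> x <= \<phi> x * (2 * B)" using assms by (intro mult_left_mono) auto
  hence "(\<phi> x * \<phi> x) * r\<^sup>2 <= \<phi> x * (2 * B) * r\<^sup>2" by (intro mult_right_mono) auto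
  thus ?thesis unfolding m by (simp add: power2_eq_square mult_ac)
  next
  case False
  have m: "min r (r\<^sup>2) = r" using False r by (simp add: min_def power2_eq_square)
  have "(r * \<phi> x) * (r * \<phi> x) <= (2 * B) * (r * \<phi> x)"
  using \<open>\<not> 1 \<le> r * \<phi> x\<close> assms r by (intro mult_right_mono) auto
  thus ?thesis unfolding m by (simp add: power2_eq_square mult_ac)
  qed
  have "exprem (th * \<phi> x * r) <= (th * (r * \<phi> x))\<^sup>2" using e by (simp add: qmin_def)
  also have "... = th\<^sup>2 * (r * \<phi> x)\<^sup>2" by (simp add: power_mult_distrib)
  also have "... <= th\<^sup>2 * (\<phi> x * (2 * B) * min r (r\<^sup>2))" by (intro mult_left_mono sq) simp
  finally have "exprem (th * \<phi> x * r) <= ?c * min r (r\<^sup>2)" by (simp add: mult_ac)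
  hence "en (exprem (th * \<phi> x * r)) <= en ?c * en (min r (r\<^sup>2))"
  using c by (simp add: ennreal_mult'[symmetric] ennreal_leI)
  thus ?thesis using False by simp
  qed
 qed
 also have "... = en ?c * jump (\<pi> x) (%r. en (min r (r\<^sup>2))) + big_jump \<pi> \<phi> x (%r. en (qmin (th * r)))"
  unfolding big_jump_def by (subst jump_add) (simp_all add: jump_cmult)
 also have "... <= en ?c * en jump_bound + big_jump \<pi> \<phi> x (%r. en (qmin (th * r)))"
  by (intro add_right_mono mult_left_mono jump_bound) simp
 also have "en ?c * en jump_bound = en (?c * jump_bound)" using c by (simp add: ennreal_mult')
 finally have J: "jump (\<pi> x) (%r. en (exprem (th * \<phi> x * r))) <= en (?c * jump_bound) + big_jump \<pi> \<phi> x (%r. en (qmin (th * r)))" .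
 have a: "1/2 * \<alpha> x * (th * \<phi> x)\<^sup>2 <= alpha_bound * B * th\<^sup>2 * \<phi> x"
 proof -
  have "1/2 * \<alpha> x <= alpha_bound" using alpha(2)[of x] alpha_bound(2)[of x] by linarith
  moreover have "(th * \<phi> x)\<^sup>2 <= th\<^sup>2 * (B * \<phi> x)"
  unfolding power_mult_distrib using assms by (intro mult_left_mono) (auto simp: power2_eq_square)
  ultimately have "(1/2 * \<alpha> x) * (th * \<phi> x)\<^sup>2 <= alpha_bound * (th\<^sup>2 * (B * \<phi> x))"
  using alpha_bound(1) by (intro mult_mono) auto
  thus ?thesis by (simp add: mult_ac)
 qed
 have "en (psi0 \<alpha> \<pi> x (th * \<phi> x)) = en (1/2 * \<alpha> x * (th * \<phi> x)\<^sup>2) + jump (\<pi> x) (%r. en (exprem (th * \<phi> x * r)))"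
  unfolding psi0_def using jump_exprem_finite[of "th * \<phi> x" x] assms alpha(2)[of x]
  by (subst ennreal_plus) (simp_all add: ennreal_enn2real)
 also have "... <= en (alpha_bound * B * th\<^sup>2 * \<phi> x) + (en (?c * jump_bound) + big_jump \<pi> \<phi> x (%r. en (qmin (th * r))))"
  by (intro add_mono ennreal_leI a J)
 also have "... = en (alpha_bound * B * th\<^sup>2 * \<phi> x + ?c * jump_bound) + big_jump \<pi> \<phi> x (%r. en (qmin (th * r)))"
  using assms alpha_bound(1) jump_bound(1) by (simp add: add.assoc)
 also have "alpha_bound * B * th\<^sup>2 * \<phi> x + ?c * jump_bound = (alpha_bound + 2 * jump_bound) * B * th\<^sup>2 * \<phi> x"
  by (simp add: algebra_simps)
 finally show ?thesis .
qed

end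

section \<open>The exponential of an integral\<close>

lemma abs_set_integral_le:
 fixes h :: "real => real"
 assumes int: "set_integrable lborel {a<..b} h" and ab: "a <= b" and bnd: "\<And>r. a < r ==> r <= b ==> \<bar>h r\<bar> <= B"
 shows "\<bar>LBINT r:{a<..b}. h r\<bar> <= B * (b - a)"
proof (cases "a = b")
 case False
 hence "0 <= B" using bnd[of b] ab by auto
 have c: "integrable lborel (%r. B * ind {a<..b} r)"
  by (intro integrable_mult_right integrable_real_indicator) (simp_all add: emeasure_lborel_Ioc[OF ab])
 have "norm (LBINT r:{a<..b}. h r) <= (LINT r|lborel. B * ind {a<..b} r)"
  unfolding set_lebesgue_integral_def
 proof (rule Bochner_Integration.integral_norm_bound_integral[OF _ c])
  show "integrable lborel (%r. ind {a<..b} r *\<^sub>R h r)" using int by (simp add: set_integrable_def)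
  show "norm (ind {a<..b} r *\<^sub>R h r) <= B * ind {a<..b} r" for r
  using bnd[of r] by (auto simp: indicator_def)
 qed
 also have "... = B * (b - a)" using ab by simp
 finally show ?thesis by simp
qed (simp add: set_lebesgue_integral_def)

lemma set_integral_split:
 fixes h :: "real => real"
 assumes "set_integrable lborel {0..b} h" "0 <= a" "a <= b"
 shows "(LBINT r:{0..b}. h r) = (LBINT r:{0..a}. h r) + (LBINT r:{a<..b}. h r)"
proof -
 have "{0..b} = {0..a} \<union> {a<..b}" using assms by auto
 moreover have "set_integrable lborel {0..a} h" "set_integrable lborel {a<..b} h"
  by (rule set_integrable_subset[OF assms(1)]; use assms in force)+
 ultimately show ?thesis
  by (simp add: set_integral_Un ivl_disj_int)
qed

lemma quadratic_increments_constant: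
 fixes g :: "real => real"
 assumes T: "0 <= T" and g: "\<And>a b. 0 <= a ==> a <= b ==> b <= T ==> \<bar>g b - g a\<bar> <= D * (b - a)\<^sup>2"
 shows "g T = g 0"
proof -
 have step: "\<bar>g (real j * (T / real n)) - g 0\<bar> <= real j * (D * (T / real n)\<^sup>2)" if "0 < n" "j <= n" for j n
  using that(2)
 proof (induction j)
  case (Suc j)
  have "real (Suc j) * (T / real n) <= real n * (T / real n)"
  using Suc.prems T by (intro mult_right_mono) auto
  hence "real (Suc j) * (T / real n) <= T" using that by simp
  hence "\<bar>g (real (Suc j) * (T / real n)) - g (real j * (T / real n))\<bar> <= D * (real (Suc j) * (T / real n) - real j * (T / real n))\<^sup>2"
  using T by (intro g mult_right_mono) auto
  also have "real (Suc j) * (T / real n) - real j * (T / real n) = T / real n"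
  by (simp add: distrib_right add_divide_distrib)
  finally show ?case using Suc by (simp add: distrib_right)
 qed simp
 have "\<bar>g T - g 0\<bar> <= (D * T\<^sup>2) / real n" if "0 < n" for n
 proof -
  have "real n * (D * (T / real n)\<^sup>2) = (D * T\<^sup>2) / real n"
  using that by (simp add: power2_eq_square)
  thus ?thesis using step[OF that order_refl] that by simp
 qed
 hence "\<bar>g T - g 0\<bar> <= (D * T\<^sup>2) / real (Suc n)" for n by blast
 moreover have "(%n. (D * T\<^sup>2) / real (Suc n)) \<longlonglongrightarrow> 0"
  using tendsto_mult[OF tendsto_const[of "D * T\<^sup>2"] LIMSEQ_inverse_real_of_nat] by (simp only: divide_inverse mult_zero_right)
 ultimately have "\<bar>g T - g 0\<bar> <= 0"
  by (intro LIMSEQ_le_const[of _ 0]) auto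
 thus ?thesis by simp
qed

text \<open>The function \<open>I\<close> below need not be differentiable everywhere, since \<open>k\<close> is only measurable, and the
 fundamental theorem of calculus does not apply. Instead, the two sides of the identity change over an
 interval of length \<open>h\<close> by amounts that agree up to \<open>O(h\<^sup>2)\<close>.\<close>

lemma exp_integral_identity:
 fixes k :: "real => real"
 defines "I \<equiv> %s. LBINT r:{0..s}. k r"
 assumes T: "0 <= T" and int: "set_integrable lborel {0..T} k" and bnd: "\<And>r. 0 <= r ==> r <= T ==> \<bar>k r\<bar> <= C"
 shows "exp (I T) = 1 + (LBINT r:{0..T}. k r * exp (I r))"
proof -
  let ?a0 = "%r. ind {0..T} r *\<^sub>R k r"
  let ?b0 = "%b a. exp (C * T) * (C * (b - a))"
  let ?c0 = "%r. ind {0..T} r *\<^sub>R (k r * exp (I r))"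
 have C: "0 <= C" using bnd[of 0] T by simp
 have int_ab: "set_integrable lborel {a<..b} k" if "0 <= a" "b <= T" for a b
  by (rule set_integrable_subset[OF int]) (use that in auto)
 have int_0: "set_integrable lborel {0..b} k" if "b <= T" for b
  by (rule set_integrable_subset[OF int]) (use that in auto)
 have I_diff: "I b - I a = (LBINT r:{a<..b}. k r)" if "0 <= a" "a <= b" "b <= T" for a b
  using set_integral_split[OF int_0[OF that(3)] that(1,2)] unfolding I_def by simp
 have I_Lip: "\<bar>I b - I a\<bar> <= C * (b - a)" if "0 <= a" "a <= b" "b <= T" for a b
  unfolding I_diff[OF that] using that by (intro abs_set_integral_le int_ab bnd) auto
 have I0: "I 0 = 0"
  unfolding I_def set_lebesgue_integral_def by (intro integral_eq_zero_AE) (use AE_lborel_singleton[of "0::real"] in \<open>auto elim!: eventually_mono\<close>)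
 have I_le: "\<bar>I s\<bar> <= C * T" if "0 <= s" "s <= T" for s
  using I_Lip[of 0 s] that I0 C by (auto intro: order_trans mult_left_mono)
 have expLip: "\<bar>exp (I b) - exp (I a)\<bar> <= exp (C * T) * (C * (b - a))" if "0 <= a" "a <= b" "b <= T" for a b
 proof -
  have *: "exp x - exp y <= exp x * (x - y)" for x y :: real
  proof -
  have "exp x * (1 + (y - x)) <= exp x * exp (y - x)" by (intro mult_left_mono exp_ge_add_one_self) simp
  thus ?thesis by (simp add: algebra_simps flip: exp_add)
  qed
  have m: "exp (I s) * \<bar>I b - I a\<bar> <= exp (C * T) * (C * (b - a))" if "s = a \<or> s = b" for s
  using I_Lip[OF \<open>0 \<le> a\<close> \<open>a \<le> b\<close> \<open>b \<le> T\<close>] I_le[of s] that \<open>0 \<le> a\<close> \<open>a \<le> b\<close> \<open>b \<le> T\<close>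
  by (intro mult_mono) auto
  have "exp (I b) * (I b - I a) <= exp (I b) * \<bar>I b - I a\<bar>" "exp (I a) * (I a - I b) <= exp (I a) * \<bar>I b - I a\<bar>"
  by (intro mult_left_mono; simp)+
  with *[of "I b" "I a"] *[of "I a" "I b"] m[of a] m[of b] show ?thesis
  by (intro abs_leI) linarith+
 qed
 define J where "J s = (LBINT r:{0..s}. k r * exp (I r))" for s
 have contI: "continuous_on {0..T} I"
 proof (rule continuous_onI)
  fix x e :: real assume x: "x : {0..T}" "0 < e"
  have "dist (I y) (I x) <= e" if y: "y : {0..T}" "dist y x < e / (C + 1)" for y
  proof -
  have "\<bar>I y - I x\<bar> <= C * \<bar>y - x\<bar>"
  proof (cases "x <= y")
  case True thus ?thesis using I_Lip[of x y] x y by simp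
  next
  case False thus ?thesis using I_Lip[of y x] x y by (simp add: abs_minus_commute)
  qed
  also have "... <= (C + 1) * (e / (C + 1))"
  using y C by (intro mult_mono) (auto simp: dist_real_def)
  finally show ?thesis using C by (simp add: dist_real_def)
  qed
  thus "\<exists>d>0. \<forall>x'\<in>{0..T}. dist x' x < d \<longrightarrow> dist (I x') (I x) <= e"
  using x C by (intro exI[of _ "e / (C + 1)"]) auto
 qed
 have int_kE: "set_integrable lborel {0..T} (%r. k r * exp (I r))"
  unfolding set_integrable_def
 proof (rule Bochner_Integration.integrable_bound)
  show "integrable lborel (%r. exp (C * T) *\<^sub>R (?a0 r))"
  using int by (intro integrable_scaleR_right) (simp add: set_integrable_def)
  have "(%r. ind {0..T} r *\<^sub>R exp (I r)) : bm borel"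
  by (intro borel_measurable_continuous_on_indicator continuous_on_exp contI) simp
  moreover have "(%r. ind {0..T} r *\<^sub>R k r) : bm lborel"
  using int by (auto simp: set_integrable_def)
  ultimately have "(%r. (?a0 r) * (ind {0..T} r *\<^sub>R exp (I r))) : bm lborel"
  by simp
  moreover have "(%r. (?a0 r) * (ind {0..T} r *\<^sub>R exp (I r))) = ?c0"
  by (auto simp: indicator_def)
  ultimately show "?c0 : bm lborel" by simp
  show "AE r in lborel. norm (ind {0..T} r *\<^sub>R (k r * exp (I r))) <= norm (exp (C * T) *\<^sub>R (?a0 r))"
  proof (intro AE_I2)
  fix r :: real
  show "norm (ind {0..T} r *\<^sub>R (k r * exp (I r))) <= norm (exp (C * T) *\<^sub>R (?a0 r))"
  using abs_le_D1[OF I_le[of r]] by (auto simp: indicator_def abs_mult mult.commute intro!: mult_left_mono)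
  qed
 qed
 have quad: "\<bar>(exp (I b) - J b) - (exp (I a) - J a)\<bar> <= 2 * exp (2 * (C * T)) * C\<^sup>2 * (b - a)\<^sup>2"
  if ab: "0 <= a" "a <= b" "b <= T" for a b
 proof -
  let ?D = "I b - I a"
  have iE: "set_integrable lborel {a<..b} (%r. k r * exp (I r))"
  by (rule set_integrable_subset[OF int_kE]) (use ab in auto)
  have iE2: "set_integrable lborel {a<..b} (%r. k r * exp (I a))"
  using ab by (intro set_integrable_mult_left int_ab) auto
  have "J b - J a = (LBINT r:{a<..b}. k r * exp (I r))"
  unfolding J_def using set_integral_split[OF set_integrable_subset[OF int_kE], of b a] ab by simp
  also have "... = (LBINT r:{a<..b}. k r * (exp (I r) - exp (I a))) + (LBINT r:{a<..b}. k r * exp (I a))"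
  using set_integral_diff(2)[OF iE iE2] by (simp add: right_diff_distrib)
  also have "(LBINT r:{a<..b}. k r * exp (I a)) = ?D * exp (I a)"
  unfolding I_diff[OF ab] by simp
  finally have J: "J b - J a = (LBINT r:{a<..b}. k r * (exp (I r) - exp (I a))) + ?D * exp (I a)" .
  have r1: "\<bar>LBINT r:{a<..b}. k r * (exp (I r) - exp (I a))\<bar> <= (C * (?b0 b a)) * (b - a)"
  proof (rule abs_set_integral_le)
  show "set_integrable lborel {a<..b} (%r. k r * (exp (I r) - exp (I a)))"
  using set_integral_diff(1)[OF iE iE2] by (simp add: right_diff_distrib)
  fix r assume r: "a < r" "r <= b"
  have "exp (C * T) * (C * (r - a)) <= exp (C * T) * (C * (b - a))"
  using r C by (intro mult_left_mono) auto
  hence "\<bar>exp (I r) - exp (I a)\<bar> <= exp (C * T) * (C * (b - a))"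
  using expLip[of a r] r ab by linarith
  thus "\<bar>k r * (exp (I r) - exp (I a))\<bar> <= C * (?b0 b a)"
  unfolding abs_mult using bnd[of r] r ab C by (intro mult_mono) auto
  qed (rule ab)
  have e1: "exp (I b) = exp (I a) * exp ?D" by (simp flip: exp_add)
  have "\<bar>exp (I b) - exp (I a) - ?D * exp (I a)\<bar> <= \<bar>?D\<bar> * \<bar>exp (I b) - exp (I a)\<bar>"
  proof -
  have "0 <= exp ?D - 1 - ?D" using exp_ge_add_one_self[of ?D] by linarith
  moreover have "exp ?D - 1 - ?D <= ?D * (exp ?D - 1)"
  proof -
  have "exp ?D * (1 + (- ?D)) <= exp ?D * exp (- ?D)"
  by (intro mult_left_mono exp_ge_add_one_self) simp
  thus ?thesis by (simp add: algebra_simps flip: exp_add)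
  qed
  moreover have "?D * (exp ?D - 1) <= \<bar>?D\<bar> * \<bar>exp ?D - 1\<bar>"
  by (metis abs_ge_self abs_mult)
  ultimately have "\<bar>exp ?D - 1 - ?D\<bar> <= \<bar>?D\<bar> * \<bar>exp ?D - 1\<bar>" by linarith
  hence "exp (I a) * \<bar>exp ?D - 1 - ?D\<bar> <= exp (I a) * (\<bar>?D\<bar> * \<bar>exp ?D - 1\<bar>)"
  by (intro mult_left_mono) auto
  moreover have "exp (I b) - exp (I a) - ?D * exp (I a) = exp (I a) * (exp ?D - 1 - ?D)"
  "exp (I b) - exp (I a) = exp (I a) * (exp ?D - 1)"
  unfolding e1 by (simp_all add: algebra_simps)
  ultimately show ?thesis by (simp only: abs_mult abs_exp_cancel mult.left_commute)
  qed
  also have "... <= (C * (b - a)) * (?b0 b a)"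
  using I_Lip[OF ab] expLip[OF ab] C ab by (intro mult_mono) auto
  finally have r2: "\<bar>exp (I b) - exp (I a) - ?D * exp (I a)\<bar> <= (C * (b - a)) * (?b0 b a)" .
  have "\<bar>(exp (I b) - J b) - (exp (I a) - J a)\<bar> <= (C * (?b0 b a)) * (b - a) + (C * (b - a)) * (?b0 b a)"
  using r1 r2 J by linarith
  also have "... = 2 * exp (C * T) * C\<^sup>2 * (b - a)\<^sup>2" by (simp add: power2_eq_square)
  also have "... <= 2 * exp (2 * (C * T)) * C\<^sup>2 * (b - a)\<^sup>2"
  using C T by (intro mult_right_mono) auto
  finally show ?thesis .
 qed
 have "exp (I T) - J T = exp (I 0) - J 0"
  by (rule quadratic_increments_constant[OF T quad])
 moreover have "J 0 = 0"
  unfolding J_def set_lebesgue_integral_def by (intro integral_eq_zero_AE) (use AE_lborel_singleton[of "0::real"] in \<open>auto elim!: eventually_mono\<close>)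
 ultimately show ?thesis using I0 by (simp add: J_def)
qed

section \<open>The Feynman--Kac transformation of the cumulant equation\<close>

lemma Fubini_bounded:
 fixes h :: "real => 'w => real"
 assumes N: "finite_measure N" and t: "0 <= t"
  and h: "(%(s, w). h s w) : bm (borel \<Otimes> N)"
  and B: "\<And>s w. 0 <= s ==> s <= t ==> w : space N ==> \<bar>h s w\<bar> <= B"
 shows "(LINT w|N. (LBINT s:{0..t}. h s w)) = (LBINT s:{0..t}. (LINT w|N. h s w))" (is ?eq)
  and "set_integrable lborel {0..t} (%s. \<integral>w. h s w \<partial>N)" (is ?i1)
  and "integrable N (%w. LBINT s:{0..t}. h s w)" (is ?i2)
proof -
  let ?a0 = "lborel \<Otimes> N"
  let ?b0 = "{0..t} \<times> space N"
  let ?c0 = "%(s, w). ind {0..t} s *\<^sub>R h s w"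
 interpret N: finite_measure N by fact
 interpret pair_sigma_finite lborel N ..
 have hm: "(%(s, w). h s w) : bm ?a0"
  using h by (subst measurable_cong_sets[OF sets_pair_measure_cong[OF sets_lborel refl] refl])
 have int: "integrable ?a0 ?c0"
 proof (rule Bochner_Integration.integrable_bound)
  have "emeasure ?a0 ?b0 = en t * emeasure N (space N)"
  using t by (subst N.emeasure_pair_measure_Times) auto
  also have "... < \<infinity>" by (simp add: ennreal_mult_less_top N.emeasure_eq_measure)
  finally show "integrable ?a0 (%x. B * ind ?b0 x)"
  by (intro integrable_mult_right integrable_real_indicator) auto
  show "?c0 : bm ?a0"
  using hm unfolding case_prod_beta' by measurable
  show "AE x in lborel \<Otimes> N. norm (case x of (s, w) => ind {0..t} s *\<^sub>R h s w) <= norm (B * ind ?b0 x)"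
  proof (intro AE_I2)
  fix x :: "real \<times> 'w" assume "x : space ?a0"
  thus "norm (case x of (s, w) => ind {0..t} s *\<^sub>R h s w) <= norm (B * ind ?b0 x)"
  using B[of "fst x" "snd x"] by (cases x) (auto simp: space_pair_measure indicator_def)
  qed
 qed
 have c: "(LINT w|N. ind {0..t} s *\<^sub>R h s w) = ind {0..t} s *\<^sub>R (LINT w|N. h s w)" for s
  by (simp add: indicator_def)
 show ?eq
  unfolding set_lebesgue_integral_def using Fubini_integral[OF int] by (simp add: c)
 show ?i1
  unfolding set_integrable_def using integrable_fst[OF int] by (simp add: c)
 show ?i2
  unfolding set_lebesgue_integral_def by (rule integrable_snd[OF int])
qed

lemma set_integrable_bounded:
 fixes h :: "real => real"
 assumes "h : bm borel" "\<And>s. 0 <= s ==> s <= t ==> \<bar>h s\<bar> <= B"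
 shows "set_integrable lborel {0..t} h"
 unfolding set_integrable_def
proof (rule Bochner_Integration.integrable_bound)
 show "integrable lborel (%x. B * ind {0..t} x)"
  by (intro integrable_mult_right integrable_real_indicator) (auto simp: emeasure_lborel_Icc_eq)
 show "(%x. ind {0..t} x *\<^sub>R h x) : bm lborel" using assms(1) by simp
 show "AE x in lborel. norm (ind {0..t} x *\<^sub>R h x) <= norm (B * ind {0..t} x)"
  using assms(2) by (intro AE_I2) (auto simp: indicator_def intro: order_trans abs_ge_self)
qed

lemma set_integral_cong_Icc:
 "(\<And>s. 0 <= s ==> s <= t ==> f s = g s) ==> (LBINT s:{0..t :: real}. f s) = (LBINT s:{0..t}. (g s :: real))"
 by (rule set_lebesgue_integral_cong) auto

lemma set_integral_shift:
 fixes h :: "real => real"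
 shows "(LBINT u:{0..t - s}. h (s + u)) = (LBINT r:{s..t}. h r)"
proof -
 have "(LBINT r:{s..t}. h r) = (LINT u|lborel. ind {s..t} (s + 1 * u) *\<^sub>R h (s + 1 * u))"
  unfolding set_lebesgue_integral_def by (subst lborel_integral_real_affine[where c = 1 and t = s]) auto
 also have "... = (LBINT u:{0..t - s}. h (s + u))"
  unfolding set_lebesgue_integral_def by (intro Bochner_Integration.integral_cong) (auto simp: indicator_def)
 finally show ?thesis ..
qed

lemma set_integral_triangle:
 fixes g k :: "real => real"
 assumes t: "0 <= t" and g: "g : bm borel" and k: "k : bm borel"
  and bg: "\<And>s. \<bar>g s\<bar> <= B" and bk: "\<And>s. \<bar>k s\<bar> <= B'"
 shows "(LBINT s:{0..t}. g s * (LBINT r:{s..t}. k r)) = (LBINT r:{0..t}. k r * (LBINT s:{0..r}. g s))"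
proof -
 let ?N = "restrict_space lborel {0..t}"
 have N: "finite_measure ?N"
  by (rule finite_measureI) (simp add: emeasure_restrict_space space_restrict_space emeasure_lborel_Icc_eq)
 have intN: "(LINT x|?N. f x) = (LBINT x:{0..t}. f x)" for f :: "real => real"
  unfolding set_lebesgue_integral_def by (rule integral_restrict_space) simp
 have "(LINT r|?N. (LBINT s:{0..t}. g s * (ind {s..} r * k r))) = (LBINT s:{0..t}. (LINT r|?N. g s * (ind {s..} r * k r)))"
 proof (rule Fubini_bounded[OF N t, of _ "B * B'"])
  have id: "(%x. x) : ?N \<rightarrow>\<^sub>M borel" by (rule measurable_restrict_space1) simp
  have A: "(%x. (fst x, snd x)) : borel \<Otimes> ?N \<rightarrow>\<^sub>M borel \<Otimes> borel"
  by (intro measurable_Pair measurable_fst measurable_compose[OF measurable_snd id])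
  have A': "(%x. g (fst x) * (ind {fst x..} (snd x) * k (snd x))) : bm (borel \<Otimes> borel)"
  proof -
  have "(%x::real \<times> real. ind {fst x..} (snd x) :: real) = (%x. if fst x <= snd x then 1 else 0)"
  by (auto simp: indicator_def)
  moreover have "(%x::real \<times> real. if fst x <= snd x then 1 else 0 :: real) : bm (borel \<Otimes> borel)"
  by measurable
  ultimately show ?thesis
  by (intro borel_measurable_times measurable_compose[OF measurable_fst g] measurable_compose[OF measurable_snd k]) simp
  qed
  show "(%(s, r). g s * (ind {s..} r * k r)) : bm (borel \<Otimes> ?N)"
  using measurable_compose[OF A A'] by (simp only: case_prod_beta' fst_conv snd_conv)
  have B0: "0 <= B" "0 <= B'" using bg[of 0] bk[of 0] by auto
  show "\<bar>g s * (ind {s..} r * k r)\<bar> <= B * B'" for s r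
  proof -
  have "\<bar>ind {s..} r * k r\<bar> <= B'" using bk[of r] B0 by (auto simp: indicator_def)
  thus ?thesis unfolding abs_mult[of "g s"] using bg[of s] B0 by (intro mult_mono) auto
  qed
 qed
 moreover have "(LBINT s:{0..t}. g s * (ind {s..} r * k r)) = k r * (LBINT s:{0..r}. g s)" if "r : {0..t}" for r
 proof -
  have "(LBINT s:{0..t}. g s * (ind {s..} r * k r)) = (LINT s|lborel. (ind {0..r} s *\<^sub>R g s) * k r)"
  unfolding set_lebesgue_integral_def using that
  by (intro Bochner_Integration.integral_cong) (auto simp: indicator_def)
  thus ?thesis unfolding set_lebesgue_integral_def by (simp add: mult.commute)
 qed
 hence "(LINT r|?N. (LBINT s:{0..t}. g s * (ind {s..} r * k r))) = (LBINT r:{0..t}. k r * (LBINT s:{0..r}. g s))"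
  unfolding intN by (intro set_integral_cong_Icc) auto
 moreover have "(LINT r|?N. g s * (ind {s..} r * k r)) = g s * (LBINT r:{s..t}. k r)" if "0 <= s" for s
 proof -
  have "(LINT r|?N. g s * (ind {s..} r * k r)) = (LINT r|lborel. g s * (ind {s..t} r *\<^sub>R k r))"
  unfolding intN set_lebesgue_integral_def using that
  by (intro Bochner_Integration.integral_cong) (auto simp: indicator_def)
  thus ?thesis unfolding set_lebesgue_integral_def by simp
 qed
 hence "(LBINT s:{0..t}. (LINT r|?N. g s * (ind {s..} r * k r))) = (LBINT s:{0..t}. g s * (LBINT r:{s..t}. k r))"
  by (intro set_integral_cong_Icc) auto
 ultimately show ?thesis by simp
qed

context superprocess_lc
begin

abbreviation clip :: "real => real => real" where "clip t r \<equiv> max 0 (min r t)"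

lemma transition_joint_kernel:
 "(%(r, y). motion.transition (max 0 r) y) : borel \<Otimes> BE \<rightarrow>\<^sub>M subprob_algebra (BE)"
proof -
  let ?a0 = "borel \<Otimes> BE"
  let ?b0 = "BE"
  let ?c0 = "%r q. \<xi> (max 0 r) q"
 let ?ka = "%x. motion.transition (max 0 (fst x)) (snd x)"
 have fin: "prob_space (?ka x)" for x
  by (intro motion.prob_space_transition) auto
 have "?ka : borel \<Otimes> BE \<rightarrow>\<^sub>M subprob_algebra ?b0"
 proof (rule measurable_subprob_algebra)
  show "subprob_space (?ka x)" for x by (rule prob_space_imp_subprob_space[OF fin])
  show "(%x. emeasure (?ka x) A) : bm ?a0"
  if A: "A : sets ?b0" for A
  proof (rule finite_kernel_measurable[OF locally_compact _ _ A])
  show "?ka x : finite_measures ?b0" for x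
  using prob_space.finite_measure[OF fin[of x]] by (simp add: finite_measures_iff)
  fix g :: "'e option => real"
  assume g: "continuous_map E_del euclideanreal g" "\<And>y. 0 <= g y" "\<And>y. g y <= 1"
  have gm: "g : bm ?b0" by (rule continuous_map_topo_borel_measurable[OF g(1)])
  have eq: "(LINT z|motion.transition (max 0 r) y. g z) = (LINT q|Q y. g (?c0 r q))" for r y
  unfolding motion.transition_def by (rule integral_distr[OF motion.X_measurable gm]) auto
  have "(%(r, y). \<integral>q. g (?c0 r q) \<partial>Q y) : bm ?a0"
  proof (rule right_continuous_joint_measurable)
  fix r :: real
  have "(%y. \<integral>z. g z \<partial>motion.transition (max 0 r) y) : bm ?b0"
  using g by (intro measurable_compose[OF motion.transition_kernel integral_measurable_subprob_algebra[OF gm]]) auto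
  thus "(%y. \<integral>q. g (?c0 r q) \<partial>Q y) : bm ?b0"
  by (simp only: eq)
  next
  fix y :: "'e option" and r :: real
  interpret prob_space "Q y" by (rule motion.prob_P) simp
  show "((%s. \<integral>q. g (\<xi> (max 0 s) q) \<partial>Q y) \<longlongrightarrow> (LINT q|Q y. g (?c0 r q))) (at_right r)"
  proof (rule tendsto_at_right_sequentially[of r "r + 1"])
  fix S :: "nat => real" assume S: "\<And>n. r < S n" "S \<longlonglongrightarrow> r"
  show "(%n. \<integral>q. g (\<xi> (max 0 (S n)) q) \<partial>Q y) \<longlonglongrightarrow> (LINT q|Q y. g (?c0 r q))"
  proof (rule integral_dominated_convergence[where w = "%_. 1"])
  have gx: "(%q. g (\<xi> (max 0 s) q)) : bm (Q y)" for s
  by (rule measurable_compose[OF motion.X_measurable gm]) auto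
  show "(%q. g (?c0 r q)) : bm (Q y)" by (rule gx)
  show "(%q. g (\<xi> (max 0 (S n)) q)) : bm (Q y)" for n by (rule gx)
  show "AE q in Q y. (%n. g (\<xi> (max 0 (S n)) q)) \<longlonglongrightarrow> g (?c0 r q)"
  proof (intro AE_I2)
  fix q assume "q : space (Q y)"
  hence q: "q : space M" by (simp add: motion.space_P)
  show "(%n. g (\<xi> (max 0 (S n)) q)) \<longlonglongrightarrow> g (?c0 r q)"
  proof (cases "0 <= r")
  case True
  have "filterlim S (at_right r) sequentially"
  unfolding filterlim_at using S by (auto simp: less_imp_neq[symmetric] intro!: always_eventually less_imp_neq[OF S(1), symmetric])
  from filterlim_compose[OF cadlag_continuous_map_at_right[OF motion.cadlag_paths[OF q] g(1) True] this]
  have "(%n. g (\<xi> (S n) q)) \<longlonglongrightarrow> g (\<xi> r q)" .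
  moreover have "max 0 (S n) = S n" for n using S(1)[of n] True by simp
  ultimately show ?thesis using True by simp
  next
  case False
  hence "\<forall>\<^sub>F n in sequentially. S n < 0" using S(2) by (auto intro: order_tendstoD)
  hence "\<forall>\<^sub>F n in sequentially. g (?c0 r q) = g (\<xi> (max 0 (S n)) q)"
  by eventually_elim (use False in \<open>simp add: max_def\<close>)
  thus ?thesis by (rule Lim_transform_eventually[OF tendsto_const])
  qed
  qed
  show "AE q in Q y. norm (g (\<xi> (max 0 (S n)) q)) <= 1" for n using g by simp
  qed simp
  qed simp
  qed
  thus "(%x. \<integral>z. g z \<partial>?ka x) : bm ?a0"
  by (simp add: case_prod_beta' eq)
  qed
 qed simp
 thus ?thesis by (simp add: case_prod_beta')
qed

lemma expectation_joint_measurable: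
 fixes H :: "'n => 'e option => real"
 assumes H: "(%(n, y). H n y) : bm (N \<Otimes> BE)" and B: "\<And>n y. \<bar>H n y\<bar> <= B"
  and r: "r : bm N" and y: "y : N \<rightarrow>\<^sub>M BE"
 shows "(%n. \<integral>w. H n (\<xi> (max 0 (r n)) w) \<partial>Q (y n)) : bm N"
proof -
 have "(%n. (r n, y n)) : N \<rightarrow>\<^sub>M borel \<Otimes> BE" by (rule measurable_Pair[OF r y])
 from measurable_compose[OF this transition_joint_kernel]
 have k: "(%n. motion.transition (max 0 (r n)) (y n)) : N \<rightarrow>\<^sub>M subprob_algebra (BE)" by simp
 have "(%(n, y). en (H n y + B)) : bm (N \<Otimes> BE)"
  using H unfolding case_prod_beta' by measurable
 from nn_integral_measurable_subprob_algebra2[OF this k]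
 have "(%n. enn2real (NN z|motion.transition (max 0 (r n)) (y n). en (H n z + B)) - B) : bm N"
  by measurable
 moreover have "(LINT w|Q (y n). H n (\<xi> (max 0 (r n)) w)) = enn2real (NN z|motion.transition (max 0 (r n)) (y n). en (H n z + B)) - B"
  if n: "n : space N" for n
 proof -
  let ?m = "motion.transition (max 0 (r n)) (y n)"
  interpret prob_space ?m by (rule motion.prob_space_transition) auto
  have Hn: "H n : bm (BE)"
  using measurable_compose[OF measurable_Pair1'[OF n] H] by simp
  hence Hm: "H n : bm ?m" by (subst measurable_cong_sets[OF motion.sets_transition refl])
  have Hi: "integrable ?m (H n)" using B Hm by (intro integrable_const_bound[of _ B]) auto
  have "enn2real (NN z|?m. en (H n z + B)) = (LINT z|?m. H n z + B)"
  proof (rule integral_eq_nn_integral[symmetric])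
  have "0 <= H n z + B" for z using abs_le_D2[OF B[of n z]] by simp
  thus "AE z in ?m. 0 <= H n z + B" by simp
  qed (use Hm in simp)
  also have "... = (LINT z|?m. H n z) + B" using Hi by (subst Bochner_Integration.integral_add) (auto simp: prob_space)
  also have "(LINT z|?m. H n z) = (LINT w|Q (y n). H n (\<xi> (max 0 (r n)) w))"
  unfolding motion.transition_def by (rule integral_distr[OF motion.X_measurable Hn]) auto
  finally show ?thesis by simp
 qed
 ultimately show ?thesis by (rule measurable_congI[rotated])
qed

lemma measurable_pair_F_Q:
 "h : borel \<Otimes> F t \<rightarrow>\<^sub>M B ==> h : borel \<Otimes> Q x \<rightarrow>\<^sub>M B"
proof -
 assume h: "h : borel \<Otimes> F t \<rightarrow>\<^sub>M B"
 have "(%y. (fst y, snd y)) : borel \<Otimes> Q x \<rightarrow>\<^sub>M borel \<Otimes> F t"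
  by (intro measurable_Pair measurable_fst measurable_compose[OF measurable_snd motion.id_measurable_P]) simp
 from measurable_compose[OF this h] show ?thesis by simp
qed

definition weight :: "('e option => real) => real => 'v => real" where
 "weight \<gamma> s w = exp (LBINT r:{0..s}. \<gamma> (\<xi> r w))"

lemma path_functional_clamped_measurable:
 assumes h: "(%(r, y). h r y) : bm (borel \<Otimes> BE)" and t: "0 <= t"
 shows "(%(r, w). h r (\<xi> (clip t r) w)) : bm (borel \<Otimes> F (en t))"
proof -
 have "(%x. (fst x, \<xi> (clip t (fst x)) (snd x))) : borel \<Otimes> F (en t) \<rightarrow>\<^sub>M borel \<Otimes> BE"
  using \<xi>_clamped_measurable[OF t] by (intro measurable_Pair measurable_fst) (simp add: case_prod_beta')
 from measurable_compose[OF this h] show ?thesis by (simp add: case_prod_beta')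
qed

lemma path_functional_measurable:
 assumes h: "(%(r, y). h r y) : bm (borel \<Otimes> BE)" and t: "0 <= t" and w: "w : space M"
 shows "(%r. h r (\<xi> (clip t r) w)) : bm borel"
proof -
 have "(%r. (r, w)) : borel \<rightarrow>\<^sub>M borel \<Otimes> F (en t)"
  using w by (intro measurable_Pair2') (simp add: motion.space_F)
 from measurable_compose[OF this path_functional_clamped_measurable[OF h t]] show ?thesis by simp
qed

lemma path_set_integrable:
 fixes h :: "real => 'e option => real"
 assumes h: "(%(r, y). h r y) : bm (borel \<Otimes> BE)" and t: "0 <= t" and w: "w : space M"
  and B: "\<And>r y. \<bar>h r y\<bar> <= B"
 shows "set_integrable lborel {0..t} (%r. h r (\<xi> r w))"
proof -
 have "set_integrable lborel {0..t} (%r. h r (\<xi> (clip t r) w))"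
  by (rule set_integrable_bounded[OF path_functional_measurable[OF h t w]]) (rule B)
 thus ?thesis
  by (rule set_integrable_cong[THEN iffD1, rotated -1]) (auto)
qed

lemma const_time_measurable:
 "\<gamma> : bm (BE) ==> (%(r::real, y). \<gamma> y) : bm (borel \<Otimes> BE)"
 unfolding case_prod_beta' by (rule measurable_compose[OF measurable_snd])

lemma weight_clamped_measurable:
 assumes \<gamma>: "\<gamma> : bm (BE)" and t: "0 <= t"
 shows "(%(s, w). weight \<gamma> (clip t s) w) : bm (borel \<Otimes> F (en t))"
proof -
 let ?S = "borel \<Otimes> F (en t)"
 have eq: "(LBINT r:{0..clip t s}. \<gamma> (\<xi> r w)) = (LINT r|lborel. (if 0 <= r \<and> r <= clip t s then \<gamma> (\<xi> (clip t r) w) else 0))" for s w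
  unfolding set_lebesgue_integral_def
  by (intro Bochner_Integration.integral_cong refl) (auto simp: indicator_def max_def min_def)
 have m: "(%z. (snd z, snd (fst z))) : ?S \<Otimes> lborel \<rightarrow>\<^sub>M ?S" by measurable
 have "(%z. \<gamma> (\<xi> (clip t (snd z)) (snd (fst z)))) : bm (?S \<Otimes> lborel)"
  using measurable_compose[OF m path_functional_clamped_measurable[OF const_time_measurable[OF \<gamma>] t]] by simp
 hence "(%z. if 0 <= snd z \<and> snd z <= clip t (fst (fst z)) then \<gamma> (\<xi> (clip t (snd z)) (snd (fst z))) else 0) : bm (?S \<Otimes> lborel)"
  by measurable
 hence "(%x. \<integral>r. (if 0 <= r \<and> r <= clip t (fst x) then \<gamma> (\<xi> (clip t r) (snd x)) else 0) \<partial>lborel) : bm ?S"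
  by (intro lborel.borel_measurable_lebesgue_integral) (simp add: case_prod_beta')
 hence "(%x. exp (LBINT r:{0..clip t (fst x)}. \<gamma> (\<xi> r (snd x)))) : bm ?S"
  unfolding eq by measurable
 thus ?thesis unfolding weight_def by (simp add: case_prod_beta')
qed

lemma weight_measurable_F:
 assumes \<gamma>: "\<gamma> : bm (BE)" and t: "0 <= t"
 shows "weight \<gamma> t : bm (F (en t))"
proof -
 have "(%w. (t, w)) : F (en t) \<rightarrow>\<^sub>M borel \<Otimes> F (en t)" by simp
 from measurable_compose[OF this weight_clamped_measurable[OF \<gamma> t]] show ?thesis using t by simp
qed

lemma weight_pos [simp]: "0 < weight \<gamma> s w" "0 <= weight \<gamma> s w"
 by (simp_all add: weight_def)

lemma weight_le:
 assumes \<gamma>: "\<gamma> : bm (BE)" and C: "\<And>y. \<bar>\<gamma> y\<bar> <= C" and s: "0 <= s" and w: "w : space M"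
 shows "weight \<gamma> s w <= exp (C * s)"
proof -
 have "(LBINT r:{0..s}. \<gamma> (\<xi> r w)) <= (LBINT r:{0..s}. C)"
  by (rule set_integral_mono[OF path_set_integrable[OF const_time_measurable[OF \<gamma>] s w C]])
  (use C in \<open>auto simp: abs_le_iff intro!: set_integrable_bounded[of _ _ "\<bar>C\<bar>"]\<close>)
 also have "... = C * s" using s by (simp add: set_lebesgue_integral_def)
 finally show ?thesis by (simp add: weight_def)
qed

end

lemma abs_set_integral_Icc_le:
 fixes h :: "real => real"
 assumes h: "h : bm borel" and ab: "a <= b" and B: "\<And>r. \<bar>h r\<bar> <= B"
 shows "\<bar>LBINT r:{a..b}. h r\<bar> <= B * (b - a)"
proof -
 have c: "integrable lborel (%r. B * ind {a..b} r)"
  by (intro integrable_mult_right integrable_real_indicator) (auto simp: emeasure_lborel_Icc_eq)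
 have bd: "norm (ind {a..b} r *\<^sub>R h r) <= B * ind {a..b} r" for r
  using B[of r] by (auto simp: indicator_def)
 have i: "integrable lborel (%r. ind {a..b} r *\<^sub>R h r)"
  by (rule Bochner_Integration.integrable_bound[OF c]) (use h bd in \<open>auto intro: order_trans[OF _ abs_ge_self]\<close>)
 have "norm (LBINT r:{a..b}. h r) <= (LINT r|lborel. B * ind {a..b} r)"
  unfolding set_lebesgue_integral_def
  by (rule Bochner_Integration.integral_norm_bound_integral[OF i c bd])
 also have "... = B * (b - a)" using ab by simp
 finally show ?thesis by simp
qed

lemma (in prob_space) abs_integral_le:
 fixes f :: "'a => real"
 assumes B: "\<And>x. \<bar>f x\<bar> <= B"
 shows "\<bar>\<integral>x. f x \<partial>M\<bar> <= B"
proof (cases "integrable M f")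
 case True
 have "(LINT x|M. f x) <= B" "- B <= (LINT x|M. f x)"
  using abs_le_D1[OF B] abs_le_D2[OF B]
  by (intro integral_le_const integral_ge_const True AE_I2; simp add: minus_le_iff)+
 thus ?thesis by (intro abs_leI) auto
next
 case False
 thus ?thesis using B[of undefined] by (simp add: not_integrable_integral_eq)
qed

context superprocess_lc
begin

text \<open>If \<open>v\<close> solves the mild equation with source \<open>- k\<close>, it also solves the mild equation for the motion
 weighted by \<open>exp (\<integral> \<gamma>)\<close>, with \<open>\<gamma> v\<close> added to \<open>k\<close>. By the Markov property \<open>v\<close> may be replaced,
 inside the correction term, by its own mild equation; the time integrals are then evaluated
 through \<open>exp_integral_identity\<close>.\<close>

lemma Feynman_Kac_transform:
 fixes f \<gamma> :: "'e option => real" and k v :: "real => 'e option => real"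
 assumes t: "0 <= t"
  and f: "f : bm (BE)" "\<And>y. \<bar>f y\<bar> <= B"
  and \<gamma>: "\<gamma> : bm (BE)" "\<And>y. \<bar>\<gamma> y\<bar> <= C"
  and k: "(%(r, y). k r y) : bm (borel \<Otimes> BE)" "\<And>r y. \<bar>k r y\<bar> <= B"
  and v: "(%(r, y). v r y) : bm (borel \<Otimes> BE)" "\<And>r y. \<bar>v r y\<bar> <= B"
  and mild: "\<And>r y. 0 <= r ==> r <= t ==> v r y = (LINT q|Q y. f (\<xi> r q)) - (LINT q|Q y. (LBINT s:{0..r}. k (r - s) (\<xi> s q)))"
 shows "v t x = (LINT q|Q x. weight \<gamma> t q * f (\<xi> t q))
  - (LINT q|Q x. (LBINT s:{0..t}. weight \<gamma> s q * (k (t - s) (\<xi> s q) + \<gamma> (\<xi> s q) * v (t - s) (\<xi> s q))))"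
proof -
 let ?R = "Q x"
 interpret R: prob_space ?R by (rule motion.prob_P) simp
 have finR: "finite_measure ?R" by (rule R.finite_measure_axioms)
 have spR: "space ?R = space M" by (simp add: motion.space_P)
 have B0: "0 <= B" using f(2)[of None] by linarith
 have C0: "0 <= C" using \<gamma>(2)[of None] by linarith
 define D where "D = exp (C * t)"
 have D0: "0 < D" by (simp add: D_def)
 define e where "e s q = weight \<gamma> (clip t s) q" for s q
 define g where "g s q = e s q * \<gamma> (\<xi> (clip t s) q)" for s q
 define ka where "ka s q = k (t - s) (\<xi> (clip t s) q)" for s q
 define w where "w s q = v (t - s) (\<xi> (clip t s) q)" for s q
 let ?S = "borel \<Otimes> F (en t)"
 have em: "(%(s, q). e s q) : bm ?S"
  unfolding e_def by (rule weight_clamped_measurable[OF \<gamma>(1) t])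
 have rev: "(%(r, y). h (t - r) y) : bm (borel \<Otimes> BE)"
  if h: "(%(r, y). h r y) : bm (borel \<Otimes> BE)" for h :: "real => 'e option => real" and t
 proof -
  have "(%x. (t - fst x, snd x)) : borel \<Otimes> BE \<rightarrow>\<^sub>M borel \<Otimes> BE" by measurable
  from measurable_compose[OF this h] show ?thesis by (simp add: case_prod_beta')
 qed
 have gm: "(%(s, q). g s q) : bm ?S"
  using em path_functional_clamped_measurable[OF const_time_measurable[OF \<gamma>(1)] t]
  unfolding g_def case_prod_beta' by (rule borel_measurable_times)
 have kam: "(%(s, q). ka s q) : bm ?S"
  unfolding ka_def by (rule path_functional_clamped_measurable[OF rev[OF k(1)] t])
 have wm: "(%(s, q). w s q) : bm ?S"
  unfolding w_def by (rule path_functional_clamped_measurable[OF rev[OF v(1)] t])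
 have fm: "(%q. f (\<xi> t q)) : bm ?R"
  by (rule measurable_compose[OF motion.X_measurable f(1)]) (use t in auto)
 note emR = measurable_pair_F_Q[OF em, of x] and gmR = measurable_pair_F_Q[OF gm, of x]
  and kamR = measurable_pair_F_Q[OF kam, of x] and wmR = measurable_pair_F_Q[OF wm, of x]
 have sec: "(%s. h s q) : bm borel"
  if "(%(s, q). h s q) : bm (borel \<Otimes> ?R)" "q : space ?R" for h :: "real => 'v => real" and q
  using measurable_compose[OF measurable_Pair2'[OF that(2)] that(1)] by simp
 have sec': "h s : bm ?R"
  if "(%(s, q). h s q) : bm (borel \<Otimes> ?R)" for h :: "real => 'v => real" and s
  using measurable_compose[OF measurable_Pair1' that, of s] by simp
 have eb: "0 <= e s q" "\<bar>e s q\<bar> <= D" if "q : space ?R" for s q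
 proof -
  have "e s q <= exp (C * clip t s)" unfolding e_def using that by (intro weight_le \<gamma>) (auto simp: spR)
  also have "... <= D" unfolding D_def using C0 t by (simp add: mult_left_mono)
  finally show "0 <= e s q" "\<bar>e s q\<bar> <= D" by (auto simp: e_def)
 qed
 have gb: "\<bar>g s q\<bar> <= D * C" if "q : space ?R" for s q
  unfolding g_def abs_mult using eb[OF that] \<gamma>(2) D0 C0 by (intro mult_mono) auto
 have kab: "\<bar>ka s q\<bar> <= B" for s q unfolding ka_def by (rule k(2))
 have wb: "\<bar>w s q\<bar> <= B" for s q unfolding w_def by (rule v(2))
 have prodb: "\<bar>a * b\<bar> <= A * A'" if "\<bar>a\<bar> <= A" "\<bar>b\<bar> <= A'" for a b A A' :: real
  unfolding abs_mult using that by (intro mult_mono) auto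
 \<comment> \<open>Replace \<open>v\<close> by its mild equation at a fixed time \<open>s\<close>.\<close>
 have S2: "(LINT q|?R. g s q * w s q) = (LINT q|?R. g s q * (f (\<xi> t q) - (LBINT r:{s..t}. ka r q)))"
  if s: "0 <= s" "s <= t" for s
 proof -
  define u0 where "u0 = t - s"
  have u0: "0 <= u0" using s by (simp add: u0_def)
  have cs: "clip t s = s" using s by simp
  define K where "K u y = (LINT q|Q y. k (u0 - u) (\<xi> (max 0 u) q))" for u y
  have Km: "(%(u, y). K u y) : bm (borel \<Otimes> BE)"
  proof -
  have "(%z. (u0 - fst (fst z), snd z)) : (borel \<Otimes> BE) \<Otimes> BE \<rightarrow>\<^sub>M borel \<Otimes> BE"
  by measurable
  from measurable_compose[OF this k(1)]
  have "(%x. \<integral>q. k (u0 - fst x) (\<xi> (max 0 (fst x)) q) \<partial>Q (snd x)) : bm (borel \<Otimes> BE)"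
  using k(2) by (intro expectation_joint_measurable[where B = B]) (auto simp: case_prod_beta')
  thus ?thesis unfolding K_def by (simp add: case_prod_beta')
  qed
  have Kb: "\<bar>K u y\<bar> <= B" for u y
  proof -
  interpret y: prob_space "Q y" by (rule motion.prob_P) simp
  show ?thesis unfolding K_def by (rule y.abs_integral_le[OF k(2)])
  qed
  have vK: "v u0 y = (LINT q|Q y. f (\<xi> u0 q)) - (LBINT u:{0..u0}. K u y)" for y
  proof -
  interpret y: prob_space "Q y" by (rule motion.prob_P) simp
  have fin: "finite_measure (Q y)" by (rule y.finite_measure_axioms)
  have "(LINT q|Q y. (LBINT u:{0..u0}. k (u0 - u) (\<xi> (clip u0 u) q))) = (LBINT u:{0..u0}. (LINT q|Q y. k (u0 - u) (\<xi> (clip u0 u) q)))"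
  by (rule Fubini_bounded(1)[OF fin u0 measurable_pair_F_Q[OF path_functional_clamped_measurable[OF rev[OF k(1)] u0]] k(2)])
  moreover have "(LBINT u:{0..u0}. (LINT q|Q y. k (u0 - u) (\<xi> (clip u0 u) q))) = (LBINT u:{0..u0}. K u y)"
  unfolding K_def by (rule set_integral_cong_Icc) simp
  moreover have "(LBINT u:{0..u0}. k (u0 - u) (\<xi> (clip u0 u) q)) = (LBINT u:{0..u0}. k (u0 - u) (\<xi> u q))" for q
  by (rule set_integral_cong_Icc) simp
  ultimately show ?thesis using mild[of u0 y] u0 s by (simp add: u0_def)
  qed
  have gsF: "g s : bm (F (en s))"
  proof -
  have "weight \<gamma> s : bm (F (en s))" by (rule weight_measurable_F[OF \<gamma>(1) s(1)])
  moreover have "(%q. \<gamma> (\<xi> s q)) : bm (F (en s))"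
  by (rule measurable_compose[OF motion.adapted[OF s(1)] \<gamma>(1)])
  ultimately show ?thesis unfolding g_def e_def cs by (intro borel_measurable_times)
  qed
  have gsR: "g s : bm ?R" by (rule sec'[OF gmR])
  have markov: "(LINT q|?R. g s q * h (\<xi> (s + u) q)) = (LINT q|?R. g s q * (LINT q'|Q (\<xi> s q). h (\<xi> u q')))"
  if h: "h : bm (BE)" "\<And>y. \<bar>h y\<bar> <= B" and u: "0 <= u" for h u
  proof -
  have "(%(q, y). g s q * h y) : bm (F (en s) \<Otimes> BE)"
  unfolding case_prod_beta'
  by (intro borel_measurable_times measurable_compose[OF measurable_fst gsF] measurable_compose[OF measurable_snd h(1)])
  from motion.markov_integral[OF _ s(1) u this, of x "D * C * B"]
  have "(LINT q|?R. g s q * h (\<xi> (s + u) q)) = (LINT q|?R. (LINT q'|Q (\<xi> s q). g s q * h (\<xi> u q')))"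
  using gb h(2) by (auto simp: spR intro!: prodb)
  thus ?thesis by simp
  qed
  let ?\<xi>s = "%q. \<xi> s q"
  have \<xi>sm: "?\<xi>s : ?R \<rightarrow>\<^sub>M BE" by (rule motion.X_measurable[OF s(1)]) simp
  have hKm: "(%(u, q). g s q * K u (\<xi> s q)) : bm (borel \<Otimes> ?R)"
  proof -
  have "(%z. (fst z, \<xi> s (snd z))) : borel \<Otimes> ?R \<rightarrow>\<^sub>M borel \<Otimes> BE"
  by (intro measurable_Pair measurable_fst measurable_compose[OF measurable_snd \<xi>sm])
  from measurable_compose[OF this Km] have "(%z. K (fst z) (\<xi> s (snd z))) : bm (borel \<Otimes> ?R)" by simp
  thus ?thesis unfolding case_prod_beta'
  by (intro borel_measurable_times measurable_compose[OF measurable_snd gsR])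
  qed
  have hkam: "(%(u, q). g s q * ka (s + u) q) : bm (borel \<Otimes> ?R)"
  proof -
  have "(%z. (s + fst z, snd z)) : borel \<Otimes> ?R \<rightarrow>\<^sub>M borel \<Otimes> ?R" by measurable
  from measurable_compose[OF this kamR] have "(%z. ka (s + fst z) (snd z)) : bm (borel \<Otimes> ?R)" by simp
  thus ?thesis unfolding case_prod_beta'
  by (intro borel_measurable_times measurable_compose[OF measurable_snd gsR])
  qed
  have hKb: "\<bar>g s q * K u (\<xi> s q)\<bar> <= D * C * B" and hkab: "\<bar>g s q * ka (s + u) q\<bar> <= D * C * B"
  if "q : space ?R" for u q
  using gb[OF that] Kb kab by (auto intro!: prodb)
  have "(LINT q|?R. (LBINT u:{0..u0}. g s q * K u (\<xi> s q))) = (LBINT u:{0..u0}. (LINT q|?R. g s q * K u (\<xi> s q)))"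
  by (rule Fubini_bounded(1)[OF finR u0 hKm hKb])
  also have "... = (LBINT u:{0..u0}. (LINT q|?R. g s q * ka (s + u) q))"
  proof (rule set_integral_cong_Icc)
  fix u assume u: "0 <= u" "u <= u0"
  have c: "clip t (s + u) = s + u" using u s by (simp add: u0_def)
  have "k (u0 - u) : bm (BE)"
  using measurable_compose[OF measurable_Pair1' k(1), of "u0 - u"] by simp
  from markov[OF this k(2) u(1)]
  have m: "(LINT q|?R. g s q * K u (\<xi> s q)) = (LINT q|?R. g s q * k (u0 - u) (\<xi> (s + u) q))"
  using u by (simp add: K_def)
  have tt: "t - (s + u) = u0 - u" by (simp add: u0_def)
  show "(LINT q|?R. g s q * K u (\<xi> s q)) = (LINT q|?R. g s q * ka (s + u) q)"
  unfolding ka_def tt c by (rule m)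
  qed
  also have "... = (LINT q|?R. (LBINT u:{0..u0}. g s q * ka (s + u) q))"
  by (rule Fubini_bounded(1)[OF finR u0 hkam hkab, symmetric])
  also have "... = (LINT q|?R. g s q * (LBINT r:{s..t}. ka r q))"
  unfolding u0_def set_integral_shift[symmetric, of s t] by simp
  finally have part2: "(LINT q|?R. (LBINT u:{0..u0}. g s q * K u (\<xi> s q))) = (LINT q|?R. g s q * (LBINT r:{s..t}. ka r q))" .
  have part1: "(LINT q|?R. g s q * (LINT q'|Q (\<xi> s q). f (\<xi> u0 q'))) = (LINT q|?R. g s q * f (\<xi> t q))"
  using markov[OF f u0] by (simp add: u0_def)
  have i1: "integrable ?R (%q. g s q * (LINT q'|Q (\<xi> s q). f (\<xi> u0 q')))"
  proof (rule R.integrable_const_bound[of _ "D * C * B"])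
  have "(%q. \<integral>q'. f (\<xi> (max 0 u0) q') \<partial>Q (\<xi> s q)) : bm ?R"
  using f \<xi>sm by (intro expectation_joint_measurable[where B = B]) (auto simp: case_prod_beta')
  thus "(%q. g s q * (LINT q'|Q (\<xi> s q). f (\<xi> u0 q'))) : bm ?R"
  using gsR u0 by simp
  have "\<bar>\<integral>q'. f (\<xi> u0 q') \<partial>Q y\<bar> <= B" for y
  proof -
  interpret y: prob_space "Q y" by (rule motion.prob_P) simp
  show ?thesis by (rule y.abs_integral_le[OF f(2)])
  qed
  thus "AE q in ?R. norm (g s q * (LINT q'|Q (\<xi> s q). f (\<xi> u0 q'))) <= D * C * B"
  unfolding real_norm_def by (intro AE_I2 prodb gb)
  qed
  have i2: "integrable ?R (%q. LBINT u:{0..u0}. g s q * K u (\<xi> s q))"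
  by (rule Fubini_bounded(3)[OF finR u0 hKm hKb])
  have i3: "integrable ?R (%q. g s q * f (\<xi> t q))"
  by (rule R.integrable_const_bound[of _ "D * C * B"]) (use gsR fm gb f in \<open>auto intro!: prodb\<close>)
  have i4: "integrable ?R (%q. g s q * (LBINT r:{s..t}. ka r q))"
  using Fubini_bounded(3)[OF finR u0 hkam hkab] unfolding u0_def set_integral_shift[symmetric, of s t] by simp
  have "(LINT q|?R. g s q * w s q) = (LINT q|?R. g s q * (LINT q'|Q (\<xi> s q). f (\<xi> u0 q')) - (LBINT u:{0..u0}. g s q * K u (\<xi> s q)))"
  unfolding w_def cs using vK by (simp add: u0_def[symmetric] right_diff_distrib)
  also have "... = (LINT q|?R. g s q * f (\<xi> t q)) - (LINT q|?R. g s q * (LBINT r:{s..t}. ka r q))"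
  unfolding Bochner_Integration.integral_diff[OF i1 i2] part1 part2 ..
  also have "... = (LINT q|?R. g s q * (f (\<xi> t q) - (LBINT r:{s..t}. ka r q)))"
  unfolding Bochner_Integration.integral_diff[OF i3 i4, symmetric] right_diff_distrib ..
  finally show ?thesis .
 qed
 \<comment> \<open>Integrate over \<open>s\<close>.\<close>
 define L where "L s q = (LINT r|lborel. (if s <= r \<and> r <= t then ka r q else 0))" for s q
 have L_eq: "(LBINT r:{s..t}. ka r q) = L s q" for s q
  unfolding L_def set_lebesgue_integral_def by (intro Bochner_Integration.integral_cong refl) (auto simp: indicator_def)
 have Lm: "(%(s, q). L s q) : bm (borel \<Otimes> ?R)"
 proof -
  have "(%z. (snd z, snd (fst z))) : (borel \<Otimes> ?R) \<Otimes> lborel \<rightarrow>\<^sub>M borel \<Otimes> ?R" by measurable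
  from measurable_compose[OF this kamR]
  have "(%z. ka (snd z) (snd (fst z))) : bm ((borel \<Otimes> ?R) \<Otimes> lborel)" by simp
  hence "(%z. if fst (fst z) <= snd z \<and> snd z <= t then ka (snd z) (snd (fst z)) else 0) : bm ((borel \<Otimes> ?R) \<Otimes> lborel)"
  by measurable
  hence "(%x. \<integral>r. (if fst x <= r \<and> r <= t then ka r (snd x) else 0) \<partial>lborel) : bm (borel \<Otimes> ?R)"
  by (intro lborel.borel_measurable_lebesgue_integral) (simp add: case_prod_beta')
  thus ?thesis unfolding L_def by (simp add: case_prod_beta')
 qed
 have Lb: "\<bar>L s q\<bar> <= B * t" if "0 <= s" "s <= t" "q : space ?R" for s q
 proof -
  have "\<bar>L s q\<bar> <= B * (t - s)"
  unfolding L_eq[symmetric] by (rule abs_set_integral_Icc_le[OF sec[OF kamR that(3)] that(2) kab])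
  also have "... <= B * t" using that B0 by (intro mult_left_mono) auto
  finally show ?thesis .
 qed
 have gwm: "(%(s, q). g s q * w s q) : bm (borel \<Otimes> ?R)"
  using gmR wmR unfolding case_prod_beta' by (rule borel_measurable_times)
 have gwb: "\<bar>g s q * w s q\<bar> <= D * C * B" if "q : space ?R" for s q
  using gb[OF that] wb by (intro prodb)
 have gLm: "(%(s, q). g s q * (f (\<xi> t q) - L s q)) : bm (borel \<Otimes> ?R)"
  using gmR Lm measurable_compose[OF measurable_snd fm] unfolding case_prod_beta'
  by (intro borel_measurable_times borel_measurable_diff)
 have gLb: "\<bar>g s q * (f (\<xi> t q) - L s q)\<bar> <= D * C * (B + B * t)" if "0 <= s" "s <= t" "q : space ?R" for s q
  using gb[OF that(3)] Lb[OF that] f(2)[of "\<xi> t q"] by (intro prodb) (auto simp: abs_le_iff)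
 have ekam: "(%(s, q). e s q * ka s q) : bm (borel \<Otimes> ?R)"
  using emR kamR unfolding case_prod_beta' by (rule borel_measurable_times)
 have ekab: "\<bar>e s q * ka s q\<bar> <= D * B" if "q : space ?R" for s q
  using eb[OF that] kab by (intro prodb)
 have T2: "(LINT q|?R. (LBINT s:{0..t}. g s q * w s q)) = (LINT q|?R. (LBINT s:{0..t}. g s q * (f (\<xi> t q) - L s q)))"
 proof -
  have "(LINT q|?R. (LBINT s:{0..t}. g s q * w s q)) = (LBINT s:{0..t}. (LINT q|?R. g s q * w s q))"
  by (rule Fubini_bounded(1)[OF finR t gwm gwb])
  also have "... = (LBINT s:{0..t}. (LINT q|?R. g s q * (f (\<xi> t q) - L s q)))"
  using S2 by (intro set_integral_cong_Icc) (simp add: L_eq)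
  also have "... = (LINT q|?R. (LBINT s:{0..t}. g s q * (f (\<xi> t q) - L s q)))"
  by (rule Fubini_bounded(1)[OF finR t gLm gLb, symmetric])
  finally show ?thesis .
 qed
 have path: "(LBINT s:{0..t}. g s q * (f (\<xi> t q) - L s q))
  = e t q * f (\<xi> t q) - f (\<xi> t q) - (LBINT s:{0..t}. e s q * ka s q) + (LBINT s:{0..t}. ka s q)"
  if q: "q : space ?R" for q
 proof -
  have qM: "q : space M" using q spR by simp
  have gs: "(%s. g s q) : bm borel" by (rule sec[OF gmR q])
  have kas: "(%s. ka s q) : bm borel" by (rule sec[OF kamR q])
  have es: "(%s. e s q * ka s q) : bm borel" by (rule sec[OF ekam q])
  have gint: "(LBINT s:{0..r}. g s q) = e r q - 1" if r: "0 <= r" "r <= t" for r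
  proof -
  have "exp (LBINT s:{0..r}. \<gamma> (\<xi> s q)) = 1 + (LBINT s:{0..r}. \<gamma> (\<xi> s q) * exp (LBINT u:{0..s}. \<gamma> (\<xi> u q)))"
  by (rule exp_integral_identity[OF r(1) path_set_integrable[OF const_time_measurable[OF \<gamma>(1)] r(1) qM \<gamma>(2)] \<gamma>(2)])
  moreover have "(LBINT s:{0..r}. \<gamma> (\<xi> s q) * exp (LBINT u:{0..s}. \<gamma> (\<xi> u q))) = (LBINT s:{0..r}. g s q)"
  using r by (intro set_integral_cong_Icc) (simp add: g_def e_def weight_def mult.commute)
  ultimately show ?thesis using r by (simp add: e_def weight_def)
  qed
  have Ls: "(%s. L s q) : bm borel" by (rule sec[OF Lm q])
  have i1: "set_integrable lborel {0..t} (%s. g s q * f (\<xi> t q))"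
  using gs gb[OF q] f(2) by (intro set_integrable_bounded[where B = "D * C * B"] prodb) auto
  have i2: "set_integrable lborel {0..t} (%s. g s q * L s q)"
  using gs Ls gb[OF q] Lb[OF _ _ q] by (intro set_integrable_bounded[where B = "D * C * (B * t)"] prodb) auto
  have i3: "set_integrable lborel {0..t} (%s. e s q * ka s q)"
  by (rule set_integrable_bounded[OF es ekab[OF q]])
  have i4: "set_integrable lborel {0..t} (%s. ka s q)"
  by (rule set_integrable_bounded[OF kas kab])
  have "(LBINT s:{0..t}. g s q * L s q) = (LBINT r:{0..t}. ka r q * (LBINT s:{0..r}. g s q))"
  unfolding L_eq[symmetric] by (rule set_integral_triangle[OF t gs kas gb[OF q] kab])
  also have "... = (LBINT r:{0..t}. e r q * ka r q - ka r q)"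
  by (rule set_integral_cong_Icc) (simp add: gint algebra_simps)
  also have "... = (LBINT r:{0..t}. e r q * ka r q) - (LBINT r:{0..t}. ka r q)"
  by (rule set_integral_diff(2)[OF i3 i4])
  finally have tri: "(LBINT s:{0..t}. g s q * L s q) = (LBINT r:{0..t}. e r q * ka r q) - (LBINT r:{0..t}. ka r q)" .
  have "(LBINT s:{0..t}. g s q * (f (\<xi> t q) - L s q)) = (LBINT s:{0..t}. g s q * f (\<xi> t q)) - (LBINT s:{0..t}. g s q * L s q)"
  using set_integral_diff(2)[OF i1 i2] by (simp add: right_diff_distrib)
  also have "(LBINT s:{0..t}. g s q * f (\<xi> t q)) = (e t q - 1) * f (\<xi> t q)"
  using gint[OF t order_refl] by simp
  finally show ?thesis using tri by (simp add: algebra_simps)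
 qed
 have ie: "integrable ?R (%q. e t q * f (\<xi> t q))"
  by (rule R.integrable_const_bound[of _ "D * B"]) (use sec'[OF emR, of t] fm eb f(2) in \<open>auto intro!: prodb\<close>)
 have if': "integrable ?R (%q. f (\<xi> t q))"
  by (rule R.integrable_const_bound[of _ B]) (use fm f(2) in auto)
 have ieka: "integrable ?R (%q. LBINT s:{0..t}. e s q * ka s q)"
  by (rule Fubini_bounded(3)[OF finR t ekam ekab])
 have ika: "integrable ?R (%q. LBINT s:{0..t}. ka s q)"
  by (rule Fubini_bounded(3)[OF finR t kamR kab])
 have igw: "integrable ?R (%q. LBINT s:{0..t}. g s q * w s q)"
  by (rule Fubini_bounded(3)[OF finR t gwm gwb])
 have "(LINT q|?R. (LBINT s:{0..t}. g s q * w s q))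
  = (LINT q|?R. e t q * f (\<xi> t q) - f (\<xi> t q) - (LBINT s:{0..t}. e s q * ka s q) + (LBINT s:{0..t}. ka s q))"
  unfolding T2 by (rule Bochner_Integration.integral_cong[OF refl path])
 also have "... = (LINT q|?R. e t q * f (\<xi> t q)) - (LINT q|?R. f (\<xi> t q)) - (LINT q|?R. (LBINT s:{0..t}. e s q * ka s q)) + (LINT q|?R. (LBINT s:{0..t}. ka s q))"
  using ie if' ieka ika by simp
 finally have T2': "(LINT q|?R. (LBINT s:{0..t}. g s q * w s q)) = (LINT q|?R. e t q * f (\<xi> t q)) - (LINT q|?R. f (\<xi> t q))
  - (LINT q|?R. (LBINT s:{0..t}. e s q * ka s q)) + (LINT q|?R. (LBINT s:{0..t}. ka s q))" .
 have "(LINT q|?R. (LBINT s:{0..t}. weight \<gamma> s q * (k (t - s) (\<xi> s q) + \<gamma> (\<xi> s q) * v (t - s) (\<xi> s q))))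
  = (LINT q|?R. (LBINT s:{0..t}. e s q * ka s q) + (LBINT s:{0..t}. g s q * w s q))"
 proof (rule Bochner_Integration.integral_cong[OF refl])
  fix q assume q: "q : space ?R"
  have i3: "set_integrable lborel {0..t} (%s. e s q * ka s q)"
  by (rule set_integrable_bounded[OF sec[OF ekam q] ekab[OF q]])
  have i4: "set_integrable lborel {0..t} (%s. g s q * w s q)"
  by (rule set_integrable_bounded[OF sec[OF gwm q] gwb[OF q]])
  have "(LBINT s:{0..t}. weight \<gamma> s q * (k (t - s) (\<xi> s q) + \<gamma> (\<xi> s q) * v (t - s) (\<xi> s q)))
  = (LBINT s:{0..t}. e s q * ka s q + g s q * w s q)"
  by (rule set_integral_cong_Icc) (simp add: e_def ka_def g_def w_def algebra_simps)
  also have "... = (LBINT s:{0..t}. e s q * ka s q) + (LBINT s:{0..t}. g s q * w s q)"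
  by (rule set_integral_add(2)[OF i3 i4])
  finally show "(LBINT s:{0..t}. weight \<gamma> s q * (k (t - s) (\<xi> s q) + \<gamma> (\<xi> s q) * v (t - s) (\<xi> s q)))
  = (LBINT s:{0..t}. e s q * ka s q) + (LBINT s:{0..t}. g s q * w s q)" .
 qed
 also have "... = (LINT q|?R. (LBINT s:{0..t}. e s q * ka s q)) + (LINT q|?R. (LBINT s:{0..t}. g s q * w s q))"
  by (rule Bochner_Integration.integral_add[OF ieka igw])
 finally have T: "(LINT q|?R. (LBINT s:{0..t}. weight \<gamma> s q * (k (t - s) (\<xi> s q) + \<gamma> (\<xi> s q) * v (t - s) (\<xi> s q))))
  = (LINT q|?R. e t q * f (\<xi> t q)) - (LINT q|?R. f (\<xi> t q)) + (LINT q|?R. (LBINT s:{0..t}. ka s q))"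
  using T2' by simp
 have "(LBINT s:{0..t}. ka s q) = (LBINT s:{0..t}. k (t - s) (\<xi> s q))" for q
  by (rule set_integral_cong_Icc) (simp add: ka_def)
 moreover have "e t q = weight \<gamma> t q" for q using t by (simp add: e_def)
 ultimately show ?thesis using mild[OF t order_refl, of x] T by simp
qed

end

section \<open>Cumulants and the mean semigroup\<close>

context superprocess_lc
begin

abbreviation "B_del \<equiv> topo_borel (E_del :: 'e option topology)"

abbreviation "MF == finite_measures B_del"

definition beta_bound :: real where
 "beta_bound = (SOME C. 0 <= C \<and> (\<forall>x. \<bar>\<beta> x\<bar> <= C))"

lemma beta_bound: "0 <= beta_bound" "\<bar>\<beta> x\<bar> <= beta_bound"
proof -
 obtain C where "\<forall>x. \<bar>\<beta> x\<bar> <= C" using branching.beta unfolding bounded_borel_def bounded_iff by auto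
 hence "\<exists>C. 0 <= C \<and> (\<forall>x. \<bar>\<beta> x\<bar> <= C)"
  by (intro exI[of _ "max 0 C"]) (auto intro: max.coboundedI2)
 from someI_ex[OF this] show "0 <= beta_bound" "\<bar>\<beta> x\<bar> <= beta_bound"
  unfolding beta_bound_def by auto
qed

lemma ext0_beta: "ext0 \<beta> : bm B_del" "\<bar>ext0 \<beta> y\<bar> <= beta_bound"
 using branching.beta beta_bound by (auto simp: ext0_measurable_iff bounded_borel_def ext0_def split: option.splits)

definition psi0_bar :: "'e option => real => real" where
 "psi0_bar y z = ext0 (%x. psi0 \<alpha> \<pi> x z) y"

lemma psi0_bar_simps [simp]: "psi0_bar None z = 0" "psi0_bar (Some x) z = psi0 \<alpha> \<pi> x z"
 by (simp_all add: psi0_bar_def)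

lemma psi0_bar_nonneg: "0 <= psi0_bar y z"
 using branching.psi0_nonneg by (cases y) auto

lemma psi0_bar_mono_Lipschitz:
 assumes "0 <= b" "b <= a" "a <= K"
 shows "psi0_bar y b <= psi0_bar y a" and "psi0_bar y a <= psi0_bar y b + branching.psi0_slope K * (a - b)"
 using branching.psi0_mono_Lipschitz[OF assms] branching.psi0_slope_nonneg[of K] assms by (cases y; auto)+

lemma psi0_bar_le_slope: "0 <= a ==> a <= K ==> psi0_bar y a <= branching.psi0_slope K * a"
 using branching.psi0_le_slope[of a K] branching.psi0_slope_nonneg[of K] by (cases y) auto

lemma psi_bar_eq: "0 <= z ==> psi_bar (psi \<alpha> \<beta> \<pi>) y z = psi0_bar y z - ext0 \<beta> y * z"
 by (cases y) (simp_all add: psi_bar_def branching.psi_eq_psi0)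

lemma psi0_bar_measurable:
 assumes g: "g : N \<rightarrow>\<^sub>M B_del" and z: "z : bm N"
 shows "(%n. psi0_bar (g n) (z n)) : bm N"
proof -
 define un where "un y = (case y of None => undefined | Some x => x)" for y :: "'e option"
 have "un : B_del \<rightarrow>\<^sub>M borel"
  by (subst measurable_E_del_iff) (simp_all add: un_def)
 from measurable_compose[OF g this] have "(%n. psi0 \<alpha> \<pi> (un (g n)) (z n)) : bm N"
  by (rule branching.psi0_measurable[OF _ z])
 moreover have "(%n. ind (range Some) (g n) :: real) : bm N"
  by (rule measurable_compose[OF g borel_measurable_indicator[OF range_Some_sets]])
 ultimately have "(%n. ind (range Some) (g n) * psi0 \<alpha> \<pi> (un (g n)) (z n)) : bm N"
  by simp
 moreover have "psi0_bar y a = ind (range Some) y * psi0 \<alpha> \<pi> (un y) a" for y a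
  by (cases y) (auto simp: un_def indicator_def)
 ultimately show ?thesis by simp
qed

text \<open>The mean semigroup on the compactification, where the cemetery contributes no growth.\<close>

definition MS :: "real => ('e option => ennreal) => 'e option => ennreal" where
 "MS t h y = (NN w|Q y. en (weight (ext0 \<beta>) t w) * h (\<xi> t w))"

lemma lifetime_gt:
 assumes w: "w : space M" and t: "0 <= t" and s: "\<xi> t w \<noteq> None"
 shows "ereal t < lifetime \<xi> w"
proof -
 have "limitin E_del (%s. \<xi> s w) (\<xi> t w) (at_right t)"
  using motion.cadlag_paths[OF w] t by (simp add: cadlag_def)
 moreover have "openin E_del (range Some :: 'e option set)" by simp
 moreover have "\<xi> t w : range Some" using s by auto
 ultimately have "\<forall>\<^sub>F s in at_right t. \<xi> s w : range Some" unfolding limitin_def by blast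
 then obtain b where b: "t < b" "\<And>s. t < s ==> s < b ==> \<xi> s w : range Some"
  by (auto simp: eventually_at_right_field)
 have "ereal b <= lifetime \<xi> w"
  unfolding lifetime_def
 proof (rule Inf_greatest)
  fix x assume "x : {ereal t | t. 0 < t \<and> \<xi> t w = None}"
  then obtain u where u: "x = ereal u" "0 < u" "\<xi> u w = None" by auto
  have "\<not> u <= t" using trap[OF w _ _ u(3), of t] u(2) s by auto
  moreover have "\<not> (t < u \<and> u < b)" using b(2)[of u] u(3) by auto
  ultimately show "ereal b <= x" using u(1) by auto
 qed
 thus ?thesis using b(1) by (meson ereal_less_eq(3) less_le_trans less_ereal.simps(1))
qed

lemma mean_semigroup_eq_MS:
 assumes t: "0 <= t"
 shows "mean_semigroup \<xi> Q \<beta> t f x = MS t (ext0 f) (Some x)"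
 unfolding mean_semigroup_def MS_def weight_def
proof (intro nn_integral_cong)
 fix w assume "w : space (Q (Some x))"
 hence w: "w : space M" by (simp add: motion.space_P)
 show "en (exp (LBINT s:{0..t}. ext0 \<beta> (\<xi> s w))) * ext0 f (\<xi> t w) * ind {w. ereal t < lifetime \<xi> w} w
  = en (exp (LBINT r:{0..t}. ext0 \<beta> (\<xi> r w))) * ext0 f (\<xi> t w)"
  using lifetime_gt[OF w t] by (cases "\<xi> t w") (auto simp: indicator_def)
qed

lemma weight_measurable_Q: "0 <= t ==> weight (ext0 \<beta>) t : bm (Q y)"
 by (rule measurable_compose[OF motion.id_measurable_P weight_measurable_F[OF ext0_beta(1)]]) auto

lemma \<xi>_measurable_Q: "0 <= t ==> \<xi> t : Q y \<rightarrow>\<^sub>M B_del"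
 by (rule motion.X_measurable) auto

lemma MS_integrand_measurable:
 assumes "0 <= t" "h : bm B_del"
 shows "(%w. en (weight (ext0 \<beta>) t w) * h (\<xi> t w)) : bm (Q y)"
 using measurable_compose[OF \<xi>_measurable_Q[OF assms(1)] assms(2), of y] weight_measurable_Q[OF assms(1), of y] by simp

lemma MS_mono: "(\<And>z. h z <= h' z) ==> MS t h y <= MS t h' y"
 unfolding MS_def by (intro nn_integral_mono mult_left_mono) auto

lemma MS_add:
 assumes "0 <= t" "h : bm B_del" "h' : bm B_del"
 shows "MS t (%z. h z + h' z) y = MS t h y + MS t h' y"
 unfolding MS_def distrib_left
 by (rule nn_integral_add[OF MS_integrand_measurable[OF assms(1,2)] MS_integrand_measurable[OF assms(1,3)]])

lemma MS_cmult:
 assumes "0 <= t" "h : bm B_del"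
 shows "MS t (%z. c * h z) y = c * MS t h y"
 unfolding MS_def mult.left_commute[of _ c]
 by (rule nn_integral_cmult[OF MS_integrand_measurable[OF assms]])

lemma MS_SUP:
 assumes t: "0 <= t" and h: "\<And>i::nat. h i : bm B_del" and inc: "incseq h"
 shows "MS t (%z. SUP i. h i z) y = (SUP i. MS t (h i) y)"
proof -
 have "MS t (%z. SUP i. h i z) y = (NN w|Q y. (SUP i. en (weight (ext0 \<beta>) t w) * h i (\<xi> t w)))"
  unfolding MS_def by (simp add: SUP_mult_left_ennreal)
 also have "... = (SUP i. MS t (h i) y)"
  unfolding MS_def
 proof (rule nn_integral_monotone_convergence_SUP)
  show "incseq (%i w. en (weight (ext0 \<beta>) t w) * h i (\<xi> t w))"
  using inc unfolding incseq_def le_fun_def by (auto intro!: mult_left_mono)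
 qed (rule MS_integrand_measurable[OF t h])
 finally show ?thesis .
qed

lemma MS_bounded:
 assumes t: "0 <= t" and h: "\<And>z. h z <= en K" and K: "0 <= K"
 shows "MS t h y <= en (K * exp (beta_bound * t))"
proof -
 interpret prob_space "Q y" by (rule motion.prob_P) simp
 have "MS t h y <= (NN w|Q y. en (K * exp (beta_bound * t)))"
  unfolding MS_def
 proof (intro nn_integral_mono)
  fix w assume "w : space (Q y)"
  hence "weight (ext0 \<beta>) t w <= exp (beta_bound * t)"
  using t by (intro weight_le ext0_beta) (auto simp: motion.space_P)
  hence "en (weight (ext0 \<beta>) t w) * h (\<xi> t w) <= en (exp (beta_bound * t)) * en K"
  by (intro mult_mono h ennreal_leI) auto
  thus "en (weight (ext0 \<beta>) t w) * h (\<xi> t w) <= en (K * exp (beta_bound * t))"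
  using K by (simp add: ennreal_mult mult.commute)
 qed
 thus ?thesis by (simp add: emeasure_space_1)
qed

lemma MS_None:
 assumes t: "0 <= t"
 shows "MS t (ext0 f) None = 0"
proof -
 have "AE w in Q None. \<xi> 0 w = None" by (rule motion.normal) simp
 hence "AE w in Q None. en (weight (ext0 \<beta>) t w) * ext0 f (\<xi> t w) = 0"
  using AE_space
 proof eventually_elim
  case (elim w)
  hence "\<xi> t w = None" using trap[of w 0 t] t by (simp add: motion.space_P)
  thus ?case by simp
 qed
 hence "MS t (ext0 f) None = (NN w|Q None. 0)" unfolding MS_def by (rule nn_integral_cong_AE)
 thus ?thesis by simp
qed

definition cumulant :: "('e option => real) => real => 'e option => real" where
 "cumulant f = (SOME v. cumulant_solution \<xi> Q (psi \<alpha> \<beta> \<pi>) f v \<and>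
  (\<forall>\<mu>\<in>MF. \<forall>t\<ge>0. (LINT w|P \<mu>. exp (- (LINT y|X t w. f y))) = exp (- (LINT y|\<mu>. v t y))))"

definition test_function :: "('e option => real) => real => bool" where
 "test_function f B \<longleftrightarrow> f : bm B_del \<and> (\<forall>y. 0 <= f y \<and> f y <= B)"

lemma test_functionD:
 assumes "test_function f B"
 shows "f : bm B_del" "0 <= f y" "f y <= B" "0 <= B"
 using assms order_trans[of 0 "f y" B] by (auto simp: test_function_def)

lemma
 assumes f: "test_function f B"
 shows cumulant_solution: "cumulant_solution \<xi> Q (psi \<alpha> \<beta> \<pi>) f (cumulant f)"
  and cumulant_laplace: "\<And>\<mu> t. \<mu> : MF ==> 0 <= t ==>
  (LINT w|P \<mu>. exp (- (LINT y|X t w. f y))) = exp (- (LINT y|\<mu>. cumulant f t y))"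
proof -
 have "bounded_borel B_del f" using test_functionD[OF f] unfolding bounded_borel_def
  by (auto intro!: boundedI[of _ B])
 from laplace[OF this test_functionD(2)[OF f]]
 have "\<exists>v. cumulant_solution \<xi> Q (psi \<alpha> \<beta> \<pi>) f v \<and>
  (\<forall>\<mu>\<in>MF. \<forall>t\<ge>0. (LINT w|P \<mu>. exp (- (LINT y|X t w. f y))) = exp (- (LINT y|\<mu>. v t y)))"
  by blast
 from someI_ex[OF this] show "cumulant_solution \<xi> Q (psi \<alpha> \<beta> \<pi>) f (cumulant f)"
  "\<And>\<mu> t. \<mu> : MF ==> 0 <= t ==>
  (LINT w|P \<mu>. exp (- (LINT y|X t w. f y))) = exp (- (LINT y|\<mu>. cumulant f t y))"
  unfolding cumulant_def by blast+
qed

lemma cumulant_nonneg: "test_function f B ==> 0 <= t ==> 0 <= cumulant f t y"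
 using cumulant_solution unfolding cumulant_solution_def by blast

lemma cumulant_joint_measurable:
 assumes f: "test_function f B"
 shows "(%(r, y). cumulant f (max 0 r) y) : bm (borel \<Otimes> B_del)"
proof -
 have m: "(%(t, x). cumulant f t x) : bm (restrict_space borel {0..} \<Otimes> B_del)"
  using cumulant_solution[OF f] unfolding cumulant_solution_def by blast
 have a: "(%x. max 0 (fst x)) : (borel :: real measure) \<Otimes> B_del \<rightarrow>\<^sub>M restrict_space borel {0..}"
  by (rule measurable_restrict_space2) auto
 have "(%x. (max 0 (fst x), snd x)) : (borel :: real measure) \<Otimes> B_del \<rightarrow>\<^sub>M restrict_space borel {0..} \<Otimes> B_del"
  by (rule measurable_Pair[OF a measurable_snd])
 from measurable_compose[OF this m] show ?thesis by (simp add: case_prod_beta')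
qed

lemma cumulant_joint_measurable':
 assumes f: "test_function f B" and r: "r : bm N" and y: "y : N \<rightarrow>\<^sub>M B_del"
 shows "(%n. cumulant f (max 0 (r n)) (y n)) : bm N"
 using measurable_compose[OF measurable_Pair[OF r y] cumulant_joint_measurable[OF f]] by simp

lemma cumulant_measurable: "test_function f B ==> 0 <= t ==> cumulant f t : bm B_del"
 using cumulant_joint_measurable'[of f B "%_. t" B_del "%y. y"] by simp

lemma cumulant_locally_bounded:
 assumes f: "test_function f B" and t: "0 <= t"
 obtains K where "0 <= K" "\<And>s y. 0 <= s ==> s <= t ==> cumulant f s y <= K"
proof -
 have "\<exists>K. \<forall>s\<in>{0..t + 1}. \<forall>x. cumulant f s x <= K"
  using cumulant_solution[OF f] t unfolding cumulant_solution_def by auto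
 then obtain K where K': "\<forall>s\<in>{0..t + 1}. \<forall>x. cumulant f s x <= K" by blast
 hence K: "\<And>s x. 0 <= s ==> s <= t + 1 ==> cumulant f s x <= K" by auto
 show ?thesis
 proof (rule that)
  show "0 <= K" using K[of 0 None] cumulant_nonneg[OF f, of 0 None] t by linarith
  show "cumulant f s y <= K" if "0 <= s" "s <= t" for s y using that by (intro K) auto
 qed
qed

lemma weight_shift:
 assumes t: "0 <= t" and w: "w : space M"
 shows "weight (%y. ext0 \<beta> y - L) t w = exp (- (L * t)) * weight (ext0 \<beta>) t w"
proof -
 have i: "set_integrable lborel {0..t} (%r. ext0 \<beta> (\<xi> r w))"
  by (rule path_set_integrable[OF const_time_measurable[OF ext0_beta(1)] t w ext0_beta(2)])
 have "set_integrable lborel {0..t} (%r. L)" by (rule set_integrable_bounded[of _ _ "\<bar>L\<bar>"]) auto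
 from set_integral_diff(2)[OF i this]
 have eq: "(LBINT r:{0..t}. ext0 \<beta> (\<xi> r w) - L) = (LBINT r:{0..t}. ext0 \<beta> (\<xi> r w)) - L * t"
  using t by (simp add: set_lebesgue_integral_def)
 show ?thesis unfolding weight_def eq by (simp add: exp_diff exp_minus divide_inverse mult.commute)
qed

text \<open>The cumulant equation relative to the mean semigroup, discounted at an arbitrary rate \<open>L\<close>. For
 \<open>L = 0\<close> it bounds the cumulants from above by first moments; for large \<open>L\<close> the remaining
 non-linear term has the opposite sign, which gives lower bounds.\<close>

lemma cumulant_Feynman_Kac:
 assumes f: "test_function f B" and t: "0 <= t"
 shows "cumulant f t y = (LINT w|Q y. exp (- (L * t)) * weight (ext0 \<beta>) t w * f (\<xi> t w))
  - (LINT w|Q y. (LBINT s:{0..t}. exp (- (L * s)) * weight (ext0 \<beta>) s w *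
  (psi0_bar (\<xi> s w) (cumulant f (t - s) (\<xi> s w)) - L * cumulant f (t - s) (\<xi> s w))))"
proof -
  let ?a0 = "%k v. \<integral>w. (LBINT s:{0..t}. weight (%y. ext0 \<beta> y - L) s w * (k (t - s) (\<xi> s w) + (ext0 \<beta> (\<xi> s w) - L) * v (t - s) (\<xi> s w))) \<partial>Q y"
  let ?b0 = "\<integral>w. weight (%y. ext0 \<beta> y - L) t w * f (\<xi> t w) \<partial>Q y"
  let ?c0 = "%r w. LBINT s:{0..r}. psi_bar (psi \<alpha> \<beta> \<pi>) (\<xi> s w) (cumulant f (r - s) (\<xi> s w))"
 obtain K where K: "0 <= K" "\<And>s y. 0 <= s ==> s <= t ==> cumulant f s y <= K"
  using cumulant_locally_bounded[OF f t] by blast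
 define v where "v r y = cumulant f (clip t r) y" for r y
 define k where "k r y = psi0_bar y (v r y) - ext0 \<beta> y * v r y" for r y
 define B' where "B' = B + K + (branching.psi0_slope K * K + beta_bound * K)"
 have v0: "0 <= v r y" "v r y <= K" for r y
  unfolding v_def using K cumulant_nonneg[OF f] t by auto
 have sl: "0 <= branching.psi0_slope K" by (rule branching.psi0_slope_nonneg[OF K(1)])
 have B0: "0 <= B" by (rule test_functionD(4)[OF f])
 have nn: "0 <= branching.psi0_slope K * K" "0 <= beta_bound * K"
  using sl K(1) beta_bound(1) by auto
 have vm: "(%(r, y). v r y) : bm (borel \<Otimes> B_del)"
  unfolding v_def case_prod_beta' by (rule cumulant_joint_measurable'[OF f]) simp_all
 have km: "(%(r, y). k r y) : bm (borel \<Otimes> B_del)"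
  using vm psi0_bar_measurable[OF measurable_snd vm[unfolded case_prod_beta']] measurable_compose[OF measurable_snd ext0_beta(1)]
  unfolding k_def case_prod_beta' by (intro borel_measurable_diff borel_measurable_times)
 have kb: "\<bar>k r y\<bar> <= B'" for r y
 proof -
  have "psi0_bar y (v r y) <= branching.psi0_slope K * v r y" by (rule psi0_bar_le_slope[OF v0])
  also have "... <= branching.psi0_slope K * K" using v0 sl by (intro mult_left_mono)
  finally have "\<bar>psi0_bar y (v r y)\<bar> <= branching.psi0_slope K * K" using psi0_bar_nonneg by simp
  moreover have "\<bar>ext0 \<beta> y * v r y\<bar> <= beta_bound * K"
  unfolding abs_mult using ext0_beta(2) v0 beta_bound(1) by (intro mult_mono) auto
  ultimately show ?thesis unfolding k_def B'_def using B0 K(1) by linarith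
 qed
 have mild: "v r y = (LINT w|Q y. f (\<xi> r w)) - (LINT w|Q y. (LBINT s:{0..r}. k (r - s) (\<xi> s w)))"
  if r: "0 <= r" "r <= t" for r y
 proof -
  have "cumulant f r y + (LINT w|Q y. (?c0 r w)) = (LINT w|Q y. f (\<xi> r w))"
  using cumulant_solution[OF f] r unfolding cumulant_solution_def by blast
  moreover have "(?c0 r w) = (LBINT s:{0..r}. k (r - s) (\<xi> s w))" for w
  using r cumulant_nonneg[OF f] by (intro set_integral_cong_Icc) (simp add: k_def v_def psi_bar_eq)
  ultimately show ?thesis using r by (simp add: v_def)
 qed
 have \<gamma>: "(%y. ext0 \<beta> y - L) : bm B_del" "\<bar>ext0 \<beta> y - L\<bar> <= beta_bound + \<bar>L\<bar>" for y
  using ext0_beta(1) ext0_beta(2)[of y] by (auto intro: order_trans[OF abs_triangle_ineq4])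
 have fb: "\<bar>f y\<bar> <= B'" for y
  using test_functionD(2,3)[OF f, of y] K(1) nn unfolding B'_def by linarith
 have vb: "\<bar>v r y\<bar> <= B'" for r y
  using v0[of r y] B0 nn unfolding B'_def by linarith
 have "v t y = ?b0
  - (?a0 k v)"
  by (rule Feynman_Kac_transform[OF t test_functionD(1)[OF f] fb \<gamma> km kb vm vb mild])
 also have "?b0 = (LINT w|Q y. exp (- (L * t)) * weight (ext0 \<beta>) t w * f (\<xi> t w))"
  by (rule Bochner_Integration.integral_cong[OF refl]) (simp add: weight_shift[OF t] motion.space_P)
 also have "(?a0 k v)
  = (LINT w|Q y. (LBINT s:{0..t}. exp (- (L * s)) * weight (ext0 \<beta>) s w *
  (psi0_bar (\<xi> s w) (cumulant f (t - s) (\<xi> s w)) - L * cumulant f (t - s) (\<xi> s w))))"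
  by (intro Bochner_Integration.integral_cong[OF refl] set_integral_cong_Icc)
  (simp add: weight_shift motion.space_P k_def v_def algebra_simps)
 finally show ?thesis using t by (simp add: v_def)
qed

lemma weighted_source_measurable:
 assumes f: "test_function f B" and t: "0 <= t" and a: "\<And>z. (%(y, u). a y u) : bm (B_del \<Otimes> borel)"
 shows "(%(s, w). weight (ext0 \<beta>) (clip t s) w * a (\<xi> (clip t s) w) (cumulant f (max 0 (t - s)) (\<xi> (clip t s) w)))
  : bm (borel \<Otimes> Q y)"
proof -
  let ?a0 = "borel \<Otimes> Q y"
 have \<xi>m: "(%x. \<xi> (clip t (fst x)) (snd x)) : borel \<Otimes> Q y \<rightarrow>\<^sub>M B_del"
  using measurable_pair_F_Q[OF \<xi>_clamped_measurable[OF t]] by (simp add: case_prod_beta')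
 have "(%x. cumulant f (max 0 (t - fst x)) (\<xi> (clip t (fst x)) (snd x))) : bm ?a0"
  by (rule cumulant_joint_measurable'[OF f _ \<xi>m]) simp
 from measurable_compose[OF measurable_Pair[OF \<xi>m this] a]
 have "(%x. a (\<xi> (clip t (fst x)) (snd x)) (cumulant f (max 0 (t - fst x)) (\<xi> (clip t (fst x)) (snd x)))) : bm ?a0"
  by simp
 moreover have "(%x. weight (ext0 \<beta>) (clip t (fst x)) (snd x)) : bm ?a0"
  using measurable_pair_F_Q[OF weight_clamped_measurable[OF ext0_beta(1) t]] by (simp add: case_prod_beta')
 ultimately show ?thesis unfolding case_prod_beta' by (intro borel_measurable_times)
qed

lemma clipped_weight_le: "0 <= t ==> w : space (Q y) ==> weight (ext0 \<beta>) (clip t s) w <= exp (beta_bound * t)"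
 by (rule order_trans[OF weight_le[OF ext0_beta]]) (auto simp: motion.space_P beta_bound mult_left_mono)

lemma psi0_bar_joint: "(%(y, u). psi0_bar y u) : bm (B_del \<Otimes> borel)"
 unfolding case_prod_beta' by (rule psi0_bar_measurable) auto

lemma cumulant_equation:
 assumes f: "test_function f B" and t: "0 <= t"
 shows "en (cumulant f t y) + (\<integral>\<^sup>+s\<in>{0..t}. MS s (%z. en (psi0_bar z (cumulant f (t - s) z))) y \<partial>lborel)
  = MS t (%z. en (f z)) y"
proof -
  let ?a0 = "%h. \<integral>w. (LBINT s:{0..t}. h s w) \<partial>Q y"
  let ?b0 = "%h w. \<integral>\<^sup>+s. en (h s w) * ind {0..t} s \<partial>lborel"
  let ?c0 = "\<integral>\<^sup>+s\<in>{0..t}. MS s (%z. en (psi0_bar z (cumulant f (t - s) z))) y \<partial>lborel"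
  let ?d0 = "\<integral>w. weight (ext0 \<beta>) t w * f (\<xi> t w) \<partial>Q y"
  let ?e0 = "%w. weight (ext0 \<beta>) t w * f (\<xi> t w)"
 interpret prob_space "Q y" by (rule motion.prob_P) simp
 have fin: "finite_measure (Q y)" by (rule finite_measure_axioms)
 interpret pair_sigma_finite lborel "Q y" ..
 obtain K where K: "0 <= K" "\<And>s y. 0 <= s ==> s <= t ==> cumulant f s y <= K"
  using cumulant_locally_bounded[OF f t] by blast
 define h where "h s w = weight (ext0 \<beta>) (clip t s) w * psi0_bar (\<xi> (clip t s) w) (cumulant f (max 0 (t - s)) (\<xi> (clip t s) w))" for s w
 have hm: "(%(s, w). h s w) : bm (borel \<Otimes> Q y)"
  unfolding h_def by (rule weighted_source_measurable[OF f t psi0_bar_joint])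
 have h0: "0 <= h s w" for s w unfolding h_def using psi0_bar_nonneg by simp
 have hb: "\<bar>h s w\<bar> <= exp (beta_bound * t) * (branching.psi0_slope K * K)" if "0 <= s" "s <= t" "w : space (Q y)" for s w
 proof -
  let ?c = "cumulant f (max 0 (t - s)) (\<xi> (clip t s) w)"
  have c: "0 <= ?c" "?c <= K" using K cumulant_nonneg[OF f] that by auto
  have "psi0_bar (\<xi> (clip t s) w) ?c <= branching.psi0_slope K * ?c" by (rule psi0_bar_le_slope[OF c])
  also have "... <= branching.psi0_slope K * K" by (intro mult_left_mono c branching.psi0_slope_nonneg K)
  finally have "h s w <= exp (beta_bound * t) * (branching.psi0_slope K * K)"
  unfolding h_def using psi0_bar_nonneg that t by (intro mult_mono clipped_weight_le) auto
  thus ?thesis using h0 by simp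
 qed
 have i2: "integrable (Q y) (%w. LBINT s:{0..t}. h s w)" by (rule Fubini_bounded(3)[OF fin t hm hb])
 have hmL: "(%(s, w). h s w) : bm (lborel \<Otimes> Q y)"
  using hm by (subst measurable_cong_sets[OF sets_pair_measure_cong[OF sets_lborel refl] refl])
 have hind: "(%(s, w). en (h s w) * ind {0..t} s) : bm (lborel \<Otimes> Q y)"
  using hmL unfolding case_prod_beta' by measurable
 have "?c0 = (NN s|lborel. (NN w|Q y. en (h s w) * ind {0..t} s))"
 proof (intro nn_integral_cong)
  fix s :: real
  show "MS s (%z. en (psi0_bar z (cumulant f (t - s) z))) y * ind {0..t} s = (NN w|Q y. en (h s w) * ind {0..t} s)"
  by (cases "s : {0..t}") (auto simp: MS_def h_def ennreal_mult')
 qed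
 also have "... = (NN w|Q y. (?b0 h w))"
  by (rule Fubini'[OF hind, symmetric])
 also have "... = (NN w|Q y. en (LBINT s:{0..t}. h s w))"
 proof (rule nn_integral_cong)
  fix w assume w: "w : space (Q y)"
  have "(%s. h s w) : bm borel" using measurable_compose[OF measurable_Pair2'[OF w] hm] by simp
  from set_integrable_bounded[OF this hb[OF _ _ w]] have i: "set_integrable lborel {0..t} (%s. h s w)" .
  have "(?b0 h w) = (NN s|lborel. en (ind {0..t} s *\<^sub>R h s w))"
  by (intro nn_integral_cong) (auto simp: indicator_def)
  also have "... = en (LBINT s:{0..t}. h s w)"
  unfolding set_lebesgue_integral_def using i h0 by (intro nn_integral_eq_integral) (auto simp: set_integrable_def)
  finally show "(?b0 h w) = en (LBINT s:{0..t}. h s w)" .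
 qed
 also have "... = en (?a0 h)"
  by (rule nn_integral_eq_integral[OF i2]) (auto simp: set_lebesgue_integral_def intro!: AE_I2 integral_nonneg_AE mult_nonneg_nonneg h0)
 finally have S: "?c0 = en (?a0 h)" .
 have wf: "?e0 : bm (Q y)"
  using weight_measurable_Q[OF t] measurable_compose[OF \<xi>_measurable_Q[OF t] test_functionD(1)[OF f]] by simp
 have "MS t (%z. en (f z)) y = (NN w|Q y. en (weight (ext0 \<beta>) t w * f (\<xi> t w)))"
  unfolding MS_def using test_functionD(2)[OF f] by (simp add: ennreal_mult')
 also have "... = en ?d0"
 proof (rule nn_integral_eq_integral)
  show "integrable (Q y) ?e0"
  proof (rule integrable_const_bound[of _ "exp (beta_bound * t) * B", OF _ wf], intro AE_I2)
  fix w assume "w : space (Q y)"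
  hence "weight (ext0 \<beta>) t w * f (\<xi> t w) <= exp (beta_bound * t) * B"
  using t test_functionD[OF f] by (intro mult_mono weight_le ext0_beta) (auto simp: motion.space_P)
  thus "norm (weight (ext0 \<beta>) t w * f (\<xi> t w)) <= exp (beta_bound * t) * B"
  using test_functionD(2)[OF f] by (simp add: abs_mult)
  qed
 qed (use test_functionD(2)[OF f] in simp)
 also have "?d0 = cumulant f t y + (?a0 h)"
 proof -
  have "(LBINT s:{0..t}. weight (ext0 \<beta>) s w * psi0_bar (\<xi> s w) (cumulant f (t - s) (\<xi> s w))) = (LBINT s:{0..t}. h s w)" for w
  by (rule set_integral_cong_Icc) (simp add: h_def)
  thus ?thesis using cumulant_Feynman_Kac[OF f t, of y 0] by simp
 qed
 also have "ennreal ... = en (cumulant f t y) + en (?a0 h)"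
  using cumulant_nonneg[OF f t]
  by (intro ennreal_plus) (auto simp: set_lebesgue_integral_def intro!: integral_nonneg_AE AE_I2 mult_nonneg_nonneg h0)
 finally show ?thesis unfolding S ..
qed

lemma cumulant_le_MS: "test_function f B ==> 0 <= t ==> en (cumulant f t y) <= MS t (%z. en (f z)) y"
 unfolding cumulant_equation[symmetric] by simp

lemma cumulant_le: "test_function f B ==> 0 <= t ==> cumulant f t y <= B * exp (beta_bound * t)"
proof -
 assume f: "test_function f B" and t: "0 <= t"
 have "en (cumulant f t y) <= en (B * exp (beta_bound * t))"
  using test_functionD[OF f] by (intro order_trans[OF cumulant_le_MS[OF f t] MS_bounded[OF t]] ennreal_leI) auto
 thus ?thesis using test_functionD(4)[OF f] by simp
qed

end

lemma one_minus_exp_ge: "0 <= x ==> x - x\<^sup>2 <= 1 - exp (- x)" for x :: real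
 using exprem_le_qmin[of x] unfolding exprem_def qmin_def by simp

lemma scaled_one_minus_exp_tendsto:
 assumes "0 <= x"
 shows "(%n. real (Suc n) * (1 - exp (- (x / real (Suc n))))) \<longlonglongrightarrow> x"
proof -
  let ?a0 = "%n. 1 - exp (- (x / real (Suc n)))"
 have inv: "(%n. 1 / real (Suc n)) \<longlonglongrightarrow> 0"
  using LIMSEQ_inverse_real_of_nat by (simp add: inverse_eq_divide)
 have "(%n. x - x\<^sup>2 * (1 / real (Suc n))) \<longlonglongrightarrow> x - x\<^sup>2 * 0"
  by (intro tendsto_diff tendsto_const tendsto_mult inv)
 hence l: "(%n. x - x\<^sup>2 * (1 / real (Suc n))) \<longlonglongrightarrow> x" by (simp only: mult_zero_right diff_0_right)
 show ?thesis
 proof (rule tendsto_sandwich[OF _ _ l tendsto_const])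
  have "x - x\<^sup>2 * (1 / real (Suc n)) <= real (Suc n) * (?a0 n)" for n
  proof -
  have "real (Suc n) * (x / real (Suc n) - (x / real (Suc n))\<^sup>2) <= real (Suc n) * (?a0 n)"
  using assms by (intro mult_left_mono one_minus_exp_ge) auto
  moreover have "real (Suc n) * (x / real (Suc n) - (x / real (Suc n))\<^sup>2) = x - x\<^sup>2 * (1 / real (Suc n))"
  by (simp add: right_diff_distrib power2_eq_square del: of_nat_Suc)
  ultimately show ?thesis by (simp only:)
  qed
  thus "\<forall>\<^sub>F n in sequentially. x - x\<^sup>2 * (1 / real (Suc n)) <= real (Suc n) * (?a0 n)"
  by simp
  have "real (Suc n) * (?a0 n) <= x" for n
  proof -
  have "real (Suc n) * (?a0 n) <= real (Suc n) * (x / real (Suc n))"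
  using exp_ge_add_one_self[of "- (x / real (Suc n))"] by (intro mult_left_mono) auto
  thus ?thesis by (simp del: of_nat_Suc)
  qed
  thus "\<forall>\<^sub>F n in sequentially. real (Suc n) * (?a0 n) <= x" by simp
 qed
qed

context superprocess_lc
begin

lemma test_function_scale: "test_function f B ==> 0 < c ==> test_function (%z. f z / c) (B / c)"
 unfolding test_function_def by (auto simp: divide_right_mono)

lemma MS_time_measurable:
 assumes t: "0 <= t" and h: "h : bm B_del"
 shows "(%s. MS (clip t s) h y) : bm borel"
proof -
  let ?a0 = "borel \<Otimes> Q y"
 interpret prob_space "Q y" by (rule motion.prob_P) simp
 have "(%x. \<xi> (clip t (fst x)) (snd x)) : borel \<Otimes> Q y \<rightarrow>\<^sub>M B_del"
  using measurable_pair_F_Q[OF \<xi>_clamped_measurable[OF t]] by (simp add: case_prod_beta')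
 from measurable_compose[OF this h] have 1: "(%x. h (\<xi> (clip t (fst x)) (snd x))) : bm ?a0" .
 have "(%x. weight (ext0 \<beta>) (clip t (fst x)) (snd x)) : bm ?a0"
  using measurable_pair_F_Q[OF weight_clamped_measurable[OF ext0_beta(1) t]] by (simp add: case_prod_beta')
 hence "(%(s, w). en (weight (ext0 \<beta>) (clip t s) w) * h (\<xi> (clip t s) w)) : bm ?a0"
  using 1 unfolding case_prod_beta' by measurable
 from borel_measurable_nn_integral[OF this] show ?thesis unfolding MS_def .
qed

text \<open>By the linear lower order of \<open>psi0\<close> near zero, the cumulants linearize to the mean semigroup.\<close>

lemma cumulant_linearization:
 assumes f: "test_function f B" and t: "0 <= t"
 shows "en (real (Suc n) * cumulant (%z. f z / real (Suc n)) t y) <= MS t (%z. en (f z)) y"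
  and "(%n. en (real (Suc n) * cumulant (%z. f z / real (Suc n)) t y)) \<longlonglongrightarrow> MS t (%z. en (f z)) y"
proof -
 let ?n = "%n. real (Suc n)"
 let ?m = "MS t (%z. en (f z)) y"
 define V where "V n = cumulant (%z. f z / ?n n)" for n
 define K where "K = B * exp (beta_bound * t)"
 have B0: "0 <= B" by (rule test_functionD(4)[OF f])
 have K0: "0 <= K" using B0 by (simp add: K_def)
 have tf: "test_function (%z. f z / ?n n) (B / ?n n)" for n by (rule test_function_scale[OF f]) simp
 have fm: "(%z. en (f z)) : bm B_del" using test_functionD(1)[OF f] by simp
 have V0: "0 <= V n s z" if "0 <= s" for n s z unfolding V_def by (rule cumulant_nonneg[OF tf that])
 have VK: "V n s z <= K / ?n n" if "0 <= s" "s <= t" for n s z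
 proof -
  have "V n s z <= B / ?n n * exp (beta_bound * s)" unfolding V_def by (rule cumulant_le[OF tf that(1)])
  also have "... <= B / ?n n * exp (beta_bound * t)"
  using that B0 beta_bound(1) by (intro mult_left_mono) (auto intro: mult_left_mono)
  finally show ?thesis by (simp add: K_def)
 qed
 define d where "d n z = en (?n n * psi0_bar z (K / ?n n))" for n z
 have dm: "d n : bm B_del" for n
  unfolding d_def using psi0_bar_measurable[of "%z. z" B_del "%_. K / ?n n"] by simp
 define S where "S = branching.psi0_slope K * K"
 have S0: "0 <= S" unfolding S_def using K0 branching.psi0_slope_nonneg by simp
 have dS: "d n z <= en S" for n z
 proof -
  have "K / ?n n <= K" using K0 by (simp add: divide_le_eq mult_right_mono del: of_nat_Suc) (simp add: mult_le_cancel_left1)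
  hence "psi0_bar z (K / ?n n) <= branching.psi0_slope K * (K / ?n n)" using K0 by (intro psi0_bar_le_slope) auto
  hence "?n n * psi0_bar z (K / ?n n) <= ?n n * (branching.psi0_slope K * (K / ?n n))" by (intro mult_left_mono) auto
  thus ?thesis unfolding d_def S_def by (intro ennreal_leI) (simp del: of_nat_Suc)
 qed
 have d_lim: "(%n. d n z) \<longlonglongrightarrow> 0" for z
 proof (cases z)
  case (Some x)
  have "(%n. en (?n n * psi0 \<alpha> \<pi> x (K / ?n n))) \<longlonglongrightarrow> en 0"
  by (intro tendsto_ennrealI branching.psi0_sublinear K0)
  thus ?thesis unfolding d_def Some by simp
 qed (simp add: d_def)
 define E where "E n = (\<integral>\<^sup>+s\<in>{0..t}. MS (clip t s) (d n) y \<partial>lborel)" for n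
 define M0 where "M0 = S * exp (beta_bound * t)"
 have M00: "0 <= M0" using S0 by (simp add: M0_def)
 have MSd: "MS s (d n) y <= en M0" if "0 <= s" "s <= t" for s n
 proof -
  have "MS s (d n) y <= en (S * exp (beta_bound * s))" by (rule MS_bounded[OF that(1) dS S0])
  also have "... <= en M0" unfolding M0_def using that S0 beta_bound(1)
  by (intro ennreal_leI mult_left_mono) (auto intro: mult_left_mono)
  finally show ?thesis .
 qed
 have MSlim: "(%n. MS s (d n) y) \<longlonglongrightarrow> 0" if s: "0 <= s" for s
 proof -
  interpret prob_space "Q y" by (rule motion.prob_P) simp
  have "(%n. \<integral>\<^sup>+q. en (weight (ext0 \<beta>) s q) * d n (\<xi> s q) \<partial>Q y) \<longlonglongrightarrow> (NN q|Q y. 0)"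
  proof (rule nn_integral_dominated_convergence[where w = "%_. en (exp (beta_bound * s) * S)"])
  show "(%q. en (weight (ext0 \<beta>) s q) * d n (\<xi> s q)) : bm (Q y)" for n
  by (rule MS_integrand_measurable[OF s dm])
  show "AE q in Q y. en (weight (ext0 \<beta>) s q) * d n (\<xi> s q) <= en (exp (beta_bound * s) * S)" for n
  proof (intro AE_I2)
  fix q assume "q : space (Q y)"
  hence "weight (ext0 \<beta>) s q <= exp (beta_bound * s)"
  using s by (intro weight_le ext0_beta) (auto simp: motion.space_P)
  hence "en (weight (ext0 \<beta>) s q) * d n (\<xi> s q) <= en (exp (beta_bound * s)) * en S"
  by (intro mult_mono dS ennreal_leI) auto
  thus "en (weight (ext0 \<beta>) s q) * d n (\<xi> s q) <= en (exp (beta_bound * s) * S)"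
  using S0 by (simp add: ennreal_mult)
  qed
  show "(NN q|Q y. en (exp (beta_bound * s) * S)) < \<infinity>" by (simp add: emeasure_space_1)
  show "AE q in Q y. (%n. en (weight (ext0 \<beta>) s q) * d n (\<xi> s q)) \<longlonglongrightarrow> 0"
  proof (intro AE_I2)
  fix q
  have "(%n. en (weight (ext0 \<beta>) s q) * d n (\<xi> s q)) \<longlonglongrightarrow> en (weight (ext0 \<beta>) s q) * 0"
  by (intro ennreal_tendsto_cmult d_lim) simp
  thus "(%n. en (weight (ext0 \<beta>) s q) * d n (\<xi> s q)) \<longlonglongrightarrow> 0" by simp
  qed
  qed simp_all
  thus ?thesis unfolding MS_def by simp
 qed
 have E_lim: "E \<longlonglongrightarrow> 0"
 proof -
  have "(%n. \<integral>\<^sup>+s. MS (clip t s) (d n) y * ind {0..t} s \<partial>lborel) \<longlonglongrightarrow> (NN s|(lborel :: real measure). 0)"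
  proof (rule nn_integral_dominated_convergence[where w = "%s. en M0 * ind {0..t} s"])
  show "(%s. MS (clip t s) (d n) y * ind {0..t} s) : bm lborel" for n
  using MS_time_measurable[OF t dm] by simp
  show "AE s in lborel. MS (clip t s) (d n) y * ind {0..t} s <= en M0 * ind {0..t} s" for n
  using MSd by (intro AE_I2) (auto simp: indicator_def)
  show "(NN s|lborel. en M0 * ind {0..t} s) < \<infinity>"
  using t by (simp add: nn_integral_cmult ennreal_mult_less_top)
  show "AE s in lborel. (%n. MS (clip t s) (d n) y * ind {0..t} s) \<longlonglongrightarrow> 0"
  using MSlim by (intro AE_I2) (auto simp: indicator_def)
  qed simp_all
  thus ?thesis unfolding E_def by simp
 qed
 have eq: "en (?n n * V n t y) + en (?n n) * (\<integral>\<^sup>+s\<in>{0..t}. MS s (%z. en (psi0_bar z (V n (t - s) z))) y \<partial>lborel) = ?m" for n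
 proof -
  have "?m = MS t (%z. en (?n n) * en (f z / ?n n)) y"
  using test_functionD(2)[OF f] by (intro arg_cong[where f = "%h. MS t h y"] ext) (simp add: ennreal_mult'[symmetric] del: of_nat_Suc)
  also have "... = en (?n n) * MS t (%z. en (f z / ?n n)) y"
  using test_functionD(1)[OF tf, of n] by (intro MS_cmult t) simp
  also have "... = en (?n n) * (en (V n t y) + (\<integral>\<^sup>+s\<in>{0..t}. MS s (%z. en (psi0_bar z (V n (t - s) z))) y \<partial>lborel))"
  unfolding V_def cumulant_equation[OF tf t] ..
  finally show ?thesis by (simp add: distrib_left ennreal_mult' del: of_nat_Suc)
 qed
 have mfin: "?m < \<top>"
 proof -
  have "?m <= en (B * exp (beta_bound * t))"
  by (rule MS_bounded[OF t _ B0]) (use test_functionD[OF f] in \<open>auto intro: ennreal_leI\<close>)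
  thus ?thesis by (auto intro: le_less_trans)
 qed
 have upper: "en (?n n * V n t y) <= ?m" for n
  unfolding eq[of n, symmetric] by simp
 thus "en (?n n * cumulant (%z. f z / ?n n) t y) <= ?m" for n unfolding V_def .
 have lower: "?m <= en (?n n * V n t y) + E n" for n
 proof -
  have "en (?n n) * (\<integral>\<^sup>+s\<in>{0..t}. MS s (%z. en (psi0_bar z (V n (t - s) z))) y \<partial>lborel)
  <= en (?n n) * (\<integral>\<^sup>+s\<in>{0..t}. MS (clip t s) (%z. en (psi0_bar z (K / ?n n))) y \<partial>lborel)"
  proof (intro mult_left_mono nn_integral_mono)
  fix s :: real
  show "MS s (%z. en (psi0_bar z (V n (t - s) z))) y * ind {0..t} s <= MS (clip t s) (%z. en (psi0_bar z (K / ?n n))) y * ind {0..t} s"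
  using V0[of "t - s" n] VK[of "t - s" n]
  by (cases "s : {0..t}") (auto intro!: MS_mono ennreal_leI psi0_bar_mono_Lipschitz(1)[OF _ _ order_refl])
  qed simp
  also have "... = (NN s|lborel. en (?n n) * (MS (clip t s) (%z. en (psi0_bar z (K / ?n n))) y * ind {0..t} s))"
  using MS_time_measurable[OF t, of "%z. en (psi0_bar z (K / ?n n))" y] psi0_bar_measurable[of "%z. z" B_del "%_. K / ?n n"]
  by (subst nn_integral_cmult) auto
  also have "... = E n"
  unfolding E_def
  proof (intro nn_integral_cong)
  fix s :: real
  have "en (?n n) * MS (clip t s) (%z. en (psi0_bar z (K / ?n n))) y = MS (clip t s) (d n) y"
  unfolding d_def using psi0_bar_measurable[of "%z. z" B_del "%_. K / ?n n"]
  by (subst MS_cmult[symmetric]) (simp_all add: ennreal_mult' del: of_nat_Suc)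
  thus "en (?n n) * (MS (clip t s) (%z. en (psi0_bar z (K / ?n n))) y * ind {0..t} s) = MS (clip t s) (d n) y * ind {0..t} s"
  by (simp add: mult.assoc[symmetric] del: of_nat_Suc)
  qed
  finally have "en (?n n) * (\<integral>\<^sup>+s\<in>{0..t}. MS s (%z. en (psi0_bar z (V n (t - s) z))) y \<partial>lborel) <= E n" .
  hence "en (?n n * V n t y) + en (?n n) * (\<integral>\<^sup>+s\<in>{0..t}. MS s (%z. en (psi0_bar z (V n (t - s) z))) y \<partial>lborel) <= en (?n n * V n t y) + E n"
  by (rule add_left_mono)
  thus ?thesis unfolding eq .
 qed
 have lim: "(%n. ?m - E n) \<longlonglongrightarrow> ?m - 0"
  using mfin by (intro tendsto_diff_ennreal_general tendsto_const E_lim) auto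
 have "(%n. en (?n n * V n t y)) \<longlonglongrightarrow> ?m"
 proof (rule tendsto_sandwich)
  show "(%n. ?m - E n) \<longlonglongrightarrow> ?m" using lim by simp
  show "\<forall>\<^sub>F n in sequentially. ?m - E n <= en (?n n * V n t y)"
  using lower by (intro always_eventually allI) (use less_imp_neq[OF mfin] in \<open>simp add: ennreal_minus_le_iff add.commute del: of_nat_Suc\<close>)
  show "\<forall>\<^sub>F n in sequentially. en (?n n * V n t y) <= ?m"
  using upper by (intro always_eventually allI)
 qed (rule tendsto_const)
 thus "(%n. en (?n n * cumulant (%z. f z / ?n n) t y)) \<longlonglongrightarrow> ?m" unfolding V_def .
qed

lemma min_real_nat_SUP:
 fixes h :: "'x => ennreal"
 shows "incseq (%k z. min (h z) (of_nat k))" "(SUP k. min (h z) (of_nat k)) = h z"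
proof -
 show "incseq (%k z. min (h z) (of_nat k :: ennreal))"
  unfolding incseq_def le_fun_def by (intro allI impI min.mono order_refl of_nat_mono)
 have "(SUP k. min (h z) (of_nat k)) = min (h z) (SUP k. of_nat k :: ennreal)"
  by (simp add: inf_min[symmetric] inf_SUP)
 thus "(SUP k. min (h z) (of_nat k)) = h z" by (simp add: ennreal_SUP_of_nat_eq_top)
qed

lemma test_function_min:
 assumes "h : bm B_del"
 shows "test_function (%z. enn2real (min (h z) (of_nat k))) (real k)"
  and "en (enn2real (min (h z) (of_nat k))) = min (h z) (of_nat k)"
proof -
 have lt: "min (h z) (of_nat k) < \<top>" for z by (simp add: min_less_iff_disj of_nat_less_top)
 show eq: "en (enn2real (min (h z) (of_nat k))) = min (h z) (of_nat k)" for z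
  by (rule ennreal_enn2real[OF lt])
 have "enn2real (min (h z) (of_nat k)) <= real k" for z
  by (intro enn2real_leI) (auto simp: ennreal_of_nat_eq_real_of_nat)
 thus "test_function (%z. enn2real (min (h z) (of_nat k))) (real k)"
  unfolding test_function_def using assms by simp
qed

text \<open>Statements about the mean semigroup pass from bounded functions to all non-negative ones.\<close>

lemma bounded_to_nonneg:
 assumes h: "h : bm B_del" and t: "0 <= t"
 shows "MS t h y = (SUP k. MS t (%z. en (enn2real (min (h z) (of_nat k)))) y)"
proof -
 have "MS t h y = MS t (%z. SUP k. min (h z) (of_nat k)) y" by (simp add: min_real_nat_SUP(2))
 also have "... = (SUP k. MS t (%z. min (h z) (of_nat k)) y)"
  using h by (intro MS_SUP t min_real_nat_SUP(1)) auto
 finally show ?thesis by (simp add: test_function_min(2)[OF h])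
qed

lemma MS_joint_measurable:
 assumes h: "h : bm B_del" and r: "r : bm N" and y: "y : N \<rightarrow>\<^sub>M B_del"
 shows "(%n. MS (max 0 (r n)) h (y n)) : bm N"
proof -
  let ?a0 = "%k f n. real (Suc k) * cumulant (%z. f z / real (Suc k)) (max 0 (r n)) (y n)"
 have "(%n. MS (max 0 (r n)) (%z. en (f z)) (y n)) : bm N" if f: "test_function f B" for f B
 proof -
  have lim: "(%k. en (?a0 k f n)) \<longlonglongrightarrow> MS (max 0 (r n)) (%z. en (f z)) (y n)" for n
  by (rule cumulant_linearization(2)[OF f]) simp
  have "(%n. liminf (%k. en (?a0 k f n))) : bm N"
  proof (rule borel_measurable_liminf)
  fix k
  have "(%n. cumulant (%z. f z / real (Suc k)) (max 0 (r n)) (y n)) : bm N"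
  by (rule cumulant_joint_measurable'[OF test_function_scale[OF f] r y]) simp
  thus "(%n. en (?a0 k f n)) : bm N"
  by simp
  qed
  moreover have "liminf (%k. en (?a0 k f n)) = MS (max 0 (r n)) (%z. en (f z)) (y n)" for n
  by (rule lim_imp_Liminf[OF _ lim]) simp
  ultimately show ?thesis by simp
 qed
 from this[OF test_function_min(1)[OF h]]
 have "(%n. SUP k. MS (max 0 (r n)) (%z. en (enn2real (min (h z) (of_nat k)))) (y n)) : bm N"
  by (intro borel_measurable_SUP) auto
 thus ?thesis using bounded_to_nonneg[OF h] by simp
qed

lemma MS_measurable: "h : bm B_del ==> 0 <= t ==> MS t h : bm B_del"
 using MS_joint_measurable[of h "%_. t" B_del "%y. y"] by simp

lemma finite_measures_sets: "\<mu> : MF ==> sets \<mu> = sets B_del"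
 by (simp add: finite_measures_iff)

lemma finite_measures_measurable: "\<mu> : MF ==> f : bm B_del ==> f : bm \<mu>"
 by (subst measurable_cong_sets[OF finite_measures_sets refl]) auto

lemma test_function_integral:
 assumes f: "test_function f B" and \<mu>: "\<mu> : MF"
 shows "integrable \<mu> f" "(NN y|\<mu>. en (f y)) = en (LINT y|\<mu>. f y)" "0 <= (LINT y|\<mu>. f y)"
proof -
 interpret finite_measure \<mu> using \<mu> by (simp add: finite_measures_iff)
 show i: "integrable \<mu> f"
  using test_functionD[OF f] by (intro integrable_const_bound[of _ B] finite_measures_measurable[OF \<mu>]) auto
 show "(NN y|\<mu>. en (f y)) = en (LINT y|\<mu>. f y)"
  by (rule nn_integral_eq_integral[OF i]) (use test_functionD(2)[OF f] in simp)
 show "0 <= (LINT y|\<mu>. f y)" using test_functionD(2)[OF f] by simp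
qed

lemma X_integral_measurable:
 assumes f: "test_function f B" and t: "0 <= t"
 shows "(%w. \<integral>y. f y \<partial>X t w) : bm W"
proof -
 have "(%w. enn2real (NN y|X t w. en (f y))) : bm W"
  using X_nn_integral_measurable[OF t, of "%y. en (f y)"] test_functionD(1)[OF f] by simp
 thus ?thesis
 proof (rule measurable_congI[rotated])
  fix w assume "w : space W"
  from test_function_integral[OF f X_finite_measure[OF t this]]
  show "(LINT y|X t w. f y) = enn2real (NN y|X t w. en (f y))" by simp
 qed
qed

lemma cumulant_test_function: "test_function f B ==> 0 <= t ==> test_function (cumulant f t) (B * exp (beta_bound * t))"
 unfolding test_function_def[of "cumulant f t"] using cumulant_measurable cumulant_nonneg cumulant_le by blast

lemma P_measurable: "\<mu> : MF ==> h : bm W ==> h : bm (P \<mu>)"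
 by (subst measurable_cong_sets[OF mass.sets_P refl]) auto

lemma prob_P: "\<mu> : MF ==> prob_space (P \<mu>)"
 by (rule mass.prob_P) simp

lemma space_P: "\<mu> : MF ==> space (P \<mu>) = space W"
 by (rule mass.space_P) simp

lemma mean_formula_bounded:
 assumes f: "test_function f B" and t: "0 <= t" and \<mu>: "\<mu> : MF"
 shows "(NN w|P \<mu>. en (LINT y|X t w. f y)) = (NN y|\<mu>. MS t (%z. en (f z)) y)"
proof -
 interpret prob_space "P \<mu>" by (rule prob_P[OF \<mu>])
 interpret \<mu>: finite_measure \<mu> using \<mu> by (simp add: finite_measures_iff)
 let ?n = "%n. real (Suc n)"
 let ?x = "%w. \<integral>y. f y \<partial>X t w"
 let ?m = "%y. MS t (%z. en (f z)) y"
 let ?A = "\<integral>\<^sup>+y. ?m y \<partial>\<mu>"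
 define V where "V n = cumulant (%z. f z / ?n n) t" for n
 define a where "a n = ?n n * (LINT y|\<mu>. V n y)" for n
 have tf: "test_function (%z. f z / ?n n) (B / ?n n)" for n by (rule test_function_scale[OF f]) simp
 have x0: "0 <= ?x w" if "w : space W" for w by (rule test_function_integral(3)[OF f X_finite_measure[OF t that]])
 have xm: "?x : bm (P \<mu>)" by (rule P_measurable[OF \<mu> X_integral_measurable[OF f t]])
 have lap: "(LINT w|P \<mu>. exp (- (?x w / ?n n))) = exp (- (a n / ?n n))" for n
  using cumulant_laplace[OF tf[of n] \<mu> t] by (simp add: a_def V_def del: of_nat_Suc)
 have ei: "integrable (P \<mu>) (%w. exp (- (?x w / ?n n)))" for n
 proof (rule integrable_const_bound[of _ 1])
  show "AE w in P \<mu>. norm (exp (- (?x w / ?n n))) <= 1"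
  using x0 by (intro AE_I2) (auto simp: space_P[OF \<mu>])
 qed (use xm in measurable)
 have en: "(NN w|P \<mu>. en (?n n * (1 - exp (- (?x w / ?n n))))) = en (?n n * (1 - exp (- (a n / ?n n))))" for n
 proof -
  have "integrable (P \<mu>) (%w. ?n n * (1 - exp (- (?x w / ?n n))))" using ei by simp
  hence "(NN w|P \<mu>. en (?n n * (1 - exp (- (?x w / ?n n))))) = en (LINT w|P \<mu>. ?n n * (1 - exp (- (?x w / ?n n))))"
  by (rule nn_integral_eq_integral) (use x0 in \<open>auto intro!: AE_I2 mult_nonneg_nonneg simp: space_P[OF \<mu>] simp del: of_nat_Suc\<close>)
  also have "(LINT w|P \<mu>. ?n n * (1 - exp (- (?x w / ?n n)))) = ?n n * (1 - exp (- (a n / ?n n)))"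
  using ei lap by (simp add: prob_space del: of_nat_Suc)
  finally show ?thesis .
 qed
 have a_eq: "en (a n) = (NN y|\<mu>. en (?n n * V n y))" and a0: "0 <= a n" for n
 proof -
  have ct: "test_function (V n) (B / ?n n * exp (beta_bound * t))"
  unfolding V_def by (rule cumulant_test_function[OF tf t])
  show "0 <= a n" unfolding a_def using test_function_integral(3)[OF ct \<mu>] by simp
  have "(NN y|\<mu>. en (?n n * V n y)) = (NN y|\<mu>. en (?n n) * en (V n y))"
  by (simp add: ennreal_mult' del: of_nat_Suc)
  also have "... = en (?n n) * (NN y|\<mu>. en (V n y))"
  using test_functionD(1)[OF ct] by (intro nn_integral_cmult finite_measures_measurable[OF \<mu>]) simp
  also have "... = en (a n)"
  unfolding test_function_integral(2)[OF ct \<mu>] a_def by (simp add: ennreal_mult' del: of_nat_Suc)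
  finally show "en (a n) = (NN y|\<mu>. en (?n n * V n y))" ..
 qed
 have aA: "en (a n) <= ?A" for n
  unfolding a_eq V_def by (intro nn_integral_mono cumulant_linearization(1)[OF f t])
 have Afin: "?A < \<top>"
 proof -
  have "?A <= (NN y|\<mu>. en (B * exp (beta_bound * t)))"
  using test_functionD[OF f] by (intro nn_integral_mono MS_bounded[OF t]) (auto intro: ennreal_leI)
  also have "... < \<top>" by (simp add: ennreal_mult_less_top \<mu>.emeasure_eq_measure)
  finally show ?thesis .
 qed
 have le1: "(NN w|P \<mu>. en (?x w)) <= ?A"
 proof -
  have "(NN w|P \<mu>. en (?x w)) = (NN w|P \<mu>. liminf (%n. en (?n n * (1 - exp (- (?x w / ?n n))))))"
  proof (rule nn_integral_cong)
  fix w assume "w : space (P \<mu>)"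
  hence "0 <= ?x w" using x0 by (simp add: space_P[OF \<mu>])
  from tendsto_ennrealI[OF scaled_one_minus_exp_tendsto[OF this]]
  show "en (?x w) = liminf (%n. en (?n n * (1 - exp (- (?x w / ?n n)))))"
  by (intro lim_imp_Liminf[symmetric]) simp_all
  qed
  also have "... <= liminf (%n. \<integral>\<^sup>+w. en (?n n * (1 - exp (- (?x w / ?n n)))) \<partial>P \<mu>)"
  by (rule nn_integral_liminf) (use xm in measurable)
  also have "... <= liminf (%n. ?A)"
  proof (rule Liminf_mono, intro always_eventually allI)
  fix n
  have "?n n * (1 - exp (- (a n / ?n n))) <= ?n n * (a n / ?n n)"
  using exp_ge_add_one_self[of "- (a n / ?n n)"] by (intro mult_left_mono) auto
  hence "en (?n n * (1 - exp (- (a n / ?n n)))) <= en (a n)" by (intro ennreal_leI) (simp del: of_nat_Suc)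
  thus "(NN w|P \<mu>. en (?n n * (1 - exp (- (?x w / ?n n))))) <= ?A"
  unfolding en using aA by (rule order_trans)
  qed
  finally show ?thesis by (simp add: Liminf_const)
 qed
 obtain A where A: "?A = en A" "0 <= A" using Afin by (cases ?A) auto
 obtain e where e: "(NN w|P \<mu>. en (?x w)) = en e" "0 <= e"
  using le1 Afin by (cases "\<integral>\<^sup>+w. en (?x w) \<partial>P \<mu>") (auto simp: top_unique)
 have an: "a n <= e + A\<^sup>2 * (1 / ?n n)" for n
 proof -
  have "a n <= A" using aA[of n] A a0 by simp
  hence "(a n)\<^sup>2 <= A\<^sup>2" using a0 by (intro power_mono)
  have "?n n * (a n / ?n n - (a n / ?n n)\<^sup>2) <= ?n n * (1 - exp (- (a n / ?n n)))"
  using a0 by (intro mult_left_mono one_minus_exp_ge) auto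
  moreover have "?n n * (a n / ?n n - (a n / ?n n)\<^sup>2) = a n - (a n)\<^sup>2 * (1 / ?n n)"
  by (simp add: right_diff_distrib power2_eq_square del: of_nat_Suc)
  moreover have "(a n)\<^sup>2 * (1 / ?n n) <= A\<^sup>2 * (1 / ?n n)" using \<open>(a n)\<^sup>2 \<le> A\<^sup>2\<close> by (intro mult_right_mono) auto
  moreover have "?n n * (1 - exp (- (a n / ?n n))) <= e"
  proof -
  have "en (?n n * (1 - exp (- (a n / ?n n)))) <= (NN w|P \<mu>. en (?x w))"
  unfolding en[symmetric]
  proof (intro nn_integral_mono ennreal_leI)
  fix w
  have "?n n * (1 - exp (- (?x w / ?n n))) <= ?n n * (?x w / ?n n)"
  using exp_ge_add_one_self[of "- (?x w / ?n n)"] by (intro mult_left_mono) auto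
  thus "?n n * (1 - exp (- (?x w / ?n n))) <= ?x w" by (simp del: of_nat_Suc)
  qed
  thus ?thesis unfolding e(1) using e(2) by (simp del: of_nat_Suc)
  qed
  ultimately show ?thesis by linarith
 qed
 have le2: "?A <= (NN w|P \<mu>. en (?x w))"
 proof -
  have "?A = (NN y|\<mu>. liminf (%n. en (?n n * V n y)))"
  unfolding V_def by (intro nn_integral_cong lim_imp_Liminf[symmetric] cumulant_linearization(2)[OF f t]) simp
  also have "... <= liminf (%n. \<integral>\<^sup>+y. en (?n n * V n y) \<partial>\<mu>)"
  proof (rule nn_integral_liminf)
  fix n
  have "V n : bm B_del" unfolding V_def by (rule cumulant_measurable[OF tf t])
  hence "(%y. en (?n n * V n y)) : bm B_del" by simp
  thus "(%y. en (?n n * V n y)) : bm \<mu>" by (rule finite_measures_measurable[OF \<mu>])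
  qed
  also have "... <= liminf (%n. en (e + A\<^sup>2 * (1 / ?n n)))"
  unfolding a_eq[symmetric] by (intro Liminf_mono always_eventually allI ennreal_leI an)
  also have "... = en e"
  proof (rule lim_imp_Liminf)
  have inv: "(%n. 1 / ?n n) \<longlonglongrightarrow> 0"
  using LIMSEQ_inverse_real_of_nat by (simp add: inverse_eq_divide)
  have "(%n. e + A\<^sup>2 * (1 / ?n n)) \<longlonglongrightarrow> e + A\<^sup>2 * 0"
  by (intro tendsto_add tendsto_const tendsto_mult inv)
  hence "(%n. en (e + A\<^sup>2 * (1 / ?n n))) \<longlonglongrightarrow> en (e + A\<^sup>2 * 0)" by (rule tendsto_ennrealI)
  thus "(%n. en (e + A\<^sup>2 * (1 / ?n n))) \<longlonglongrightarrow> en e" by (simp only: mult_zero_right add_0_right)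
  qed simp
  finally show ?thesis unfolding e .
 qed
 show ?thesis using le1 le2 by (rule antisym)
qed

text \<open>The mean of a superprocess is its mean semigroup. It is the derivative of the Laplace functional at zero, obtained
 from the linearization of cumulants.\<close>

lemma mean_formula:
 assumes h: "h : bm B_del" and t: "0 <= t" and \<mu>: "\<mu> : MF"
 shows "(NN w|P \<mu>. (NN y|X t w. h y)) = (NN y|\<mu>. MS t h y)"
proof -
  let ?a0 = "%w. \<integral>\<^sup>+y. h y \<partial>X t w"
 let ?h = "%k z. min (h z) (of_nat k)"
 have hm: "?h k : bm B_del" for k using h by simp
 have "(NN w|P \<mu>. (?a0 w)) = (NN w|P \<mu>. (SUP k. \<integral>\<^sup>+y. ?h k y \<partial>X t w))"
 proof (rule nn_integral_cong)
  fix w assume "w : space (P \<mu>)"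
  hence w: "X t w : MF" by (intro X_finite_measure t) (simp add: space_P[OF \<mu>])
  have "(?a0 w) = (NN y|X t w. (SUP k. ?h k y))" by (simp add: min_real_nat_SUP(2))
  also have "... = (SUP k. \<integral>\<^sup>+y. ?h k y \<partial>X t w)"
  by (rule nn_integral_monotone_convergence_SUP[OF min_real_nat_SUP(1) finite_measures_measurable[OF w hm]])
  finally show "(?a0 w) = (SUP k. \<integral>\<^sup>+y. ?h k y \<partial>X t w)" .
 qed
 also have "... = (SUP k. \<integral>\<^sup>+w. (NN y|X t w. ?h k y) \<partial>P \<mu>)"
 proof (rule nn_integral_monotone_convergence_SUP)
  show "incseq (%k w. \<integral>\<^sup>+y. ?h k y \<partial>X t w)"
  using min_real_nat_SUP(1)[of h] unfolding incseq_def le_fun_def by (auto intro!: nn_integral_mono)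
  show "(%w. \<integral>\<^sup>+y. ?h k y \<partial>X t w) : bm (P \<mu>)" for k
  by (rule P_measurable[OF \<mu> X_nn_integral_measurable[OF t hm]])
 qed
 also have "... = (SUP k. \<integral>\<^sup>+y. MS t (%z. en (enn2real (?h k z))) y \<partial>\<mu>)"
 proof (intro SUP_cong refl)
  fix k
  have "(NN w|P \<mu>. (NN y|X t w. ?h k y)) = (NN w|P \<mu>. en (LINT y|X t w. enn2real (?h k y)))"
  proof (rule nn_integral_cong)
  fix w assume "w : space (P \<mu>)"
  hence w: "X t w : MF" by (intro X_finite_measure t) (simp add: space_P[OF \<mu>])
  show "(NN y|X t w. ?h k y) = en (LINT y|X t w. enn2real (?h k y))"
  unfolding test_function_integral(2)[OF test_function_min(1)[OF h] w, symmetric] by (simp add: test_function_min(2)[OF h])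
  qed
  thus "(NN w|P \<mu>. (NN y|X t w. ?h k y)) = (NN y|\<mu>. MS t (%z. en (enn2real (?h k z))) y)"
  using mean_formula_bounded[OF test_function_min(1)[OF h] t \<mu>] by simp
 qed
 also have "... = (NN y|\<mu>. (SUP k. MS t (%z. en (enn2real (?h k z))) y))"
 proof (rule nn_integral_monotone_convergence_SUP[symmetric])
  show "incseq (%k y. MS t (%z. en (enn2real (?h k z))) y)"
  using min_real_nat_SUP(1)[of h] unfolding test_function_min(2)[OF h] incseq_def le_fun_def by (auto intro!: MS_mono)
  show "(%y. MS t (%z. en (enn2real (?h k z))) y) : bm \<mu>" for k
  unfolding test_function_min(2)[OF h] by (rule finite_measures_measurable[OF \<mu> MS_measurable[OF hm t]])
 qed
 also have "... = (NN y|\<mu>. MS t h y)"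
  using bounded_to_nonneg[OF h t] by simp
 finally show ?thesis .
qed

end

section \<open>Comparison of cumulants\<close>

context superprocess_lc
begin

lemma return_finite_measure: "return B_del y : MF"
 unfolding finite_measures_iff by (auto intro!: prob_space.finite_measure prob_space_return)

lemma cumulant_mono:
 assumes f: "test_function f B" and g: "test_function g B'" and le: "\<And>z. g z <= f z" and t: "0 <= t"
 shows "cumulant g t y <= cumulant f t y"
proof -
  let ?a0 = "%h w. - (LINT z|X t w. h z)"
 let ?\<mu> = "return B_del y"
 interpret prob_space "P ?\<mu>" by (rule prob_P[OF return_finite_measure])
 have lap: "(LINT w|P ?\<mu>. exp (?a0 h w)) = exp (- cumulant h t y)" if h: "test_function h C" for h C
  using cumulant_laplace[OF h return_finite_measure t, of y] cumulant_measurable[OF h t] by (simp add: integral_return)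
 have int: "integrable (P ?\<mu>) (%w. exp (?a0 h w))" if h: "test_function h C" for h C
 proof (rule integrable_const_bound[of _ 1])
  have "(%w. \<integral>z. h z \<partial>X t w) : bm (P ?\<mu>)"
  by (rule P_measurable[OF return_finite_measure X_integral_measurable[OF h t]])
  thus "(%w. exp (?a0 h w)) : bm (P ?\<mu>)" by measurable
  show "AE w in P ?\<mu>. norm (exp (?a0 h w)) <= 1"
  using test_function_integral(3)[OF h X_finite_measure[OF t]] by (intro AE_I2) (simp add: space_P[OF return_finite_measure])
 qed
 have "(LINT w|P ?\<mu>. exp (- (LINT z|X t w. f z))) <= (LINT w|P ?\<mu>. exp (- (LINT z|X t w. g z)))"
 proof (rule integral_mono[OF int[OF f] int[OF g]])
  fix w assume "w : space (P ?\<mu>)"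
  hence w: "X t w : MF" by (intro X_finite_measure t) (simp add: space_P[OF return_finite_measure])
  have "(LINT z|X t w. g z) <= (LINT z|X t w. f z)"
  by (rule integral_mono[OF test_function_integral(1)[OF g w] test_function_integral(1)[OF f w] le])
  thus "exp (- (LINT z|X t w. f z)) <= exp (- (LINT z|X t w. g z))" by simp
 qed
 thus ?thesis unfolding lap[OF f] lap[OF g] by simp
qed

text \<open>In the equation for the difference of two cumulants, discounting at the Lipschitz constant of
 \<open>psi0\<close> leaves a remainder with a favourable sign.\<close>

lemma cumulant_comparison:
 assumes f: "test_function f B" and g: "test_function g B" and le: "\<And>z. g z <= f z" and t: "0 <= t"
 defines "L \<equiv> branching.psi0_slope (B * exp (beta_bound * t))"
 shows "en (cumulant g t y) + en (exp (- (L * t))) * MS t (%z. en (f z - g z)) y <= en (cumulant f t y)"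
proof -
  let ?a0 = "\<integral>w. exp (- (L * t)) * weight (ext0 \<beta>) t w * f (\<xi> t w) \<partial>Q y"
  let ?b0 = "\<integral>w. exp (- (L * t)) * weight (ext0 \<beta>) t w * g (\<xi> t w) \<partial>Q y"
  let ?c0 = "\<integral>w. weight (ext0 \<beta>) t w * (f (\<xi> t w) - g (\<xi> t w)) \<partial>Q y"
 interpret prob_space "Q y" by (rule motion.prob_P) simp
 have fin: "finite_measure (Q y)" by (rule finite_measure_axioms)
 define K where "K = B * exp (beta_bound * t)"
 have B0: "0 <= B" by (rule test_functionD(4)[OF f])
 have K0: "0 <= K" using B0 by (simp add: K_def)
 have L0: "0 <= L" unfolding L_def K_def[symmetric] by (rule branching.psi0_slope_nonneg[OF K0])
 have cK: "cumulant h s z <= K" if "test_function h B" "0 <= s" "s <= t" for h s z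
 proof -
  have "cumulant h s z <= B * exp (beta_bound * s)" by (rule cumulant_le[OF that(1,2)])
  also have "... <= K" unfolding K_def using that B0 beta_bound(1) by (intro mult_left_mono) (auto intro: mult_left_mono)
  finally show ?thesis .
 qed
 define a where "a z u = psi0_bar z u - L * u" for z u
 have am: "(%(z, u). a z u) : bm (B_del \<Otimes> borel)"
  using psi0_bar_joint unfolding a_def case_prod_beta' by measurable
 define H where "H h s w = exp (- (L * s)) * (weight (ext0 \<beta>) (clip t s) w * a (\<xi> (clip t s) w) (cumulant h (max 0 (t - s)) (\<xi> (clip t s) w)))" for h s w
 have Hm: "(%(s, w). H h s w) : bm (borel \<Otimes> Q y)" if "test_function h B" for h
  using weighted_source_measurable[OF that t am, of y] unfolding H_def case_prod_beta' by measurable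
 have Hb: "\<bar>H h s w\<bar> <= 1 * (exp (beta_bound * t) * (L * K))" if h: "test_function h B" and s: "0 <= s" "s <= t" and w: "w : space (Q y)" for h s w
 proof -
  let ?z = "\<xi> (clip t s) w"
  let ?c = "cumulant h (max 0 (t - s)) ?z"
  have c: "0 <= ?c" "?c <= K" using cK[OF h] cumulant_nonneg[OF h] s by auto
  have "psi0_bar ?z ?c <= L * ?c" unfolding L_def K_def[symmetric] by (rule psi0_bar_le_slope[OF c])
  moreover have "L * ?c <= L * K" using c L0 by (intro mult_left_mono)
  moreover have "0 <= L * ?c" using c L0 by simp
  ultimately have ab: "\<bar>a ?z ?c\<bar> <= L * K" using psi0_bar_nonneg[of ?z ?c] unfolding a_def by linarith
  show ?thesis unfolding H_def abs_mult
  using ab s L0 K0 clipped_weight_le[OF t w, of s] by (intro mult_mono) auto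
 qed
 have eq: "(LBINT s:{0..t}. exp (- (L * s)) * weight (ext0 \<beta>) s w * (psi0_bar (\<xi> s w) (cumulant h (t - s) (\<xi> s w)) - L * cumulant h (t - s) (\<xi> s w))) = (LBINT s:{0..t}. H h s w)" for h w
  by (rule set_integral_cong_Icc) (simp add: H_def a_def)
 have FK: "cumulant h t y = (LINT w|Q y. exp (- (L * t)) * weight (ext0 \<beta>) t w * h (\<xi> t w)) - (LINT w|Q y. (LBINT s:{0..t}. H h s w))"
  if "test_function h B" for h
  using cumulant_Feynman_Kac[OF that t, of y L] unfolding eq .
 have "(LINT w|Q y. (LBINT s:{0..t}. H f s w)) <= (LINT w|Q y. (LBINT s:{0..t}. H g s w))"
 proof (rule integral_mono[OF Fubini_bounded(3)[OF fin t Hm[OF f] Hb[OF f]] Fubini_bounded(3)[OF fin t Hm[OF g] Hb[OF g]]])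
  fix w assume w: "w : space (Q y)"
  have si: "set_integrable lborel {0..t} (%s. H h s w)" if h: "test_function h B" for h
  proof -
  have "(%s. H h s w) : bm borel" using measurable_compose[OF measurable_Pair2'[OF w] Hm[OF h]] by simp
  from set_integrable_bounded[OF this Hb[OF h _ _ w]] show ?thesis .
  qed
  show "(LBINT s:{0..t}. H f s w) <= (LBINT s:{0..t}. H g s w)"
  proof (rule set_integral_mono[OF si[OF f] si[OF g]])
  fix s assume s: "s : {0..t}"
  let ?z = "\<xi> (clip t s) w"
  have "psi0_bar ?z (cumulant f (t - s) ?z) <= psi0_bar ?z (cumulant g (t - s) ?z) + L * (cumulant f (t - s) ?z - cumulant g (t - s) ?z)"
  unfolding L_def K_def[symmetric]
  using s by (intro psi0_bar_mono_Lipschitz(2) cumulant_nonneg[OF g] cumulant_mono[OF f g le] cK[OF f]) auto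
  hence "a ?z (cumulant f (t - s) ?z) <= a ?z (cumulant g (t - s) ?z)"
  unfolding a_def by (simp add: algebra_simps)
  thus "H f s w <= H g s w" unfolding H_def using s by (intro mult_left_mono) auto
  qed
 qed
 hence diff: "?a0 - ?b0
  <= cumulant f t y - cumulant g t y"
  unfolding FK[OF f] FK[OF g] by simp
 have wi: "integrable (Q y) (%w. weight (ext0 \<beta>) t w * h (\<xi> t w))" if h: "h : bm B_del" "\<And>z. \<bar>h z\<bar> <= B" for h
 proof (rule integrable_const_bound[of _ "exp (beta_bound * t) * B"])
  show "(%w. weight (ext0 \<beta>) t w * h (\<xi> t w)) : bm (Q y)"
  using weight_measurable_Q[OF t] measurable_compose[OF \<xi>_measurable_Q[OF t] h(1)] by simp
  show "AE w in Q y. norm (weight (ext0 \<beta>) t w * h (\<xi> t w)) <= exp (beta_bound * t) * B"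
  proof (intro AE_I2)
  fix w assume "w : space (Q y)"
  thus "norm (weight (ext0 \<beta>) t w * h (\<xi> t w)) <= exp (beta_bound * t) * B"
  unfolding real_norm_def abs_mult using t h(2)
  by (intro mult_mono) (auto intro!: weight_le ext0_beta simp: motion.space_P)
  qed
 qed
 have fb: "\<bar>f z\<bar> <= B" "\<bar>g z\<bar> <= B" "\<bar>f z - g z\<bar> <= B" for z
  using test_functionD(2,3)[OF f, of z] test_functionD(2,3)[OF g, of z] le[of z] by auto
 note wif = wi[OF test_functionD(1)[OF f] fb(1)] and wig = wi[OF test_functionD(1)[OF g] fb(2)]
 have fgm: "(%z. f z - g z) : bm B_del" using test_functionD(1)[OF f] test_functionD(1)[OF g] by simp
 have "MS t (%z. en (f z - g z)) y = (NN w|Q y. en (weight (ext0 \<beta>) t w * (f (\<xi> t w) - g (\<xi> t w))))"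
  unfolding MS_def using le by (simp add: ennreal_mult')
 also have "... = en ?c0"
  by (rule nn_integral_eq_integral[OF wi[OF fgm fb(3)]]) (use le in simp)
 finally have M: "MS t (%z. en (f z - g z)) y = en ?c0" (is "_ = en ?I") .
 have I0: "0 <= ?I" using le by (intro Bochner_Integration.integral_nonneg) auto
 have "exp (- (L * t)) * ?I = ?a0 - ?b0"
  using Bochner_Integration.integral_diff[OF wif wig] by (simp add: right_diff_distrib mult.assoc)
 with diff have "cumulant g t y + exp (- (L * t)) * ?I <= cumulant f t y" by linarith
 hence "en (cumulant g t y + exp (- (L * t)) * ?I) <= en (cumulant f t y)" by (rule ennreal_leI)
 thus ?thesis unfolding M using I0 cumulant_nonneg[OF g t] by (simp add: ennreal_mult')
qed

end

section \<open>The principal eigenfunction\<close>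

text \<open>The spectral assumptions in the form in which they are used: an eigenfunction \<open>\<phi>\<close>, an invariant
 measure \<open>\<nu>\<close>, and two-sided bounds of the mean semigroup by the rank one operator \<open>f \<mapsto>
 \<phi> \<nu>(f)\<close>.\<close>

locale spectral_superprocess = superprocess_lc M F \<xi> Q \<alpha> \<beta> \<pi> W G X P
 for M :: "'v measure" and F :: "ennreal => 'v measure"
  and \<xi> :: "real => 'v => 'e::{metric_space, second_countable_topology} option"
  and Q :: "'e option => 'v measure"
  and \<alpha> \<beta> :: "'e => real" and \<pi> :: "'e => real measure"
  and W :: "'w measure" and G :: "ennreal => 'w measure"
  and X :: "real => 'w => 'e option measure" and P :: "'e option measure => 'w measure" +
 fixes l :: real and \<phi> :: "'e => real" and \<nu> :: "'e measure"
 assumes l_pos: "0 < l"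
  and phi: "bounded_borel borel \<phi>" "\<And>x. 0 < \<phi> x"
  and nu: "sets \<nu> = sets borel" "prob_space \<nu>"
  and phi_eigen: "\<And>t x. 0 <= t ==>
  mean_semigroup \<xi> Q \<beta> t (%y. en (\<phi> y)) x = en (exp (l * t) * \<phi> x)"
  and nu_eigen: "\<And>t B. 0 <= t ==> B : sets borel ==>
  (NN x|\<nu>. mean_semigroup \<xi> Q \<beta> t (ind B) x) = en (exp (l * t)) * emeasure \<nu> B"
  and mean_upper: "\<exists>C>0. \<forall>t>1. \<forall>f\<in>L1_plus \<nu>. \<forall>x.
  mean_semigroup \<xi> Q \<beta> t (%y. en (f y)) x <= en (C * exp (l * t) * \<phi> x * (LINT y|\<nu>. f y))"
  and mean_lower: "\<exists>t0>1. \<forall>t\<ge>t0. \<forall>f\<in>L1_plus \<nu>. \<forall>x.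
  en (1/2 * exp (l * t) * \<phi> x * (LINT y|\<nu>. f y)) <= mean_semigroup \<xi> Q \<beta> t (%y. en (f y)) x"
begin

lemma phi_measurable [measurable]: "\<phi> : bm borel"
 using phi(1) by (simp add: bounded_borel_def)

definition phi_bound :: real where
 "phi_bound = (SOME B. 1 <= B \<and> (\<forall>x. \<phi> x <= B))"

lemma phi_bound: "1 <= phi_bound" "\<phi> x <= phi_bound"
proof -
 obtain C where "\<forall>x. \<bar>\<phi> x\<bar> <= C" using phi(1) unfolding bounded_borel_def bounded_iff by auto
 hence "\<exists>B. 1 <= B \<and> (\<forall>x. \<phi> x <= B)"
  by (intro exI[of _ "max 1 C"]) (auto intro: order_trans[OF abs_ge_self] max.coboundedI2)
 from someI_ex[OF this] show "1 <= phi_bound" "\<phi> x <= phi_bound"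
  unfolding phi_bound_def by auto
qed

abbreviation "\<Phi> \<equiv> ext0 \<phi>"

lemma Phi_measurable: "\<Phi> : bm B_del" by (simp add: ext0_measurable_iff)

lemma Phi_nonneg: "0 <= \<Phi> y" and Phi_le: "\<Phi> y <= phi_bound"
 using phi(2) phi_bound by (auto simp: ext0_def less_imp_le split: option.splits)

lemma test_function_Phi: "0 <= th ==> test_function (%z. th * \<Phi> z) (th * phi_bound)"
 unfolding test_function_def using Phi_measurable Phi_nonneg Phi_le by (auto intro: mult_left_mono)

lemma ext0_comp: "h 0 = 0 ==> ext0 (%x. h (f x)) z = h (ext0 f z)"
 by (cases z) auto

lemma MS_Phi:
 assumes t: "0 <= t" and th: "0 <= th"
 shows "MS t (%z. en (th * \<Phi> z)) y = en (th * exp (l * t) * \<Phi> y)"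
proof -
  let ?a0 = "%z. en (\<Phi> z)"
 have e: "ext0 (%x. en (\<phi> x)) = ?a0"
  by (intro ext ext0_comp[where h = ennreal]) simp
 have "MS t ?a0 y = en (exp (l * t) * \<Phi> y)"
 proof (cases y)
  case None
  thus ?thesis using MS_None[OF t, of "%x. en (\<phi> x)"] unfolding e by simp
 next
  case (Some x)
  thus ?thesis using phi_eigen[OF t, of x] unfolding mean_semigroup_eq_MS[OF t] e by simp
 qed
 hence "en th * MS t ?a0 y = en (th * exp (l * t) * \<Phi> y)"
  using th Phi_nonneg by (simp add: ennreal_mult'[symmetric] mult.assoc)
 thus ?thesis using th Phi_measurable MS_cmult[OF t, of "%z. en (\<Phi> z)" "en th" y] by (simp add: ennreal_mult')
qed

lemma nu_MS:
 assumes t: "0 <= t" and h: "h : bm borel"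
 shows "(NN x|\<nu>. MS t (ext0 h) (Some x)) = en (exp (l * t)) * (NN x|\<nu>. h x)"
 using h
proof (induction rule: borel_measurable_induct)
 case (cong f g)
 hence "f = g" by auto
 with cong show ?case by simp
next
 case (set A)
 have "(NN x|\<nu>. ind A x) = emeasure \<nu> A" using set nu(1) by simp
 thus ?case using nu_eigen[OF t set] unfolding mean_semigroup_eq_MS[OF t] by simp
next
 case (mult u c)
 have um: "ext0 u : bm B_del" using mult by (simp add: ext0_measurable_iff)
 have e: "ext0 (%x. c * u x) = (%z. c * ext0 u z)" by (intro ext ext0_comp) simp
 have m: "(%x. MS t (ext0 u) (Some x)) : bm \<nu>"
  using measurable_compose[OF Some_measurable MS_measurable[OF um t]] by (simp add: measurable_cong_sets[OF nu(1) refl])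
 have "u : bm \<nu>" using mult by (simp add: measurable_cong_sets[OF nu(1) refl])
 thus ?case unfolding e MS_cmult[OF t um] using m mult by (simp add: nn_integral_cmult mult.left_commute)
next
 case (add u v)
 have um: "ext0 u : bm B_del" "ext0 v : bm B_del" using add by (simp_all add: ext0_measurable_iff)
 have e: "ext0 (%x. v x + u x) = (%z. ext0 v z + ext0 u z)" by (auto simp: ext0_def fun_eq_iff split: option.splits)
 have m: "(%x. MS t (ext0 w) (Some x)) : bm \<nu>" if "ext0 w : bm B_del" for w
  using measurable_compose[OF Some_measurable MS_measurable[OF that t]] by (simp add: measurable_cong_sets[OF nu(1) refl])
 have "u : bm \<nu>" "v : bm \<nu>" using add by (simp_all add: measurable_cong_sets[OF nu(1) refl])
 thus ?case unfolding e MS_add[OF t um(2,1)] using m[OF um(1)] m[OF um(2)] add by (simp add: nn_integral_add distrib_left)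
next
 case (seq U)
 have um: "ext0 (U i) : bm B_del" for i using seq by (simp add: ext0_measurable_iff)
 have inc: "incseq (%i. ext0 (U i))" using seq(3) by (auto simp: incseq_def le_fun_def ext0_def split: option.splits)
 have e: "ext0 (Sup (range U)) = (%z. SUP i. ext0 (U i) z)"
  by (auto simp: ext0_def fun_eq_iff image_comp split: option.splits)
 have m: "(%x. MS t (ext0 (U i)) (Some x)) : bm \<nu>" for i
  using measurable_compose[OF Some_measurable MS_measurable[OF um t]] by (simp add: measurable_cong_sets[OF nu(1) refl])
 have U\<nu>: "U i : bm \<nu>" for i using seq by (simp add: measurable_cong_sets[OF nu(1) refl])
 have "(NN x|\<nu>. MS t (ext0 (Sup (range U))) (Some x)) = (NN x|\<nu>. (SUP i. MS t (ext0 (U i)) (Some x)))"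
  unfolding e MS_SUP[OF t um inc] ..
 also have "... = (SUP i. \<integral>\<^sup>+x. MS t (ext0 (U i)) (Some x) \<partial>\<nu>)"
 proof (rule nn_integral_monotone_convergence_SUP[OF _ m])
  show "incseq (%i x. MS t (ext0 (U i)) (Some x))"
  using inc unfolding incseq_def le_fun_def by (auto intro!: MS_mono)
 qed
 also have "... = (SUP i. en (exp (l * t)) * (NN x|\<nu>. U i x))" using seq by simp
 also have "... = en (exp (l * t)) * (SUP i. \<integral>\<^sup>+x. U i x \<partial>\<nu>)" by (simp add: SUP_mult_left_ennreal)
 also have "(SUP i. \<integral>\<^sup>+x. U i x \<partial>\<nu>) = (NN x|\<nu>. Sup (range U) x)"
  unfolding SUP_apply by (rule nn_integral_monotone_convergence_SUP[OF seq(3) U\<nu>, symmetric])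
 finally show ?case .
qed

lemma min_L1_plus:
 fixes h :: "'e => ennreal"
 assumes h: "h : bm borel"
 defines "hk \<equiv> %k x. enn2real (min (h x) (of_nat k))"
 shows "hk k : L1_plus \<nu>" "en (LINT x|\<nu>. hk k x) = (NN x|\<nu>. min (h x) (of_nat k))" "en (hk k x) = min (h x) (of_nat k)"
  and "(NN x|\<nu>. h x) = (SUP k. \<integral>\<^sup>+x. min (h x) (of_nat k) \<partial>\<nu>)"
proof -
  let ?a0 = "SUP k. \<integral>\<^sup>+x. min (h x) (of_nat k) \<partial>\<nu>"
 interpret prob_space \<nu> by (rule nu(2))
 have lt: "min (h x) (of_nat k) < \<top>" for x k by (simp add: min_less_iff_disj of_nat_less_top)
 show e: "en (hk k x) = min (h x) (of_nat k)" for k x unfolding hk_def by (rule ennreal_enn2real[OF lt])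
 have m: "hk k : bm borel" for k unfolding hk_def using h by measurable
 have b: "0 <= hk k x" "hk k x <= real k" for k x
  unfolding hk_def by (auto intro!: enn2real_leI simp: ennreal_of_nat_eq_real_of_nat)
 have i: "integrable \<nu> (hk k)" for k
  using b by (intro integrable_const_bound[of _ "real k"]) (auto simp: measurable_cong_sets[OF nu(1) refl] m)
 thus "hk k : L1_plus \<nu>" for k unfolding L1_plus_def using m b by auto
 show "en (LINT x|\<nu>. hk k x) = (NN x|\<nu>. min (h x) (of_nat k))" for k
  unfolding e[symmetric] using b by (intro nn_integral_eq_integral[OF i, symmetric]) auto
 have "(NN x|\<nu>. h x) = (NN x|\<nu>. (SUP k. min (h x) (of_nat k)))" by (simp add: min_real_nat_SUP(2))
 also have "... = ?a0"
  by (rule nn_integral_monotone_convergence_SUP[OF min_real_nat_SUP(1)]) (use h in \<open>simp add: measurable_cong_sets[OF nu(1) refl]\<close>)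
 finally show "(NN x|\<nu>. h x) = ?a0" .
qed

lemma ext0_min: "ext0 (%x. min (h x) (of_nat k)) z = min (ext0 h z) (of_nat k :: ennreal)"
 by (cases z) auto

lemma MS_le_nu:
 obtains C where "0 < C"
  "\<And>t h x. 1 < t ==> h : bm borel ==> MS t (ext0 h) (Some x) <= en (C * exp (l * t) * \<phi> x) * (NN x|\<nu>. h x)"
proof -
 obtain C where C: "0 < C" "\<And>t f x. 1 < t ==> f : L1_plus \<nu> ==>
  mean_semigroup \<xi> Q \<beta> t (%y. en (f y)) x <= en (C * exp (l * t) * \<phi> x * (LINT y|\<nu>. f y))"
  using mean_upper by blast
 have "MS t (ext0 h) (Some x) <= en (C * exp (l * t) * \<phi> x) * (NN x|\<nu>. h x)"
  if t: "1 < t" and h: "h : bm borel" for t h x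
 proof -
  have t0: "0 <= t" using t by simp
  have hm: "ext0 h : bm B_del" using h by (simp add: ext0_measurable_iff)
  have "MS t (ext0 h) (Some x) = (SUP k. MS t (ext0 (%x. min (h x) (of_nat k))) (Some x))"
  unfolding bounded_to_nonneg[OF hm t0] test_function_min(2)[OF hm] ext0_min ..
  also have "... <= en (C * exp (l * t) * \<phi> x) * (NN x|\<nu>. h x)"
  proof (rule SUP_least)
  fix k
  have "MS t (ext0 (%x. min (h x) (of_nat k))) (Some x) <= en (C * exp (l * t) * \<phi> x * (LINT x|\<nu>. enn2real (min (h x) (of_nat k))))"
  using C(2)[OF t min_L1_plus(1)[OF h], of k x] unfolding mean_semigroup_eq_MS[OF t0] min_L1_plus(3)[OF h] .
  also have "... = en (C * exp (l * t) * \<phi> x) * (NN x|\<nu>. min (h x) (of_nat k))"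
  unfolding min_L1_plus(2)[OF h, symmetric] using C(1) phi(2)[of x] by (simp add: ennreal_mult' less_imp_le)
  also have "... <= en (C * exp (l * t) * \<phi> x) * (NN x|\<nu>. h x)"
  by (intro mult_left_mono nn_integral_mono) auto
  finally show "MS t (ext0 (%x. min (h x) (of_nat k))) (Some x) <= en (C * exp (l * t) * \<phi> x) * (NN x|\<nu>. h x)" .
  qed
  finally show ?thesis .
 qed
 thus ?thesis using that[OF C(1)] by blast
qed

lemma MS_ge_nu:
 obtains t0 where "1 < t0"
  "\<And>t h x. t0 <= t ==> h : bm borel ==> en (1/2 * exp (l * t) * \<phi> x) * (NN x|\<nu>. h x) <= MS t (ext0 h) (Some x)"
proof -
  let ?a0 = "%h k. \<integral>\<^sup>+x. min (h x) (of_nat k) \<partial>\<nu>"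
  let ?b0 = "%t x. 1/2 * exp (l * t) * \<phi> x"
 obtain t0 where t0: "1 < t0" "\<And>t f x. t0 <= t ==> f : L1_plus \<nu> ==>
  en (1/2 * exp (l * t) * \<phi> x * (LINT y|\<nu>. f y)) <= mean_semigroup \<xi> Q \<beta> t (%y. en (f y)) x"
  using mean_lower by blast
 have "en (?b0 t x) * (NN x|\<nu>. h x) <= MS t (ext0 h) (Some x)"
  if t: "t0 <= t" and h: "h : bm borel" for t h x
 proof -
  have tn: "0 <= t" using t t0 by simp
  have "en (?b0 t x) * (NN x|\<nu>. h x) = (SUP k. en (?b0 t x) * (?a0 h k))"
  unfolding min_L1_plus(4)[OF h] by (simp add: SUP_mult_left_ennreal)
  also have "... <= MS t (ext0 h) (Some x)"
  proof (rule SUP_least)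
  fix k
  have "en (?b0 t x) * (?a0 h k) = en (1/2 * exp (l * t) * \<phi> x * (LINT x|\<nu>. enn2real (min (h x) (of_nat k))))"
  unfolding min_L1_plus(2)[OF h, symmetric] using phi(2)[of x] by (subst ennreal_mult'[symmetric]) auto
  also have "... <= MS t (ext0 (%x. min (h x) (of_nat k))) (Some x)"
  using t0(2)[OF t min_L1_plus(1)[OF h], of x k] unfolding mean_semigroup_eq_MS[OF tn] min_L1_plus(3)[OF h] .
  also have "... <= MS t (ext0 h) (Some x)"
  unfolding ext0_min by (rule MS_mono) simp
  finally show "en (?b0 t x) * (?a0 h k) <= MS t (ext0 h) (Some x)" .
  qed
  finally show ?thesis .
 qed
 thus ?thesis using that[OF t0(1)] by blast
qed

end

section \<open>Moments of the centred mass\<close>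

lemma qmin_mono: "0 <= a ==> a <= b ==> qmin a <= qmin b"
 unfolding qmin_def by (rule min.mono) (auto intro: power_mono)

context spectral_superprocess
begin

text \<open>The gap between the linear part and the cumulant of the normalized mass at time \<open>s\<close>.\<close>

definition deficit :: "real => real => 'e option => real" where
 "deficit th s y = th * \<Phi> y - cumulant (%z. (th * exp (- (l * s))) * \<Phi> z) s y"

lemma cumulant_Phi_le:
 assumes "0 <= th" "0 <= t"
 shows "cumulant (%z. th * \<Phi> z) t y <= th * exp (l * t) * \<Phi> y"
 using cumulant_le_MS[OF test_function_Phi[OF assms(1)] assms(2), of y] MS_Phi[OF assms(2,1), of y] assms Phi_nonneg
 by simp

text \<open>The cumulant equation for the eigenfunction, whose linear part is known explicitly. It expresses the gap by
 non-negative terms only, so it can be estimated from both sides.\<close>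

lemma deficit_eq:
 assumes th: "0 <= th" and s: "0 <= s"
 shows "en (deficit th s y) = (\<integral>\<^sup>+u\<in>{0..s}. MS u (%z. en (psi0_bar z (cumulant (%z. (th * exp (- (l * s))) * \<Phi> z) (s - u) z))) y \<partial>lborel)"
  and "0 <= deficit th s y" and "deficit th s y <= th * \<Phi> y"
proof -
 let ?th = "th * exp (- (l * s))"
 let ?S = "\<integral>\<^sup>+u\<in>{0..s}. MS u (%z. en (psi0_bar z (cumulant (%z. ?th * \<Phi> z) (s - u) z))) y \<partial>lborel"
 have th': "0 <= ?th" using th by simp
 have e: "?th * exp (l * s) * \<Phi> y = th * \<Phi> y" by (simp add: exp_minus)
 have c0: "0 <= cumulant (%z. ?th * \<Phi> z) s y" by (rule cumulant_nonneg[OF test_function_Phi[OF th'] s])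
 have "cumulant (%z. ?th * \<Phi> z) s y <= th * \<Phi> y" using cumulant_Phi_le[OF th' s, of y] unfolding e .
 thus d0: "0 <= deficit th s y" unfolding deficit_def by simp
 show "deficit th s y <= th * \<Phi> y" unfolding deficit_def using c0 by simp
 have "en (cumulant (%z. ?th * \<Phi> z) s y) + ?S = en (th * \<Phi> y)"
  unfolding cumulant_equation[OF test_function_Phi[OF th'] s] MS_Phi[OF s th'] e ..
 also have "... = en (cumulant (%z. ?th * \<Phi> z) s y) + en (deficit th s y)"
  using c0 d0 by (subst ennreal_plus[symmetric]) (auto simp: deficit_def)
 finally show "en (deficit th s y) = ?S" by (simp add: ennreal_add_left_cancel)
qed

lemma test_function_deficit:
 assumes "0 <= th" "0 <= s"
 shows "test_function (deficit th s) (th * phi_bound)"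
proof -
 have "cumulant (%z. (th * exp (- (l * s))) * \<Phi> z) s : bm B_del"
  using assms by (intro cumulant_measurable[OF test_function_Phi]) auto
 hence "deficit th s : bm B_del"
  using Phi_measurable unfolding deficit_def[abs_def] by simp
 moreover have "deficit th s y <= th * phi_bound" for y
  using deficit_eq(3)[OF assms, of y] Phi_le[of y] assms by (auto intro: order_trans mult_left_mono)
 ultimately show ?thesis using deficit_eq(2)[OF assms] unfolding test_function_def by auto
qed

lemma mass_mean:
 assumes \<eta>: "\<eta> : MF" and s: "0 <= s"
 shows "integrable (P \<eta>) (%w. \<integral>y. \<Phi> y \<partial>X s w)" "(LINT w|P \<eta>. (LINT y|X s w. \<Phi> y)) = exp (l * s) * (LINT y|\<eta>. \<Phi> y)"
proof -
  let ?a0 = "\<integral>y. \<Phi> y \<partial>\<eta>"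
  let ?b0 = "\<integral>\<^sup>+w. en (LINT y|X s w. \<Phi> y) \<partial>P \<eta>"
  let ?c0 = "%w. \<integral>y. \<Phi> y \<partial>X s w"
 have tf: "test_function \<Phi> phi_bound" using test_function_Phi[of 1] by simp
 have xm: "?c0 : bm (P \<eta>)" by (rule P_measurable[OF \<eta> X_integral_measurable[OF tf s]])
 have x0: "AE w in P \<eta>. 0 <= (LINT y|X s w. \<Phi> y)" using Phi_nonneg by simp
 have m0: "0 <= ?a0" by (rule test_function_integral(3)[OF tf \<eta>])
 have "?b0 = (NN y|\<eta>. en (exp (l * s)) * en (\<Phi> y))"
  unfolding mean_formula_bounded[OF tf s \<eta>]
  by (rule nn_integral_cong) (use MS_Phi[OF s, of 1] in \<open>simp add: ennreal_mult'\<close>)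
 also have "... = en (exp (l * s)) * (NN y|\<eta>. en (\<Phi> y))"
  using Phi_measurable by (intro nn_integral_cmult finite_measures_measurable[OF \<eta>]) simp
 also have "... = en (exp (l * s) * ?a0)"
  unfolding test_function_integral(2)[OF tf \<eta>] by (simp add: ennreal_mult')
 finally have n: "?b0 = en (exp (l * s) * ?a0)" .
 show "integrable (P \<eta>) ?c0"
  using n by (intro integrableI_nonneg xm x0) simp
 show "(LINT w|P \<eta>. (LINT y|X s w. \<Phi> y)) = exp (l * s) * ?a0"
  using integral_eq_nn_integral[OF xm x0] n m0 by simp
qed

text \<open>The first moments cancel against the compensator, so that only the Laplace functional remains.\<close>

lemma exprem_expectation:
 assumes \<eta>: "\<eta> : MF" and s: "0 <= s" and th: "0 <= th"
 defines "Z \<equiv> %w. exp (- (l * s)) * (LINT y|X s w. \<Phi> y) - (LINT y|\<eta>. \<Phi> y)"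
 shows "(NN w|P \<eta>. en (exprem (th * Z w))) = en (exp (LINT y|\<eta>. deficit th s y) - 1)"
proof -
  let ?a0 = "\<integral>y. deficit th s y \<partial>\<eta>"
 interpret prob_space "P \<eta>" by (rule prob_P[OF \<eta>])
 let ?th = "th * exp (- (l * s))"
 let ?m = "\<integral>y. \<Phi> y \<partial>\<eta>"
 let ?x = "%w. \<integral>y. \<Phi> y \<partial>X s w"
 have th': "0 <= ?th" using th by simp
 have tf: "test_function \<Phi> phi_bound" using test_function_Phi[of 1] by simp
 note tfth = test_function_Phi[OF th']
 have xm: "?x : bm (P \<eta>)" by (rule P_measurable[OF \<eta> X_integral_measurable[OF tf s]])
 have lap: "(LINT w|P \<eta>. exp (- (?th * ?x w))) = exp (- (LINT y|\<eta>. cumulant (%z. ?th * \<Phi> z) s y))"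
  using cumulant_laplace[OF tfth \<eta> s] by simp
 have ei: "integrable (P \<eta>) (%w. exp (- (?th * ?x w)))"
 proof (rule integrable_const_bound[of _ 1])
  show "AE w in P \<eta>. norm (exp (- (?th * ?x w))) <= 1"
  using Phi_nonneg th by simp
 qed (use xm in measurable)
 have d: "?a0 = th * ?m - (LINT y|\<eta>. cumulant (%z. ?th * \<Phi> z) s y)"
  unfolding deficit_def
  using test_function_integral(1)[OF tf \<eta>] test_function_integral(1)[OF cumulant_test_function[OF tfth s] \<eta>] by simp
 have ex: "exprem (th * Z w) = exp (th * ?m) * exp (- (?th * ?x w)) - 1 + th * (exp (- (l * s)) * ?x w - ?m)" for w
  unfolding exprem_def Z_def by (simp add: algebra_simps flip: exp_add)
 have i: "integrable (P \<eta>) (%w. exprem (th * Z w))"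
  unfolding ex using ei mass_mean(1)[OF \<eta> s] by (intro Bochner_Integration.integrable_add Bochner_Integration.integrable_diff integrable_mult_right) auto
 have "(LINT w|P \<eta>. exprem (th * Z w)) = exp (th * ?m) * exp (- (LINT y|\<eta>. cumulant (%z. ?th * \<Phi> z) s y)) - 1 + th * (exp (- (l * s)) * (exp (l * s) * ?m) - ?m)"
  unfolding ex using ei mass_mean[OF \<eta> s] lap by (simp add: prob_space)
 also have "... = exp ?a0 - 1"
  unfolding d by (simp add: exp_minus exp_diff divide_inverse)
 finally show ?thesis
  using nn_integral_eq_integral[OF i] by simp
qed

text \<open>The time axis is cut into unit cells, and on the cell \<open>[j, j + 1]\<close> the decay \<open>exp (- l u)\<close> of the
 eigenfunction is bounded by its value at \<open>j\<close>.\<close>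

definition scaled_big_jump :: "nat => (real => ennreal) => 'e => ennreal" where
 "scaled_big_jump j f x = big_jump \<pi> \<phi> x (%r. f (r * exp (- (l * real j))))"

definition cell :: "nat => (real => ennreal) => 'e option => ennreal" where
 "cell j f y = (\<integral>\<^sup>+u\<in>{real j..real j + 1}. MS (max 0 u) (ext0 (scaled_big_jump j f)) y \<partial>lborel)"

lemma scaled_big_jump_measurable:
 assumes f: "f : bm borel"
 shows "scaled_big_jump j f : bm borel"
proof -
 have "(%z. snd z * exp (- (l * real j))) : (borel :: 'e measure) \<Otimes> (borel :: real measure) \<rightarrow>\<^sub>M borel" by measurable
 from measurable_compose[OF this f]
 have "(%(x :: 'e, r). f (r * exp (- (l * real j)))) : bm (borel \<Otimes> borel)" by (simp add: case_prod_beta')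
 from branching.big_jump_measurable[OF this phi_measurable] show ?thesis
  unfolding scaled_big_jump_def[abs_def] .
qed

lemma ext0_scaled_big_jump_measurable:
 "f : bm borel ==> ext0 (scaled_big_jump j f) : bm B_del"
 by (subst ext0_measurable_iff) (rule scaled_big_jump_measurable)

lemma cell_integrand_measurable:
 assumes "f : bm borel"
 shows "(%u. MS (max 0 u) (ext0 (scaled_big_jump j f)) y) : bm borel"
 by (rule MS_joint_measurable[OF ext0_scaled_big_jump_measurable[OF assms]]) auto

lemma scale_measurable:
 "f : bm borel ==> (%r::real. f (r * c)) : bm borel"
 by (rule measurable_compose[of "%r. r * c" borel borel f borel]) simp_all

lemma cell_add:
 assumes f: "f : bm borel" and g: "g : bm borel"
 shows "cell j (%r. f r + g r) y = cell j f y + cell j g y"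
proof -
  let ?a0 = "scaled_big_jump j (%r. f r + g r)"
 have e: "ext0 ?a0 = (%z. ext0 (scaled_big_jump j f) z + ext0 (scaled_big_jump j g) z)"
 proof
  fix z show "ext0 ?a0 z = ext0 (scaled_big_jump j f) z + ext0 (scaled_big_jump j g) z"
  unfolding scaled_big_jump_def
  by (cases z) (simp_all add: branching.big_jump_add scale_measurable f g)
 qed
 have "MS (max 0 u) (ext0 ?a0) y = MS (max 0 u) (ext0 (scaled_big_jump j f)) y + MS (max 0 u) (ext0 (scaled_big_jump j g)) y" for u
  unfolding e by (rule MS_add[OF _ ext0_scaled_big_jump_measurable[OF f] ext0_scaled_big_jump_measurable[OF g]]) simp
 thus ?thesis
  unfolding cell_def using cell_integrand_measurable[OF f] cell_integrand_measurable[OF g]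
  by (simp add: distrib_right nn_integral_add)
qed

lemma cell_cmult:
 assumes f: "f : bm borel"
 shows "cell j (%r. c * f r) y = c * cell j f y"
proof -
  let ?a0 = "scaled_big_jump j (%r. c * f r)"
 have e: "ext0 ?a0 = (%z. c * ext0 (scaled_big_jump j f) z)"
 proof
  fix z show "ext0 ?a0 z = c * ext0 (scaled_big_jump j f) z"
  unfolding scaled_big_jump_def
  by (cases z) (simp_all add: branching.big_jump_cmult scale_measurable f)
 qed
 have "MS (max 0 u) (ext0 ?a0) y = c * MS (max 0 u) (ext0 (scaled_big_jump j f)) y" for u
  unfolding e by (rule MS_cmult[OF _ ext0_scaled_big_jump_measurable[OF f]]) simp
 thus ?thesis
  unfolding cell_def using cell_integrand_measurable[OF f] by (simp add: mult.assoc nn_integral_cmult)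
qed

lemma scaled_big_jump_mono: "(\<And>r. f r <= g r) ==> scaled_big_jump j f x <= scaled_big_jump j g x"
 unfolding scaled_big_jump_def using phi(2) by (intro branching.big_jump_mono) auto

lemma ext0_scaled_big_jump_mono: "(\<And>r. f r <= g r) ==> ext0 (scaled_big_jump j f) z <= ext0 (scaled_big_jump j g) z"
 by (cases z) (auto intro: scaled_big_jump_mono)

lemma cell_mono: "(\<And>r. f r <= g r) ==> cell j f y <= cell j g y"
 unfolding cell_def by (intro nn_integral_mono mult_right_mono MS_mono ext0_scaled_big_jump_mono) auto

lemma cell_SUP:
 assumes f: "\<And>i::nat. f i : bm borel" and inc: "incseq f"
 shows "cell j (%r. SUP i. f i r) y = (SUP i. cell j (f i) y)"
proof -
  let ?a0 = "%i. scaled_big_jump j (f i)"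
  let ?b0 = "scaled_big_jump j (%r. SUP i. f i r)"
 have le: "f m r <= f n r" if "m <= n" for m n r using inc that by (auto simp: incseq_def le_fun_def)
 have e: "ext0 ?b0 = (%z. SUP i. ext0 (?a0 i) z)"
 proof
  fix z
  have "incseq (%i r. f i (r * exp (- (l * real j))))" using le by (auto simp: incseq_def le_fun_def)
  from branching.big_jump_SUP[OF scale_measurable[OF f] this]
  show "ext0 ?b0 z = (SUP i. ext0 (?a0 i) z)"
  unfolding scaled_big_jump_def by (cases z) auto
 qed
 have inc2: "incseq (%i. ext0 (?a0 i))"
  unfolding incseq_def le_fun_def using le by (auto intro!: ext0_scaled_big_jump_mono)
 have "MS (max 0 u) (ext0 ?b0) y = (SUP i. MS (max 0 u) (ext0 (?a0 i)) y)" for u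
  unfolding e by (rule MS_SUP[OF _ ext0_scaled_big_jump_measurable[OF f] inc2]) simp
 hence "cell j (%r. SUP i. f i r) y = (NN u|lborel. (SUP i. MS (max 0 u) (ext0 (?a0 i)) y * ind {real j..real j + 1} u))"
  unfolding cell_def by (simp add: SUP_mult_right_ennreal)
 also have "... = (SUP i. cell j (f i) y)"
  unfolding cell_def
 proof (rule nn_integral_monotone_convergence_SUP)
  show "incseq (%i u. MS (max 0 u) (ext0 (?a0 i)) y * ind {real j..real j + 1} u)"
  unfolding incseq_def le_fun_def using le by (auto intro!: mult_right_mono MS_mono ext0_scaled_big_jump_mono)
  show "(%u. MS (max 0 u) (ext0 (?a0 i)) y * ind {real j..real j + 1} u) : bm lborel" for i
  using cell_integrand_measurable[OF f] by simp
 qed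
 finally show ?thesis .
qed

lemma cell_measurable:
 assumes f: "f : bm borel"
 shows "cell j f : bm B_del"
proof -
  let ?a0 = "ext0 (scaled_big_jump j f)"
 have "(%x. MS (max 0 (snd x)) ?a0 (fst x)) : bm (B_del \<Otimes> borel)"
  by (rule MS_joint_measurable[OF ext0_scaled_big_jump_measurable[OF f]]) auto
 hence "(%x. MS (max 0 (snd x)) ?a0 (fst x) * ind {real j..real j + 1} (snd x)) : bm (B_del \<Otimes> lborel)"
  unfolding measurable_cong_sets[OF sets_pair_measure_cong[OF refl sets_lborel] refl]
  by (intro borel_measurable_times_ennreal) (auto intro!: measurable_compose[OF measurable_snd borel_measurable_indicator])
 hence "(%y. \<integral>\<^sup>+u. MS (max 0 u) ?a0 y * ind {real j..real j + 1} u \<partial>lborel) : bm B_del"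
  by (intro lborel.borel_measurable_nn_integral) (simp add: case_prod_beta')
 thus ?thesis unfolding cell_def[abs_def] .
qed

text \<open>Finiteness makes the comparison measure below sigma-finite.\<close>

lemma cell_const_finite: "cell j (%_. 1) y <= en (phi_bound * branching.jump_bound * exp (l * (real j + 1)) * \<Phi> y)"
proof -
  let ?a0 = "scaled_big_jump j (%_. 1)"
 let ?K = "phi_bound * branching.jump_bound"
 have K0: "0 <= ?K" using phi_bound(1) branching.jump_bound(1) by simp
 have bj: "ext0 ?a0 z <= en (?K * \<Phi> z)" for z
 proof (cases z)
  case (Some x)
  have "scaled_big_jump j (%_. 1) x <= big_jump \<pi> \<phi> x (%r. en r)"
  unfolding scaled_big_jump_def using phi(2) by (intro branching.big_jump_mono) (auto simp: ennreal_1[symmetric] simp del: ennreal_1 intro: ennreal_leI)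
  also have "... <= en (?K * \<phi> x)"
  by (rule branching.big_jump_first_moment[OF phi(2) phi_bound(2,1)])
  finally show ?thesis by (simp add: Some)
 qed simp
 have "cell j (%_. 1) y <= (NN u|lborel. en (?K * exp (l * (real j + 1)) * \<Phi> y) * ind {real j..real j + 1} u)"
  unfolding cell_def
 proof (intro nn_integral_mono)
  fix u :: real
  show "MS (max 0 u) (ext0 ?a0) y * ind {real j..real j + 1} u <= en (?K * exp (l * (real j + 1)) * \<Phi> y) * ind {real j..real j + 1} u"
  proof (cases "u : {real j..real j + 1}")
  case True
  hence u: "0 <= u" "max 0 u = u" "u <= real j + 1" by auto
  have "MS u (ext0 ?a0) y <= MS u (%z. en (?K * \<Phi> z)) y" by (rule MS_mono[OF bj])
  also have "... = en (?K * exp (l * u) * \<Phi> y)" by (rule MS_Phi[OF u(1) K0])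
  also have "... <= en (?K * exp (l * (real j + 1)) * \<Phi> y)"
  using u(3) l_pos K0 Phi_nonneg by (intro ennreal_leI mult_right_mono mult_left_mono) auto
  finally show ?thesis using True u by simp
  qed simp
 qed
 also have "... = en (?K * exp (l * (real j + 1)) * \<Phi> y)" by (simp add: nn_integral_cmult)
 finally show ?thesis .
qed

definition deficit_const :: real where
 "deficit_const = (branching.alpha_bound + 2 * branching.jump_bound) * phi_bound / l + 1"

lemma deficit_const_pos: "0 < deficit_const"
 unfolding deficit_const_def
 using branching.alpha_bound(1) branching.jump_bound(1) phi_bound(1) l_pos by (simp add: add_nonneg_pos)

text \<open>For \<open>\<theta> > 1\<close> the trivial bound \<open>\<theta> \<Phi>\<close> suffices. Otherwise, under the mean
 semigroup at time \<open>u\<close> stands the cumulant for the remaining time \<open>s - u\<close>, which is at most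
 \<open>\<theta> exp (- l u) \<Phi>\<close>. The quadratic part of the mechanism then decays like \<open>exp (- 2 l
 u)\<close>, which outweighs the growth \<open>exp (l u)\<close> of the mean semigroup, and the large jumps are
 collected in the cells.\<close>

lemma deficit_le_cells:
 assumes th: "0 <= th" and s: "0 <= s" "s < real N"
 shows "en (deficit th s y) <= en (deficit_const * \<Phi> y * qmin th) + (\<Sum>j<N. cell j (%r. en (qmin (th * r))) y)"
proof (cases "th <= 1")
 case False
 have "deficit th s y <= \<Phi> y * th" using deficit_eq(3)[OF th s(1)] by (simp add: mult.commute)
 also have "... <= deficit_const * \<Phi> y * qmin th"
 proof -
  have "qmin th = th" using False by (simp add: qmin_def power2_eq_square)
  moreover have "1 * (\<Phi> y * th) <= deficit_const * (\<Phi> y * th)"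
  unfolding deficit_const_def using branching.alpha_bound(1) branching.jump_bound(1) phi_bound(1) l_pos th Phi_nonneg
  by (intro mult_right_mono) auto
  ultimately show ?thesis by (simp add: mult.assoc)
 qed
 finally have "en (deficit th s y) <= en (deficit_const * \<Phi> y * qmin th)" by (rule ennreal_leI)
 thus ?thesis by (rule order_trans) simp
next
 case True
 let ?c0 = "(branching.alpha_bound + 2 * branching.jump_bound) * phi_bound"
 let ?q = "%r. en (qmin (th * r))"
 let ?th = "th * exp (- (l * s))"
 have c0: "0 <= ?c0" using branching.alpha_bound(1) branching.jump_bound(1) phi_bound(1) by simp
 have qm: "?q : bm borel" by simp
 have qmin_eq: "qmin th = th\<^sup>2" using True th by (simp add: qmin_def power2_eq_square mult_left_le)
 have point: "MS u (%z. en (psi0_bar z (cumulant (%z. ?th * \<Phi> z) (s - u) z))) y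
  <= en (?c0 * th\<^sup>2 * \<Phi> y * exp (- (l * u))) + MS u (ext0 (scaled_big_jump j ?q)) y"
  if u: "0 <= u" "u <= s" "real j <= u" for u j
 proof -
  have "en (psi0_bar z (cumulant (%z. ?th * \<Phi> z) (s - u) z))
  <= en (?c0 * (th * exp (- (l * u)))\<^sup>2 * \<Phi> z) + ext0 (scaled_big_jump j ?q) z" for z
  proof (cases z)
  case (Some x)
  have "cumulant (%z. ?th * \<Phi> z) (s - u) z <= ?th * exp (l * (s - u)) * \<Phi> z"
  using th u by (intro cumulant_Phi_le) auto
  also have "... = (th * exp (- (l * u))) * \<phi> x" by (simp add: Some right_diff_distrib exp_diff exp_minus divide_inverse)
  finally have "psi0 \<alpha> \<pi> x (cumulant (%z. ?th * \<Phi> z) (s - u) z) <= psi0 \<alpha> \<pi> x ((th * exp (- (l * u))) * \<phi> x)"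
  using th u by (intro branching.psi0_mono_Lipschitz(1)[OF _ _ order_refl] cumulant_nonneg[OF test_function_Phi]) auto
  hence "en (psi0_bar z (cumulant (%z. ?th * \<Phi> z) (s - u) z)) <= en (psi0 \<alpha> \<pi> x ((th * exp (- (l * u))) * \<phi> x))"
  by (simp add: Some ennreal_leI)
  also have "... <= en (?c0 * (th * exp (- (l * u)))\<^sup>2 * \<phi> x) + big_jump \<pi> \<phi> x (%r. en (qmin ((th * exp (- (l * u))) * r)))"
  using th by (intro branching.psi0_le_big_jump phi(2) phi_bound) auto
  also have "... <= en (?c0 * (th * exp (- (l * u)))\<^sup>2 * \<phi> x) + scaled_big_jump j ?q x"
  unfolding scaled_big_jump_def
  proof (intro add_left_mono branching.big_jump_mono phi(2) ennreal_leI qmin_mono)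
  fix r :: real assume r: "1 <= r"
  show "0 <= th * exp (- (l * u)) * r" using th r by simp
  have "exp (- (l * u)) <= exp (- (l * real j))" using u(3) l_pos by (simp add: mult_left_mono)
  hence "(th * r) * exp (- (l * u)) <= (th * r) * exp (- (l * real j))" using th r by (intro mult_left_mono) auto
  thus "th * exp (- (l * u)) * r <= th * (r * exp (- (l * real j)))" by (simp add: mult_ac)
  qed
  finally show ?thesis by (simp add: Some)
  qed simp
  hence "MS u (%z. en (psi0_bar z (cumulant (%z. ?th * \<Phi> z) (s - u) z))) y
  <= MS u (%z. en (?c0 * (th * exp (- (l * u)))\<^sup>2 * \<Phi> z) + ext0 (scaled_big_jump j ?q) z) y"
  by (rule MS_mono)
  also have "... = MS u (%z. en (?c0 * (th * exp (- (l * u)))\<^sup>2 * \<Phi> z)) y + MS u (ext0 (scaled_big_jump j ?q)) y"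
  using Phi_measurable by (intro MS_add u ext0_scaled_big_jump_measurable qm) simp
  also have "MS u (%z. en (?c0 * (th * exp (- (l * u)))\<^sup>2 * \<Phi> z)) y = en (?c0 * (th * exp (- (l * u)))\<^sup>2 * exp (l * u) * \<Phi> y)"
  using c0 by (intro MS_Phi u) simp
  also have "?c0 * (th * exp (- (l * u)))\<^sup>2 * exp (l * u) * \<Phi> y = ?c0 * th\<^sup>2 * \<Phi> y * exp (- (l * u))"
  by (simp add: power2_eq_square exp_minus)
  finally show ?thesis .
 qed
 have "en (deficit th s y) = (\<integral>\<^sup>+u\<in>{0..s}. MS u (%z. en (psi0_bar z (cumulant (%z. ?th * \<Phi> z) (s - u) z))) y \<partial>lborel)"
  by (rule deficit_eq(1)[OF th s(1)])
 also have "... <= (NN u|lborel. en (?c0 * th\<^sup>2 * \<Phi> y) * (en (exp (- l * u)) * ind {0..} u)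
  + (\<Sum>j<N. MS (max 0 u) (ext0 (scaled_big_jump j ?q)) y * ind {real j..real j + 1} u))"
 proof (intro nn_integral_mono)
  fix u :: real
  show "MS u (%z. en (psi0_bar z (cumulant (%z. ?th * \<Phi> z) (s - u) z))) y * ind {0..s} u
  <= en (?c0 * th\<^sup>2 * \<Phi> y) * (en (exp (- l * u)) * ind {0..} u)
  + (\<Sum>j<N. MS (max 0 u) (ext0 (scaled_big_jump j ?q)) y * ind {real j..real j + 1} u)"
  proof (cases "0 <= u \<and> u <= s")
  case True
  define j where "j = nat \<lfloor>u\<rfloor>"
  have j: "real j <= u" "u <= real j + 1" using True unfolding j_def by linarith+
  have "real j < real N" using j True s by linarith
  hence jN: "j < N" by simp
  have "MS u (%z. en (psi0_bar z (cumulant (%z. ?th * \<Phi> z) (s - u) z))) y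
  <= en (?c0 * th\<^sup>2 * \<Phi> y * exp (- (l * u))) + MS u (ext0 (scaled_big_jump j ?q)) y"
  by (rule point) (use True j in auto)
  also have "MS u (ext0 (scaled_big_jump j ?q)) y = MS (max 0 u) (ext0 (scaled_big_jump j ?q)) y * ind {real j..real j + 1} u"
  using True j by simp
  also have "... <= (\<Sum>j<N. MS (max 0 u) (ext0 (scaled_big_jump j ?q)) y * ind {real j..real j + 1} u)"
  by (rule member_le_sum) (use jN in auto)
  finally show ?thesis
  using True c0 Phi_nonneg by (simp add: ennreal_mult'[symmetric] add_left_mono)
  qed simp
 qed
 also have "... = en (?c0 * th\<^sup>2 * \<Phi> y) * (\<integral>\<^sup>+u\<in>{0..}. en (exp (- l * u)) \<partial>lborel) + (\<Sum>j<N. cell j ?q y)"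
 proof (subst nn_integral_add)
  have m: "(%u. MS (max 0 u) (ext0 (scaled_big_jump j ?q)) y * ind {real j..real j + 1} u) : bm lborel" for j
  using cell_integrand_measurable[OF qm] by simp
  show "(%u. \<Sum>j<N. MS (max 0 u) (ext0 (scaled_big_jump j ?q)) y * ind {real j..real j + 1} u) : bm lborel"
  by (intro borel_measurable_sum m)
  have "(NN u|lborel. (\<Sum>j<N. MS (max 0 u) (ext0 (scaled_big_jump j ?q)) y * ind {real j..real j + 1} u)) = (\<Sum>j<N. cell j ?q y)"
  unfolding cell_def by (rule nn_integral_sum[OF m])
  moreover have "(NN u|lborel. en (?c0 * th\<^sup>2 * \<Phi> y) * (en (exp (- l * u)) * ind {0..} u))
  = en (?c0 * th\<^sup>2 * \<Phi> y) * (\<integral>\<^sup>+u\<in>{0..}. en (exp (- l * u)) \<partial>lborel)"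
  by (rule nn_integral_cmult) measurable
  ultimately show "(NN u|lborel. en (?c0 * th\<^sup>2 * \<Phi> y) * (en (exp (- l * u)) * ind {0..} u))
  + (NN u|lborel. (\<Sum>j<N. MS (max 0 u) (ext0 (scaled_big_jump j ?q)) y * ind {real j..real j + 1} u))
  = en (?c0 * th\<^sup>2 * \<Phi> y) * (\<integral>\<^sup>+u\<in>{0..}. en (exp (- l * u)) \<partial>lborel) + (\<Sum>j<N. cell j ?q y)"
  by simp
 qed measurable
 also have "(\<integral>\<^sup>+u\<in>{0..}. en (exp (- l * u)) \<partial>lborel) = en (1 / l)"
  by (rule nn_integral_set_has_integral) (use has_integral_exp_minus_to_infinity[OF l_pos, of 0] in auto)
 also have "en (?c0 * th\<^sup>2 * \<Phi> y) * en (1 / l) <= en (deficit_const * \<Phi> y * qmin th)"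
 proof -
  have "?c0 * th\<^sup>2 * \<Phi> y * (1 / l) = ?c0 / l * (\<Phi> y * qmin th)" by (simp add: qmin_eq)
  also have "... <= deficit_const * (\<Phi> y * qmin th)"
  unfolding deficit_const_def using Phi_nonneg by (intro mult_right_mono) auto
  finally have "?c0 * th\<^sup>2 * \<Phi> y * (1 / l) <= deficit_const * \<Phi> y * qmin th" by (simp add: mult.assoc)
  thus ?thesis using c0 Phi_nonneg l_pos by (subst ennreal_mult'[symmetric]) (auto intro: ennreal_leI)
 qed
 finally show ?thesis by (simp add: add_right_mono)
qed

definition growth :: "real => 'e option => ennreal" where
 "growth p y = (\<Sum>j. cell j (%r. en (\<bar>r\<bar> powr p)) y)"

lemma growth_measurable: "growth p : bm B_del"
 unfolding growth_def[abs_def] by (intro borel_measurable_suminf_order cell_measurable) simp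

text \<open>The \<open>p\<close>-th central moment of the normalized mass is of the order of the initial state and not of
 its \<open>p\<close>-th power. The truncated squares are controlled at all scales \<open>th\<close> for which the
 cumulant deficit is at most one, and the threshold \<open>B powr (- 1 / p)\<close> for \<open>th\<close> is of the same order as
 the moment bound itself, so that smaller values of the centred mass contribute at most \<open>B\<close>.\<close>

lemma centred_moment_le:
 assumes p: "1 < p" "p <= 2" and \<eta>: "\<eta> : MF" and s: "0 <= s" and B: "0 < B"
  and bound: "en (deficit_const * (LINT y|\<eta>. \<Phi> y)) + (NN y|\<eta>. growth p y) <= en B"
 defines "Z \<equiv> %w. exp (- (l * s)) * (LINT y|X s w. \<Phi> y) - (LINT y|\<eta>. \<Phi> y)"
 shows "(NN w|P \<eta>. en (\<bar>Z w\<bar> powr p)) <= en ((1 + 8 / (p - 1)) * B)"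
proof -
 interpret prob_space "P \<eta>" by (rule prob_P[OF \<eta>])
 have tf: "test_function \<Phi> phi_bound" using test_function_Phi[of 1] by simp
 obtain N :: nat where N: "s < real N" using reals_Archimedean2 by blast
 let ?m = "\<integral>y. \<Phi> y \<partial>\<eta>"
 have m0: "0 <= ?m" by (rule test_function_integral(3)[OF tf \<eta>])
 define J where "J f = en (deficit_const * ?m) * f 1 + (NN y|\<eta>. (\<Sum>j<N. cell j f y))" for f :: "real => ennreal"
 have cm: "cell j f : bm \<eta>" if "f : bm borel" for j f
  by (rule finite_measures_measurable[OF \<eta> cell_measurable[OF that]])
 have "\<exists>\<G>. sets \<G> = sets borel \<and> (\<forall>f\<in>bm borel. (NN r|\<G>. f r) = J f)"
 proof (rule functional_is_integral[of J])
  fix f g :: "real => ennreal" and c :: ennreal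
  assume f: "f : bm borel"
  show "J (%x. c * f x) = c * J f"
  unfolding J_def cell_cmult[OF f] sum_distrib_left[symmetric]
  using cm[OF f] by (simp add: nn_integral_cmult distrib_left mult.left_commute)
  assume g: "g : bm borel"
  show "J (%x. f x + g x) = J f + J g"
  unfolding J_def cell_add[OF f g] sum.distrib
  using cm[OF f] cm[OF g] by (subst nn_integral_add) (simp_all only: distrib_left distrib_right ac_simps borel_measurable_sum)
 next
  fix f :: "nat => real => ennreal" assume f: "\<And>i. f i : bm borel" and inc: "incseq f"
  have le: "f m r <= f n r" if "m <= n" for m n r using inc that by (auto simp: incseq_def le_fun_def)
  have i1: "incseq (%i. cell j (f i) y)" for j y
  unfolding incseq_def using le by (auto intro: cell_mono)
  have "(NN y|\<eta>. (\<Sum>j<N. cell j (%r. SUP i. f i r) y)) = (NN y|\<eta>. (SUP i. \<Sum>j<N. cell j (f i) y))"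
  unfolding cell_SUP[OF f inc] using i1 by (simp add: ennreal_SUP_sum)
  also have "... = (SUP i. \<integral>\<^sup>+y. (\<Sum>j<N. cell j (f i) y) \<partial>\<eta>)"
  proof (rule nn_integral_monotone_convergence_SUP)
  show "incseq (%i y. \<Sum>j<N. cell j (f i) y)"
  unfolding incseq_def le_fun_def using le by (auto intro!: sum_mono cell_mono)
  qed (use cm[OF f] in simp)
  finally have a: "(NN y|\<eta>. (\<Sum>j<N. cell j (%r. SUP i. f i r) y)) = (SUP i. \<integral>\<^sup>+y. (\<Sum>j<N. cell j (f i) y) \<partial>\<eta>)" .
  show "J (%x. SUP i. f i x) = (SUP i. J (f i))"
  unfolding J_def a SUP_mult_left_ennreal
  proof (rule ennreal_SUP_add[symmetric])
  show "incseq (%i. en (deficit_const * ?m) * f i 1)"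
  unfolding incseq_def using le by (auto intro: mult_left_mono)
  show "incseq (%i. \<integral>\<^sup>+y. (\<Sum>j<N. cell j (f i) y) \<partial>\<eta>)"
  unfolding incseq_def using le by (auto intro!: nn_integral_mono sum_mono cell_mono)
  qed
 qed auto
 then obtain \<G> where \<G>: "sets \<G> = sets borel" "\<And>f. f : bm borel ==> (NN r|\<G>. f r) = J f"
  by blast
 have finG: "finite_measure \<G>"
 proof (rule finite_measureI)
  have "emeasure \<G> (space \<G>) = (NN r|\<G>. 1)" by simp
  also have "... = J (%_. 1)" by (rule \<G>(2)) simp
  also have "... \<noteq> \<infinity>"
  proof -
  interpret \<eta>: finite_measure \<eta> using \<eta> by (simp add: finite_measures_iff)
  let ?c = "%j. phi_bound * branching.jump_bound * exp (l * (real j + 1)) * phi_bound"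
  have "(NN y|\<eta>. (\<Sum>j<N. cell j (%_. 1) y)) <= (NN y|\<eta>. (\<Sum>j<N. en (?c j)))"
  proof (intro nn_integral_mono sum_mono order_trans[OF cell_const_finite] ennreal_leI mult_left_mono Phi_le)
  fix j :: nat show "0 <= phi_bound * branching.jump_bound * exp (l * (real j + 1))"
  using phi_bound(1) branching.jump_bound(1) by simp
  qed
  also have "... < \<infinity>" by (simp add: ennreal_mult_less_top \<eta>.emeasure_eq_measure)
  finally show ?thesis unfolding J_def by simp
  qed
  finally show "emeasure \<G> (space \<G>) \<noteq> \<infinity>" .
 qed
 have Gp: "(NN r|\<G>. en (\<bar>r\<bar> powr p)) <= en B"
 proof -
  have "(NN r|\<G>. en (\<bar>r\<bar> powr p)) = J (%r. en (\<bar>r\<bar> powr p))" by (rule \<G>(2)) simp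
  also have "... <= en (deficit_const * ?m) + (NN y|\<eta>. growth p y)"
  unfolding J_def growth_def by (intro add_mono nn_integral_mono sum_le_suminf) auto
  finally show ?thesis using bound by (rule order_trans)
 qed
 define T where "T = B powr (- (1 / p))"
 have T: "0 < T" using B by (simp add: T_def)
 have Tp: "T powr p = 1 / B" unfolding T_def powr_powr using B p by (simp add: powr_minus_divide)
 have Zm: "Z : bm (P \<eta>)"
  unfolding Z_def using P_measurable[OF \<eta> X_integral_measurable[OF tf s]] by simp
 have key: "(NN w|P \<eta>. en (qmin (th * Z w))) <= 8 * (NN r|\<G>. en (qmin (th * r)))"
  if th: "0 < th" "th <= T" for th
 proof -
  have th0: "0 <= th" using th by simp
  define d where "d = (LINT y|\<eta>. deficit th s y)"
  have d0: "0 <= d" unfolding d_def by (rule test_function_integral(3)[OF test_function_deficit[OF th0 s] \<eta>])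
  have dG: "en d <= (NN r|\<G>. en (qmin (th * r)))"
  proof -
  have qm: "(%r. en (qmin (th * r))) : bm borel" by simp
  have "en d = (NN y|\<eta>. en (deficit th s y))"
  unfolding d_def by (rule test_function_integral(2)[OF test_function_deficit[OF th0 s] \<eta>, symmetric])
  also have "... <= (NN y|\<eta>. en (deficit_const * \<Phi> y * qmin th) + (\<Sum>j<N. cell j (%r. en (qmin (th * r))) y))"
  by (intro nn_integral_mono deficit_le_cells[OF th0 s N])
  also have "... = (NN y|\<eta>. en (deficit_const * qmin th) * en (\<Phi> y)) + (NN y|\<eta>. (\<Sum>j<N. cell j (%r. en (qmin (th * r))) y))"
  proof (subst nn_integral_add)
  show "(%y. en (deficit_const * \<Phi> y * qmin th)) : bm \<eta>"
  using Phi_measurable by (intro finite_measures_measurable[OF \<eta>]) simp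
  show "(%y. \<Sum>j<N. cell j (%r. en (qmin (th * r))) y) : bm \<eta>"
  using cm[OF qm] by simp
  have "en (deficit_const * \<Phi> y * qmin th) = en (deficit_const * qmin th) * en (\<Phi> y)" for y
  using deficit_const_pos by (subst ennreal_mult'[symmetric]) (simp_all add: mult_ac)
  thus "(NN y|\<eta>. en (deficit_const * \<Phi> y * qmin th)) + (NN y|\<eta>. (\<Sum>j<N. cell j (%r. en (qmin (th * r))) y))
  = (NN y|\<eta>. en (deficit_const * qmin th) * en (\<Phi> y)) + (NN y|\<eta>. (\<Sum>j<N. cell j (%r. en (qmin (th * r))) y))"
  by simp
  qed
  also have "(NN y|\<eta>. en (deficit_const * qmin th) * en (\<Phi> y)) = en (deficit_const * qmin th) * en ?m"
  using Phi_measurable unfolding test_function_integral(2)[OF tf \<eta>, symmetric]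
  by (intro nn_integral_cmult finite_measures_measurable[OF \<eta>]) simp
  also have "... = en (deficit_const * ?m) * en (qmin (th * 1))"
  using deficit_const_pos m0 by (simp add: ennreal_mult'[symmetric] mult_ac)
  also have "... + (NN y|\<eta>. (\<Sum>j<N. cell j (%r. en (qmin (th * r))) y)) = (NN r|\<G>. en (qmin (th * r)))"
  unfolding \<G>(2)[OF qm] J_def ..
  finally show ?thesis .
  qed
  have "(NN r|\<G>. en (qmin (th * r))) <= (NN r|\<G>. en (th powr p) * en (\<bar>r\<bar> powr p))"
  proof (intro nn_integral_mono)
  fix r :: real
  have "qmin (th * r) <= \<bar>th * r\<bar> powr p" using p by (intro qmin_le_powr) auto
  also have "... = th powr p * \<bar>r\<bar> powr p" using th by (simp add: abs_mult powr_mult)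
  finally show "en (qmin (th * r)) <= en (th powr p) * en (\<bar>r\<bar> powr p)"
  by (simp add: ennreal_mult'[symmetric] ennreal_leI)
  qed
  also have "... = en (th powr p) * (NN r|\<G>. en (\<bar>r\<bar> powr p))"
  by (rule nn_integral_cmult) (simp add: measurable_cong_sets[OF \<G>(1) refl])
  also have "... <= en (T powr p) * en B"
  using th p by (intro mult_mono Gp ennreal_leI powr_mono2) auto
  also have "... = 1" using B by (simp add: Tp ennreal_mult'[symmetric])
  finally have "en d <= 1" using dG by (rule order_trans[rotated])
  hence d1: "d <= 1" by (simp add: ennreal_le_1)
  have "exp d - 1 <= 2 * d"
  using exp_bound[OF d0 d1] mult_left_mono[OF d1 d0] by (simp add: power2_eq_square)
  have "en (1/4) * (NN w|P \<eta>. en (qmin (th * Z w))) = (NN w|P \<eta>. en (1/4) * en (qmin (th * Z w)))"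
  by (rule nn_integral_cmult[symmetric]) (use Zm in measurable)
  also have "... <= (NN w|P \<eta>. en (exprem (th * Z w)))"
  using qmin_le_exprem by (intro nn_integral_mono) (simp add: ennreal_mult'[symmetric] ennreal_leI)
  also have "... = en (exp d - 1)" unfolding Z_def d_def by (rule exprem_expectation[OF \<eta> s th0])
  also have "... <= en (2 * d)" by (rule ennreal_leI) fact
  also have "... = 2 * en d" using d0 by (simp add: ennreal_mult')
  also have "... <= 2 * (NN r|\<G>. en (qmin (th * r)))" by (intro mult_left_mono dG) simp
  finally have "en 4 * (en (1/4) * (NN w|P \<eta>. en (qmin (th * Z w)))) <= en 4 * (2 * (NN r|\<G>. en (qmin (th * r))))"
  by (intro mult_left_mono) auto
  moreover have "en 4 * en (1/4) = 1" by (subst ennreal_mult'[symmetric]) auto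
  moreover have "en 4 * 2 = 8"
  using ennreal_mult'[of 4 2] by simp
  ultimately show ?thesis by (simp only: mult.assoc[symmetric] mult_1)
 qed
 have tail: "(NN w|P \<eta>. en (\<bar>Z w\<bar> powr p) * ind {w. 1 / T <= \<bar>Z w\<bar>} w)
  <= en (1 / (p - 1)) * (8 * (NN r|\<G>. en (\<bar>r\<bar> powr p)))"
 proof (rule tail_moment_comparison[OF _ _ Zm _ p T])
  show "sigma_finite_measure (P \<eta>)" by (rule sigma_finite_measure_axioms)
  show "sigma_finite_measure \<G>" using finG by (simp add: finite_measure_def)
  show "(%r. r) : bm \<G>" by (simp add: measurable_cong_sets[OF \<G>(1) refl])
 qed (rule key)
 have "(NN w|P \<eta>. en (\<bar>Z w\<bar> powr p)) <= (NN w|P \<eta>. en B + en (\<bar>Z w\<bar> powr p) * ind {w. 1 / T <= \<bar>Z w\<bar>} w)"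
 proof (intro nn_integral_mono)
  fix w
  have "\<bar>Z w\<bar> powr p <= B" if "\<not> 1 / T <= \<bar>Z w\<bar>"
  proof -
  have "\<bar>Z w\<bar> powr p <= (1 / T) powr p" using that p by (intro powr_mono2) auto
  also have "... = B" using T B by (simp add: powr_divide Tp)
  finally show ?thesis .
  qed
  thus "en (\<bar>Z w\<bar> powr p) <= en B + en (\<bar>Z w\<bar> powr p) * ind {w. 1 / T <= \<bar>Z w\<bar>} w"
  by (cases "1 / T <= \<bar>Z w\<bar>") (auto intro: ennreal_leI)
 qed
 also have "... = en B + (NN w|P \<eta>. en (\<bar>Z w\<bar> powr p) * ind {w. 1 / T <= \<bar>Z w\<bar>} w)"
  using Zm by (subst nn_integral_add) (auto simp: emeasure_space_1)
 also have "... <= en B + en (1 / (p - 1)) * (8 * en B)"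
  by (intro add_left_mono order_trans[OF tail] mult_left_mono Gp) auto
 also have "... = en ((1 + 8 / (p - 1)) * B)"
 proof -
  have "en (1 / (p - 1)) * (8 * en B) = en (1 / (p - 1) * (8 * B))"
  proof -
  have "8 * en B = en (8 * B)" by (simp add: ennreal_mult')
  thus ?thesis using p by (simp only:) (rule ennreal_mult'[symmetric], simp)
  qed
  hence "en B + en (1 / (p - 1)) * (8 * en B) = en (B + 1 / (p - 1) * (8 * B))"
  using B p by (simp add: ennreal_plus[symmetric] del: ennreal_plus)
  also have "B + 1 / (p - 1) * (8 * B) = (1 + 8 / (p - 1)) * B" by (simp add: algebra_simps)
  finally show ?thesis .
 qed
 finally show ?thesis .
qed

end

section \<open>Jumps from the moments of one increment\<close>

context spectral_superprocess
begin

definition phi_mass :: "real => 'w => real" where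
 "phi_mass t w = (LINT y|X t w. \<Phi> y)"

lemma test_function_phi: "test_function \<Phi> phi_bound"
 using test_function_Phi[of 1] by simp

lemma phi_mass_nonneg: "0 <= phi_mass t w"
 unfolding phi_mass_def using Phi_nonneg by simp

lemma phi_mass_measurable: "0 <= t ==> phi_mass t : bm W"
 unfolding phi_mass_def[abs_def] by (rule X_integral_measurable[OF test_function_phi])

lemma phi_mass_nn_integral: "0 <= t ==> w : space W ==> phi_mass t w = enn2real (NN y|X t w. en (\<Phi> y))"
 unfolding phi_mass_def
 using test_function_integral(2,3)[OF test_function_phi X_finite_measure, of t w] by simp

lemma Phi_ennreal_measurable: "(%y. en (\<Phi> y)) : bm B_del"
 using Phi_measurable by simp

lemma phi_mass_measurable_G: "0 <= s ==> s <= t ==> phi_mass s : bm (G (en t))"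
 by (subst measurable_congI[OF phi_mass_nn_integral])
  (auto simp: mass.space_F intro!: borel_measurable_enn2real X_nn_integral_measurable_G Phi_ennreal_measurable)

lemma Phi_integral_measurable_weak: "(%\<eta>. \<integral>y. \<Phi> y \<partial>\<eta>) : bm (topo_borel (weak_topology E_del))"
proof -
 have e: "(LINT y|\<eta>. \<Phi> y) = enn2real (NN y|\<eta>. en (\<Phi> y))" if "\<eta> : space (topo_borel (weak_topology E_del))" for \<eta>
  using test_function_integral(2,3)[OF test_function_phi, of \<eta>] that by (simp add: space_topo_borel)
 show ?thesis
  by (subst measurable_congI[OF e])
  (auto intro!: borel_measurable_enn2real weak_topology_nn_integral_measurable locally_compact Phi_ennreal_measurable)
qed

text \<open>The Markov property for functionals of the masses at two times, in a form that does not refer to conditional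
 expectations.\<close>

lemma markov_phi_mass:
 assumes \<mu>: "\<mu> : MF" and t: "0 <= t" and s: "0 <= s"
  and h: "(%z. h (fst z) (snd z)) : bm (borel \<Otimes> borel)"
 shows "(NN w|P \<mu>. h (phi_mass t w) (phi_mass (t + s) w)) = (NN w|P \<mu>. (NN w'|P (X t w). h (phi_mass t w) (phi_mass s w')))"
proof -
 let ?N = "G (en t) \<Otimes> topo_borel (weak_topology E_del)"
 have "(%z. (phi_mass t (fst z), \<integral>y. \<Phi> y \<partial>snd z)) : ?N \<rightarrow>\<^sub>M borel \<Otimes> borel"
  by (intro measurable_Pair measurable_compose[OF measurable_fst phi_mass_measurable_G[OF t order_refl]]
  measurable_compose[OF measurable_snd Phi_integral_measurable_weak])
 from measurable_compose[OF this h]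
 have "(%(w, \<eta>). h (phi_mass t w) (LINT y|\<eta>. \<Phi> y)) : bm ?N" by (simp add: case_prod_beta')
 from mass.markov_nn_integral[OF _ t s this, of \<mu>] \<mu> show ?thesis by (simp add: phi_mass_def)
qed

text \<open>The moments of the jump measure \<open>\<pi>\<close>, scaled by \<open>\<phi>\<close> and averaged over \<open>\<nu>\<close>.\<close>

definition nu_jump :: "(real => ennreal) => ennreal" where
 "nu_jump f = (NN x|\<nu>. big_jump \<pi> \<phi> x f)"

lemma nu_measurable: "f : bm borel ==> f : bm \<nu>"
 by (subst measurable_cong_sets[OF nu(1) refl])

lemma big_jump_measurable_x:
 assumes f: "f : bm borel"
 shows "(%x. big_jump \<pi> \<phi> x f) : bm borel"
proof -
 have "(%(x :: 'e, r). f r) : bm (borel \<Otimes> borel)"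
  using measurable_compose[OF measurable_snd f] by (simp add: case_prod_beta')
 from branching.big_jump_measurable[OF this phi_measurable] show ?thesis .
qed

lemma nu_jump_add: "f : bm borel ==> g : bm borel ==> nu_jump (%r. f r + g r) = nu_jump f + nu_jump g"
 unfolding nu_jump_def by (simp add: branching.big_jump_add nn_integral_add nu_measurable big_jump_measurable_x)

lemma nu_jump_cmult: "f : bm borel ==> nu_jump (%r. c * f r) = c * nu_jump f"
 unfolding nu_jump_def by (simp add: branching.big_jump_cmult nn_integral_cmult nu_measurable big_jump_measurable_x)

lemma nu_jump_mono: "(\<And>r. 1 <= r ==> f r <= g r) ==> nu_jump f <= nu_jump g"
 unfolding nu_jump_def by (intro nn_integral_mono branching.big_jump_mono phi(2))

lemma nu_jump_SUP:
 assumes f: "\<And>i::nat. f i : bm borel" and inc: "incseq f"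
 shows "nu_jump (%r. SUP i. f i r) = (SUP i. nu_jump (f i))"
 unfolding nu_jump_def branching.big_jump_SUP[OF f inc]
proof (rule nn_integral_monotone_convergence_SUP)
 have "f m r <= f n r" if "m <= n" for m n r using inc that by (auto simp: incseq_def le_fun_def)
 thus "incseq (%i x. big_jump \<pi> \<phi> x (f i))"
  unfolding incseq_def le_fun_def by (intro allI impI branching.big_jump_mono phi(2)) auto
qed (intro nu_measurable big_jump_measurable_x f)

text \<open>Averaged over the invariant measure, a cell loses its dependence on the motion.\<close>

lemma nu_cell:
 assumes f: "f : bm borel"
 shows "(NN x|\<nu>. cell j f (Some x))
  = (\<integral>\<^sup>+u\<in>{real j..real j + 1}. en (exp (l * u)) \<partial>lborel) * nu_jump (%r. f (r * exp (- (l * real j))))"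
proof -
 interpret prob_space \<nu> by (rule nu(2))
 interpret pair_sigma_finite lborel \<nu> ..
 let ?h = "scaled_big_jump j f"
 let ?I = "ind {real j..real j + 1} :: real => ennreal"
 note hm = scaled_big_jump_measurable[OF f, of j]
 have "(%z :: real \<times> 'e. MS (max 0 (fst z)) (ext0 ?h) (Some (snd z))) : bm (borel \<Otimes> borel)"
  by (rule MS_joint_measurable[OF ext0_scaled_big_jump_measurable[OF f]]) (auto intro!: measurable_compose[OF measurable_snd Some_measurable])
 hence m: "(%(u, x). MS (max 0 u) (ext0 ?h) (Some x) * ?I u) : bm (lborel \<Otimes> \<nu>)"
  unfolding measurable_cong_sets[OF sets_pair_measure_cong[OF sets_lborel nu(1)] refl] case_prod_beta'
  by (intro borel_measurable_times_ennreal) (auto intro!: measurable_compose[OF measurable_fst borel_measurable_indicator])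
 have "(NN x|\<nu>. cell j f (Some x)) = (NN u|lborel. (NN x|\<nu>. MS (max 0 u) (ext0 ?h) (Some x) * ?I u))"
  unfolding cell_def using Fubini'[OF m] by simp
 also have "... = (NN u|lborel. (en (exp (l * u)) * ?I u) * (NN x|\<nu>. ?h x))"
 proof (rule nn_integral_cong)
  fix u :: real
  show "(NN x|\<nu>. MS (max 0 u) (ext0 ?h) (Some x) * ?I u) = (en (exp (l * u)) * ?I u) * (NN x|\<nu>. ?h x)"
  proof (cases "u : {real j..real j + 1}")
  case True
  hence "0 <= u" "max 0 u = u" by auto
  with True nu_MS[OF _ hm, of u] show ?thesis by simp
  qed simp
 qed
 also have "... = (NN u|lborel. en (exp (l * u)) * ?I u) * (NN x|\<nu>. ?h x)"
  by (rule nn_integral_multc) simp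
 finally show ?thesis unfolding nu_jump_def scaled_big_jump_def .
qed

text \<open>Over a time span of length one a cumulant retains a fixed proportion of the eigenfunction. Here the discount rate is
 bounded uniformly in the span.\<close>

lemma cumulant_Phi_ge:
 assumes th: "0 <= th" "th <= 1" and r: "0 <= r" "r <= 1"
 shows "exp (- branching.psi0_slope (phi_bound * exp beta_bound)) * th * \<Phi> y <= cumulant (%z. th * \<Phi> z) r y"
proof -
  let ?a0 = "%z. th * \<Phi> z"
  let ?b0 = "th * exp (l * r) * \<Phi> y"
 let ?L = "branching.psi0_slope (phi_bound * exp beta_bound)"
 let ?Lr = "branching.psi0_slope (phi_bound * exp (beta_bound * r))"
 have pb: "0 <= phi_bound" using phi_bound(1) by simp
 have tf: "test_function ?a0 phi_bound"
  using test_functionD[OF test_function_Phi[OF th(1)]] mult_right_mono[OF th(2) pb] unfolding test_function_def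
  by (auto intro: order_trans)
 have tf0: "test_function (%_. 0) phi_bound" unfolding test_function_def using pb by simp
 have "en (exp (- (?Lr * r))) * MS r (%z. en (th * \<Phi> z - 0)) y
  <= en (cumulant (%_. 0) r y) + en (exp (- (?Lr * r))) * MS r (%z. en (th * \<Phi> z - 0)) y" by simp
 also have "... <= en (cumulant ?a0 r y)"
  using th Phi_nonneg by (intro cumulant_comparison[OF tf tf0 _ r(1)]) simp
 finally have "en (exp (- (?Lr * r)) * ?b0) <= en (cumulant ?a0 r y)"
  by (simp add: MS_Phi[OF r(1) th(1)] ennreal_mult')
 hence a: "exp (- (?Lr * r)) * ?b0 <= cumulant ?a0 r y"
  using cumulant_nonneg[OF tf r(1)] by (simp add: ennreal_le_iff)
 have K: "phi_bound * exp (beta_bound * r) <= phi_bound * exp beta_bound"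
  using pb beta_bound(1) r by (intro mult_left_mono) (auto simp: mult_left_le)
 have "?Lr <= ?L"
  unfolding branching.psi0_slope_def
  by (rule add_mono[OF mult_left_mono[OF K branching.alpha_bound(1)] mult_right_mono[OF max.mono[OF order_refl K] branching.jump_bound(1)]])
 moreover have "0 <= ?L" using pb by (intro branching.psi0_slope_nonneg) simp
 ultimately have "?Lr * r <= ?L" using mult_mono[of ?Lr ?L r 1] r by simp
 hence "exp (- ?L) * (th * 1 * \<Phi> y) <= exp (- (?Lr * r)) * ?b0"
  using th r l_pos Phi_nonneg by (intro mult_mono) auto
 with a show ?thesis by (simp add: mult.assoc)
qed

text \<open>The non-linear part of the mechanism is monotone, so the lower bound on the cumulant can be inserted; the scale
 \<open>k <= 1\<close> is then taken out of the truncated square at the price of \<open>k\<^sup>2\<close>.\<close>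

lemma deficit_ge_nu_jump:
 obtains c where "0 < c"
  "\<And>th. 0 <= th ==> th <= 1 ==> en c * nu_jump (%r. en (qmin (th * r))) <= (NN x|\<nu>. en (deficit th 1 (Some x)))"
proof -
  let ?a0 = "\<integral>\<^sup>+u\<in>{0..1}. en (exp (l * u)) \<partial>lborel"
  let ?b0 = "phi_bound * exp beta_bound"
 define k where "k = exp (- branching.psi0_slope ?b0) * exp (- l)"
 have "0 <= branching.psi0_slope ?b0" using phi_bound(1) by (intro branching.psi0_slope_nonneg) simp
 hence k: "0 < k" "k <= 1" unfolding k_def using l_pos by (auto intro!: mult_le_one)
 have main: "en (k\<^sup>2 / 4) * nu_jump (%r. en (qmin (th * r))) <= (NN x|\<nu>. en (deficit th 1 (Some x)))"
  if th: "0 <= th" "th <= 1" for th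
 proof -
  let ?q = "%r. en (qmin (th * r))"
  let ?th = "th * exp (- (l * 1))"
  have th': "0 <= ?th" "?th <= 1" using th l_pos by (auto intro!: mult_le_one)
  have qm: "?q : bm borel" by simp
  have point: "en (k\<^sup>2 / 4) * ext0 (scaled_big_jump 0 ?q) z <= en (psi0_bar z (cumulant (%z. ?th * \<Phi> z) (1 - u) z))"
  if u: "0 <= u" "u <= 1" for u z
  proof (cases z)
  case (Some x)
  have "k * th * \<phi> x = exp (- branching.psi0_slope ?b0) * ?th * \<Phi> z" by (simp add: k_def Some)
  also have "... <= cumulant (%z. ?th * \<Phi> z) (1 - u) z" using u by (intro cumulant_Phi_ge th') auto
  finally have V: "k * th * \<phi> x <= cumulant (%z. ?th * \<Phi> z) (1 - u) z" .
  have "en (k\<^sup>2 / 4) * big_jump \<pi> \<phi> x ?q = en (1/4) * big_jump \<pi> \<phi> x (%r. en (k\<^sup>2) * ?q r)"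
  unfolding branching.big_jump_cmult[OF qm] using ennreal_mult'[of "1/4" "k\<^sup>2"] by (simp add: mult.assoc)
  also have "... <= en (1/4) * big_jump \<pi> \<phi> x (%r. en (qmin ((k * th) * r)))"
  using qmin_mult_ge[of k] k
  by (intro mult_left_mono branching.big_jump_mono phi(2)) (auto simp: ennreal_mult'[symmetric] mult.assoc intro!: ennreal_leI)
  also have "... <= en (psi0 \<alpha> \<pi> x (k * th * \<phi> x))"
  using k th by (intro branching.psi0_ge_big_jump phi(2)) auto
  also have "... <= en (psi0 \<alpha> \<pi> x (cumulant (%z. ?th * \<Phi> z) (1 - u) z))"
  using k th phi(2)[of x] by (intro ennreal_leI branching.psi0_mono_Lipschitz(1)[OF _ V order_refl]) (auto simp: less_imp_le)
  finally show ?thesis by (simp add: Some scaled_big_jump_def)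
  qed simp
  have "en (k\<^sup>2 / 4) * cell 0 ?q y <= en (deficit th 1 y)" for y
  proof -
  have "en (k\<^sup>2 / 4) * cell 0 ?q y = (NN u|lborel. en (k\<^sup>2 / 4) * (MS (max 0 u) (ext0 (scaled_big_jump 0 ?q)) y * ind {real 0..real 0 + 1} u))"
  unfolding cell_def using cell_integrand_measurable[OF qm] by (intro nn_integral_cmult[symmetric]) simp
  also have "... <= (\<integral>\<^sup>+u\<in>{0..1}. MS u (%z. en (psi0_bar z (cumulant (%z. ?th * \<Phi> z) (1 - u) z))) y \<partial>lborel)"
  proof (rule nn_integral_mono)
  fix u :: real
  show "en (k\<^sup>2 / 4) * (MS (max 0 u) (ext0 (scaled_big_jump 0 ?q)) y * ind {real 0..real 0 + 1} u)
  <= MS u (%z. en (psi0_bar z (cumulant (%z. ?th * \<Phi> z) (1 - u) z))) y * ind {0..1} u"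
  proof (cases "0 <= u \<and> u <= 1")
  case True
  hence u: "0 <= u" "u <= 1" by auto
  have "en (k\<^sup>2 / 4) * MS u (ext0 (scaled_big_jump 0 ?q)) y = MS u (%z. en (k\<^sup>2 / 4) * ext0 (scaled_big_jump 0 ?q) z) y"
  by (rule MS_cmult[OF u(1) ext0_scaled_big_jump_measurable[OF qm], symmetric])
  also have "... <= MS u (%z. en (psi0_bar z (cumulant (%z. ?th * \<Phi> z) (1 - u) z))) y"
  by (rule MS_mono[OF point[OF u]])
  finally show ?thesis using u by simp
  qed simp
  qed
  also have "... = en (deficit th 1 y)" by (rule deficit_eq(1)[OF th(1), symmetric]) simp
  finally show ?thesis .
  qed
  hence "(NN x|\<nu>. en (k\<^sup>2 / 4) * cell 0 ?q (Some x)) <= (NN x|\<nu>. en (deficit th 1 (Some x)))"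
  by (intro nn_integral_mono)
  moreover have "(NN x|\<nu>. en (k\<^sup>2 / 4) * cell 0 ?q (Some x)) = en (k\<^sup>2 / 4) * (NN x|\<nu>. cell 0 ?q (Some x))"
  by (intro nn_integral_cmult nu_measurable measurable_compose[OF Some_measurable cell_measurable[OF qm]])
  moreover have "nu_jump ?q <= (NN x|\<nu>. cell 0 ?q (Some x))"
  proof -
  have "(\<integral>\<^sup>+u\<in>{0..1::real}. 1 \<partial>lborel) <= ?a0"
  using l_pos by (intro nn_integral_mono) (auto simp: indicator_def)
  hence "1 * nu_jump ?q <= ?a0 * nu_jump ?q"
  by (intro mult_right_mono) auto
  thus ?thesis unfolding nu_cell[OF qm] by simp
  qed
  ultimately show ?thesis by (auto intro: order_trans[OF mult_left_mono])
 qed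
 show thesis by (rule that[of "k\<^sup>2 / 4"]) (use k main in auto)
qed

text \<open>For negative arguments \<open>exprem\<close> is not dominated by truncated squares, but \<open>exp (- m) exprem u <=
 qmin u\<close> for \<open>u >= - m\<close>, and a centred increment is bounded below by minus the mass
 \<open>m\<close> at the earlier time. Damped by \<open>exp (- m)\<close>, the expectation of the remainder can be
 computed with the Markov property. The damped expectation of the deficit is a difference of two Laplace functionals,
 bounded from below through the comparison of cumulants, and the mean semigroup at a late time replaces the initial
 state by a multiple of \<open>\<nu>\<close>.\<close>

lemma increment_moment_imp_nu_jump:
 assumes \<mu>: "\<mu> : MF" and m0: "0 < (LINT y|\<mu>. \<Phi> y)" and p: "1 < p" "p <= 2"
 obtains t0 where "\<And>t. t0 <= t ==> (NN w|P \<mu>. en (\<bar>exp (- l) * phi_mass (t + 1) w - phi_mass t w\<bar> powr p)) < \<infinity>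
  ==> nu_jump (%r. en (\<bar>r\<bar> powr p)) < \<infinity>"
proof -
  let ?a0 = "%th Y. \<integral>\<^sup>+w. en (qmin (th * Y w)) \<partial>P \<mu>"
  let ?b0 = "%t w. \<integral>y. \<Phi> y \<partial>X t w"
  let ?c0 = "%th. %r. en (qmin (th * r))"
  let ?d0 = "%t w th. \<integral>\<^sup>+w'. en (exp (- phi_mass t w)) * en (exprem (th * (exp (- l) * phi_mass 1 w' - phi_mass t w))) \<partial>P (X t w)"
  let ?e0 = "%f t w. - (LINT y|X t w. f y)"
  let ?f0 = "phi_bound * branching.jump_bound * phi_bound"
  let ?g0 = "%r. en (\<bar>r\<bar> powr p) * ind {r. 1 / 1 <= \<bar>r\<bar>} r"
 interpret prob_space "P \<mu>" by (rule prob_P[OF \<mu>])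
 obtain t0 where t0: "1 < t0" "\<And>t h x. t0 <= t ==> h : bm borel ==>
  en (1/2 * exp (l * t) * \<phi> x) * (NN x|\<nu>. h x) <= MS t (ext0 h) (Some x)"
  using MS_ge_nu by blast
 obtain c where c: "0 < c" "\<And>th. 0 <= th ==> th <= 1 ==>
  en c * nu_jump (?c0 th) <= (NN x|\<nu>. en (deficit th 1 (Some x)))"
  using deficit_ge_nu_jump by blast
 let ?m0 = "\<integral>y. \<Phi> y \<partial>\<mu>"
 have pb: "0 <= phi_bound" using phi_bound(1) by simp
 have main: "nu_jump (%r. en (\<bar>r\<bar> powr p)) < \<infinity>"
  if t: "t0 <= t" and fin: "(NN w|P \<mu>. en (\<bar>exp (- l) * phi_mass (t + 1) w - phi_mass t w\<bar> powr p)) < \<infinity>" for t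
 proof -
  have t': "0 <= t" "0 <= t + 1" using t t0(1) by auto
  define Y where "Y w = exp (- l) * phi_mass (t + 1) w - phi_mass t w" for w
  have Ym: "Y : bm (P \<mu>)"
  unfolding Y_def[abs_def] using P_measurable[OF \<mu> phi_mass_measurable[OF t'(1)]] P_measurable[OF \<mu> phi_mass_measurable[OF t'(2)]] by simp
  define a where "a = exp (- (branching.psi0_slope (2 * phi_bound * exp (beta_bound * t)) * t))"
  define A where "A = exp (l * t) * ?m0"
  define v where "v = (LINT y|\<mu>. cumulant \<Phi> t y)"
  define b where "b = exp (- v) * exp (- A) * a * (1/2 * exp (l * t) * ?m0) * c"
  have a1: "a <= 1" "0 < a" unfolding a_def using t' pb by (auto intro!: mult_nonneg_nonneg branching.psi0_slope_nonneg)
  have b: "0 < b" unfolding b_def using a1 m0 c(1) by simp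
  have low: "en b * nu_jump (?c0 th) <= (?a0 th Y)"
  if th: "0 < th" "th <= 1" for th
  proof -
  have th0: "0 <= th" using th by simp
  let ?D = "deficit th 1"
  have tD: "test_function ?D (th * phi_bound)" by (rule test_function_deficit[OF th0]) simp
  have DPhi: "?D y <= \<Phi> y" for y
  using deficit_eq(3)[OF th0, of 1 y] mult_right_mono[OF th(2) Phi_nonneg[of y]] by simp
  have tD1: "test_function ?D phi_bound"
  using test_functionD(1,2)[OF tD] order_trans[OF DPhi Phi_le] unfolding test_function_def by blast
  have t2: "test_function (%z. \<Phi> z + ?D z) (2 * phi_bound)"
  using test_functionD(1,2)[OF tD1] test_functionD(1,2)[OF test_function_phi] add_mono[OF test_functionD(3)[OF test_function_phi] test_functionD(3)[OF tD1]]
  unfolding test_function_def by auto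
  have t1: "test_function \<Phi> (2 * phi_bound)"
  using Phi_measurable Phi_nonneg order_trans[OF Phi_le, of "2 * phi_bound"] pb unfolding test_function_def by simp
  define x where "x = enn2real (NN y|\<mu>. MS t (%z. en (?D z)) y)"
  have xle: "(NN y|\<mu>. MS t (%z. en (?D z)) y) <= en A"
  proof -
  have "(NN y|\<mu>. MS t (%z. en (?D z)) y) <= (NN y|\<mu>. MS t (%z. en (\<Phi> z)) y)"
  by (intro nn_integral_mono MS_mono ennreal_leI DPhi)
  also have "... = (NN w|P \<mu>. en (?b0 t w))"
  by (rule mean_formula_bounded[OF test_function_phi t'(1) \<mu>, symmetric])
  also have "... = en A"
  using nn_integral_eq_integral[OF mass_mean(1)[OF \<mu> t'(1)]] Phi_nonneg mass_mean(2)[OF \<mu> t'(1)] by (simp add: A_def)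
  finally show ?thesis .
  qed
  have x: "en x = (NN y|\<mu>. MS t (%z. en (?D z)) y)" "0 <= x" "x <= A"
  proof -
  show x1: "en x = (NN y|\<mu>. MS t (%z. en (?D z)) y)"
  unfolding x_def using xle by (intro ennreal_enn2real) (auto simp: less_top[symmetric] top_unique)
  show "0 <= x" unfolding x_def by simp
  have "0 <= A" unfolding A_def using m0 by simp
  thus "x <= A" using xle unfolding x1[symmetric] by (simp add: ennreal_le_iff)
  qed
  have xlow: "en (1/2 * exp (l * t) * ?m0) * (en c * nu_jump (?c0 th)) <= en x"
  proof -
  let ?h = "%x. en (?D (Some x))"
  have hm: "?h : bm borel"
  using measurable_compose[OF Some_measurable test_functionD(1)[OF tD]] by simp
  have e: "(%z. en (?D z)) = ext0 ?h"
  proof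
  fix z show "en (?D z) = ext0 ?h z"
  using deficit_eq(2,3)[OF th0, of 1 None] by (cases z) auto
  qed
  have "en (1/2 * exp (l * t) * ?m0) * (en c * nu_jump (?c0 th))
  <= en (1/2 * exp (l * t)) * en ?m0 * (NN x|\<nu>. ?h x)"
  using c(2)[OF th0 th(2)] by (subst ennreal_mult'[symmetric]) (auto intro!: mult_left_mono)
  also have "... = (NN y|\<mu>. (en (1/2 * exp (l * t)) * en (\<Phi> y)) * (NN x|\<nu>. ?h x))"
  using finite_measures_measurable[OF \<mu> Phi_ennreal_measurable]
  by (simp add: nn_integral_multc nn_integral_cmult test_function_integral(2)[OF test_function_phi \<mu>])
  also have "... <= (NN y|\<mu>. MS t (%z. en (?D z)) y)"
  proof (rule nn_integral_mono)
  fix y show "(en (1/2 * exp (l * t)) * en (\<Phi> y)) * (NN x|\<nu>. ?h x) <= MS t (%z. en (?D z)) y"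
  proof (cases y)
  case (Some x)
  thus ?thesis unfolding e using t0(2)[OF t hm, of x] ennreal_mult'[of "1/2 * exp (l * t)" "\<phi> x"] by simp
  qed simp
  qed
  finally show ?thesis unfolding x(1) .
  qed
  have ax: "v + a * x <= (LINT y|\<mu>. cumulant (%z. \<Phi> z + ?D z) t y)"
  proof -
  note tV = cumulant_test_function[OF t2 t'(1)] and tV1 = cumulant_test_function[OF t1 t'(1)]
  have cm: "en (cumulant \<Phi> t y) + en a * MS t (%z. en (?D z)) y <= en (cumulant (%z. \<Phi> z + ?D z) t y)" for y
  using cumulant_comparison[OF t2 t1 _ t'(1), of y] test_functionD(2)[OF tD] unfolding a_def by simp
  have m1: "(%y. en (cumulant \<Phi> t y)) : bm \<mu>"
  using test_functionD(1)[OF tV1] by (intro finite_measures_measurable[OF \<mu>]) simp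
  have m2: "MS t (%z. en (?D z)) : bm \<mu>"
  using test_functionD(1)[OF tD] t' by (intro finite_measures_measurable[OF \<mu>] MS_measurable) auto
  have v0: "0 <= v" unfolding v_def by (rule test_function_integral(3)[OF tV1 \<mu>])
  have "en (v + a * x) = en v + en a * en x"
  using v0 a1 x(2) by (simp add: ennreal_mult')
  also have "... = (NN y|\<mu>. en (cumulant \<Phi> t y) + en a * MS t (%z. en (?D z)) y)"
  unfolding x(1) v_def test_function_integral(2)[OF tV1 \<mu>, symmetric] using m1 m2
  by (subst nn_integral_add) (simp_all add: nn_integral_cmult)
  also have "... <= (NN y|\<mu>. en (cumulant (%z. \<Phi> z + ?D z) t y))" by (rule nn_integral_mono[OF cm])
  also have "... = en (LINT y|\<mu>. cumulant (%z. \<Phi> z + ?D z) t y)" by (rule test_function_integral(2)[OF tV \<mu>])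
  finally show ?thesis using test_function_integral(3)[OF tV \<mu>] by (simp add: ennreal_le_iff)
  qed
  let ?XD = "%w. \<integral>y. ?D y \<partial>X t w"
  have lap: "integrable (P \<mu>) (%w. exp (?e0 f t w))" "(LINT w|P \<mu>. exp (?e0 f t w)) = exp (- (LINT y|\<mu>. cumulant f t y))"
  if f: "test_function f B" for f B
  proof -
  show "(LINT w|P \<mu>. exp (?e0 f t w)) = exp (- (LINT y|\<mu>. cumulant f t y))"
  by (rule cumulant_laplace[OF f \<mu> t'(1)])
  show "integrable (P \<mu>) (%w. exp (?e0 f t w))"
  proof (rule integrable_const_bound[of _ 1])
  show "(%w. exp (?e0 f t w)) : bm (P \<mu>)"
  using P_measurable[OF \<mu> X_integral_measurable[OF f t'(1)]] by simp
  qed (use test_functionD(2)[OF f] in simp)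
  qed
  have split: "(LINT y|X t w. \<Phi> y + ?D y) = phi_mass t w + ?XD w" if "w : space W" for w
  unfolding phi_mass_def using that t'
  by (intro Bochner_Integration.integral_add test_function_integral(1)[OF test_function_phi] test_function_integral(1)[OF tD] X_finite_measure)
  have XD0: "0 <= ?XD w" for w using test_functionD(2)[OF tD] by simp
  have "exp (- v) * exp (- A) * (a * x) <= exp (- v) * (1 - exp (- (a * x)))"
  proof -
  have ax0: "0 <= a * x" "a * x <= A" using a1 x mult_mono[of a 1 x A] by auto
  have "exp (- A) * (a * x) <= exp (- (a * x)) * (a * x)" using ax0 by (intro mult_right_mono) auto
  also have "... <= exp (- (a * x)) * (exp (a * x) - 1)"
  proof (rule mult_left_mono)
  show "a * x <= exp (a * x) - 1" using exp_ge_add_one_self[of "a * x"] by linarith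
  qed simp
  also have "... = 1 - exp (- (a * x))" by (simp add: right_diff_distrib flip: exp_add)
  finally show ?thesis by (simp add: mult.assoc)
  qed
  also have "... = exp (- v) - exp (- (v + a * x))" by (simp add: right_diff_distrib flip: exp_add)
  also have "... <= exp (- v) - exp (- (LINT y|\<mu>. cumulant (%z. \<Phi> z + ?D z) t y))" using ax by simp
  also have "... = (LINT w|P \<mu>. exp (- (?b0 t w)) - exp (- (LINT y|X t w. \<Phi> y + ?D y)))"
  unfolding v_def using lap[OF t1] lap[OF t2] by simp
  finally have "en (exp (- v) * exp (- A) * (a * x))
  <= en (LINT w|P \<mu>. exp (- (?b0 t w)) - exp (- (LINT y|X t w. \<Phi> y + ?D y)))" by (rule ennreal_leI)
  also have "... = (NN w|P \<mu>. en (exp (- (?b0 t w)) - exp (- (LINT y|X t w. \<Phi> y + ?D y))))"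
  proof (rule nn_integral_eq_integral[symmetric])
  show "AE w in P \<mu>. 0 <= exp (- (?b0 t w)) - exp (- (LINT y|X t w. \<Phi> y + ?D y))"
  using split XD0 by (intro AE_I2) (simp add: space_P[OF \<mu>] phi_mass_def)
  qed (intro Bochner_Integration.integrable_diff lap(1)[OF t1] lap(1)[OF t2])
  also have "... <= (NN w|P \<mu>. en (exp (- phi_mass t w)) * en (exp (?XD w) - 1))"
  proof (rule nn_integral_mono)
  fix w assume "w : space (P \<mu>)"
  hence "w : space W" by (simp add: space_P[OF \<mu>])
  from split[OF this] have "exp (- (?b0 t w)) - exp (- (LINT y|X t w. \<Phi> y + ?D y)) = exp (- phi_mass t w) * (1 - exp (- ?XD w))"
  by (simp add: phi_mass_def right_diff_distrib flip: exp_add)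
  also have "... <= exp (- phi_mass t w) * (exp (?XD w) - 1)"
  proof (rule mult_left_mono)
  show "1 - exp (- ?XD w) <= exp (?XD w) - 1"
  using exp_ge_add_one_self[of "?XD w"] exp_ge_add_one_self[of "- ?XD w"] by linarith
  qed simp
  finally show "en (exp (- (?b0 t w)) - exp (- (LINT y|X t w. \<Phi> y + ?D y))) <= en (exp (- phi_mass t w)) * en (exp (?XD w) - 1)"
  by (simp add: ennreal_mult'[symmetric] ennreal_leI)
  qed
  also have "... = (NN w|P \<mu>. (?d0 t w th))"
  proof (rule nn_integral_cong)
  fix w assume "w : space (P \<mu>)"
  hence X: "X t w : MF" using t' by (intro X_finite_measure) (simp_all add: space_P[OF \<mu>])
  have "(%w'. en (exprem (th * (exp (- l) * phi_mass 1 w' - phi_mass t w)))) : bm (P (X t w))"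
  using P_measurable[OF X phi_mass_measurable[of 1]] unfolding exprem_def by simp
  thus "en (exp (- phi_mass t w)) * en (exp (?XD w) - 1)
  = (?d0 t w th)"
  using exprem_expectation[OF X _ th0, of 1] by (simp add: nn_integral_cmult phi_mass_def)
  qed
  also have "... = (NN w|P \<mu>. en (exp (- phi_mass t w)) * en (exprem (th * Y w)))"
  unfolding Y_def
  by (rule markov_phi_mass[OF \<mu> t'(1), of 1 "%m m'. en (exp (- m)) * en (exprem (th * (exp (- l) * m' - m)))", symmetric])
  (simp_all add: exprem_def)
  also have "... <= (?a0 th Y)"
  proof (rule nn_integral_mono)
  fix w
  have "- phi_mass t w <= th * (- phi_mass t w)" using mult_right_mono[OF th(2) phi_mass_nonneg[of t w]] by simp
  also have "... <= th * Y w" unfolding Y_def using th0 phi_mass_nonneg by (intro mult_left_mono) auto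
  finally show "en (exp (- phi_mass t w)) * en (exprem (th * Y w)) <= en (qmin (th * Y w))"
  using exp_exprem_le_qmin[OF phi_mass_nonneg] by (subst ennreal_mult'[symmetric]) (auto intro: ennreal_leI)
  qed
  finally have up: "en (exp (- v) * exp (- A) * (a * x)) <= (?a0 th Y)" .
  have "en b * nu_jump (?c0 th)
  = en (exp (- v) * exp (- A) * a) * (en (1/2 * exp (l * t) * ?m0) * (en c * nu_jump (?c0 th)))"
  unfolding b_def using a1 m0 c(1) by (simp only: mult.assoc ennreal_mult' mult_nonneg_nonneg less_imp_le exp_ge_zero zero_le_divide_1_iff zero_le_numeral)
  also have "... <= en (exp (- v) * exp (- A) * a) * en x" by (intro mult_left_mono xlow) simp
  also have "... = en (exp (- v) * exp (- A) * (a * x))"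
  using a1 by (subst ennreal_mult'[symmetric]) (simp_all add: mult.assoc)
  finally show ?thesis using up by (rule order_trans)
  qed
  have "\<exists>\<G>. sets \<G> = sets borel \<and> (\<forall>f\<in>bm borel. (NN r|\<G>. f r) = nu_jump f)"
  by (rule functional_is_integral[of nu_jump, OF nu_jump_add nu_jump_cmult nu_jump_SUP]) auto
  then obtain \<G> where \<G>: "sets \<G> = sets borel" "\<And>f. f : bm borel ==> (NN r|\<G>. f r) = nu_jump f"
  by blast
  have finG: "finite_measure \<G>"
  proof (rule finite_measureI)
  interpret \<nu>: prob_space \<nu> by (rule nu(2))
  have "emeasure \<G> (space \<G>) = (NN r|\<G>. 1)" by simp
  also have "... = nu_jump (%_. 1)" by (rule \<G>(2)) simp
  also have "... <= (NN x|\<nu>. en ?f0)"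
  unfolding nu_jump_def
  proof (rule nn_integral_mono)
  fix x
  have "big_jump \<pi> \<phi> x (%_. 1) <= big_jump \<pi> \<phi> x (%r. en r)"
  using phi(2) by (intro branching.big_jump_mono) (auto simp: ennreal_1[symmetric] simp del: ennreal_1 intro: ennreal_leI)
  also have "... <= en (phi_bound * branching.jump_bound * \<phi> x)"
  by (rule branching.big_jump_first_moment[OF phi(2) phi_bound(2,1)])
  also have "... <= en ?f0"
  using pb branching.jump_bound(1) phi_bound(2) by (intro ennreal_leI mult_left_mono) auto
  finally show "big_jump \<pi> \<phi> x (%_. 1) <= en ?f0" .
  qed
  also have "... < \<infinity>" by (simp add: \<nu>.emeasure_space_1)
  finally show "emeasure \<G> (space \<G>) \<noteq> \<infinity>" by simp
  qed
  have "(NN r|\<G>. en (\<bar>r\<bar> powr p) * ind {r. 1 / 1 <= \<bar>r\<bar>} r)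
  <= en (1 / (p - 1)) * (en (1 / b) * (NN w|P \<mu>. en (\<bar>Y w\<bar> powr p)))"
  proof (rule tail_moment_comparison[OF _ _ _ Ym p])
  show "sigma_finite_measure \<G>" using finG by (simp add: finite_measure_def)
  show "sigma_finite_measure (P \<mu>)" by (rule sigma_finite_measure_axioms)
  show "(%r. r) : bm \<G>" by (simp add: measurable_cong_sets[OF \<G>(1) refl])
  fix th :: real assume th: "0 < th" "th <= 1"
  have "(NN r|\<G>. en (qmin (th * r))) = en (1 / b) * (en b * nu_jump (?c0 th))"
  unfolding mult.assoc[symmetric] using b by (subst ennreal_mult'[symmetric]) (simp_all add: \<G>(2))
  also have "... <= en (1 / b) * (?a0 th Y)" by (intro mult_left_mono low th) simp
  finally show "(NN r|\<G>. en (qmin (th * r))) <= en (1 / b) * (?a0 th Y)" .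
  qed simp
  also have "... < \<infinity>" using fin unfolding Y_def by (simp add: ennreal_mult_less_top)
  finally have "nu_jump ?g0 < \<infinity>"
  by (subst (asm) \<G>(2)) simp_all
  moreover have "nu_jump (%r. en (\<bar>r\<bar> powr p)) <= nu_jump ?g0"
  by (rule nu_jump_mono) simp
  ultimately show ?thesis by (rule order_le_less_trans[rotated])
 qed
 show thesis by (rule that[of t0]) (rule main)
qed

end

section \<open>Moments and convergence of random integrals\<close>

lemma Lp_space_iff:
 "f : Lp_space p M \<longleftrightarrow> f : bm M \<and> (NN w|M. en (\<bar>f w\<bar> powr p)) < \<infinity>"
 unfolding Lp_space_def by (auto simp: integrable_iff_bounded)

lemma Lp_space_combination:
 assumes f: "f : Lp_space p M" and g: "g : Lp_space p M" and p: "0 <= p"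
 shows "(%w. u * f w + v * g w) : Lp_space p M"
proof -
 have m [measurable]: "f : bm M" "g : bm M" using f g by (auto simp: Lp_space_def)
 have "integrable M (%w. \<bar>u * f w + v * g w\<bar> powr p)"
 proof (rule Bochner_Integration.integrable_bound)
  show "integrable M (%w. (2 * \<bar>u\<bar>) powr p * \<bar>f w\<bar> powr p + (2 * \<bar>v\<bar>) powr p * \<bar>g w\<bar> powr p)"
  using f g by (auto simp: Lp_space_def)
  have "\<bar>u * x + v * y\<bar> powr p <= (2 * \<bar>u\<bar>) powr p * \<bar>x\<bar> powr p + (2 * \<bar>v\<bar>) powr p * \<bar>y\<bar> powr p" for x y
  proof -
  have t: "\<bar>u * x + v * y\<bar> <= \<bar>u\<bar> * \<bar>x\<bar> + \<bar>v\<bar> * \<bar>y\<bar>" using abs_triangle_ineq[of "u * x" "v * y"] by (simp add: abs_mult)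
  show ?thesis
  proof (cases "\<bar>u\<bar> * \<bar>x\<bar> <= \<bar>v\<bar> * \<bar>y\<bar>")
  case True
  hence "\<bar>u * x + v * y\<bar> <= 2 * \<bar>v\<bar> * \<bar>y\<bar>" using t by simp
  hence "\<bar>u * x + v * y\<bar> powr p <= (2 * \<bar>v\<bar> * \<bar>y\<bar>) powr p" using p by (intro powr_mono2) auto
  thus ?thesis by (simp add: powr_mult add_increasing)
  next
  case False
  hence "\<bar>u * x + v * y\<bar> <= 2 * \<bar>u\<bar> * \<bar>x\<bar>" using t by simp
  hence "\<bar>u * x + v * y\<bar> powr p <= (2 * \<bar>u\<bar> * \<bar>x\<bar>) powr p" using p by (intro powr_mono2) auto
  thus ?thesis by (simp add: powr_mult add_increasing2)
  qed
  qed
  thus "AE w in M. norm (\<bar>u * f w + v * g w\<bar> powr p) <= norm ((2 * \<bar>u\<bar>) powr p * \<bar>f w\<bar> powr p + (2 * \<bar>v\<bar>) powr p * \<bar>g w\<bar> powr p)"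
  by (auto intro!: order_trans[OF _ abs_ge_self])
 qed measurable
 thus ?thesis unfolding Lp_space_def by simp
qed

lemma Lp_space_diff: "f : Lp_space p M ==> g : Lp_space p M ==> 0 <= p ==> (%w. f w - g w) : Lp_space p M"
 using Lp_space_combination[of f p M g 1 "- 1"] by simp

lemma Lp_space_cong_AE:
 assumes "f : Lp_space p M" "g : bm M" "AE w in M. f w = g w"
 shows "g : Lp_space p M"
proof -
 have [measurable]: "f : bm M" using assms(1) by (simp add: Lp_space_def)
 have "integrable M (%w. \<bar>f w\<bar> powr p) \<longleftrightarrow> integrable M (%w. \<bar>g w\<bar> powr p)"
  using assms(2,3) by (intro integrable_cong_AE) auto
 with assms(1,2) show ?thesis by (simp add: Lp_space_def)
qed

lemma Lp_norm_eq:
 assumes "f : Lp_space p M"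
 shows "Lp_norm p M f = enn2real (NN w|M. en (\<bar>f w\<bar> powr p)) powr (1 / p)"
 unfolding Lp_norm_def using assms by (subst integral_eq_nn_integral) (auto simp: Lp_space_def)

lemma Lp_norm_le:
 assumes "(NN w|M. en (\<bar>f w\<bar> powr p)) <= en R" "f : bm M" "0 <= R" "0 < p"
 shows "f : Lp_space p M" "Lp_norm p M f <= R powr (1 / p)"
proof -
 show f: "f : Lp_space p M"
  unfolding Lp_space_iff using assms by (auto intro: order_le_less_trans)
 have "enn2real (NN w|M. en (\<bar>f w\<bar> powr p)) <= R"
  using enn2real_mono[OF assms(1)] assms(3) by simp
 thus "Lp_norm p M f <= R powr (1 / p)"
  unfolding Lp_norm_eq[OF f] using assms(4) by (intro powr_mono2) auto
qed

lemma convex_abs_powr: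
 assumes p: "1 <= p"
 shows "convex_on UNIV (%x::real. \<bar>x\<bar> powr p)"
proof (rule convex_onI)
 fix t x y :: real assume t: "0 < t" "t < 1"
 have pos: "((1 - t) * a + t * b) powr p <= (1 - t) * a powr p + t * b powr p" if "0 <= a" "0 <= b" for a b
 proof (cases "a = 0 \<or> b = 0")
  case False
  thus ?thesis
  using convex_onD[OF powr_convex[OF p], of t a b] that t by simp
 next
  case True
  have s: "s powr p <= s" if "0 < s" "s < 1" for s :: real using powr_mono'[of 1 p s] that p by simp
  show ?thesis
  using True that t s[of t] s[of "1 - t"] by (auto simp: powr_mult intro!: mult_right_mono)
 qed
 have "\<bar>(1 - t) * x + t * y\<bar> <= (1 - t) * \<bar>x\<bar> + t * \<bar>y\<bar>"
  using abs_triangle_ineq[of "(1 - t) * x" "t * y"] t by (simp add: abs_mult)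
 hence "\<bar>(1 - t) * x + t * y\<bar> powr p <= ((1 - t) * \<bar>x\<bar> + t * \<bar>y\<bar>) powr p" using p by (intro powr_mono2) auto
 also have "... <= (1 - t) * \<bar>x\<bar> powr p + t * \<bar>y\<bar> powr p" by (rule pos) auto
 finally show "\<bar>(1 - t) *\<^sub>R x + t *\<^sub>R y\<bar> powr p <= (1 - t) * \<bar>x\<bar> powr p + t * \<bar>y\<bar> powr p" by simp
qed simp

lemma nn_integral_exp_tail:
 assumes "0 < k"
 shows "(\<integral>\<^sup>+s\<in>{t<..}. en (exp (- (k * s))) \<partial>lborel) = en (exp (- (k * t)) / k)"
proof -
 have "(\<integral>\<^sup>+s\<in>{t<..}. en (exp (- (k * s))) \<partial>lborel) = (\<integral>\<^sup>+s\<in>{t..}. en (exp (- k * s)) \<partial>lborel)"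
  using AE_lborel_singleton[of t] by (intro nn_integral_cong_AE) (auto simp: indicator_def)
 also have "... = en (exp (- k * t) / k)"
  by (rule nn_integral_set_has_integral) (use has_integral_exp_minus_to_infinity[OF assms, of t] in auto)
 finally show ?thesis by simp
qed

text \<open>Hoelder with the weight \<open>exp (\<eta> s)\<close>. It is derived from the pointwise inequality of Young with a
 scale \<open>c\<close> that balances both terms.\<close>

lemma weighted_Holder:
 fixes g :: "real => real"
 assumes g [measurable]: "g : bm borel" and p: "1 < p" and \<eta>: "0 < \<eta>" and t: "0 <= t" and R: "0 < R"
  and le: "(\<integral>\<^sup>+s\<in>{t<..}. en (\<bar>g s\<bar> powr p * exp (\<eta> * s)) \<partial>lborel) <= en R"
 shows "(\<integral>\<^sup>+s\<in>{t<..}. en \<bar>g s\<bar> \<partial>lborel) <= en (((p - 1) / \<eta>) powr (1 - 1 / p) * R powr (1 / p))"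
proof -
  let ?a0 = "%s. \<bar>g s\<bar> powr p * exp (\<eta> * s)"
  let ?b0 = "%w. \<integral>\<^sup>+s\<in>{t<..}. en (exp (- (1 / w * s))) \<partial>lborel"
  let ?c0 = "%c s. c * (\<bar>g s\<bar> * exp (\<eta> * s / p))"
 define q where "q = p / (p - 1)"
 define w where "w = (p - 1) / \<eta>"
 define c where "c = (w / R) powr (1 / (p * q))"
 have q: "1 < q" "1 / p + 1 / q = 1" "1 / q = 1 - 1 / p" using p by (auto simp: q_def field_simps)
 have w: "0 < w" using p \<eta> by (simp add: w_def)
 have c: "0 < c" using w R by (simp add: c_def)
 let ?v = "w powr (1 - 1 / p) * R powr (1 / p)"
 have cp: "c powr p * R = ?v"
 proof -
  have "c powr p = (w / R) powr (1 / q)" unfolding c_def powr_powr using p q by (simp add: field_simps)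
  also have "... = w powr (1 / q) / R powr (1 / q)" using w R by (simp add: powr_divide)
  finally have "c powr p * R = w powr (1 / q) * (R powr 1 / R powr (1 / q))" using R by simp
  also have "R powr 1 / R powr (1 / q) = R powr (1 / p)"
  using q(2) unfolding powr_diff[symmetric] by (intro arg_cong[where f = "%x. R powr x"]) simp
  finally show ?thesis by (simp add: q(3))
 qed
 have cq: "(1 / c) powr q * w = ?v"
 proof -
  have "c powr q = (w / R) powr (1 / p)" unfolding c_def powr_powr using p q by (simp add: field_simps)
  hence "(1 / c) powr q = R powr (1 / p) / w powr (1 / p)" using w R c by (simp add: powr_divide)
  hence "(1 / c) powr q * w = R powr (1 / p) * (w powr 1 / w powr (1 / p))" using w by simp
  also have "w powr 1 / w powr (1 / p) = w powr (1 - 1 / p)" by (rule powr_diff[symmetric])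
  finally show ?thesis by (simp add: mult.commute)
 qed
 have point: "\<bar>g s\<bar> <= c powr p / p * (?a0 s) + (1 / c) powr q / q * exp (- (1 / w * s))" for s
 proof -
  have "\<bar>g s\<bar> = (?c0 c s) * (1 / c * exp (- (\<eta> * s / p)))"
  using c by (simp add: exp_minus)
  also have "... <= (?c0 c s) powr p / p + (1 / c * exp (- (\<eta> * s / p))) powr q / q"
  using c by (intro Youngs_inequality p q) auto
  also have "(?c0 c s) powr p = c powr p * (?a0 s)"
  using c p by (simp add: powr_mult exp_powr_real)
  also have "(1 / c * exp (- (\<eta> * s / p))) powr q = (1 / c) powr q * exp (- (1 / w * s))"
  proof -
  have "- (\<eta> * s / p) * q = - (1 / w * s)" using p by (simp add: q_def w_def)
  thus ?thesis using c by (subst powr_mult) (simp_all add: exp_powr_real)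
  qed
  finally show ?thesis by simp
 qed
 have "(\<integral>\<^sup>+s\<in>{t<..}. en \<bar>g s\<bar> \<partial>lborel) <= (NN s|lborel. en (c powr p / p) * (en (?a0 s) * ind {t<..} s)
  + en ((1 / c) powr q / q) * (en (exp (- (1 / w * s))) * ind {t<..} s))"
 proof (rule nn_integral_mono)
  fix s
  have "en \<bar>g s\<bar> <= en (c powr p / p) * en (?a0 s) + en ((1 / c) powr q / q) * en (exp (- (1 / w * s)))"
  using ennreal_leI[OF point[of s]] p q by (simp add: ennreal_mult'[symmetric] ennreal_plus[symmetric] del: ennreal_plus)
  thus "en \<bar>g s\<bar> * ind {t<..} s <= en (c powr p / p) * (en (?a0 s) * ind {t<..} s)
  + en ((1 / c) powr q / q) * (en (exp (- (1 / w * s))) * ind {t<..} s)"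
  by (cases "s : {t<..}") auto
 qed
 also have "... = en (c powr p / p) * (\<integral>\<^sup>+s\<in>{t<..}. en (?a0 s) \<partial>lborel)
  + en ((1 / c) powr q / q) * (?b0 w)"
  by (subst nn_integral_add) (auto simp: nn_integral_cmult)
 also have "... <= en (c powr p / p) * en R + en ((1 / c) powr q / q) * en w"
 proof (intro add_mono mult_left_mono le)
  have "0 < 1 / w" using w by simp
  from nn_integral_exp_tail[OF this, of t] show "(?b0 w) <= en w"
  using w t by (auto intro!: ennreal_leI simp: mult_le_cancel_left1)
 qed auto
 also have "... = en (c powr p * R / p + (1 / c) powr q * w / q)"
  using p q R w by (simp add: ennreal_mult'[symmetric] ennreal_plus[symmetric] del: ennreal_plus)
 also have "c powr p * R / p + (1 / c) powr q * w / q = ?v * (1 / p + 1 / q)" unfolding cp cq by (simp add: algebra_simps)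
 finally show ?thesis unfolding q(2) w_def by simp
qed

text \<open>The exponential weight makes \<open>g\<close> integrable and controls its tails in the \<open>p\<close>-th power.\<close>

lemma weighted_integral_tail:
 fixes g :: "real => real"
 assumes g [measurable]: "g : bm borel" and p: "1 < p" and \<eta>: "0 < \<eta>"
  and fin: "(\<integral>\<^sup>+s\<in>{1<..}. en (\<bar>g s\<bar> powr p * exp (\<eta> * s)) \<partial>lborel) < \<infinity>"
 shows "((%t. LBINT s:{1<..t}. g s) \<longlongrightarrow> (LBINT s:{1<..}. g s)) at_top"
  and "1 <= t ==> en (\<bar>(LBINT s:{1<..t}. g s) - (LBINT s:{1<..}. g s)\<bar> powr p)
  <= en (((p - 1) / \<eta>) powr (p - 1)) * (\<integral>\<^sup>+s\<in>{t<..}. en (\<bar>g s\<bar> powr p * exp (\<eta> * s)) \<partial>lborel)"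
proof -
 let ?H = "%t. \<integral>\<^sup>+s\<in>{t<..}. en (\<bar>g s\<bar> powr p * exp (\<eta> * s)) \<partial>lborel"
 have Hfin: "?H t < \<infinity>" if "1 <= t" for t
 proof (rule order_le_less_trans[OF _ fin])
  show "?H t <= ?H 1" using that by (intro nn_integral_mono) (auto simp: indicator_def)
 qed
 have int: "set_integrable lborel {t<..} g" if t: "1 <= t" for t
 proof -
  have "?H t <= en (enn2real (?H t) + 1)" using Hfin[OF t] by (cases "?H t") (auto intro: ennreal_leI)
  from weighted_Holder[OF g p \<eta> _ _ this] have "(\<integral>\<^sup>+s\<in>{t<..}. en \<bar>g s\<bar> \<partial>lborel) < \<infinity>"
  by (rule order_le_less_trans) (use t in \<open>auto intro: add_nonneg_pos\<close>)
  moreover have "(NN s|lborel. en (norm (ind {t<..} s *\<^sub>R g s))) = (\<integral>\<^sup>+s\<in>{t<..}. en \<bar>g s\<bar> \<partial>lborel)"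
  by (intro nn_integral_cong) (auto simp: indicator_def)
  ultimately show ?thesis unfolding set_integrable_def by (intro integrableI_bounded) auto
 qed
 have "((%t. LBINT s:{1..t}. ind {1<..} s * g s) \<longlongrightarrow> (LBINT s:{1..}. ind {1<..} s * g s)) at_top"
 proof (rule tendsto_set_lebesgue_integral_at_top)
  have "(%s. ind {1..} s *\<^sub>R (ind {1<..} s * g s)) = (%s. ind {1<..} s *\<^sub>R g s)"
  by (auto simp: indicator_def)
  with int[of 1] show "set_integrable lborel {1..} (%s. ind {1<..} s * g s)" unfolding set_integrable_def by simp
 qed simp
 moreover have "(LBINT s:{1..t}. ind {1<..} s * g s) = (LBINT s:{1<..t}. g s)" for t
  unfolding set_lebesgue_integral_def by (intro Bochner_Integration.integral_cong) (auto simp: indicator_def)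
 moreover have "(LBINT s:{1..}. ind {1<..} s * g s) = (LBINT s:{1<..}. g s)"
  unfolding set_lebesgue_integral_def by (intro Bochner_Integration.integral_cong) (auto simp: indicator_def)
 ultimately show "((%t. LBINT s:{1<..t}. g s) \<longlongrightarrow> (LBINT s:{1<..}. g s)) at_top" by simp
 assume t: "1 <= t"
 have S: "{1<..t} \<union> {t<..} = {1<..}" using t by auto
 have "set_integrable lborel {1<..t} g" by (rule set_integrable_subset[OF int[OF order_refl]]) auto
 from set_integral_Un[OF _ this int[OF t]]
 have "(LBINT s:{1<..}. g s) = (LBINT s:{1<..t}. g s) + (LBINT s:{t<..}. g s)" unfolding S by force
 hence e: "\<bar>(LBINT s:{1<..t}. g s) - (LBINT s:{1<..}. g s)\<bar> = \<bar>LBINT s:{t<..}. g s\<bar>" by simp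
 have ab: "en \<bar>LBINT s:{t<..}. g s\<bar> <= (\<integral>\<^sup>+s\<in>{t<..}. en \<bar>g s\<bar> \<partial>lborel)"
 proof -
  have "en \<bar>LBINT s:{t<..}. g s\<bar> <= (NN s|lborel. en (norm (ind {t<..} s *\<^sub>R g s)))"
  using integral_norm_bound_ennreal[OF int[OF t, unfolded set_integrable_def]] unfolding set_lebesgue_integral_def by simp
  also have "... = (\<integral>\<^sup>+s\<in>{t<..}. en \<bar>g s\<bar> \<partial>lborel)"
  by (intro nn_integral_cong) (auto simp: indicator_def)
  finally show ?thesis .
 qed
 let ?w = "(p - 1) / \<eta>"
 let ?h = "enn2real (?H t)"
 have h: "?H t = en ?h" using Hfin[OF t] by simp
 have w: "0 < ?w" using p \<eta> by simp
 have "\<bar>LBINT s:{t<..}. g s\<bar> powr p <= ?w powr (p - 1) * ?h + e" if "0 < e" for e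
 proof -
  define R where "R = ?h + e / ?w powr (p - 1)"
  have "0 < ?w powr (p - 1)" using w unfolding powr_gt_zero by (rule less_imp_neq[THEN not_sym])
  hence e0: "0 < e / ?w powr (p - 1)" by (rule divide_pos_pos[OF that])
  hence R: "0 < R" unfolding R_def by (intro add_nonneg_pos) auto
  have "?H t <= en R" by (subst h) (use e0 in \<open>auto simp: R_def intro: ennreal_leI\<close>)
  from order_trans[OF ab weighted_Holder[OF g p \<eta> _ R this]] t
  have "\<bar>LBINT s:{t<..}. g s\<bar> <= ?w powr (1 - 1 / p) * R powr (1 / p)" by (simp add: ennreal_le_iff)
  hence "\<bar>LBINT s:{t<..}. g s\<bar> powr p <= (?w powr (1 - 1 / p) * R powr (1 / p)) powr p" using p by (intro powr_mono2) auto
  also have "... = ?w powr (p - 1) * R"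
  proof -
  have "(1 - 1 / p) * p = p - 1" using p by (simp add: field_simps)
  thus ?thesis using p R w by (simp add: powr_mult powr_powr)
  qed
  also have "... = ?w powr (p - 1) * ?h + e" unfolding R_def using p \<eta> by (simp add: distrib_left)
  finally show ?thesis .
 qed
 hence "\<bar>LBINT s:{t<..}. g s\<bar> powr p <= ?w powr (p - 1) * ?h" by (rule field_le_epsilon)
 thus "en (\<bar>(LBINT s:{1<..t}. g s) - (LBINT s:{1<..}. g s)\<bar> powr p) <= en (?w powr (p - 1)) * ?H t"
  unfolding e by (subst h) (simp add: ennreal_mult'[symmetric] ennreal_leI)
qed

text \<open>Half of the exponential rate of the moments is spent as the weight of the Hoelder inequality; the other half makes
 the expected weighted tails vanish.\<close>

lemma random_integral_converges:
 fixes Y :: "real => 'w => real"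
 assumes M: "prob_space M" and Y: "(%(q, s). Y s q) : bm (M \<Otimes> lborel)"
  and p: "1 < p" and k: "0 < k" and D: "0 <= D"
  and le: "\<And>s. 1 < s ==> (NN q|M. en (\<bar>Y s q\<bar> powr p)) <= en (D * exp (- (k * s)))"
 shows "converges_Lp p M (%t q. LBINT s:{1<..t}. Y s q)"
  and "converges_AE M (%t q. LBINT s:{1<..t}. Y s q)"
proof -
  let ?a0 = "%\<eta> t. D / \<eta> * exp (- (\<eta> * t))"
  let ?b0 = "%s q \<eta>. \<bar>Y s q\<bar> powr p * exp (\<eta> * s)"
 interpret prob_space M by (rule M)
 interpret pair_sigma_finite M lborel ..
 define \<eta> where "\<eta> = k / 2"
 have \<eta>: "0 < \<eta>" using k by (simp add: \<eta>_def)
 let ?H = "%t q. \<integral>\<^sup>+s\<in>{t<..}. en (?b0 s q \<eta>) \<partial>lborel"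
 let ?w = "((p - 1) / \<eta>) powr (p - 1)"
 let ?B = "%t q. LBINT s:{1<..t}. Y s q"
 let ?Z = "%q. LBINT s:{1<..}. Y s q"
 have Ys: "Y s : bm M" for s using measurable_Pair1'[of s lborel M] measurable_compose[OF _ Y, of "%q. (q, s)" M] by simp
 have path: "(%s. Y s q) : bm borel" if "q : space M" for q
  using measurable_compose[OF measurable_Pair1'[OF that, of lborel] Y] by simp
 have im: "(%q. LBINT s:S. Y s q) : bm M" if "S : sets borel" for S
  unfolding set_lebesgue_integral_def using Y that
  by (intro lborel.borel_measurable_lebesgue_integral) (simp add: case_prod_beta' measurable_compose[OF measurable_snd borel_measurable_indicator])
 have Hm: "(%(q, s). en (?b0 s q \<eta>) * ind {t<..} s) : bm (M \<Otimes> lborel)" for t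
  using Y by (simp add: case_prod_beta' measurable_compose[OF measurable_snd borel_measurable_indicator])
 have Hm': "?H t : bm M" for t
  using lborel.borel_measurable_nn_integral[OF Hm[of t]] .
 have EH: "(NN q|M. ?H t q) <= en (?a0 \<eta> t)" if t: "1 <= t" for t
 proof -
  have "(NN q|M. ?H t q) = (NN s|lborel. (NN q|M. en (?b0 s q \<eta>) * ind {t<..} s))"
  by (rule Fubini'[OF Hm, symmetric])
  also have "... <= (NN s|lborel. en D * (en (exp (- (\<eta> * s))) * ind {t<..} s))"
  proof (rule nn_integral_mono)
  fix s :: real
  show "(NN q|M. en (?b0 s q \<eta>) * ind {t<..} s) <= en D * (en (exp (- (\<eta> * s))) * ind {t<..} s)"
  proof (cases "t < s")
  case True
  have "(NN q|M. en (?b0 s q \<eta>)) = (NN q|M. en (\<bar>Y s q\<bar> powr p)) * en (exp (\<eta> * s))"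
  using Ys[of s] by (subst nn_integral_multc[symmetric]) (simp_all add: ennreal_mult')
  also have "... <= en (D * exp (- (k * s))) * en (exp (\<eta> * s))" using True t by (intro mult_right_mono le) auto
  also have "... = en (D * exp (- (\<eta> * s)))"
  using D by (simp add: ennreal_mult'[symmetric] mult.assoc \<eta>_def flip: exp_add)
  finally show ?thesis using True D by (simp add: ennreal_mult')
  qed simp
  qed
  also have "... = en D * en (exp (- (\<eta> * t)) / \<eta>)"
  by (simp add: nn_integral_cmult nn_integral_exp_tail[OF \<eta>])
  also have "... = en (?a0 \<eta> t)" using D by (simp add: ennreal_mult'[symmetric])
  finally show ?thesis .
 qed
 have "AE q in M. ?H 1 q \<noteq> \<infinity>"
  by (rule nn_integral_noteq_infinite[OF Hm']) (use EH[of 1] in \<open>auto simp: top_unique\<close>)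
 hence good: "AE q in M. ?H 1 q < \<infinity>" by (simp add: less_top)
 have lim: "AE q in M. ((%t. ?B t q) \<longlongrightarrow> ?Z q) at_top"
 proof (rule AE_mp[OF good AE_I2], rule impI)
  fix q assume q: "q : space M" "?H 1 q < \<infinity>"
  show "((%t. ?B t q) \<longlongrightarrow> ?Z q) at_top" by (rule weighted_integral_tail(1)[OF path[OF q(1)] p \<eta> q(2)])
 qed
 thus "converges_AE M ?B" unfolding converges_AE_def by (rule eventually_mono) (rule exI)
 have diff: "(NN q|M. en (\<bar>?B t q - ?Z q\<bar> powr p)) <= en (?w * (?a0 \<eta> t))" if t: "1 <= t" for t
 proof -
  have "(NN q|M. en (\<bar>?B t q - ?Z q\<bar> powr p)) <= (NN q|M. en ?w * ?H t q)"
  proof (rule nn_integral_mono_AE, rule AE_mp[OF good AE_I2], rule impI)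
  fix q assume q: "q : space M" "?H 1 q < \<infinity>"
  show "en (\<bar>?B t q - ?Z q\<bar> powr p) <= en ?w * ?H t q"
  by (rule weighted_integral_tail(2)[OF path[OF q(1)] p \<eta> q(2) t])
  qed
  also have "... = en ?w * (NN q|M. ?H t q)" by (rule nn_integral_cmult[OF Hm'])
  also have "... <= en ?w * en (?a0 \<eta> t)" by (intro mult_left_mono EH[OF t]) simp
  also have "... = en (?w * (?a0 \<eta> t))" by (rule ennreal_mult'[symmetric]) simp
  finally show ?thesis .
 qed
 have R0: "0 <= ?w * (?a0 \<eta> t)" for t using D \<eta> by simp
 have p0: "0 < p" using p by simp
 have dm: "(%q. ?B t q - ?Z q) : bm M" for t by (intro borel_measurable_diff im) auto
 note dLp = Lp_norm_le[OF diff dm R0 p0]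
 have "?B 1 = (%_. 0)" by (simp add: set_lebesgue_integral_def)
 hence "(%q. ?B 1 q) : Lp_space p M" by (simp add: Lp_space_def)
 from Lp_space_diff[OF this dLp(1)[OF order_refl]] p have Z: "?Z : Lp_space p M" by simp
 have B: "?B t : Lp_space p M" if "1 <= t" for t
  using Lp_space_combination[OF dLp(1)[OF that] Z, of 1 1] p by simp
 have "((%t. Lp_norm p M (%q. ?B t q - ?Z q)) \<longlongrightarrow> 0) at_top"
 proof (rule tendsto_sandwich[OF _ _ tendsto_const])
  show "\<forall>\<^sub>F t in at_top. 0 <= Lp_norm p M (%q. ?B t q - ?Z q)" by (simp add: Lp_norm_def)
  show "\<forall>\<^sub>F t in at_top. Lp_norm p M (%q. ?B t q - ?Z q) <= (?w * (D / \<eta>)) powr (1 / p) * exp (- (\<eta> / p * t))"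
  proof (rule eventually_mono[OF eventually_ge_at_top[of 1]])
  fix t :: real assume "1 <= t"
  have "(?w * (?a0 \<eta> t)) powr (1 / p) = (?w * (D / \<eta>)) powr (1 / p) * exp (- (\<eta> * t)) powr (1 / p)"
  unfolding mult.assoc[symmetric] by (rule powr_mult)
  also have "exp (- (\<eta> * t)) powr (1 / p) = exp (- (\<eta> / p * t))" by (simp add: exp_powr_real)
  finally show "Lp_norm p M (%q. ?B t q - ?Z q) <= (?w * (D / \<eta>)) powr (1 / p) * exp (- (\<eta> / p * t))"
  using dLp(2)[OF \<open>1 \<le> t\<close>] by simp
  qed
  have "((%t. exp (- (\<eta> / p * t))) \<longlongrightarrow> 0) at_top"
  using \<eta> p by (intro filterlim_compose[OF exp_at_bot] filterlim_uminus_at_bot_at_top[THEN filterlim_compose]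
  filterlim_tendsto_pos_mult_at_top[OF tendsto_const _ filterlim_ident]) simp
  from tendsto_mult[OF tendsto_const this] show "((%t. (?w * (D / \<eta>)) powr (1 / p) * exp (- (\<eta> / p * t))) \<longlongrightarrow> 0) at_top" by simp
 qed
 with B Z show "converges_Lp p M ?B"
  unfolding converges_Lp_def by (auto intro: eventually_mono[OF eventually_ge_at_top[of 1]])
qed

section \<open>The martingale\<close>

context spectral_superprocess
begin

definition mart :: "real => 'w => real" where
 "mart t w = exp (- (l * t)) * phi_mass t w"

lemma mart_nonneg: "0 <= mart t w"
 unfolding mart_def using phi_mass_nonneg by simp

lemma mart_measurable: "0 <= t ==> mart t : bm W"
 unfolding mart_def[abs_def] using phi_mass_measurable by simp

lemma mart_measurable_P: "\<mu> : MF ==> 0 <= t ==> mart t : bm (P \<mu>)"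
 by (intro P_measurable mart_measurable)

lemma mart_joint_measurable:
 fixes N :: "'w measure" and h :: "real => real"
 assumes N: "space N = space W" and m: "(%(r, w). \<integral>\<^sup>+y. en (\<Phi> y) \<partial>X (h r) w) : bm (borel \<Otimes> N)"
  and h: "h : bm borel" "\<And>r. 0 <= h r"
 shows "(%(w, r). mart (h r) w) : bm (N \<Otimes> lborel)"
proof -
  let ?a0 = "%z. \<integral>\<^sup>+y. en (\<Phi> y) \<partial>X (h (snd z)) (fst z)"
  let ?b0 = "N \<Otimes> borel"
 have "(%z. (snd z, fst z)) : N \<Otimes> (borel :: real measure) \<rightarrow>\<^sub>M borel \<Otimes> N" by measurable
 from measurable_compose[OF this m]
 have g: "(%z. exp (- (l * h (snd z))) * enn2real (?a0 z)) : bm ?b0"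
  using measurable_compose[OF measurable_snd h(1), of N] by (simp add: case_prod_beta')
 have eq: "mart (h (snd z)) (fst z) = exp (- (l * h (snd z))) * enn2real (?a0 z)"
  if "z : space ?b0" for z
  using that h(2) N by (simp add: mart_def phi_mass_nn_integral space_pair_measure mem_Times_iff)
 have "(%z. mart (h (snd z)) (fst z)) : bm ?b0"
  by (rule measurable_congI[OF eq g])
 thus ?thesis
  unfolding measurable_cong_sets[OF sets_pair_measure_cong[OF refl sets_lborel] refl] by (simp add: case_prod_beta')
qed

lemma mart_joint_measurable_W: "(%(w, r). mart (max 0 r) w) : bm (W \<Otimes> lborel)"
 by (rule mart_joint_measurable[OF refl X_nn_integral_joint_measurable[OF Phi_ennreal_measurable]]) auto

lemma mart_joint_measurable_G:
 "0 <= t ==> (%(w, r). mart (max 0 (min r t)) w) : bm (G (en t) \<Otimes> lborel)"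
 by (rule mart_joint_measurable[OF mass.space_F X_nn_integral_clamped_measurable[OF _ Phi_ennreal_measurable]]) auto

lemma mart_joint_measurable_P:
 assumes "\<mu> : MF"
 shows "(%(w, r). mart (max 0 r) w) : bm (P \<mu> \<Otimes> lborel)"
proof -
 have "sets (P \<mu>) = sets W" using assms by (intro mass.sets_P) simp
 from measurable_cong_sets[OF sets_pair_measure_cong[OF this refl] refl] mart_joint_measurable_W show ?thesis by blast
qed

text \<open>The cell \<open>j\<close> gains \<open>exp (l (j + 1))\<close> from the mean semigroup and loses \<open>exp (- l p
 j)\<close> from the scaling of the jumps. The sum is geometric because \<open>p > 1\<close>.\<close>

lemma nu_growth_finite:
 assumes p: "1 < p" and fin: "nu_jump (%r. en (\<bar>r\<bar> powr p)) < \<infinity>"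
 shows "(NN x|\<nu>. growth p (Some x)) < \<infinity>"
proof -
 let ?f = "%r. en (\<bar>r\<bar> powr p)"
 let ?q = "exp (- (l * (p - 1)))"
 have fm: "?f : bm borel" by simp
 have q: "norm ?q < 1" using l_pos p by simp
 have cell: "(NN x|\<nu>. cell j ?f (Some x)) <= en (exp l * ?q ^ j) * nu_jump ?f" for j
 proof -
  have "(\<integral>\<^sup>+u\<in>{real j..real j + 1}. en (exp (l * u)) \<partial>lborel) <= (NN u|lborel. en (exp (l * (real j + 1))) * ind {real j..real j + 1} u)"
  using l_pos by (intro nn_integral_mono) (auto simp: indicator_def intro!: ennreal_leI)
  also have "... = en (exp (l * (real j + 1)))" by (simp add: nn_integral_cmult)
  finally have e: "(\<integral>\<^sup>+u\<in>{real j..real j + 1}. en (exp (l * u)) \<partial>lborel) <= en (exp (l * (real j + 1)))" .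
  have "nu_jump (%r. ?f (r * exp (- (l * real j)))) = nu_jump (%r. en (exp (- (l * real j * p))) * ?f r)"
  by (intro arg_cong[where f = nu_jump] ext) (simp add: abs_mult powr_mult exp_powr_real ennreal_mult'[symmetric] mult.commute)
  also have "... = en (exp (- (l * real j * p))) * nu_jump ?f" by (rule nu_jump_cmult[OF fm])
  finally have "(NN x|\<nu>. cell j ?f (Some x)) <= en (exp (l * (real j + 1))) * (en (exp (- (l * real j * p))) * nu_jump ?f)"
  unfolding nu_cell[OF fm] using e by (simp add: mult_right_mono)
  also have "... = en (exp (l * (real j + 1)) * exp (- (l * real j * p))) * nu_jump ?f"
  by (simp add: ennreal_mult' mult.assoc)
  also have "exp (l * (real j + 1)) * exp (- (l * real j * p)) = exp l * ?q ^ j"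
  by (simp add: exp_of_nat_mult[symmetric] algebra_simps flip: exp_add)
  finally show ?thesis .
 qed
 have "(NN x|\<nu>. growth p (Some x)) = (\<Sum>j. \<integral>\<^sup>+x. cell j ?f (Some x) \<partial>\<nu>)"
  unfolding growth_def by (intro nn_integral_suminf nu_measurable measurable_compose[OF Some_measurable cell_measurable[OF fm]])
 also have "... <= (\<Sum>j. en (exp l * ?q ^ j) * nu_jump ?f)" by (intro suminf_le cell) auto
 also have "... = (\<Sum>j. en (exp l * ?q ^ j)) * nu_jump ?f" by simp
 also have "(\<Sum>j. en (exp l * ?q ^ j)) = en (exp l * (1 / (1 - ?q)))"
  by (intro suminf_ennreal_eq sums_mult geometric_sums q) simp
 also have "en (exp l * (1 / (1 - ?q))) * nu_jump ?f < \<infinity>" using fin by (simp add: ennreal_mult_less_top)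
 finally show ?thesis .
qed

text \<open>Conditionally on the state at time \<open>t\<close> the increment is a centred mass, whose moment is at most linear
 in the state. The upper bound on the mean semigroup then yields a single factor \<open>exp (l t)\<close>. The
 summand \<open>1\<close> in the conditional bound keeps it positive when the state vanishes.\<close>

lemma increment_moment_le:
 assumes \<mu>: "\<mu> : MF" and p: "1 < p" "p <= 2" and fin: "nu_jump (%r. en (\<bar>r\<bar> powr p)) < \<infinity>"
 obtains D where "0 <= D"
  "\<And>t s. 1 < t ==> 0 <= s ==> (NN w|P \<mu>. en (\<bar>mart (t + s) w - mart t w\<bar> powr p)) <= en (D * exp (- (l * (p - 1) * t)))"
proof -
  let ?a0 = "%t w. \<integral>\<^sup>+y. growth p y \<partial>X t w"
  let ?b0 = "%t w. deficit_const * phi_mass t w"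
  let ?c0 = "%t s. \<integral>\<^sup>+w. en (\<bar>mart (t + s) w - mart t w\<bar> powr p) \<partial>P \<mu>"
  let ?d0 = "%\<eta>. \<integral>y. \<Phi> y \<partial>\<eta>"
  let ?e0 = "%s t w. \<bar>exp (- (l * s)) * phi_mass (t + s) w - phi_mass t w\<bar> powr p"
  let ?f0 = "%\<eta>. \<integral>\<^sup>+y. growth p y \<partial>\<eta>"
  let ?g0 = "%s t w. \<integral>\<^sup>+w'. en (\<bar>exp (- (l * s)) * phi_mass s w' - phi_mass t w\<bar> powr p) \<partial>P (X t w)"
  let ?h0 = "%x. growth p (Some x)"
  let ?i0 = "\<integral>\<^sup>+x. growth p (Some x) \<partial>\<nu>"
 interpret prob_space "P \<mu>" by (rule prob_P[OF \<mu>])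
 obtain C where C: "0 < C" "\<And>t h x. 1 < t ==> h : bm borel ==>
  MS t (ext0 h) (Some x) <= en (C * exp (l * t) * \<phi> x) * (NN x|\<nu>. h x)"
  using MS_le_nu by blast
 define K where "K = 1 + 8 / (p - 1)"
 have K: "0 < K" using p by (auto simp: K_def intro: add_pos_nonneg)
 let ?m = "\<integral>y. \<Phi> y \<partial>\<mu>"
 have m0: "0 <= ?m" by (rule test_function_integral(3)[OF test_function_phi \<mu>])
 define Ng where "Ng = enn2real ?i0"
 have Ng: "?i0 = en Ng" "0 <= Ng"
  using nu_growth_finite[OF p(1) fin] by (simp_all add: Ng_def)
 define D where "D = K * (deficit_const * ?m + C * ?m * Ng + 1)"
 have centred: "(NN w|P \<eta>. en (\<bar>exp (- (l * s)) * phi_mass s w - (?d0 \<eta>)\<bar> powr p))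
  <= en K * (en (deficit_const * (?d0 \<eta>)) + (?f0 \<eta>) + 1)"
  if \<eta>: "\<eta> : MF" and s: "0 <= s" for \<eta> s
 proof (cases "(?f0 \<eta>) = \<infinity>")
  case True
  thus ?thesis using K by (simp add: ennreal_mult_top)
 next
  case False
  have m\<eta>: "0 <= deficit_const * (?d0 \<eta>)"
  using deficit_const_pos test_function_integral(3)[OF test_function_phi \<eta>] by simp
  define B where "B = deficit_const * (?d0 \<eta>) + enn2real (?f0 \<eta>) + 1"
  have B: "0 < B" unfolding B_def using m\<eta> by (intro add_nonneg_pos) auto
  have eB: "en B = en (deficit_const * (?d0 \<eta>)) + (?f0 \<eta>) + 1"
  unfolding B_def using m\<eta> False by (simp add: ennreal_enn2real less_top)
  have "(NN w|P \<eta>. en (\<bar>exp (- (l * s)) * phi_mass s w - (?d0 \<eta>)\<bar> powr p)) <= en (K * B)"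
  unfolding phi_mass_def K_def by (rule centred_moment_le[OF p \<eta> s B]) (simp add: eB)
  thus ?thesis using K by (simp add: ennreal_mult' eB)
 qed
 have D0: "0 <= D" unfolding D_def using K deficit_const_pos m0 C(1) Ng(2) by (intro mult_nonneg_nonneg add_nonneg_nonneg) auto
 have main: "(?c0 t s) <= en (D * exp (- (l * (p - 1) * t)))"
  if t: "1 < t" and s: "0 <= s" for t s
 proof -
  have t0: "0 <= t" using t by simp
  have gW: "(%w. \<integral>\<^sup>+y. growth p y \<partial>X t w) : bm (P \<mu>)"
  by (rule P_measurable[OF \<mu> X_nn_integral_measurable[OF t0 growth_measurable]])
  have pm: "phi_mass t : bm (P \<mu>)" "phi_mass (t + s) : bm (P \<mu>)"
  using t0 s by (auto intro!: P_measurable[OF \<mu>] phi_mass_measurable)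
  have eg: "growth p = ext0 ?h0"
  proof
  fix y
  have "cell j f None = 0" for j f unfolding cell_def by (simp add: MS_None)
  thus "growth p y = ext0 ?h0 y" by (cases y) (simp_all add: growth_def)
  qed
  have gm: "?h0 : bm borel"
  by (rule measurable_compose[OF Some_measurable growth_measurable])
  have gE: "(NN w|P \<mu>. (?a0 t w)) <= en (exp (l * t) * (C * ?m * Ng))"
  proof -
  have "(NN w|P \<mu>. (?a0 t w)) = (NN y|\<mu>. MS t (growth p) y)"
  by (rule mean_formula[OF growth_measurable t0 \<mu>])
  also have "... <= (NN y|\<mu>. en (C * exp (l * t) * Ng) * en (\<Phi> y))"
  proof (rule nn_integral_mono)
  fix y show "MS t (growth p) y <= en (C * exp (l * t) * Ng) * en (\<Phi> y)"
  proof (cases y)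
  case None
  thus ?thesis using MS_None[OF t0] by (subst eg) simp
  next
  case (Some x)
  have "en (C * exp (l * t) * \<phi> x) * en Ng = en (C * exp (l * t) * Ng) * en (\<phi> x)"
  using C(1) Ng(2) phi(2)[of x] by (simp add: ennreal_mult'[symmetric] less_imp_le mult_ac)
  with C(2)[OF t gm, of x] show ?thesis unfolding Some Ng(1) eg[symmetric] by simp
  qed
  qed
  also have "... = en (C * exp (l * t) * Ng) * en ?m"
  using finite_measures_measurable[OF \<mu> Phi_ennreal_measurable]
  by (simp add: nn_integral_cmult test_function_integral(2)[OF test_function_phi \<mu>])
  also have "... = en (exp (l * t) * (C * ?m * Ng))"
  using C(1) Ng(2) by (subst ennreal_mult'[symmetric]) (simp_all add: mult_ac)
  finally show ?thesis .
  qed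
  have mE: "(NN w|P \<mu>. en (?b0 t w)) = en (exp (l * t) * (deficit_const * ?m))"
  proof -
  have "(NN w|P \<mu>. en (phi_mass t w)) = en (exp (l * t) * ?m)"
  unfolding phi_mass_def using nn_integral_eq_integral[OF mass_mean(1)[OF \<mu> t0]] Phi_nonneg mass_mean(2)[OF \<mu> t0] by simp
  thus ?thesis
  using pm(1) deficit_const_pos m0 by (simp add: ennreal_mult' nn_integral_cmult mult.left_commute)
  qed
  have inc: "en (\<bar>mart (t + s) w - mart t w\<bar> powr p) = en (exp (- (l * t * p))) * en (?e0 s t w)" for w
  proof -
  have "mart (t + s) w - mart t w = exp (- (l * t)) * (exp (- (l * s)) * phi_mass (t + s) w - phi_mass t w)"
  unfolding mart_def by (simp add: algebra_simps flip: exp_add)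
  thus ?thesis by (simp add: abs_mult powr_mult exp_powr_real ennreal_mult'[symmetric])
  qed
  have outer: "(?c0 t s)
  = en (exp (- (l * t * p))) * (NN w|P \<mu>. en (?e0 s t w))"
  unfolding inc using pm by (intro nn_integral_cmult) simp
  have "(NN w|P \<mu>. en (?e0 s t w))
  = (NN w|P \<mu>. (?g0 s t w))"
  by (rule markov_phi_mass[OF \<mu> t0 s, of "%m m'. en (\<bar>exp (- (l * s)) * m' - m\<bar> powr p)"]) simp
  also have "... <= (NN w|P \<mu>. en K * (en (?b0 t w) + (?a0 t w) + 1))"
  proof (rule nn_integral_mono)
  fix w assume "w : space (P \<mu>)"
  hence "X t w : MF" by (intro X_finite_measure t0) (simp add: space_P[OF \<mu>])
  from centred[OF this s] show "(?g0 s t w)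
  <= en K * (en (?b0 t w) + (?a0 t w) + 1)"
  unfolding phi_mass_def[of t] .
  qed
  also have "... = en K * (en (exp (l * t) * (deficit_const * ?m)) + (NN w|P \<mu>. (?a0 t w)) + 1)"
  proof -
  have dm: "(%w. en (?b0 t w)) : bm (P \<mu>)" using pm(1) by simp
  have "(NN w|P \<mu>. en K * (en (?b0 t w) + (?a0 t w) + 1))
  = en K * (NN w|P \<mu>. en (?b0 t w) + (?a0 t w) + 1)"
  by (intro nn_integral_cmult borel_measurable_add dm gW) simp
  also have "(NN w|P \<mu>. en (?b0 t w) + (?a0 t w) + 1)
  = (NN w|P \<mu>. en (?b0 t w) + (?a0 t w)) + (NN w|P \<mu>. 1)"
  by (intro nn_integral_add borel_measurable_add dm gW) simp
  also have "(NN w|P \<mu>. en (?b0 t w) + (?a0 t w))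
  = (NN w|P \<mu>. en (?b0 t w)) + (NN w|P \<mu>. (?a0 t w))"
  by (rule nn_integral_add[OF dm gW])
  finally show ?thesis unfolding mE by (simp add: emeasure_space_1)
  qed
  also have "... <= en K * (en (exp (l * t) * (deficit_const * ?m)) + en (exp (l * t) * (C * ?m * Ng)) + en (exp (l * t)))"
  using gE t0 l_pos by (intro mult_left_mono add_mono) auto
  also have "... = en (K * (exp (l * t) * (deficit_const * ?m + C * ?m * Ng + 1)))"
  using K C(1) Ng(2) m0 deficit_const_pos
  by (subst ennreal_mult', simp) (simp add: distrib_left ennreal_plus[symmetric] del: ennreal_plus)
  also have "K * (exp (l * t) * (deficit_const * ?m + C * ?m * Ng + 1)) = exp (l * t) * D" unfolding D_def by (rule mult.left_commute)
  finally have "(?c0 t s) <= en (exp (- (l * t * p))) * en (exp (l * t) * D)"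
  unfolding outer by (rule mult_left_mono) simp
  also have "en (exp (- (l * t * p))) * en (exp (l * t) * D) = en (D * exp (- (l * (p - 1) * t)))"
  proof -
  have "exp (- (l * t * p)) * (exp (l * t) * D) = D * exp (- (l * (p - 1) * t))" by (simp add: algebra_simps flip: exp_add)
  thus ?thesis by (subst ennreal_mult'[symmetric]) (simp_all only: exp_ge_zero)
  qed
  finally show ?thesis .
 qed
 show thesis by (rule that[OF D0 main])
qed

text \<open>Fatou along integer times.\<close>

lemma limit_moment_le:
 assumes \<mu>: "\<mu> : MF" and t: "0 <= t" and Minf: "Minf : bm W"
  and lim: "AE w in P \<mu>. ((%t. mart t w) \<longlongrightarrow> Minf w) at_top"
  and le: "\<And>s. 0 <= s ==> (NN w|P \<mu>. en (\<bar>mart (t + s) w - mart t w\<bar> powr p)) <= R" and p: "0 < p"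
 shows "(NN w|P \<mu>. en (\<bar>Minf w - mart t w\<bar> powr p)) <= R"
proof -
  let ?a0 = "%w. \<bar>Minf w - mart t w\<bar> powr p"
 let ?u = "%n w. en (\<bar>mart (t + real n) w - mart t w\<bar> powr p)"
 have um: "?u n : bm (P \<mu>)" for n
  using mart_measurable_P[OF \<mu> t] mart_measurable_P[OF \<mu>, of "t + real n"] t by simp
 have "(NN w|P \<mu>. en (?a0 w)) = (NN w|P \<mu>. liminf (%n. ?u n w))"
 proof (rule nn_integral_cong_AE, rule AE_mp[OF lim AE_I2], rule impI)
  fix w assume "((%t. mart t w) \<longlongrightarrow> Minf w) at_top"
  hence "(%n. mart (t + real n) w) \<longlonglongrightarrow> Minf w"
  by (rule filterlim_compose) (intro filterlim_tendsto_add_at_top[OF tendsto_const] filterlim_real_sequentially)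
  hence "(%n. ?u n w) \<longlonglongrightarrow> en (?a0 w)"
  using p by (intro tendsto_ennrealI tendsto_powr' tendsto_rabs tendsto_diff tendsto_const) auto
  from lim_imp_Liminf[OF _ this] show "en (?a0 w) = liminf (%n. ?u n w)" by simp
 qed
 also have "... <= liminf (%n. \<integral>\<^sup>+w. ?u n w \<partial>P \<mu>)" by (rule nn_integral_liminf[OF um])
 also have "... <= liminf (%n :: nat. R)" by (intro Liminf_mono always_eventually allI le) simp
 also have "... = R" by (simp add: Liminf_const)
 finally show ?thesis .
qed

text \<open>Weighted averages of the martingale over a window of unit length.\<close>

definition window :: "real => real => 'w => ennreal" where
 "window k c w = (\<integral>\<^sup>+s\<in>{c..c + 1}. en (exp (k * s) * mart (max 0 s) w) \<partial>lborel)"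

definition window_weight :: "real => real => real" where
 "window_weight k c = enn2real (\<integral>\<^sup>+s\<in>{c..c + 1}. en (exp (k * s)) \<partial>lborel)"

lemma window_weight:
 "en (window_weight k c) = (\<integral>\<^sup>+s\<in>{c..c + 1}. en (exp (k * s)) \<partial>lborel)" "0 < window_weight k c"
proof -
  let ?a0 = "\<integral>\<^sup>+s. en (exp (- (\<bar>k\<bar> * (\<bar>c\<bar> + 1)))) * ind {c..c + 1} s \<partial>lborel"
 let ?I = "\<integral>\<^sup>+s\<in>{c..c + 1}. en (exp (k * s)) \<partial>lborel"
 have kb: "\<bar>k * s\<bar> <= \<bar>k\<bar> * (\<bar>c\<bar> + 1)" if "s : {c..c + 1}" for s
  unfolding abs_mult using that by (intro mult_left_mono) auto
 have "?I <= (NN s|lborel. en (exp (\<bar>k\<bar> * (\<bar>c\<bar> + 1))) * ind {c..c + 1} s)"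
  using kb by (intro nn_integral_mono) (fastforce simp: indicator_def intro!: ennreal_leI dest: kb)
 also have "... < \<infinity>" by (simp add: nn_integral_cmult)
 finally show e: "en (window_weight k c) = ?I" by (simp add: window_weight_def)
 have "?a0 <= ?I"
  using kb by (intro nn_integral_mono) (fastforce simp: indicator_def intro!: ennreal_leI dest: kb)
 moreover have "0 < ?a0" by (simp add: nn_integral_cmult)
 ultimately have "0 < en (window_weight k c)" unfolding e by (rule less_le_trans[rotated])
 thus "0 < window_weight k c" by simp
qed

text \<open>Stated for indicators of past events and non-negative integrals, which suffices to identify conditional
 expectations.\<close>

lemma martingale_property:
 assumes \<mu>: "\<mu> : MF" and c: "0 <= c" "c <= s" and A: "A : sets (G (en c))"
 shows "(NN w|P \<mu>. ind A w * en (mart s w)) = (NN w|P \<mu>. ind A w * en (mart c w))"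
proof -
  let ?a0 = "%w. \<integral>\<^sup>+w'. ind A w * en (exp (- (l * s)) * phi_mass (s - c) w') \<partial>P (X c w)"
 let ?N = "G (en c) \<Otimes> topo_borel (weak_topology E_del)"
 have "(%z. ind A (fst z) * en (exp (- (l * s)) * (LINT y|snd z. \<Phi> y))) : bm ?N"
  using measurable_compose[OF measurable_snd Phi_integral_measurable_weak, of "G (en c)"]
  by (intro borel_measurable_times_ennreal measurable_compose[OF measurable_fst borel_measurable_indicator[OF A]]) simp
 hence H: "(%(w, \<eta>). ind A w * en (exp (- (l * s)) * (LINT y|\<eta>. \<Phi> y))) : bm ?N"
  by (simp add: case_prod_beta')
 have "(NN w|P \<mu>. ind A w * en (mart s w))
  = (NN w|P \<mu>. (?a0 w))"
  using mass.markov_nn_integral[OF _ c(1) _ H, of \<mu> "s - c"] \<mu> c by (simp add: mart_def phi_mass_def)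
 also have "... = (NN w|P \<mu>. ind A w * en (mart c w))"
 proof (rule nn_integral_cong)
  fix w assume "w : space (P \<mu>)"
  hence X: "X c w : MF" using c by (intro X_finite_measure) (simp_all add: space_P[OF \<mu>])
  have sc: "0 <= s - c" using c by simp
  have pm: "phi_mass (s - c) : bm (P (X c w))" by (rule P_measurable[OF X phi_mass_measurable[OF sc]])
  have "(NN w'|P (X c w). en (phi_mass (s - c) w')) = en (exp (l * (s - c)) * phi_mass c w)"
  using nn_integral_eq_integral[OF mass_mean(1)[OF X sc]] Phi_nonneg mass_mean(2)[OF X sc] by (simp add: phi_mass_def)
  hence "(?a0 w)
  = ind A w * (en (exp (- (l * s))) * en (exp (l * (s - c)) * phi_mass c w))"
  using pm by (simp add: ennreal_mult' nn_integral_cmult)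
  also have "en (exp (- (l * s))) * en (exp (l * (s - c)) * phi_mass c w) = en (mart c w)"
  unfolding mart_def by (subst ennreal_mult'[symmetric]) (simp_all add: mult.assoc[symmetric] right_diff_distrib flip: exp_add)
  finally show "(?a0 w) = ind A w * en (mart c w)" .
 qed
 finally show ?thesis .
qed

lemma window_integrand_measurable:
 assumes "\<mu> : MF"
 shows "(%(w, s). en (exp (k * s) * mart (max 0 s) w) * ind {c..c + 1} s) : bm (P \<mu> \<Otimes> lborel)"
 using mart_joint_measurable_P[OF assms]
 by (simp add: case_prod_beta' measurable_compose[OF measurable_snd borel_measurable_indicator])

lemma window_measurable:
 assumes "\<mu> : MF"
 shows "window k c : bm (P \<mu>)"
 using lborel.borel_measurable_nn_integral[OF window_integrand_measurable[OF assms]] unfolding window_def[abs_def] .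

lemma window_measurable_G:
 assumes "0 <= c" "c + 1 <= t"
 shows "window k c : bm (G (en t))"
proof -
 have "(%(w, s). en (exp (k * s) * mart (max 0 (min s t)) w) * ind {c..c + 1} s) : bm (G (en t) \<Otimes> lborel)"
  using mart_joint_measurable_G[of t] assms
  by (simp add: case_prod_beta' measurable_compose[OF measurable_snd borel_measurable_indicator])
 from lborel.borel_measurable_nn_integral[OF this]
 have "(%w. \<integral>\<^sup>+s\<in>{c..c + 1}. en (exp (k * s) * mart (max 0 (min s t)) w) \<partial>lborel) : bm (G (en t))" .
 moreover have "(\<integral>\<^sup>+s\<in>{c..c + 1}. en (exp (k * s) * mart (max 0 (min s t)) w) \<partial>lborel) = window k c w" for w
  unfolding window_def using assms by (intro nn_integral_cong) (auto simp: indicator_def min_def)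
 ultimately show ?thesis by simp
qed

text \<open>Tonelli together with the martingale property: every value of the martingale inside the window may be replaced by
 the one at its left end.\<close>

lemma window_mean:
 assumes \<mu>: "\<mu> : MF" and c: "0 <= c" and A: "A : sets (G (en c))"
 shows "(NN q|P \<mu>. ind A q * window k c q) = en (window_weight k c) * (NN q|P \<mu>. ind A q * en (mart c q))"
proof -
 interpret prob_space "P \<mu>" by (rule prob_P[OF \<mu>])
 interpret pair_sigma_finite "P \<mu>" lborel ..
 have AP: "A : sets (P \<mu>)" using mass.subalgebra_P[of \<mu> "en c"] \<mu> A by (auto simp: subalgebra_def)
 let ?w = "%s q. en (exp (k * s) * mart (max 0 s) q) * ind {c..c + 1} s"
 let ?a = "\<integral>\<^sup>+q. ind A q * en (mart c q) \<partial>P \<mu>"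
 have wm: "(%(q, s). ind A q * ?w s q) : bm (P \<mu> \<Otimes> lborel)"
  using window_integrand_measurable[OF \<mu>, of k c] unfolding case_prod_beta'
  by (intro borel_measurable_times_ennreal[of "%z. ind A (fst z)"] measurable_compose[OF measurable_fst borel_measurable_indicator[OF AP]])
 have "(NN q|P \<mu>. ind A q * window k c q) = (NN q|P \<mu>. (NN s|lborel. ind A q * ?w s q))"
 proof (rule nn_integral_cong)
  fix q assume q: "q : space (P \<mu>)"
  have "(%s. ?w s q) : bm lborel"
  using measurable_compose[OF measurable_Pair1'[OF q, of lborel] window_integrand_measurable[OF \<mu>, of k c]] by simp
  thus "ind A q * window k c q = (NN s|lborel. ind A q * ?w s q)"
  unfolding window_def by (rule nn_integral_cmult[symmetric])
 qed
 also have "... = (NN s|lborel. (NN q|P \<mu>. ind A q * ?w s q))" by (rule Fubini'[OF wm, symmetric])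
 also have "... = (NN s|lborel. (en (exp (k * s)) * ind {c..c + 1} s) * ?a)"
 proof (rule nn_integral_cong)
  fix s :: real
  show "(NN q|P \<mu>. ind A q * ?w s q) = (en (exp (k * s)) * ind {c..c + 1} s) * ?a"
  proof (cases "s : {c..c + 1}")
  case True
  hence s: "c <= s" "max 0 s = s" "0 <= s" using c by auto
  have m: "(%q. ind A q * en (mart s q)) : bm (P \<mu>)"
  using mart_measurable_P[OF \<mu> s(3)] by (intro borel_measurable_times_ennreal borel_measurable_indicator[OF AP]) simp
  have "(NN q|P \<mu>. ind A q * ?w s q) = (NN q|P \<mu>. en (exp (k * s)) * (ind A q * en (mart s q)))"
  using True s by (simp add: ennreal_mult' mult.left_commute)
  also have "... = en (exp (k * s)) * ?a"
  unfolding martingale_property[OF \<mu> c s(1) A, symmetric] by (rule nn_integral_cmult[OF m])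
  finally show ?thesis using True by simp
  qed simp
 qed
 also have "... = en (window_weight k c) * ?a" unfolding window_weight(1) by (rule nn_integral_multc) simp
 finally show ?thesis .
qed

lemma mart_mean:
 assumes \<mu>: "\<mu> : MF" and c: "0 <= c"
 shows "(NN w|P \<mu>. en (mart c w)) = en (LINT y|\<mu>. \<Phi> y)"
proof -
 have i: "integrable (P \<mu>) (phi_mass c)" using mass_mean(1)[OF \<mu> c] by (simp add: phi_mass_def[abs_def])
 hence "(NN w|P \<mu>. en (mart c w)) = en (LINT w|P \<mu>. mart c w)"
  using mart_nonneg unfolding mart_def by (intro nn_integral_eq_integral) auto
 also have "(LINT w|P \<mu>. mart c w) = exp (- (l * c)) * (exp (l * c) * (LINT y|\<mu>. \<Phi> y))"
  unfolding mart_def using mass_mean(2)[OF \<mu> c] by (simp add: phi_mass_def)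
 finally show ?thesis by (simp add: mult.assoc[symmetric] flip: exp_add)
qed

lemma window_finite:
 assumes \<mu>: "\<mu> : MF" and c: "0 <= c"
 shows "(NN w|P \<mu>. window k c w) < \<infinity>" "AE w in P \<mu>. window k c w < \<infinity>"
proof -
  let ?a0 = "\<integral>\<^sup>+w. window k c w \<partial>P \<mu>"
 have "space W : sets (G (en c))" using sets.top[of "G (en c)"] by (simp add: mass.space_F)
 from window_mean[OF \<mu> c this, of k]
 have "?a0 = en (window_weight k c) * (NN w|P \<mu>. en (mart c w))"
  by (simp add: space_P[OF \<mu>, symmetric] nn_integral_indicator' cong: nn_integral_cong)
 thus f: "?a0 < \<infinity>" unfolding mart_mean[OF \<mu> c] by (simp add: ennreal_mult_less_top)
 have "AE w in P \<mu>. window k c w \<noteq> \<infinity>"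
  by (rule nn_integral_noteq_infinite[OF window_measurable[OF \<mu>]]) (use f in simp)
 thus "AE w in P \<mu>. window k c w < \<infinity>" by (simp add: less_top)
qed

text \<open>The left end value of the martingale is the conditional expectation of the window average. As \<open>V\<close>
 belongs to the past, the conditional inequality of Jensen applies to the difference.\<close>

lemma window_Lp_imp_mart_Lp:
 assumes \<mu>: "\<mu> : MF" and c: "0 <= c" and p: "1 <= p"
  and V: "V : bm (G (en c))" "integrable (P \<mu>) V"
  and Lp: "(%w. enn2real (window k c w) / window_weight k c - V w) : Lp_space p (P \<mu>)"
 shows "(%w. mart c w - V w) : Lp_space p (P \<mu>)"
proof -
  let ?a0 = "%A. \<integral>\<^sup>+w. ind A w * en (mart c w) \<partial>P \<mu>"
  let ?b0 = "%A f. \<integral>\<^sup>+w. en (ind A w *\<^sub>R f w) \<partial>P \<mu>"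
 interpret prob_space "P \<mu>" by (rule prob_P[OF \<mu>])
 let ?F = "G (en c)"
 have sub: "subalgebra (P \<mu>) ?F" using \<mu> by (intro mass.subalgebra_P) simp
 interpret finite_measure_subalgebra "P \<mu>" ?F by unfold_locales (rule sub)
 let ?K = "window_weight k c"
 let ?N = "%w. enn2real (window k c w) / ?K"
 have Nm: "?N : bm (P \<mu>)" using window_measurable[OF \<mu>] by simp
 have Neq: "AE w in P \<mu>. en (?N w) = en (1 / ?K) * window k c w"
  using window_finite(2)[OF \<mu> c, of k]
 proof (rule AE_mp[OF _ AE_I2], intro impI)
  fix w assume "window k c w < \<infinity>"
  thus "en (?N w) = en (1 / ?K) * window k c w"
  using window_weight(2)[of k c] by (cases "window k c w") (simp_all add: ennreal_mult'[symmetric])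
 qed
 have nn: "(NN w|P \<mu>. ind A w * en (?N w)) = (?a0 A)"
  if A: "A : sets ?F" for A
 proof -
  have AP: "A : sets (P \<mu>)" using sub A by (auto simp: subalgebra_def)
  have "(NN w|P \<mu>. ind A w * en (?N w)) = (NN w|P \<mu>. en (1 / ?K) * (ind A w * window k c w))"
  using Neq by (intro nn_integral_cong_AE) (auto simp: mult.left_commute)
  also have "... = en (1 / ?K) * (NN w|P \<mu>. ind A w * window k c w)"
  by (intro nn_integral_cmult borel_measurable_times_ennreal window_measurable[OF \<mu>] borel_measurable_indicator[OF AP])
  also have "... = (en (1 / ?K) * en ?K) * (?a0 A)"
  unfolding window_mean[OF \<mu> c A] by (simp add: mult.assoc)
  also have "en (1 / ?K) * en ?K = 1" using window_weight(2)[of k c] by (simp add: ennreal_mult'[symmetric])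
  finally show ?thesis by simp
 qed
 have mm: "mart c : bm ?F" unfolding mart_def[abs_def] using phi_mass_measurable_G[OF c order_refl] by simp
 have mi: "integrable (P \<mu>) (mart c)"
  using mart_mean[OF \<mu> c] mart_nonneg by (intro integrableI_nonneg mart_measurable_P[OF \<mu> c]) auto
 have Ni: "integrable (P \<mu>) ?N"
 proof (rule integrableI_nonneg[OF Nm])
  have "(NN w|P \<mu>. en (?N w)) = (NN w|P \<mu>. ind (space ?F) w * en (?N w))"
  by (intro nn_integral_cong) (simp add: mass.space_F space_P[OF \<mu>])
  also have "... = (NN w|P \<mu>. en (mart c w))"
  unfolding nn[OF sets.top] by (intro nn_integral_cong) (simp add: mass.space_F space_P[OF \<mu>])
  finally show "(NN w|P \<mu>. en (?N w)) < \<infinity>" by (simp add: mart_mean[OF \<mu> c])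
 qed (use window_weight(2)[of k c] in simp)
 have cond: "AE w in P \<mu>. real_cond_exp (P \<mu>) ?F ?N w = mart c w"
 proof (rule real_cond_exp_charact[OF _ Ni mi mm])
  fix A assume A: "A : sets ?F"
  hence AP: "A : sets (P \<mu>)" using sub by (auto simp: subalgebra_def)
  have e: "(\<integral>w\<in>A. f w \<partial>P \<mu>) = enn2real (NN w|P \<mu>. ind A w * en (f w))"
  if "f : bm (P \<mu>)" "\<And>w. 0 <= f w" for f
  proof -
  have "(\<integral>w\<in>A. f w \<partial>P \<mu>) = enn2real (?b0 A f)"
  unfolding set_lebesgue_integral_def using that(2)
  by (intro integral_eq_nn_integral borel_measurable_scaleR borel_measurable_indicator[OF AP] that(1)) simp
  also have "(?b0 A f) = (NN w|P \<mu>. ind A w * en (f w))"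
  by (intro nn_integral_cong) (simp add: indicator_def)
  finally show ?thesis .
  qed
  show "(\<integral>w\<in>A. ?N w \<partial>P \<mu>) = (\<integral>w\<in>A. mart c w \<partial>P \<mu>)"
  using e[OF Nm] e[OF mart_measurable_P[OF \<mu> c] mart_nonneg] nn[OF A] window_weight(2)[of k c] by simp
 qed
 have dm: "(%w. mart c w - V w) : bm (P \<mu>)"
  using mart_measurable_P[OF \<mu> c] V(2) by simp
 have "AE w in P \<mu>. real_cond_exp (P \<mu>) ?F (%w. ?N w - V w) w = mart c w - V w"
  using cond real_cond_exp_diff[OF Ni V(2)] real_cond_exp_F_meas[OF V(2,1)] by eventually_elim simp
 moreover have "integrable (P \<mu>) (%w. \<bar>real_cond_exp (P \<mu>) ?F (%w. ?N w - V w) w\<bar> powr p)"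
 proof (rule integrable_convex_cond_exp[where I = UNIV])
  show "integrable (P \<mu>) (%w. ?N w - V w)" using Ni V(2) by simp
  show "integrable (P \<mu>) (%w. \<bar>?N w - V w\<bar> powr p)" using Lp by (simp add: Lp_space_def)
 qed (use convex_abs_powr[OF p] in auto)
 ultimately show ?thesis
  by (intro Lp_space_cong_AE[OF _ dm]) (simp_all add: Lp_space_def)
qed

text \<open>The limit \<open>Minf\<close> itself need not be controllable, so it is removed by subtracting the average over the
 window that starts at \<open>b\<close>. This average is known at time \<open>b + 1\<close>, and two later values of
 the martingale are compared with it.\<close>

lemma windows_Lp_imp_increment_Lp:
 assumes \<mu>: "\<mu> : MF" and b: "0 <= b" and p: "1 <= p"
  and Lp: "\<And>c. b <= c ==> (%w. window_weight k c * Minf w - enn2real (window k c w)) : Lp_space p (P \<mu>)"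
 shows "(%w. mart (b + 2) w - mart (b + 1) w) : Lp_space p (P \<mu>)"
proof -
  let ?a0 = "\<integral>\<^sup>+w. en (enn2real (window k b w)) \<partial>P \<mu>"
 interpret prob_space "P \<mu>" by (rule prob_P[OF \<mu>])
 let ?V = "%c w. enn2real (window k c w) / window_weight k c"
 have p0: "0 <= p" using p by simp
 have U: "(%w. Minf w - ?V c w) : Lp_space p (P \<mu>)" if "b <= c" for c
  using Lp_space_combination[OF Lp[OF that] Lp[OF that] p0, of "1 / window_weight k c" 0] window_weight(2)[of k c]
  by (simp add: diff_divide_distrib)
 have Vi: "integrable (P \<mu>) (?V b)"
 proof -
  have "integrable (P \<mu>) (%w. enn2real (window k b w))"
  proof (rule integrableI_nonneg)
  have "?a0 <= (NN w|P \<mu>. window k b w)"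
  by (intro nn_integral_mono) (simp add: ennreal_enn2real_if)
  thus "?a0 < \<infinity>" using window_finite(1)[OF \<mu> b] by (rule order_le_less_trans)
  qed (use window_measurable[OF \<mu>] in auto)
  thus ?thesis by simp
 qed
 have step: "(%w. mart c w - ?V b w) : Lp_space p (P \<mu>)" if c: "b + 1 <= c" for c
 proof (rule window_Lp_imp_mart_Lp[OF \<mu> _ p _ Vi])
  show "0 <= c" using b c by simp
  show "?V b : bm (G (en c))" using window_measurable_G[OF b c] by simp
  show "(%w. ?V c w - ?V b w) : Lp_space p (P \<mu>)"
  using Lp_space_diff[OF U[of b] U[of c] p0] c by simp
 qed
 show ?thesis using Lp_space_diff[OF step[of "b + 2"] step[of "b + 1"] p0] by simp
qed

lemma increment_Lp_imp_nu_jump: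
 assumes \<mu>: "\<mu> : MF" and m0: "0 < (LINT y|\<mu>. \<Phi> y)" and p: "1 < p" "p <= 2"
 obtains t0 where "0 <= t0" "\<And>t. t0 <= t ==> (%w. mart (t + 1) w - mart t w) : Lp_space p (P \<mu>)
  ==> nu_jump (%r. en (\<bar>r\<bar> powr p)) < \<infinity>"
proof -
  let ?a0 = "%t. \<integral>\<^sup>+w. en (\<bar>exp (- l) * phi_mass (t + 1) w - phi_mass t w\<bar> powr p) \<partial>P \<mu>"
 obtain t0 where t0: "\<And>t. t0 <= t ==> (?a0 t) < \<infinity>
  ==> nu_jump (%r. en (\<bar>r\<bar> powr p)) < \<infinity>"
  using increment_moment_imp_nu_jump[OF \<mu> m0 p] by blast
 have "nu_jump (%r. en (\<bar>r\<bar> powr p)) < \<infinity>"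
  if t: "max 0 t0 <= t" and Lp: "(%w. mart (t + 1) w - mart t w) : Lp_space p (P \<mu>)" for t
 proof (rule t0)
  show "t0 <= t" using t by simp
  have "exp (l * t) * (mart (t + 1) w - mart t w) = exp (- l) * phi_mass (t + 1) w - phi_mass t w" for w
  unfolding mart_def by (simp add: right_diff_distrib distrib_left mult.assoc[symmetric] flip: exp_add)
  with Lp_space_combination[OF Lp Lp, of "exp (l * t)" 0] p
  show "(?a0 t) < \<infinity>"
  by (simp add: Lp_space_iff)
 qed
 thus thesis by (intro that[of "max 0 t0"]) auto
qed

end

section \<open>The weighted integral of the martingale remainder\<close>

lemma converges_Lp_cong_AE:
 assumes B: "converges_Lp p M B" and Y: "\<And>t. 1 <= t ==> Y t : bm M"
  and eq: "\<And>t. 1 <= t ==> AE w in M. B t w = Y t w"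
 shows "converges_Lp p M Y"
proof -
 obtain Z where Z: "Z : Lp_space p M" "((%t. Lp_norm p M (%w. B t w - Z w)) \<longlongrightarrow> 0) at_top"
  and ev: "\<forall>\<^sub>F t in at_top. B t : Lp_space p M"
  using B unfolding converges_Lp_def by blast
 have "\<forall>\<^sub>F t in at_top. Y t : Lp_space p M \<and> Lp_norm p M (%w. B t w - Z w) = Lp_norm p M (%w. Y t w - Z w)"
  using ev eventually_ge_at_top[of 1]
 proof eventually_elim
  case (elim t)
  have [measurable]: "B t : bm M" "Z : bm M" "Y t : bm M"
  using elim Z Y by (auto simp: Lp_space_def)
  have "(LINT w|M. \<bar>B t w - Z w\<bar> powr p) = (LINT w|M. \<bar>Y t w - Z w\<bar> powr p)"
  using eq[OF elim(2)] by (intro integral_cong_AE) auto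
  thus ?case
  using Lp_space_cong_AE[OF elim(1) Y eq] elim(2) by (simp add: Lp_norm_def)
 qed
 moreover from this Z(2) have "((%t. Lp_norm p M (%w. Y t w - Z w)) \<longlongrightarrow> 0) at_top"
  by (elim Lim_transform_eventually) (auto elim: eventually_mono)
 ultimately show ?thesis unfolding converges_Lp_def using Z(1) by (auto elim: eventually_mono)
qed

text \<open>Here \<open>k\<close> is the exponent of the weight in the integral of the martingale remainder.\<close>

locale martingale_limit = spectral_superprocess +
 fixes Minf \<eta> and p k :: real
 assumes eta: "\<eta> : MF" and eta_pos: "0 < (LINT y|\<eta>. ext0 \<phi> y)"
  and Minf_measurable: "Minf : bm W"
  and Minf_lim: "AE w in P \<eta>. ((%t. mart t w) \<longlongrightarrow> Minf w) at_top"
  and p: "1 < p" "p <= 2"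
begin

lemma Minf_measurable_P: "Minf : bm (P \<eta>)"
 by (rule P_measurable[OF eta Minf_measurable])

definition drift where "drift s w = exp (k * s) * (Minf w - mart (max 0 s) w)"

definition accumulated where "accumulated t w = (LBINT s:{0..t}. drift s w)"

lemma drift_joint_measurable: "(%(w, s). drift s w) : bm (P \<eta> \<Otimes> lborel)"
proof -
 have "(%x. exp (k * snd x)) : bm (P \<eta> \<Otimes> lborel)"
  by (rule measurable_compose[OF measurable_snd]) simp
 with mart_joint_measurable_P[OF eta] measurable_compose[OF measurable_fst Minf_measurable_P, of lborel]
 show ?thesis unfolding drift_def case_prod_beta' by (intro borel_measurable_times borel_measurable_diff) auto
qed

lemma accumulated_measurable: "accumulated t : bm (P \<eta>)"
 unfolding accumulated_def[abs_def] set_lebesgue_integral_def using drift_joint_measurable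
 by (intro lborel.borel_measurable_lebesgue_integral) (simp add: case_prod_beta' measurable_compose[OF measurable_snd borel_measurable_indicator])

lemma mart_path_measurable: "w : space W ==> (%s. mart (max 0 s) w) : bm lborel"
 using measurable_compose[OF measurable_Pair1'[of w W lborel] mart_joint_measurable_W] by simp

text \<open>Window averages have finite mean, so almost every path of the martingale is integrable on compact time intervals.
 This excludes the default value \<open>0\<close> of the integral that defines \<open>accumulated\<close>.\<close>

lemma path_integrable:
 "AE q in P \<eta>. q : space W \<and> (\<forall>T\<ge>0. set_integrable lborel {0..T} (%s. exp (k * s) * mart (max 0 s) q))"
proof -
 have "AE q in P \<eta>. \<forall>n::nat. window k (real n) q < \<infinity>"
  unfolding AE_all_countable using window_finite(2)[OF eta] by simp
 thus ?thesis
 proof (rule AE_mp[OF _ AE_I2], intro impI conjI allI)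
  fix q assume "q : space (P \<eta>)" and w: "\<forall>n::nat. window k (real n) q < \<infinity>"
  thus q: "q : space W" by (simp add: space_P[OF eta])
  let ?f = "%s. exp (k * s) * mart (max 0 s) q"
  have fm: "?f : bm lborel" using mart_path_measurable[OF q] by simp
  have cell: "set_integrable lborel {real n..real n + 1} ?f" for n
  proof -
  have "(NN s|lborel. en (norm (ind {real n..real n + 1} s *\<^sub>R ?f s))) = window k (real n) q"
  unfolding window_def using mart_nonneg by (intro nn_integral_cong) (simp add: indicator_def)
  thus ?thesis unfolding set_integrable_def using w fm by (intro integrableI_bounded) auto
  qed
  have "set_integrable lborel {0..real n} ?f" for n
  proof (induction n)
  case 0
  show ?case by (rule set_integrable_subset[OF cell[of 0]]) auto
  next
  case (Suc n)
  have "{0..real (Suc n)} = {0..real n} \<union> {real n..real n + 1}" by auto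
  thus ?case using set_integrable_Un[OF Suc.IH cell[of n]] by simp
  qed
  moreover fix T :: real
  obtain n :: nat where "T <= real n" using real_arch_simple by blast
  ultimately show "set_integrable lborel {0..T} ?f" using set_integrable_subset[of lborel "{0..real n}" ?f "{0..T}"] by auto
 qed
qed

lemma accumulated_diff:
 "AE w in P \<eta>. \<forall>c t. 0 <= c \<longrightarrow> c <= t \<longrightarrow> accumulated t w - accumulated c w = (LBINT s:{c<..t}. drift s w)
  \<and> (LBINT s:{c<..t}. drift s w) = (LBINT s:{c..t}. exp (k * s)) * Minf w - (LBINT s:{c..t}. exp (k * s) * mart (max 0 s) w)"
 using path_integrable
proof (rule AE_mp[OF _ AE_I2], intro impI allI)
 fix w and c t :: real
 assume H: "w : space W \<and> (\<forall>T\<ge>0. set_integrable lborel {0..T} (%s. exp (k * s) * mart (max 0 s) w))"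
  and c: "0 <= c" and t: "c <= t"
 let ?f = "%s. exp (k * s) * mart (max 0 s) w"
 have fi: "set_integrable lborel {0..t} ?f" using H c t by auto
 have ei: "set_integrable lborel {a..b} (%s. exp (k * s))" for a b
  by (intro borel_integrable_atLeastAtMost' continuous_intros)
 have dr: "drift s w = exp (k * s) * Minf w - ?f s" for s by (simp add: drift_def right_diff_distrib)
 have di: "set_integrable lborel {0..t} (%s. drift s w)"
  unfolding dr by (intro set_integral_diff(1) fi set_integrable_mult_left ei)
 have i1: "set_integrable lborel {0..c} (%s. drift s w)" "set_integrable lborel {c<..t} (%s. drift s w)"
  using c t by (auto intro!: set_integrable_subset[OF di])
 have S: "{0..c} \<union> {c<..t} = {0..t}" using c t by auto
 have "(LBINT s:{0..c} \<union> {c<..t}. drift s w) = (LBINT s:{0..c}. drift s w) + (LBINT s:{c<..t}. drift s w)"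
  by (rule set_integral_Un[OF _ i1]) auto
 hence 1: "accumulated t w - accumulated c w = (LBINT s:{c<..t}. drift s w)"
  unfolding S accumulated_def by simp
 have "(LBINT s:{c<..t}. drift s w) = (LBINT s:{c..t}. drift s w)"
  unfolding set_lebesgue_integral_def
 proof (rule integral_cong_AE)
  show "AE s in lborel. ind {c<..t} s *\<^sub>R drift s w = ind {c..t} s *\<^sub>R drift s w"
  using AE_lborel_singleton[of c] by eventually_elim (auto simp: indicator_def)
  have "(%s. drift s w) : bm lborel" unfolding drift_def using mart_path_measurable H by simp
  thus "(%s. ind {c<..t} s *\<^sub>R drift s w) : bm lborel"
  "(%s. ind {c..t} s *\<^sub>R drift s w) : bm lborel" by simp_all
 qed
 also have "... = (LBINT s:{c..t}. exp (k * s) * Minf w) - (LBINT s:{c..t}. ?f s)"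
  unfolding dr using c by (intro set_integral_diff(2) set_integrable_mult_left ei set_integrable_subset[OF fi]) auto
 also have "(LBINT s:{c..t}. exp (k * s) * Minf w) = (LBINT s:{c..t}. exp (k * s)) * Minf w"
  by (simp add: set_lebesgue_integral_def mult.assoc[symmetric])
 finally show "accumulated t w - accumulated c w = (LBINT s:{c<..t}. drift s w)
  \<and> (LBINT s:{c<..t}. drift s w) = (LBINT s:{c..t}. exp (k * s)) * Minf w - (LBINT s:{c..t}. ?f s)"
  using 1 by simp
qed

lemma enn2real_window:
 assumes "w : space W"
 shows "enn2real (window k c w) = (LBINT s:{c..c + 1}. exp (k * s) * mart (max 0 s) w)"
proof -
  let ?a0 = "\<integral>\<^sup>+s. en (ind {c..c + 1} s *\<^sub>R (exp (k * s) * mart (max 0 s) w)) \<partial>lborel"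
 have "(LBINT s:{c..c + 1}. exp (k * s) * mart (max 0 s) w) = enn2real ?a0"
  unfolding set_lebesgue_integral_def using mart_path_measurable[OF assms] mart_nonneg by (intro integral_eq_nn_integral) auto
 also have "?a0 = window k c w"
  unfolding window_def by (intro nn_integral_cong) (simp add: indicator_def)
 finally show ?thesis by simp
qed

lemma window_weight_eq: "window_weight k c = (LBINT s:{c..c + 1}. exp (k * s))"
proof -
  let ?a0 = "\<integral>\<^sup>+s. en (ind {c..c + 1} s *\<^sub>R exp (k * s)) \<partial>lborel"
 have "(LBINT s:{c..c + 1}. exp (k * s)) = enn2real ?a0"
  unfolding set_lebesgue_integral_def by (intro integral_eq_nn_integral) auto
 also have "?a0 = (\<integral>\<^sup>+s\<in>{c..c + 1}. en (exp (k * s)) \<partial>lborel)"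
  by (intro nn_integral_cong) (simp add: indicator_def)
 finally show ?thesis by (simp add: window_weight_def)
qed

lemma remainder_moment_le:
 assumes "nu_jump (%r. en (\<bar>r\<bar> powr p)) < \<infinity>"
 obtains D where "0 <= D" "\<And>t. 1 < t ==> (NN w|P \<eta>. en (\<bar>Minf w - mart t w\<bar> powr p)) <= en (D * exp (- (l * (p - 1) * t)))"
proof -
 obtain D where D: "0 <= D" "\<And>t s. 1 < t ==> 0 <= s ==>
  (NN w|P \<eta>. en (\<bar>mart (t + s) w - mart t w\<bar> powr p)) <= en (D * exp (- (l * (p - 1) * t)))"
  using increment_moment_le[OF eta p assms] by blast
 show thesis
 proof (rule that[OF D(1)])
  fix t :: real assume t: "1 < t"
  show "(NN w|P \<eta>. en (\<bar>Minf w - mart t w\<bar> powr p)) <= en (D * exp (- (l * (p - 1) * t)))"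
  by (rule limit_moment_le[OF eta _ Minf_measurable Minf_lim D(2)[OF t]]) (use t p in auto)
 qed
qed

lemma accumulated_converges:
 assumes fin: "nu_jump (%r. en (\<bar>r\<bar> powr p)) < \<infinity>" and k: "k * p < l * (p - 1)"
 shows "converges_Lp p (P \<eta>) (%t w. accumulated t w - accumulated 1 w)"
  and "converges_AE (P \<eta>) (%t w. accumulated t w - accumulated 1 w)"
proof -
  let ?a0 = "%s. \<integral>\<^sup>+w. en (\<bar>drift s w\<bar> powr p) \<partial>P \<eta>"
 obtain D where D: "0 <= D" "\<And>t. 1 < t ==> (NN w|P \<eta>. en (\<bar>Minf w - mart t w\<bar> powr p)) <= en (D * exp (- (l * (p - 1) * t)))"
  using remainder_moment_le[OF fin] by blast
 have le: "(?a0 s) <= en (D * exp (- ((l * (p - 1) - k * p) * s)))" if s: "1 < s" for s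
 proof -
  have s': "max 0 s = s" using s by simp
  have m: "(%w. en (\<bar>Minf w - mart s w\<bar> powr p)) : bm (P \<eta>)"
  using Minf_measurable_P mart_measurable_P[OF eta, of s] s by simp
  have "(?a0 s) = (NN w|P \<eta>. en (exp (k * s * p)) * en (\<bar>Minf w - mart s w\<bar> powr p))"
  unfolding drift_def s' by (intro nn_integral_cong) (simp add: abs_mult powr_mult exp_powr_real ennreal_mult')
  also have "... = en (exp (k * s * p)) * (NN w|P \<eta>. en (\<bar>Minf w - mart s w\<bar> powr p))"
  by (rule nn_integral_cmult[OF m])
  also have "... <= en (exp (k * s * p)) * en (D * exp (- (l * (p - 1) * s)))" by (intro mult_left_mono D(2) s) simp
  also have "... = en (exp (k * s * p) * (D * exp (- (l * (p - 1) * s))))" by (rule ennreal_mult'[symmetric]) simp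
  also have "exp (k * s * p) * (D * exp (- (l * (p - 1) * s))) = D * exp (- ((l * (p - 1) - k * p) * s))"
  by (simp add: mult.left_commute[of _ D] algebra_simps flip: exp_add)
  finally show ?thesis .
 qed
 have k': "0 < l * (p - 1) - k * p" using k by simp
 have conv: "converges_Lp p (P \<eta>) (%t w. LBINT s:{1<..t}. drift s w)" "converges_AE (P \<eta>) (%t w. LBINT s:{1<..t}. drift s w)"
  using random_integral_converges[OF prob_P[OF eta] drift_joint_measurable p(1) k' D(1)] le by blast+
 have eq: "AE w in P \<eta>. \<forall>t\<ge>1. (LBINT s:{1<..t}. drift s w) = accumulated t w - accumulated 1 w"
  using accumulated_diff by (rule eventually_mono) auto
 show "converges_Lp p (P \<eta>) (%t w. accumulated t w - accumulated 1 w)"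
 proof (rule converges_Lp_cong_AE[OF conv(1)])
  show "AE w in P \<eta>. (LBINT s:{1<..t}. drift s w) = accumulated t w - accumulated 1 w" if "1 <= t" for t
  using eq by (rule eventually_mono) (use that in auto)
 qed (intro borel_measurable_diff accumulated_measurable)
 show "converges_AE (P \<eta>) (%t w. accumulated t w - accumulated 1 w)"
  using conv(2) eq unfolding converges_AE_def
 proof eventually_elim
  case (elim w)
  then obtain L where L: "((%t. LBINT s:{1<..t}. drift s w) \<longlongrightarrow> L) at_top" by blast
  have "((%t. accumulated t w - accumulated 1 w) \<longlongrightarrow> L) at_top"
  by (rule Lim_transform_eventually[OF L eventually_mono[OF eventually_ge_at_top[of "1::real"]]]) (use elim(2) in auto)
  thus ?case by blast
 qed
qed

text \<open>An increment of \<open>accumulated\<close> over a unit interval is a multiple of \<open>Minf\<close> minus a window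
 integral, so that membership in \<open>L\<^sup>p\<close> passes to the difference of two window averages.\<close>

lemma accumulated_Lp_imp_nu_jump:
 assumes "\<forall>\<^sub>F t in at_top. (%q. accumulated t q - accumulated 1 q) : Lp_space p (P \<eta>)"
 shows "nu_jump (%r. en (\<bar>r\<bar> powr p)) < \<infinity>"
proof -
 obtain T where T: "\<And>t. T <= t ==> (%q. accumulated t q - accumulated 1 q) : Lp_space p (P \<eta>)"
  using assms unfolding eventually_at_top_linorder by blast
 obtain t0 where t0: "0 <= t0" "\<And>t. t0 <= t ==> (%q. mart (t + 1) q - mart t q) : Lp_space p (P \<eta>)
  ==> nu_jump (%r. en (\<bar>r\<bar> powr p)) < \<infinity>"
  using increment_Lp_imp_nu_jump[OF eta eta_pos p] by blast
 define b where "b = max T t0"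
 have p': "1 <= p" "0 <= p" using p by auto
 have w: "(%q. window_weight k c * Minf q - enn2real (window k c q)) : Lp_space p (P \<eta>)" if c: "b <= c" for c
 proof (rule Lp_space_cong_AE)
  have c': "T <= c" "0 <= c" using c t0(1) unfolding b_def by auto
  show "(%q. (accumulated (c + 1) q - accumulated 1 q) - (accumulated c q - accumulated 1 q)) : Lp_space p (P \<eta>)"
  using c' p' by (intro Lp_space_diff T) auto
  show "(%q. window_weight k c * Minf q - enn2real (window k c q)) : bm (P \<eta>)"
  using Minf_measurable_P window_measurable[OF eta, of k c] by simp
  show "AE q in P \<eta>. (accumulated (c + 1) q - accumulated 1 q) - (accumulated c q - accumulated 1 q)
  = window_weight k c * Minf q - enn2real (window k c q)"
  using accumulated_diff path_integrable
  proof eventually_elim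
  case (elim q)
  from elim(2) have q: "q : space W" by blast
  have "(accumulated (c + 1) q - accumulated 1 q) - (accumulated c q - accumulated 1 q) = accumulated (c + 1) q - accumulated c q" by simp
  also have "... = (LBINT s:{c..c + 1}. exp (k * s)) * Minf q - (LBINT s:{c..c + 1}. exp (k * s) * mart (max 0 s) q)"
  using elim(1)[rule_format, OF c'(2), of "c + 1"] by linarith
  finally show ?case unfolding enn2real_window[OF q] window_weight_eq .
  qed
 qed
 have "0 <= b" using t0(1) by (simp add: b_def)
 from windows_Lp_imp_increment_Lp[OF eta this p'(1) w]
 have "(%q. mart ((b + 1) + 1) q - mart (b + 1) q) : Lp_space p (P \<eta>)" by (simp add: add.assoc)
 from t0(2)[OF _ this] show ?thesis by (simp add: b_def)
qed

lemma remainder_Lp_imp_nu_jump: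
 assumes "\<forall>\<^sub>F t in at_top. (%w. Minf w - mart t w) : Lp_space p (P \<eta>)"
 shows "nu_jump (%r. en (\<bar>r\<bar> powr p)) < \<infinity>"
proof -
 obtain T where T: "\<And>t. T <= t ==> (%w. Minf w - mart t w) : Lp_space p (P \<eta>)"
  using assms unfolding eventually_at_top_linorder by blast
 obtain t0 where t0: "0 <= t0" "\<And>t. t0 <= t ==> (%w. mart (t + 1) w - mart t w) : Lp_space p (P \<eta>)
  ==> nu_jump (%r. en (\<bar>r\<bar> powr p)) < \<infinity>"
  using increment_Lp_imp_nu_jump[OF eta eta_pos p] by blast
 show ?thesis
  using Lp_space_diff[OF T[of "max T t0"] T[of "max T t0 + 1"]] p by (intro t0(2)[of "max T t0"]) auto
qed

lemma remainder_smallo: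
 assumes fin: "nu_jump (%r. en (\<bar>r\<bar> powr p)) < \<infinity>" and k: "k * p < l * (p - 1)"
 shows "\<forall>\<^sub>F t in at_top. (%w. Minf w - mart t w) : Lp_space p (P \<eta>)"
  and "(%t. Lp_norm p (P \<eta>) (%w. Minf w - mart t w)) : o[at_top](%t. exp (- (k * t)))"
proof -
  let ?a0 = "%t. %w. Minf w - mart t w"
 obtain D where D: "0 <= D" "\<And>t. 1 < t ==> (NN w|P \<eta>. en (\<bar>Minf w - mart t w\<bar> powr p)) <= en (D * exp (- (l * (p - 1) * t)))"
  using remainder_moment_le[OF fin] by blast
 have p0: "0 < p" using p by simp
 have R0: "0 <= D * exp (- (l * (p - 1) * t))" for t using D by simp
 have m: "(?a0 t) : bm (P \<eta>)" if "1 < t" for t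
  using Minf_measurable_P mart_measurable_P[OF eta, of t] that by simp
 note L = Lp_norm_le[OF D(2) m R0 p0]
 show "\<forall>\<^sub>F t in at_top. (?a0 t) : Lp_space p (P \<eta>)"
  using eventually_gt_at_top[of 1] by eventually_elim (rule L(1))
 let ?d = "(l * (p - 1) - k * p) / p"
 show "(%t. Lp_norm p (P \<eta>) (?a0 t)) : o[at_top](%t. exp (- (k * t)))"
 proof (rule smalloI_tendsto)
  show "((%t. Lp_norm p (P \<eta>) (?a0 t) / exp (- (k * t))) \<longlongrightarrow> 0) at_top"
  proof (rule tendsto_sandwich[OF _ _ tendsto_const])
  show "\<forall>\<^sub>F t in at_top. 0 <= Lp_norm p (P \<eta>) (?a0 t) / exp (- (k * t))" by (simp add: Lp_norm_def)
  show "\<forall>\<^sub>F t in at_top. Lp_norm p (P \<eta>) (?a0 t) / exp (- (k * t)) <= D powr (1 / p) * exp (- (?d * t))"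
  using eventually_gt_at_top[of 1]
  proof eventually_elim
  case (elim t)
  have e: "- (l * (p - 1) * t) * (1 / p) - - (k * t) = - (?d * t)" using p0 by (simp add: field_simps)
  have "(D * exp (- (l * (p - 1) * t))) powr (1 / p) / exp (- (k * t)) = D powr (1 / p) * (exp (- (l * (p - 1) * t) * (1 / p)) / exp (- (k * t)))"
  by (simp add: powr_mult exp_powr_real)
  also have "... = D powr (1 / p) * exp (- (?d * t))" unfolding exp_diff[symmetric] e ..
  finally show ?case using divide_right_mono[OF L(2)[OF elim elim], of "exp (- (k * t))"] by simp
  qed
  have d: "0 < ?d" using k p0 by simp
  have "((%t. exp (- (?d * t))) \<longlongrightarrow> 0) at_top"
  by (intro filterlim_compose[OF exp_at_bot] filterlim_uminus_at_bot_at_top[THEN filterlim_compose]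
  filterlim_tendsto_pos_mult_at_top[OF tendsto_const d filterlim_ident])
  from tendsto_mult[OF tendsto_const this] show "((%t. D powr (1 / p) * exp (- (?d * t))) \<longlongrightarrow> 0) at_top" by simp
  qed
 qed simp
qed

end

section \<open>The superprocess and its mass on the state space\<close>

lemma the_measurable: "the : restrict_space (topo_borel (E_del :: 'e::topological_space option topology)) (range Some) \<rightarrow>\<^sub>M borel"
proof (rule measurableI)
  let ?a0 = "restrict_space (BE) (range Some)"
 fix A :: "'e set" assume "A : sets borel"
 from image_Some_sets[OF this] have "Some ` A : sets ?a0"
  by (subst sets_restrict_space_iff) (auto simp: space_topo_borel)
 moreover have "the -` A \<inter> space ?a0 = Some ` A"
  by (auto simp: space_restrict_space space_topo_borel)
 ultimately show "the -` A \<inter> space ?a0 : sets ?a0"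
  by simp
qed simp

text \<open>Functions that vanish at the cemetery do not see the difference between the superprocess and its restriction.\<close>

lemma restr_E_integral:
 fixes \<phi> :: "'e::topological_space => real"
 assumes \<mu>: "sets \<mu> = sets (topo_borel (E_del :: 'e option topology))" and \<phi>: "\<phi> : bm borel"
 shows "(LINT x|restr_E \<mu>. \<phi> x) = (LINT y|\<mu>. ext0 \<phi> y)"
proof -
 have m: "the : restrict_space \<mu> (range Some) \<rightarrow>\<^sub>M borel"
  by (subst measurable_cong_sets[OF sets_restrict_space_cong[OF \<mu>] refl]) (rule the_measurable)
 have sp: "space \<mu> = UNIV" using sets_eq_imp_space_eq[OF \<mu>] by (simp add: space_topo_borel)
 have "(LINT x|restr_E \<mu>. \<phi> x) = (LINT y|restrict_space \<mu> (range Some). \<phi> (the y))"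
  unfolding restr_E_def by (rule integral_distr[OF m \<phi>])
 also have "... = (LINT y|\<mu>. ind (range Some) y *\<^sub>R \<phi> (the y))"
  by (rule integral_restrict_space) (simp add: sp \<mu> range_Some_sets)
 also have "... = (LINT y|\<mu>. ext0 \<phi> y)"
  by (intro Bochner_Integration.integral_cong refl) (auto simp: indicator_def ext0_def split: option.splits)
 finally show ?thesis .
qed

lemma zero_ext_finite_measures:
 fixes \<mu> :: "'e::topological_space measure"
 assumes \<mu>: "\<mu> : nonzero_measures borel"
 shows "zero_ext \<mu> : finite_measures (BE)"
proof -
 have s: "sets \<mu> = sets borel" and f: "finite_measure \<mu>" using \<mu> by (auto simp: nonzero_measures_def finite_measures_def)
 have "Some : \<mu> \<rightarrow>\<^sub>M topo_borel (E_del :: 'e option topology)"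
  by (subst measurable_cong_sets[OF s refl]) (rule Some_measurable)
 thus ?thesis
  unfolding zero_ext_def finite_measures_def using finite_measure.finite_measure_distr[OF f] by simp
qed

lemma zero_ext_integral_pos:
 fixes \<phi> :: "'e::topological_space => real"
 assumes \<mu>: "\<mu> : nonzero_measures borel" and \<phi>: "bounded_borel borel \<phi>" "\<And>x. 0 < \<phi> x"
 shows "0 < (LINT y|zero_ext \<mu>. ext0 \<phi> y)"
proof -
  let ?a0 = "\<integral>x. \<phi> x \<partial>\<mu>"
 have s: "sets \<mu> = sets borel" and "finite_measure \<mu>" and nz: "\<mu> \<noteq> null_measure borel"
  using \<mu> by (auto simp: nonzero_measures_def finite_measures_def)
 then interpret finite_measure \<mu> by simp
 have sm: "Some : \<mu> \<rightarrow>\<^sub>M topo_borel (E_del :: 'e option topology)"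
  by (subst measurable_cong_sets[OF s refl]) (rule Some_measurable)
 have \<phi>m: "\<phi> : bm borel" using \<phi>(1) by (simp add: bounded_borel_def)
 have \<phi>\<mu>: "\<phi> : bm \<mu>" using \<phi>m by (subst measurable_cong_sets[OF s refl])
 obtain B where B: "\<And>x. \<bar>\<phi> x\<bar> <= B" using \<phi>(1) unfolding bounded_borel_def bounded_iff by auto
 have i: "integrable \<mu> \<phi>" by (rule integrable_const_bound[of _ B]) (use B \<phi>\<mu> in auto)
 have "(LINT y|zero_ext \<mu>. ext0 \<phi> y) = ?a0"
  unfolding zero_ext_def using \<phi>m by (subst integral_distr[OF sm]) (simp_all add: ext0_measurable_iff)
 moreover have "?a0 \<noteq> 0"
 proof
  assume "?a0 = 0"
  hence "AE x in \<mu>. \<phi> x = 0"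
  using integral_nonneg_eq_0_iff_AE[OF i] \<phi>(2) by (auto simp: less_imp_le)
  hence "AE x in \<mu>. False" by (rule eventually_mono) (use \<phi>(2) less_irrefl in metis)
  hence "space \<mu> : null_sets \<mu>" by (simp add: AE_iff_null_sets)
  hence "emeasure \<mu> A = 0" for A
  using emeasure_space[of \<mu> A] by (simp add: null_sets_def)
  hence "\<mu> = null_measure borel" by (intro measure_eqI) (simp_all add: s)
  with nz show False ..
 qed
 moreover have "0 <= ?a0" using \<phi>(2) by (intro Bochner_Integration.integral_nonneg) (simp add: less_imp_le)
 ultimately show ?thesis by simp
qed

lemma enn2ereal_eq_ereal: "enn2ereal x = ereal r ==> x = en r"
 by (cases x) auto

text \<open>The relative error \<open>C t x f\<close> is bounded for times beyond one, which gives the upper bound, and at most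
 one half for large times, which gives the lower one.\<close>

lemma mean_bounds:
 fixes \<nu> :: "'e::topological_space measure" and m :: "real => ('e => real) => 'e => ennreal"
 assumes phi: "\<And>x. 0 < \<phi> x"
  and asymp: "\<And>t x f. 0 < t ==> f : L1_plus \<nu> ==>
  enn2ereal (m t f x) = ereal (exp (l * t) * \<phi> x * (LINT y|\<nu>. f y) * (1 + C t x f))"
  and c: "\<And>t. 0 < t ==> c t = (SUP (x, f)\<in>UNIV \<times> L1_plus \<nu>. ereal \<bar>C t x f\<bar>)"
  and c_tendsto: "(c \<longlongrightarrow> 0) at_top"
  and c_bounded: "(SUP t\<in>{1<..}. c t) < \<infinity>"
 shows "\<exists>K>0. \<forall>t>1. \<forall>f\<in>L1_plus \<nu>. \<forall>x. m t f x <= en (K * exp (l * t) * \<phi> x * (LINT y|\<nu>. f y))"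
  and "\<exists>t0>1. \<forall>t\<ge>t0. \<forall>f\<in>L1_plus \<nu>. \<forall>x. en (1/2 * exp (l * t) * \<phi> x * (LINT y|\<nu>. f y)) <= m t f x"
proof -
  let ?a0 = "%f. \<integral>y. f y \<partial>\<nu>"
 have eq: "m t f x = en (exp (l * t) * \<phi> x * (?a0 f) * (1 + C t x f))" if "0 < t" "f : L1_plus \<nu>" for t f x
  by (rule enn2ereal_eq_ereal[OF asymp[OF that]])
 have I0: "0 <= exp (l * t) * \<phi> x * (?a0 f)" if "f : L1_plus \<nu>" for t f x
  using that phi[of x] by (intro mult_nonneg_nonneg Bochner_Integration.integral_nonneg) (auto simp: L1_plus_def)
 have C: "ereal \<bar>C t x f\<bar> <= c t" if "0 < t" "f : L1_plus \<nu>" for t x f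
  unfolding c[OF that(1)] using that(2) by (intro SUP_upper2[of "(x, f)"]) auto
 obtain K :: real where K: "(SUP t\<in>{1<..}. c t) <= ereal K"
  using c_bounded by (cases "SUP t\<in>{1<..}. c t") auto
 have CK: "C t x f <= \<bar>K\<bar>" if t: "1 < t" and f: "f : L1_plus \<nu>" for t x f
 proof -
  have "ereal \<bar>C t x f\<bar> <= c t" by (rule C) (use t f in auto)
  also have "... <= (SUP t\<in>{1<..}. c t)" using t by (intro SUP_upper) simp
  finally show ?thesis using K by (auto dest: order_trans)
 qed
 show "\<exists>K>0. \<forall>t>1. \<forall>f\<in>L1_plus \<nu>. \<forall>x. m t f x <= en (K * exp (l * t) * \<phi> x * (?a0 f))"
 proof (intro exI[of _ "1 + \<bar>K\<bar>"] conjI allI impI ballI)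
  fix t :: real and f x assume t: "1 < t" and f: "f : L1_plus \<nu>"
  have "exp (l * t) * \<phi> x * (?a0 f) * (1 + C t x f) <= exp (l * t) * \<phi> x * (?a0 f) * (1 + \<bar>K\<bar>)"
  using CK[OF t f, of x] by (intro mult_left_mono I0[OF f]) simp
  thus "m t f x <= en ((1 + \<bar>K\<bar>) * exp (l * t) * \<phi> x * (?a0 f))"
  using t by (subst eq[OF _ f]) (auto intro!: ennreal_leI simp: mult_ac)
 qed (simp add: add_pos_nonneg)
 have "\<forall>\<^sub>F t in at_top. c t < ereal (1/2)" by (rule order_tendstoD(2)[OF c_tendsto]) simp
 then obtain T where T: "\<And>t. T <= t ==> c t < ereal (1/2)" unfolding eventually_at_top_linorder by blast
 show "\<exists>t0>1. \<forall>t\<ge>t0. \<forall>f\<in>L1_plus \<nu>. \<forall>x. en (1/2 * exp (l * t) * \<phi> x * (?a0 f)) <= m t f x"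
 proof (intro exI[of _ "max 2 T"] conjI allI impI ballI)
  fix t :: real and f x assume t: "max 2 T <= t" and f: "f : L1_plus \<nu>"
  have "ereal \<bar>C t x f\<bar> < ereal (1/2)" using order_le_less_trans[OF C T, of t f x] t f by simp
  hence "1/2 <= 1 + C t x f" by auto
  hence "exp (l * t) * \<phi> x * (?a0 f) * (1/2) <= exp (l * t) * \<phi> x * (?a0 f) * (1 + C t x f)"
  by (intro mult_left_mono I0[OF f])
  thus "en (1/2 * exp (l * t) * \<phi> x * (?a0 f)) <= m t f x"
  using t by (subst eq[OF _ f]) (auto intro!: ennreal_leI simp: mult_ac)
 qed simp
qed

context spectral_superprocess
begin

lemma M_phi_eq: "0 <= t ==> w : space W ==> M_phi l \<phi> X t w = mart t w"
 unfolding M_phi_def mart_def phi_mass_def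
 using X_finite_measure[of t w] by (subst restr_E_integral) (auto simp: finite_measures_iff)

lemma nu_jump_eq_pi_phi:
 "nu_jump (%r. en (\<bar>r\<bar> powr p)) = (NN y|\<nu>. (\<integral>\<^sup>+r\<in>{1..}. en (r powr p) \<partial>pi_phi \<pi> \<phi> y))"
 unfolding nu_jump_def
 by (intro nn_integral_cong) (auto simp: branching.big_jump_eq_pi_phi[of \<phi>, OF phi(2)] indicator_def intro!: nn_integral_cong)

end

context martingale_limit
begin

lemma A_int_eq:
 assumes b: "k = l / b" and w: "w : space W"
 shows "A_int l b Minf (M_phi l \<phi> X) t w = accumulated t w"
 unfolding A_int_def accumulated_def drift_def set_lebesgue_integral_def
 by (intro Bochner_Integration.integral_cong refl) (auto simp: M_phi_eq[OF _ w] b indicator_def max_def)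

end

theorem theorem1p2:
  fixes M :: "'v measure" and F :: "ennreal \<Rightarrow> 'v measure"
    and \<xi> :: "real \<Rightarrow> 'v \<Rightarrow> 'e::{metric_space, second_countable_topology} option"
    and Q :: "'e option \<Rightarrow> 'v measure"
    and \<alpha> \<beta> :: "'e \<Rightarrow> real" and \<pi> :: "'e \<Rightarrow> real measure"
    and W :: "'w measure" and G :: "ennreal \<Rightarrow> 'w measure"
    and X :: "real \<Rightarrow> 'w \<Rightarrow> 'e option measure" and P :: "'e option measure \<Rightarrow> 'w measure"
    and l :: real and \<phi> :: "'e \<Rightarrow> real" and \<nu> :: "'e measure"
    and C :: "real \<Rightarrow> 'e \<Rightarrow> ('e \<Rightarrow> real) \<Rightarrow> real" and c :: "real \<Rightarrow> ereal"
    and Minf :: "'w \<Rightarrow> real" and a a_star p :: real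
  defines "PE \<equiv> \<lambda>\<mu>. P (zero_ext \<mu>)"
    and "Mt \<equiv> M_phi l \<phi> X"
    and "A \<equiv> A_int l a_star Minf (M_phi l \<phi> X)"
    and "star \<equiv> (\<integral>\<^sup>+y. (\<integral>\<^sup>+r\<in>{1..}. ennreal (r powr p) \<partial>pi_phi \<pi> \<phi> y) \<partial>\<nu>) < \<infinity>"
  assumes E: "locally_compact_space (euclidean :: 'e topology)"
    and super: "superprocess M F \<xi> Q \<alpha> \<beta> \<pi> W G X P"
    and extinction: "\<And>x t. 0 < t \<Longrightarrow>
          measure (PE (return borel x)) {\<omega> \<in> space W. emeasure (restr_E (X t \<omega>)) UNIV = 0} > 0"
    and lambda: "0 < l"
    and phi: "bounded_borel borel \<phi>" "\<And>x. 0 < \<phi> x"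
    and nu: "sets \<nu> = sets borel" "prob_space \<nu>"
    and nu_support: "\<And>U. open U \<Longrightarrow> U \<noteq> {} \<Longrightarrow> emeasure \<nu> U > 0"
    and phi_eigen: "\<And>t x. 0 \<le> t \<Longrightarrow>
          mean_semigroup \<xi> Q \<beta> t (\<lambda>y. ennreal (\<phi> y)) x = ennreal (exp (l * t) * \<phi> x)"
    and nu_eigen: "\<And>t B. 0 \<le> t \<Longrightarrow> B \<in> sets borel \<Longrightarrow>
          (\<integral>\<^sup>+x. mean_semigroup \<xi> Q \<beta> t (indicator B) x \<partial>\<nu>) = ennreal (exp (l * t)) * emeasure \<nu> B"
    and nu_phi: "(\<integral>x. \<phi> x \<partial>\<nu>) = 1"
    and mean_asymp: "\<And>t x f. 0 < t \<Longrightarrow> f \<in> L1_plus \<nu> \<Longrightarrow>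
          enn2ereal (mean_semigroup \<xi> Q \<beta> t (\<lambda>y. ennreal (f y)) x)
          = ereal (exp (l * t) * \<phi> x * (\<integral>y. f y \<partial>\<nu>) * (1 + C t x f))"
    and c: "\<And>t. 0 < t \<Longrightarrow> c t = (SUP (x, f)\<in>UNIV \<times> L1_plus \<nu>. ereal \<bar>C t x f\<bar>)"
    and c_tendsto: "(c \<longlongrightarrow> 0) at_top"
    and c_bounded: "(SUP t\<in>{1<..}. c t) < \<infinity>"
    and LlogL: "(\<integral>\<^sup>+y. (\<integral>\<^sup>+r\<in>{1..}. ennreal (r * ln r) \<partial>pi_phi \<pi> \<phi> y) \<partial>\<nu>) < \<infinity>"
    and Minf_measurable: "Minf \<in> borel_measurable W"
    and Minf: "\<And>\<mu>. \<mu> \<in> nonzero_measures borel \<Longrightarrow>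
          AE \<omega> in PE \<mu>. ((\<lambda>t. Mt t \<omega>) \<longlongrightarrow> Minf \<omega>) at_top"
    and exponents: "1 < a" "a < p" "p \<le> 2" "1 / a + 1 / a_star = 1"
  shows "(star \<longrightarrow> (\<forall>\<mu>\<in>nonzero_measures borel.
            converges_Lp p (PE \<mu>) (\<lambda>t \<omega>. A t \<omega> - A 1 \<omega>) \<and>
            converges_AE (PE \<mu>) (\<lambda>t \<omega>. A t \<omega> - A 1 \<omega>)))
       \<and> (\<forall>\<mu>\<in>nonzero_measures borel.
            converges_Lp p (PE \<mu>) (\<lambda>t \<omega>. A t \<omega> - A 1 \<omega>) \<longrightarrow>
            converges_AE (PE \<mu>) (\<lambda>t \<omega>. A t \<omega> - A 1 \<omega>) \<and> star)
       \<and> (star \<longrightarrow> (\<forall>\<mu>\<in>nonzero_measures borel.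
            Lp_norm_smallo p (PE \<mu>) (\<lambda>t \<omega>. Minf \<omega> - Mt t \<omega>) (\<lambda>t. exp (- l * t / a_star))))
       \<and> (\<forall>\<mu>\<in>nonzero_measures borel.
            Lp_norm_smallo p (PE \<mu>) (\<lambda>t \<omega>. Minf \<omega> - Mt t \<omega>) (\<lambda>t. 1) \<longrightarrow> star)"
proof -
 have mb: "\<exists>K>0. \<forall>t>1. \<forall>f\<in>L1_plus \<nu>. \<forall>x. mean_semigroup \<xi> Q \<beta> t (\<lambda>y. ennreal (f y)) x \<le> ennreal (K * exp (l * t) * \<phi> x * (\<integral>y. f y \<partial>\<nu>))"
  "\<exists>t0>1. \<forall>t\<ge>t0. \<forall>f\<in>L1_plus \<nu>. \<forall>x. ennreal (1/2 * exp (l * t) * \<phi> x * (\<integral>y. f y \<partial>\<nu>)) \<le> mean_semigroup \<xi> Q \<beta> t (\<lambda>y. ennreal (f y)) x"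
  by (rule mean_bounds[where m = "\<lambda>t f x. mean_semigroup \<xi> Q \<beta> t (\<lambda>y. ennreal (f y)) x", OF phi(2) mean_asymp c c_tendsto c_bounded]; assumption)+
 interpret spectral_superprocess M F \<xi> Q \<alpha> \<beta> \<pi> W G X P l \<phi> \<nu>
  by (intro spectral_superprocess.intro superprocess_lc.intro superprocess_lc_axioms.intro spectral_superprocess_axioms.intro
  super E lambda phi nu phi_eigen nu_eigen mb)
 define k where "k = l / a_star"
 have p: "1 < p" "p \<le> 2" using exponents by auto
 have k: "k * p < l * (p - 1)"
 proof -
  have "k = l * (1 - 1 / a)" using exponents(4) unfolding k_def by (metis add_diff_cancel_left' mult.right_neutral times_divide_eq_right)
  moreover have "l * (1 - 1 / a) * p = l * (p - p / a)" by (simp add: algebra_simps)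
  moreover have "p - p / a < p - 1" using exponents(1,2) by simp
  ultimately show ?thesis using lambda by simp
 qed
 have star: "star \<longleftrightarrow> nu_jump (\<lambda>r. ennreal (\<bar>r\<bar> powr p)) < \<infinity>"
  unfolding star_def nu_jump_eq_pi_phi ..
 have parts: "(star \<longrightarrow> converges_Lp p (PE \<mu>) (\<lambda>t \<omega>. A t \<omega> - A 1 \<omega>) \<and> converges_AE (PE \<mu>) (\<lambda>t \<omega>. A t \<omega> - A 1 \<omega>))
  \<and> (converges_Lp p (PE \<mu>) (\<lambda>t \<omega>. A t \<omega> - A 1 \<omega>) \<longrightarrow> star)
  \<and> (star \<longrightarrow> Lp_norm_smallo p (PE \<mu>) (\<lambda>t \<omega>. Minf \<omega> - Mt t \<omega>) (\<lambda>t. exp (- l * t / a_star)))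
  \<and> (Lp_norm_smallo p (PE \<mu>) (\<lambda>t \<omega>. Minf \<omega> - Mt t \<omega>) (\<lambda>t. 1) \<longrightarrow> star)"
  if \<mu>: "\<mu> \<in> nonzero_measures borel" for \<mu>
 proof -
  let ?\<eta> = "zero_ext \<mu>"
  have eta: "?\<eta> \<in> finite_measures B_del" by (rule zero_ext_finite_measures[OF \<mu>])
  have spP: "space (P ?\<eta>) = space W" by (rule space_P[OF eta])
  have lim: "AE \<omega> in P ?\<eta>. ((\<lambda>t. mart t \<omega>) \<longlongrightarrow> Minf \<omega>) at_top"
  using Minf[OF \<mu>] unfolding PE_def
  proof (rule AE_mp[OF _ AE_I2], intro impI)
  fix \<omega> assume "\<omega> \<in> space (P ?\<eta>)" and "((\<lambda>t. Mt t \<omega>) \<longlongrightarrow> Minf \<omega>) at_top"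
  then show "((\<lambda>t. mart t \<omega>) \<longlongrightarrow> Minf \<omega>) at_top"
  by (elim Lim_transform_eventually, intro eventually_mono[OF eventually_ge_at_top[of 0]]) (simp add: Mt_def M_phi_eq spP)
  qed
  interpret martingale_limit M F \<xi> Q \<alpha> \<beta> \<pi> W G X P l \<phi> \<nu> Minf ?\<eta> p k
  by (intro martingale_limit.intro spectral_superprocess_axioms martingale_limit_axioms.intro
  eta zero_ext_integral_pos[OF \<mu> phi] Minf_measurable lim p)
  have A: "A t \<omega> - A 1 \<omega> = accumulated t \<omega> - accumulated 1 \<omega>" if "\<omega> \<in> space (P ?\<eta>)" for t \<omega>
  unfolding A_def using A_int_eq[OF k_def] that spP by simp
  have Am: "(\<lambda>\<omega>. A t \<omega> - A 1 \<omega>) \<in> borel_measurable (P ?\<eta>)" for t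
  by (rule measurable_congI[OF A borel_measurable_diff[OF accumulated_measurable accumulated_measurable]])
  have conv: "converges_Lp p (P ?\<eta>) (\<lambda>t \<omega>. A t \<omega> - A 1 \<omega>) \<and> converges_AE (P ?\<eta>) (\<lambda>t \<omega>. A t \<omega> - A 1 \<omega>)" if star
  proof
  note c = accumulated_converges[OF that[unfolded star] k]
  show "converges_Lp p (P ?\<eta>) (\<lambda>t \<omega>. A t \<omega> - A 1 \<omega>)"
  by (rule converges_Lp_cong_AE[OF c(1) Am]) (intro AE_I2, simp add: A)
  show "converges_AE (P ?\<eta>) (\<lambda>t \<omega>. A t \<omega> - A 1 \<omega>)"
  using c(2) unfolding converges_AE_def by (rule AE_mp) (intro AE_I2 impI, simp add: A)
  qed
  have Mt: "Minf \<omega> - mart t \<omega> = Minf \<omega> - Mt t \<omega>" if "0 \<le> t" "\<omega> \<in> space (P ?\<eta>)" for t \<omega>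
  using that by (simp add: Mt_def M_phi_eq spP)
  have Mm: "(\<lambda>\<omega>. Minf \<omega> - mart t \<omega>) \<in> borel_measurable (P ?\<eta>)" "(\<lambda>\<omega>. Minf \<omega> - Mt t \<omega>) \<in> borel_measurable (P ?\<eta>)" if t: "0 \<le> t" for t
  proof -
  show m: "(\<lambda>\<omega>. Minf \<omega> - mart t \<omega>) \<in> borel_measurable (P ?\<eta>)"
  using Minf_measurable_P mart_measurable_P[OF eta t] by simp
  show "(\<lambda>\<omega>. Minf \<omega> - Mt t \<omega>) \<in> borel_measurable (P ?\<eta>)" by (rule measurable_congI[OF Mt[OF t, symmetric] m])
  qed
  have Lp: "(\<lambda>\<omega>. Minf \<omega> - mart t \<omega>) \<in> Lp_space p (P ?\<eta>) \<longleftrightarrow> (\<lambda>\<omega>. Minf \<omega> - Mt t \<omega>) \<in> Lp_space p (P ?\<eta>)" if t: "0 \<le> t" for t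
  proof
  have e: "AE \<omega> in P ?\<eta>. Minf \<omega> - mart t \<omega> = Minf \<omega> - Mt t \<omega>" by (intro AE_I2 Mt t)
  then have e': "AE \<omega> in P ?\<eta>. Minf \<omega> - Mt t \<omega> = Minf \<omega> - mart t \<omega>" by (rule eventually_mono) simp
  show "(\<lambda>\<omega>. Minf \<omega> - mart t \<omega>) \<in> Lp_space p (P ?\<eta>) \<Longrightarrow> (\<lambda>\<omega>. Minf \<omega> - Mt t \<omega>) \<in> Lp_space p (P ?\<eta>)"
  by (rule Lp_space_cong_AE[OF _ Mm(2)[OF t] e])
  show "(\<lambda>\<omega>. Minf \<omega> - Mt t \<omega>) \<in> Lp_space p (P ?\<eta>) \<Longrightarrow> (\<lambda>\<omega>. Minf \<omega> - mart t \<omega>) \<in> Lp_space p (P ?\<eta>)"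
  by (rule Lp_space_cong_AE[OF _ Mm(1)[OF t] e'])
  qed
  have evLp: "(\<forall>\<^sub>F t in at_top. (\<lambda>\<omega>. Minf \<omega> - mart t \<omega>) \<in> Lp_space p (P ?\<eta>)) \<longleftrightarrow> (\<forall>\<^sub>F t in at_top. (\<lambda>\<omega>. Minf \<omega> - Mt t \<omega>) \<in> Lp_space p (P ?\<eta>))"
  by (rule eventually_cong[OF eventually_mono[OF eventually_ge_at_top[of "0::real"] Lp]])
  have small: "Lp_norm_smallo p (P ?\<eta>) (\<lambda>t \<omega>. Minf \<omega> - Mt t \<omega>) (\<lambda>t. exp (- l * t / a_star))" if star
  unfolding Lp_norm_smallo_def
  proof
  note r = remainder_smallo[OF that[unfolded star] k]
  show "\<forall>\<^sub>F t in at_top. (\<lambda>\<omega>. Minf \<omega> - Mt t \<omega>) \<in> Lp_space p (P ?\<eta>)" using r(1) unfolding evLp .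
  have e: "(\<lambda>t. exp (- l * t / a_star)) = (\<lambda>t. exp (- (k * t)))" by (simp add: k_def)
  have "\<forall>\<^sub>F t in at_top. Lp_norm p (P ?\<eta>) (\<lambda>\<omega>. Minf \<omega> - mart t \<omega>) = Lp_norm p (P ?\<eta>) (\<lambda>\<omega>. Minf \<omega> - Mt t \<omega>)"
  using eventually_ge_at_top[of "0::real"]
  proof eventually_elim
  case (elim t)
  then show ?case unfolding Lp_norm_def using Mt[OF elim] by (intro arg_cong[where f = "\<lambda>x. x powr (1 / p)"] Bochner_Integration.integral_cong) auto
  qed
  from landau_o.small.in_cong[OF this] r(2)
  show "(\<lambda>t. Lp_norm p (P ?\<eta>) (\<lambda>\<omega>. Minf \<omega> - Mt t \<omega>)) \<in> o[at_top](\<lambda>t. exp (- l * t / a_star))" unfolding e by blast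
  qed
  have "star" if "converges_Lp p (P ?\<eta>) (\<lambda>t \<omega>. A t \<omega> - A 1 \<omega>)"
  unfolding star
  proof (rule accumulated_Lp_imp_nu_jump)
  have "\<forall>\<^sub>F t in at_top. (\<lambda>\<omega>. A t \<omega> - A 1 \<omega>) \<in> Lp_space p (P ?\<eta>)" using that unfolding converges_Lp_def by blast
  then show "\<forall>\<^sub>F t in at_top. (\<lambda>\<omega>. accumulated t \<omega> - accumulated 1 \<omega>) \<in> Lp_space p (P ?\<eta>)"
  by (rule eventually_mono) (rule Lp_space_cong_AE, assumption, intro borel_measurable_diff accumulated_measurable, intro AE_I2 A)
  qed
  moreover have "star" if "Lp_norm_smallo p (P ?\<eta>) (\<lambda>t \<omega>. Minf \<omega> - Mt t \<omega>) (\<lambda>t. 1)"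
  unfolding star using that unfolding Lp_norm_smallo_def by (intro remainder_Lp_imp_nu_jump) (simp add: evLp)
  ultimately show ?thesis unfolding PE_def using conv small by blast
 qed
 show ?thesis
  using parts by blast
qed

end
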